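(* Let $2\le p<\infty$, $\ell>0$, and let $u$ be a weak solution in $B_1\subset\mathbb{R}^2$ of $$\Delta_p u=\ell^{p-1}\,\mathcal H^1\llcorner\partial_{\rm red}\{u>0\},\qquad u\ge 0,$$ in the sense defined in the context. Suppose that there is a constant $\theta>0$ such that $$\frac{|\{u=0\}\cap B_r(x)|}{|B_r(x)|}\ge\theta\qquad\text{for every ball } B_r(x)\subset B_1 \text{ with } x\in\partial\{u>0\}\cap B_1 .$$ Suppose that the curvature measure $\kappa$ of $\partial\{u>0\}$ exists and is nonnegative. If $u$ has finite Morse index, i.e. $\mathrm{Index}(x_0)<\infty$ for every $x_0\in\partial\{u>0\}\cap B_1$, then the free boundary $\partial\{u>0\}$ is locally finitely connected.
   Context: $B_r(x)=\{y\in\mathbb{R}^2:|y-x|<r\}$ and $B_1=B_1(0)$. $|\cdot|$ is Lebesgue measure, $\mathcal H^1$ is one-dimensional Hausdorff measure, $\Delta_p u=\operatorname{div}(|\nabla u|^{p-2}\nabla u)$. $\partial\{u>0\}$ is the free boundary and $\partial_{\rm red}\{u>0\}$ is the reduced boundary of $\{u>0\}$ (sense of Federer, 4.5.5). Weak solution in a domain $\Omega\subset\mathbb{R}^2$: a function $u$ such that (1) $u\in W^{1,p}(\Omega)$ is continuous and non-negative in $\Omega$, and $\Delta_p u=0$ (weakly) in $\{u>0\}$; (2) for every bounded subdomain $D\Subset\Omega$ there are constants $0<c_{\min}\le C_{\max}<\infty$, depending only on $\ell$, $p$ and $\operatorname{dist}(\partial D,\partial\Omega)$, such that for every ball $B_r(x)\subset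 D$ centered at a free boundary point $x\in\partial\{u>0\}$, $$c_{\min}\le\frac1{r^2}\int_{\partial B_r(x)}u\,d\mathcal H^1\le C_{\max};$$ (3) $\{u>0\}$ is a set of locally finite perimeter in $\Omega$, and for every $\zeta\in C_0^\infty(\Omega)$, $$-\int_\Omega|\nabla u|^{p-2}\nabla u\cdot\nabla\zeta\,dx=\ell^{p-1}\int_{\partial_{\rm red}\{u>0\}}\zeta\,d\mathcal H^1 .$$ Curvature measure: $\Gamma=\partial\{u>0\}$ is $\mathcal H^1$-rectifiable, and is regarded as the rectifiable $1$-varifold $V$ with multiplicity one and weight measure $\mu_V=\mathcal H^1\llcorner\Gamma$. $V$ has (locally) bounded first variation if for $U\Subset B_1$ there is $c>0$ with $\left|\int\operatorname{div}_\Gamma X\,d\mu_V\right|\le c$ for all $X\in C^1_0(U;\mathbb{R}^2)$, $|X|\le1$, where $\operatorname{div}_\Gamma$ is the divergence along the approximate tangent line of $\Gamma$. Then by Riesz representation there is a vector measure $H$ with $\int\operatorname{div}_\Gamma X\,d\mu_V=-\int X\cdot dH$, and $\kappa:=|H|$ is the curvature measure (if $\Gamma$ is smooth, $H$ is the curvature vector). "The curvature measure exists" means that $V$ has locally bounded first variation, so that $\kappa$ is locally finite. Morse index: $u$ has finite Morse index at $x_0\in\partial\{u>0\}$, written $\mathrm{Index}(x_0)<\infty$, if there is a constant $C_0>0$ such that $$\frac{\displaystyle\int_{\{u>0\}}|\nabla u|^{p-2}\left(|\nabla\phi|^2+(p-2)\frac{(\nabla u\cdot\nabla\phi)^2}{|\nabla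 u|^2}\right)dx-\int_{\partial\{u>0\}}\phi^2\,d\kappa}{\displaystyle\int_{\{u>0\}}|\nabla u|^{p-2}\phi^2\,dx}\ge -C_0$$ for all Lipschitz functions $\phi$ with compact support in $B_1\setminus\{x_0\}$ (for which the denominator is nonzero). "Locally finitely connected" means that near each of its points (in a neighborhood of the point) $\partial\{u>0\}$ has finitely many connected components. *)

theory Defs
  imports "HOL-Analysis.Analysis"
begin

section \<open>One-dimensional Hausdorff measure\<close>

text \<open>The normalising constant of the one-dimensional Hausdorff measure is \<open>1\<close>, so that it is
  length on a line. \<^const>\<open>diameter\<close> is only meaningful for bounded sets, hence the
  boundedness condition on the covers.\<close>

definition hausdorff1_delta :: "real \<Rightarrow> 'a::metric_space set \<Rightarrow> ennreal" where
  "hausdorff1_delta \<delta> A =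
     (INF S \<in> {S :: nat \<Rightarrow> 'a set. A \<subseteq> (\<Union>i. S i) \<and> (\<forall>i. bounded (S i) \<and> diameter (S i) \<le> \<delta>)}.
        \<Sum>i. ennreal (diameter (S i)))"

definition hausdorff1_outer :: "'a::metric_space set \<Rightarrow> ennreal" where
  "hausdorff1_outer A = (SUP \<delta>\<in>{0<..}. hausdorff1_delta \<delta> A)"

text \<open>The measure on the Caratheodory-measurable sets. It is a complete measure whose sigma-algebra
  contains the Borel sets (\<open>borel_subset_sets_hausdorff1\<close> below).\<close>

definition hausdorff1 :: "'a::metric_space measure" where
  "hausdorff1 = measure_of UNIV (lambda_system UNIV (Pow UNIV) hausdorff1_outer) hausdorff1_outer"

lemma hausdorff1_delta_le:
  assumes "A \<subseteq> (\<Union>i. S i)" "\<And>i. bounded (S i)" "\<And>i. diameter (S i) \<le> \<delta>"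
  shows "hausdorff1_delta \<delta> A \<le> (\<Sum>i. ennreal (diameter (S i)))"
  unfolding hausdorff1_delta_def using assms by (intro INF_lower) auto

lemma hausdorff1_delta_close:
  assumes "hausdorff1_delta \<delta> A < e"
  obtains S where "A \<subseteq> (\<Union>i. S i)" "\<And>i. bounded (S i)" "\<And>i. diameter (S i) \<le> \<delta>"
    "(\<Sum>i. ennreal (diameter (S i))) < e"
  using assms unfolding hausdorff1_delta_def INF_less_iff by auto

lemma hausdorff1_delta_subset: "A \<subseteq> B \<Longrightarrow> hausdorff1_delta \<delta> A \<le> hausdorff1_delta \<delta> B"
  unfolding hausdorff1_delta_def by (rule INF_superset_mono) auto

lemma hausdorff1_delta_antimono: "\<delta> \<le> \<delta>' \<Longrightarrow> hausdorff1_delta \<delta>' A \<le> hausdorff1_delta \<delta> A"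
  unfolding hausdorff1_delta_def by (rule INF_superset_mono) (auto intro: order_trans)

lemma hausdorff1_delta_le_outer: "0 < \<delta> \<Longrightarrow> hausdorff1_delta \<delta> A \<le> hausdorff1_outer A"
  unfolding hausdorff1_outer_def by (rule SUP_upper) auto

lemma hausdorff1_outer_mono: "A \<subseteq> B \<Longrightarrow> hausdorff1_outer A \<le> hausdorff1_outer B"
  unfolding hausdorff1_outer_def by (rule SUP_mono') (rule hausdorff1_delta_subset)

lemma hausdorff1_outer_empty: "hausdorff1_outer {} = 0"
proof -
  have "hausdorff1_delta \<delta> ({} :: 'a set) \<le> 0" if "\<delta> > 0" for \<delta>
    using hausdorff1_delta_le[of "{}" "\<lambda>_. {}" \<delta>] that by simp
  then show ?thesis
    unfolding hausdorff1_outer_def by (auto intro!: antisym SUP_least)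
qed

lemma hausdorff1_outer_Union: "hausdorff1_outer (\<Union>i::nat. A i) \<le> (\<Sum>i. hausdorff1_outer (A i))"
proof (subst hausdorff1_outer_def, rule SUP_least)
  fix \<delta> :: real assume "\<delta> \<in> {0<..}"
  then have \<delta>: "0 < \<delta>" by simp
  show "hausdorff1_delta \<delta> (\<Union>i. A i) \<le> (\<Sum>i. hausdorff1_outer (A i))"
  proof (rule ennreal_le_epsilon)
    fix e :: real assume e: "0 < e" and fin: "(\<Sum>i. hausdorff1_outer (A i)) < top"
    have "hausdorff1_delta \<delta> (A n) < hausdorff1_outer (A n) + ennreal (e * (1/2)^Suc n)" for n
    proof -
      have "hausdorff1_outer (A n) < top" using fin by (rule ennreal_suminf_lessD)
      then have "hausdorff1_outer (A n) < hausdorff1_outer (A n) + ennreal (e * (1/2)^Suc n)"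
        using e by (auto simp: less_top)
      with hausdorff1_delta_le_outer[OF \<delta>, of "A n"] show ?thesis by (rule le_less_trans)
    qed
    then have "\<exists>S. A n \<subseteq> (\<Union>i. S i) \<and> (\<forall>i. bounded (S i) \<and> diameter (S i) \<le> \<delta>) \<and>
        (\<Sum>i. ennreal (diameter (S i))) < hausdorff1_outer (A n) + ennreal (e * (1/2)^Suc n)" for n
      by (rule hausdorff1_delta_close) blast
    then obtain B where B: "\<And>n. A n \<subseteq> (\<Union>i. B n i)"
        "\<And>n i. bounded (B n i) \<and> diameter (B n i) \<le> \<delta>"
        "\<And>n. (\<Sum>i. ennreal (diameter (B n i))) < hausdorff1_outer (A n) + ennreal (e * (1/2)^Suc n)"
      by metis
    define C where "C = case_prod B \<circ> prod_decode"
    have "(\<Union>i. A i) \<subseteq> (\<Union>i. C i)"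
      using B(1) by (auto simp: C_def subset_eq) (metis prod.case prod_encode_inverse)
    then have "hausdorff1_delta \<delta> (\<Union>i. A i) \<le> (\<Sum>i. ennreal (diameter (C i)))"
      using B(2) by (intro hausdorff1_delta_le) (auto simp: C_def split_beta)
    also have "\<dots> = (\<Sum>n. \<Sum>i. ennreal (diameter (B n i)))"
      using suminf_ennreal_2dimen[where f = "\<lambda>x. ennreal (diameter (case_prod B x))"]
      by (simp add: C_def)
    also have "\<dots> \<le> (\<Sum>n. hausdorff1_outer (A n) + ennreal (e * (1/2)^Suc n))"
      using B(3) by (intro suminf_le less_imp_le) auto
    also have "\<dots> = (\<Sum>n. hausdorff1_outer (A n)) + (\<Sum>n. ennreal (e * (1/2)^Suc n))"
      by (subst suminf_add[symmetric]) auto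
    also have "(\<Sum>n. ennreal (e * (1/2)^Suc n)) = ennreal e"
      using e sums_mult[OF power_half_series, of e]
      by (intro suminf_ennreal_eq) auto
    finally show "hausdorff1_delta \<delta> (\<Union>i. A i) \<le> (\<Sum>i. hausdorff1_outer (A i)) + ennreal e" .
  qed
qed

lemma outer_measure_space_hausdorff1: "outer_measure_space (Pow UNIV) hausdorff1_outer"
  by (auto simp: outer_measure_space_def positive_def increasing_def countably_subadditive_def
      hausdorff1_outer_empty hausdorff1_outer_mono hausdorff1_outer_Union)

lemma hausdorff1_outer_Un: "hausdorff1_outer (A \<union> B) \<le> hausdorff1_outer A + hausdorff1_outer B"
proof -
  have "A \<union> B = (\<Union>i. binaryset A B i)" by (rule UN_binaryset_eq[symmetric])
  also have "hausdorff1_outer \<dots> \<le> (\<Sum>i. hausdorff1_outer (binaryset A B i))"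
    by (rule hausdorff1_outer_Union)
  also have "\<dots> = (\<Sum>i<2. hausdorff1_outer (binaryset A B i))"
    by (rule suminf_finite) (auto simp: binaryset_def hausdorff1_outer_empty)
  also have "\<dots> = hausdorff1_outer A + hausdorff1_outer B"
    by (simp add: binaryset_def numeral_2_eq_2)
  finally show ?thesis .
qed

lemma hausdorff1_outer_separated:
  assumes d: "0 < d" and sep: "\<And>x y. x \<in> A \<Longrightarrow> y \<in> B \<Longrightarrow> d \<le> dist x y"
  shows "hausdorff1_outer A + hausdorff1_outer B \<le> hausdorff1_outer (A \<union> B)"
proof -
  have small: "hausdorff1_delta \<delta> A + hausdorff1_delta \<delta> B \<le> hausdorff1_delta \<delta> (A \<union> B)"
    if \<delta>: "0 < \<delta>" "\<delta> < d" for \<delta>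
    unfolding hausdorff1_delta_def[of \<delta> "A \<union> B"]
  proof (rule INF_greatest, clarsimp)
    fix S :: "nat \<Rightarrow> 'a set"
    assume S: "A \<subseteq> (\<Union>i. S i)" "B \<subseteq> (\<Union>i. S i)" "\<forall>i. bounded (S i) \<and> diameter (S i) \<le> \<delta>"
    define SA where "SA i = (if S i \<inter> A = {} then {} else S i)" for i
    define SB where "SB i = (if S i \<inter> B = {} then {} else S i)" for i
    have "S i \<inter> A = {} \<or> S i \<inter> B = {}" for i
    proof (rule ccontr)
      assume "\<not> ?thesis"
      then obtain x y where "x \<in> S i" "x \<in> A" "y \<in> S i" "y \<in> B" by auto
      with sep[of x y] diameter_bounded_bound[of "S i" x y] S(3) \<delta> show False
        by (meson leD le_less_trans order_trans)
    qed
    then have le: "ennreal (diameter (SA i)) + ennreal (diameter (SB i)) \<le> ennreal (diameter (S i))" for i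
      by (auto simp: SA_def SB_def)
    have "hausdorff1_delta \<delta> A \<le> (\<Sum>i. ennreal (diameter (SA i)))"
      proof (rule hausdorff1_delta_le)
      show "A \<subseteq> (\<Union>i. SA i)"
      proof
        fix x assume "x \<in> A"
        moreover from this obtain i where "x \<in> S i" using S by auto
        ultimately have "x \<in> SA i" by (auto simp: SA_def)
        then show "x \<in> (\<Union>i. SA i)" by blast
      qed
    qed (use S \<delta> in \<open>auto simp: SA_def\<close>)
    moreover have "hausdorff1_delta \<delta> B \<le> (\<Sum>i. ennreal (diameter (SB i)))"
      proof (rule hausdorff1_delta_le)
      show "B \<subseteq> (\<Union>i. SB i)"
      proof
        fix x assume "x \<in> B"
        moreover from this obtain i where "x \<in> S i" using S by auto
        ultimately have "x \<in> SB i" by (auto simp: SB_def)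
        then show "x \<in> (\<Union>i. SB i)" by blast
      qed
    qed (use S \<delta> in \<open>auto simp: SB_def\<close>)
    ultimately have "hausdorff1_delta \<delta> A + hausdorff1_delta \<delta> B
        \<le> (\<Sum>i. ennreal (diameter (SA i)) + ennreal (diameter (SB i)))"
      by (subst suminf_add[symmetric]) (auto intro: add_mono)
    also have "\<dots> \<le> (\<Sum>i. ennreal (diameter (S i)))"
      using le by (intro suminf_le) auto
    finally show "hausdorff1_delta \<delta> A + hausdorff1_delta \<delta> B \<le> (\<Sum>i. ennreal (diameter (S i)))" .
  qed
  have "hausdorff1_outer A + hausdorff1_outer B =
      (SUP \<delta>\<in>{0<..}. hausdorff1_delta \<delta> A + hausdorff1_delta \<delta> B)"
    unfolding hausdorff1_outer_def
  proof (rule SUP_add_directed_ennreal[symmetric])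
    fix i j :: real assume "i \<in> {0<..}" "j \<in> {0<..}"
    then show "\<exists>k\<in>{0<..}. hausdorff1_delta i A + hausdorff1_delta j B
        \<le> hausdorff1_delta k A + hausdorff1_delta k B"
      by (intro bexI[of _ "min i j"] add_mono hausdorff1_delta_antimono) auto
  qed
  also have "\<dots> \<le> hausdorff1_outer (A \<union> B)"
  proof (rule SUP_least)
    fix \<delta> :: real assume \<delta>: "\<delta> \<in> {0<..}"
    define \<epsilon> where "\<epsilon> = min \<delta> (d/2)"
    have "hausdorff1_delta \<delta> A + hausdorff1_delta \<delta> B \<le> hausdorff1_delta \<epsilon> A + hausdorff1_delta \<epsilon> B"
      by (intro add_mono hausdorff1_delta_antimono) (auto simp: \<epsilon>_def)
    also have "\<dots> \<le> hausdorff1_delta \<epsilon> (A \<union> B)"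
      using d \<delta> by (intro small) (auto simp: \<epsilon>_def)
    also have "\<dots> \<le> hausdorff1_outer (A \<union> B)"
      using d \<delta> by (intro hausdorff1_delta_le_outer) (auto simp: \<epsilon>_def)
    finally show "hausdorff1_delta \<delta> A + hausdorff1_delta \<delta> B \<le> hausdorff1_outer (A \<union> B)" .
  qed
  finally show ?thesis .
qed

lemma hausdorff1_outer_separated_sum:
  fixes D :: "nat \<Rightarrow> 'a::metric_space set"
  assumes sep: "\<And>n. \<exists>d>0. \<forall>k<n. \<forall>x\<in>D k. \<forall>y\<in>D n. d \<le> dist x y"
  shows "(\<Sum>k<n. hausdorff1_outer (D k)) \<le> hausdorff1_outer (\<Union>k<n. D k)"
proof (induction n)
  case 0 then show ?case by simp
next
  case (Suc n)
  obtain d where d: "d > 0" "\<forall>k<n. \<forall>x\<in>D k. \<forall>y\<in>D n. d \<le> dist x y"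
    using sep by blast
  have "(\<Sum>k<Suc n. hausdorff1_outer (D k)) \<le> hausdorff1_outer (\<Union>k<n. D k) + hausdorff1_outer (D n)"
    using Suc by (auto intro: add_mono)
  also have "\<dots> \<le> hausdorff1_outer ((\<Union>k<n. D k) \<union> D n)"
    using d by (intro hausdorff1_outer_separated[of d]) auto
  also have "(\<Union>k<n. D k) \<union> D n = (\<Union>k<Suc n. D k)"
    by (auto simp: less_Suc_eq)
  finally show ?case .
qed

lemma hausdorff1_outer_closed:
  fixes C S :: "'a::metric_space set"
  assumes C: "closed C"
  shows "hausdorff1_outer (S \<inter> C) + hausdorff1_outer (S - C) = hausdorff1_outer S"
proof (rule antisym)
  show "hausdorff1_outer S \<le> hausdorff1_outer (S \<inter> C) + hausdorff1_outer (S - C)"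
    using hausdorff1_outer_Un[of "S \<inter> C" "S - C"] by (simp add: Un_Diff_Int Int_Diff_Un)
  show "hausdorff1_outer (S \<inter> C) + hausdorff1_outer (S - C) \<le> hausdorff1_outer S"
  proof (cases "hausdorff1_outer S = \<infinity> \<or> C = {}")
    case True then show ?thesis by (auto simp: hausdorff1_outer_empty)
  next
    case False
    then have fin: "hausdorff1_outer S < \<infinity>" and ne: "C \<noteq> {}" by (auto simp: less_top)
    define h where "h n = 1 / real (Suc n)" for n
    have h0: "h n > 0" for n by (simp add: h_def)
    have hmono: "h n \<le> h m" if "m \<le> n" for m n using that by (simp add: h_def field_simps)
    have hstrict: "h n < h m" if "m < n" for m n using that by (simp add: h_def field_simps)
    define A where "A n = {x\<in>S. h n \<le> infdist x C}" for n
    define D where "D n = {x\<in>S. h (Suc n) \<le> infdist x C \<and> infdist x C < h n}" for n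
    have far: "e - d \<le> dist x y" if "e \<le> infdist x C" "infdist y C \<le> d" for x y d e
      using infdist_triangle[of x C y] that by linarith
    have sepD: "\<exists>d>0. \<forall>k<n. \<forall>x\<in>D (2*k+c). \<forall>y\<in>D (2*n+c). d \<le> dist x y" for n c
    proof (cases n)
      case 0 then show ?thesis by (auto intro: exI[of _ 1])
    next
      case (Suc m)
      let ?d = "h (2*m+c+1) - h (2*n+c)"
      have "?d > 0" using Suc hstrict[of "2*m+c+1" "2*n+c"] by simp
      moreover have "?d \<le> dist x y" if "k < n" "x \<in> D (2*k+c)" "y \<in> D (2*n+c)" for k x y
        using that hmono[of "Suc (2*k+c)" "2*m+c+1"] Suc by (intro far) (auto simp: D_def)
      ultimately show ?thesis by blast
    qed
    have half: "(\<Sum>k<n. hausdorff1_outer (D (2*k+c))) \<le> hausdorff1_outer S" for n c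
    proof -
      have "(\<Sum>k<n. hausdorff1_outer (D (2*k+c))) \<le> hausdorff1_outer (\<Union>k<n. D (2*k+c))"
        using sepD[where c=c] by (rule hausdorff1_outer_separated_sum)
      also have "\<dots> \<le> hausdorff1_outer S"
        by (intro hausdorff1_outer_mono) (auto simp: D_def)
      finally show ?thesis .
    qed
    let ?T = "\<Sum>k. hausdorff1_outer (D k)"
    have "?T \<le> hausdorff1_outer S + hausdorff1_outer S"
    proof (rule suminf_le_const)
      fix n
      have eq: "(\<Sum>k<2*n. f k) = (\<Sum>k<n. f (2*k+0)) + (\<Sum>k<n. f (2*k+1))" for f :: "nat \<Rightarrow> ennreal"
        by (induction n) (auto simp: ac_simps)
      have "(\<Sum>k<n. hausdorff1_outer (D k)) \<le> (\<Sum>k<2*n. hausdorff1_outer (D k))"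
        by (rule sum_mono2) auto
      also have "\<dots> \<le> hausdorff1_outer S + hausdorff1_outer S"
        unfolding eq by (intro add_mono half)
      finally show "(\<Sum>k<n. hausdorff1_outer (D k)) \<le> hausdorff1_outer S + hausdorff1_outer S" .
    qed auto
    also have "\<dots> < \<infinity>" using fin by simp
    finally have Tfin: "?T < \<infinity>" .
    have step: "hausdorff1_outer (S \<inter> C) + hausdorff1_outer (S - C) + (\<Sum>k<n. hausdorff1_outer (D k))
        \<le> hausdorff1_outer S + ?T" for n
    proof -
      have "S - C \<subseteq> A n \<union> (\<Union>k. D (k + n))"
      proof
        fix x assume x: "x \<in> S - C"
        then have pos: "infdist x C > 0"
          using C ne in_closed_iff_infdist_zero infdist_nonneg[of x C] by fastforce
        show "x \<in> A n \<union> (\<Union>k. D (k + n))"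
        proof (cases "h n \<le> infdist x C")
          case True then show ?thesis using x by (auto simp: A_def)
        next
          case nle: False
          obtain m where m: "h m < infdist x C"
            using reals_Archimedean[OF pos] by (auto simp: h_def inverse_eq_divide)
          define l where "l = (LEAST m. h m \<le> infdist x C)"
          have l: "h l \<le> infdist x C" unfolding l_def by (rule LeastI[of "\<lambda>m. h m \<le> infdist x C", OF less_imp_le[OF m]])
          have ln: "n < l" proof (rule ccontr)
            assume "\<not> n < l"
            then have "h n \<le> h l" by (intro hmono) simp
            with nle l show False by simp
          qed
          then obtain k where k: "l = Suc k" by (cases l) auto
          have "infdist x C < h k" using not_less_Least[of k "\<lambda>m. h m \<le> infdist x C"] k
            by (auto simp: l_def)
          then have "x \<in> D k" using x l k by (simp add: D_def)
          then have "x \<in> D (k - n + n)" using k ln by simp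
          then show ?thesis by blast
        qed
      qed
      then have "hausdorff1_outer (S - C) \<le> hausdorff1_outer (A n \<union> (\<Union>k. D (k + n)))"
        by (rule hausdorff1_outer_mono)
      also have "\<dots> \<le> hausdorff1_outer (A n) + hausdorff1_outer (\<Union>k. D (k + n))"
        by (rule hausdorff1_outer_Un)
      also have "\<dots> \<le> hausdorff1_outer (A n) + (\<Sum>k. hausdorff1_outer (D (k + n)))"
        by (intro add_mono hausdorff1_outer_Union order_refl)
      finally have 1: "hausdorff1_outer (S - C) \<le> hausdorff1_outer (A n) + (\<Sum>k. hausdorff1_outer (D (k + n)))" .
      have "hausdorff1_outer (S \<inter> C) + hausdorff1_outer (A n) \<le> hausdorff1_outer ((S \<inter> C) \<union> A n)"
      proof (rule hausdorff1_outer_separated[OF h0[of n]])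
        fix x y assume "x \<in> S \<inter> C" "y \<in> A n"
        then show "h n \<le> dist x y"
          using far[of "h n" y x 0] by (auto simp: A_def dist_commute)
      qed
      also have "\<dots> \<le> hausdorff1_outer S"
        by (intro hausdorff1_outer_mono) (auto simp: A_def)
      finally have 2: "hausdorff1_outer (S \<inter> C) + hausdorff1_outer (A n) \<le> hausdorff1_outer S" .
      have 3: "?T = (\<Sum>k. hausdorff1_outer (D (k + n))) + (\<Sum>k<n. hausdorff1_outer (D k))"
        by (rule suminf_offset) simp
      have "hausdorff1_outer (S \<inter> C) + hausdorff1_outer (S - C) + (\<Sum>k<n. hausdorff1_outer (D k))
        \<le> hausdorff1_outer (S \<inter> C) + (hausdorff1_outer (A n) + (\<Sum>k. hausdorff1_outer (D (k + n))))
           + (\<Sum>k<n. hausdorff1_outer (D k))"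
        using 1 by (intro add_mono order_refl)
      also have "\<dots> = (hausdorff1_outer (S \<inter> C) + hausdorff1_outer (A n)) + ?T"
        unfolding 3 by (simp add: ac_simps)
      also have "\<dots> \<le> hausdorff1_outer S + ?T"
        using 2 by (intro add_mono order_refl)
      finally show ?thesis .
    qed
    have "(\<lambda>n. hausdorff1_outer (S \<inter> C) + hausdorff1_outer (S - C) + (\<Sum>k<n. hausdorff1_outer (D k)))
        \<longlonglongrightarrow> hausdorff1_outer (S \<inter> C) + hausdorff1_outer (S - C) + ?T"
      by (intro tendsto_add tendsto_const summable_LIMSEQ) auto
    then have "hausdorff1_outer (S \<inter> C) + hausdorff1_outer (S - C) + ?T \<le> hausdorff1_outer S + ?T"
      by (rule LIMSEQ_le_const2) (use step in auto)
    then show ?thesis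
      using Tfin by (auto simp add: add.commute[of _ "?T"] ennreal_add_left_cancel_le)
  qed
qed

lemma measure_space_hausdorff1:
  "measure_space UNIV (lambda_system UNIV (Pow UNIV) hausdorff1_outer) hausdorff1_outer"
  by (rule sigma_algebra.caratheodory_lemma[OF sigma_algebra_Pow outer_measure_space_hausdorff1])

lemma space_hausdorff1 [simp]: "space hausdorff1 = UNIV"
  by (simp add: hausdorff1_def space_measure_of_conv)

lemma sets_hausdorff1: "sets hausdorff1 = lambda_system UNIV (Pow UNIV) hausdorff1_outer"
  using measure_space_hausdorff1 unfolding hausdorff1_def measure_space_def
  by (metis sigma_algebra.sets_measure_of_eq)

lemma emeasure_hausdorff1:
  "A \<in> sets hausdorff1 \<Longrightarrow> emeasure hausdorff1 A = hausdorff1_outer A"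
  using measure_space_hausdorff1 emeasure_measure_of_sigma
  unfolding sets_hausdorff1 unfolding hausdorff1_def measure_space_def by blast

lemma borel_subset_sets_hausdorff1: "sets borel \<subseteq> sets hausdorff1"
proof -
  have "C \<in> sets hausdorff1" if "closed C" for C :: "'a set"
    using hausdorff1_outer_closed[OF that]
    by (auto simp: sets_hausdorff1 lambda_system_def Int_commute Diff_eq)
  then have "sigma_sets UNIV (Collect closed) \<subseteq> sets (hausdorff1 :: 'a measure)"
    using sets.sigma_sets_subset[of "Collect closed" "hausdorff1 :: 'a measure"] by auto
  then show ?thesis by (simp add: borel_eq_closed)
qed


section \<open>Test functions, weak derivatives, Sobolev space\<close>

text \<open>In finite dimension a map is \<open>C\<^sup>k\<^sup>+\<^sup>1\<close> iff it is differentiable and all its directional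
  derivatives are \<open>C\<^sup>k\<close>.\<close>

primrec Ck :: "nat \<Rightarrow> ('a::euclidean_space \<Rightarrow> 'b::real_normed_vector) \<Rightarrow> bool" where
  "Ck 0 f \<longleftrightarrow> continuous_on UNIV f"
| "Ck (Suc k) f \<longleftrightarrow> (\<forall>x. f differentiable (at x)) \<and>
     (\<forall>v. Ck k (\<lambda>x. frechet_derivative f (at x) v))"

definition compactly_supported_in :: "'a::topological_space set \<Rightarrow> ('a \<Rightarrow> 'b::zero) \<Rightarrow> bool" where
  "compactly_supported_in U f \<longleftrightarrow> compact (closure {x. f x \<noteq> 0}) \<and> closure {x. f x \<noteq> 0} \<subseteq> U"

definition compactly_contained :: "'a::topological_space set \<Rightarrow> 'a set \<Rightarrow> bool" where
  "compactly_contained U \<Omega> \<longleftrightarrow> compact (closure U) \<and> closure U \<subseteq> \<Omega>"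

definition test_function :: "'a::euclidean_space set \<Rightarrow> ('a \<Rightarrow> real) \<Rightarrow> bool" where
  "test_function \<Omega> \<zeta> \<longleftrightarrow> (\<forall>k. Ck k \<zeta>) \<and> compactly_supported_in \<Omega> \<zeta>"

definition C1_test_field :: "'a::euclidean_space set \<Rightarrow> ('a \<Rightarrow> 'a) \<Rightarrow> bool" where
  "C1_test_field U X \<longleftrightarrow> Ck 1 X \<and> compactly_supported_in U X"

definition grad :: "('a::euclidean_space \<Rightarrow> real) \<Rightarrow> 'a \<Rightarrow> 'a" where
  "grad f x = (\<Sum>b\<in>Basis. frechet_derivative f (at x) b *\<^sub>R b)"

definition divergence :: "('a::euclidean_space \<Rightarrow> 'a) \<Rightarrow> 'a \<Rightarrow> real" where
  "divergence X x = (\<Sum>b\<in>Basis. frechet_derivative X (at x) b \<bullet> b)"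

definition is_weak_gradient ::
    "'a::euclidean_space set \<Rightarrow> ('a \<Rightarrow> real) \<Rightarrow> ('a \<Rightarrow> 'a) \<Rightarrow> bool" where
  "is_weak_gradient \<Omega> u g \<longleftrightarrow>
     (\<forall>K. compact K \<and> K \<subseteq> \<Omega> \<longrightarrow> set_integrable lebesgue K u \<and> set_integrable lebesgue K g) \<and>
     (\<forall>\<zeta>. test_function \<Omega> \<zeta> \<longrightarrow>
        (LINT x:\<Omega>|lebesgue. u x *\<^sub>R grad \<zeta> x) = - (LINT x:\<Omega>|lebesgue. \<zeta> x *\<^sub>R g x))"

text \<open>A fixed representative; it is unique up to Lebesgue null sets, and is only used under
  Lebesgue integrals over subsets of \<open>\<Omega>\<close>.\<close>

definition weak_grad :: "'a::euclidean_space set \<Rightarrow> ('a \<Rightarrow> real) \<Rightarrow> 'a \<Rightarrow> 'a" where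
  "weak_grad \<Omega> u = (SOME g. is_weak_gradient \<Omega> u g)"

definition sobolev_W1 :: "'a::euclidean_space set \<Rightarrow> real \<Rightarrow> ('a \<Rightarrow> real) \<Rightarrow> bool" where
  "sobolev_W1 \<Omega> p u \<longleftrightarrow>
     set_borel_measurable lebesgue \<Omega> u \<and>
     set_integrable lebesgue \<Omega> (\<lambda>x. \<bar>u x\<bar> powr p) \<and>
     (\<exists>g. is_weak_gradient \<Omega> u g \<and> set_borel_measurable lebesgue \<Omega> g \<and>
          set_integrable lebesgue \<Omega> (\<lambda>x. norm (g x) powr p))"


section \<open>Sets of finite perimeter and the reduced boundary\<close>

definition locally_finite_perimeter :: "'a::euclidean_space set \<Rightarrow> 'a set \<Rightarrow> bool" where
  "locally_finite_perimeter \<Omega> A \<longleftrightarrow>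
     A \<inter> \<Omega> \<in> sets lebesgue \<and>
     (\<forall>U. open U \<and> compactly_contained U \<Omega> \<longrightarrow>
        (\<exists>c. \<forall>X. C1_test_field U X \<and> (\<forall>x. norm (X x) \<le> 1) \<longrightarrow>
           \<bar>LINT x:A|lebesgue. divergence X x\<bar> \<le> c))"

text \<open>Federer's exterior normal, 4.5.5: near \<open>x\<close> the set \<open>A\<close> agrees with the half space
  \<open>{y. (y - x) \<bullet> \<nu> < 0}\<close> up to a set of density zero at \<open>x\<close>. The reduced boundary consists of the
  points where such a normal exists.\<close>

definition exterior_normal :: "'a::euclidean_space set \<Rightarrow> 'a \<Rightarrow> 'a \<Rightarrow> bool" where
  "exterior_normal A x \<nu> \<longleftrightarrow> norm \<nu> = 1 \<and>
     ((\<lambda>r. measure lebesgue ({y\<in>A. (y - x) \<bullet> \<nu> > 0} \<inter> cball x r) / measure lebesgue (cball x r))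
        \<longlongrightarrow> 0) (at_right 0) \<and>
     ((\<lambda>r. measure lebesgue ({y. y \<notin> A \<and> (y - x) \<bullet> \<nu> < 0} \<inter> cball x r) / measure lebesgue (cball x r))
        \<longlongrightarrow> 0) (at_right 0)"

definition reduced_boundary :: "'a::euclidean_space set \<Rightarrow> 'a set \<Rightarrow> 'a set" where
  "reduced_boundary \<Omega> A = {x\<in>\<Omega>. \<exists>\<nu>. exterior_normal A x \<nu>}"


section \<open>Weak solutions\<close>

text \<open>The functions below are only considered on \<open>\<Omega>\<close>: positivity set and free boundary are taken
  in \<open>\<Omega>\<close>, and values of \<open>u\<close> outside \<open>\<Omega>\<close> play no role.\<close>

definition positivity_set :: "'a set \<Rightarrow> ('a \<Rightarrow> real) \<Rightarrow> 'a set" where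
  "positivity_set \<Omega> u = {x\<in>\<Omega>. u x > 0}"

definition free_boundary :: "'a::topological_space set \<Rightarrow> ('a \<Rightarrow> real) \<Rightarrow> 'a set" where
  "free_boundary \<Omega> u = \<Omega> \<inter> frontier (positivity_set \<Omega> u)"

text \<open>The weight \<open>\<bar>v\<bar>\<^bsup>p-2\<^esup>\<close>. For \<open>p = 2\<close> it is \<open>1\<close> also at \<open>v = 0\<close>, whereas \<open>0 powr 0 = 0\<close>.\<close>

definition pweight :: "real \<Rightarrow> 'a::real_normed_vector \<Rightarrow> real" where
  "pweight p v = (if p = 2 then 1 else norm v powr (p - 2))"

definition weakly_p_harmonic_on_positivity_set ::
    "(real^2) set \<Rightarrow> real \<Rightarrow> (real^2 \<Rightarrow> real) \<Rightarrow> bool" where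
  "weakly_p_harmonic_on_positivity_set \<Omega> p u \<longleftrightarrow>
     (\<forall>\<zeta>. test_function (positivity_set \<Omega> u) \<zeta> \<longrightarrow>
        (LINT x:positivity_set \<Omega> u|lebesgue.
           pweight p (weak_grad \<Omega> u x) * (weak_grad \<Omega> u x \<bullet> grad \<zeta> x)) = 0)"

text \<open>That the constants depend only on \<open>l\<close>, \<open>p\<close> and the distance of the boundaries is expressed by
  functions of these three quantities that are chosen before the subdomain \<open>D\<close>.\<close>

definition linear_growth_nondegenerate ::
    "(real^2) set \<Rightarrow> real \<Rightarrow> real \<Rightarrow> (real^2 \<Rightarrow> real) \<Rightarrow> bool" where
  "linear_growth_nondegenerate \<Omega> p l u \<longleftrightarrow>
     (\<exists>cmin Cmax :: real \<Rightarrow> real \<Rightarrow> real \<Rightarrow> real.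
        \<forall>D. open D \<and> connected D \<and> D \<noteq> {} \<and> bounded D \<and> compactly_contained D \<Omega> \<longrightarrow>
          (let c = cmin l p (setdist (frontier D) (frontier \<Omega>));
               C = Cmax l p (setdist (frontier D) (frontier \<Omega>))
           in 0 < c \<and> c \<le> C \<and>
              (\<forall>x r. x \<in> free_boundary \<Omega> u \<and> r > 0 \<and> ball x r \<subseteq> D \<longrightarrow>
                 c \<le> 1 / r^2 * (LINT y:sphere x r|hausdorff1. u y) \<and>
                 1 / r^2 * (LINT y:sphere x r|hausdorff1. u y) \<le> C)))"

definition weak_solution :: "(real^2) set \<Rightarrow> real \<Rightarrow> real \<Rightarrow> (real^2 \<Rightarrow> real) \<Rightarrow> bool" where
  "weak_solution \<Omega> p l u \<longleftrightarrow>
     sobolev_W1 \<Omega> p u \<and> continuous_on \<Omega> u \<and> (\<forall>x\<in>\<Omega>. u x \<ge> 0) \<and>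
     weakly_p_harmonic_on_positivity_set \<Omega> p u \<and>
     linear_growth_nondegenerate \<Omega> p l u \<and>
     locally_finite_perimeter \<Omega> (positivity_set \<Omega> u) \<and>
     (\<forall>\<zeta>. test_function \<Omega> \<zeta> \<longrightarrow>
        - (LINT x:\<Omega>|lebesgue. pweight p (weak_grad \<Omega> u x) * (weak_grad \<Omega> u x \<bullet> grad \<zeta> x)) =
        l powr (p - 1) * (LINT x:reduced_boundary \<Omega> (positivity_set \<Omega> u)|hausdorff1. \<zeta> x))"


section \<open>Curvature measure\<close>

text \<open>\<open>\<tau>\<close> is a unit vector spanning the approximate tangent line of \<open>\<Gamma>\<close> at \<open>x\<close>: the measures
  \<open>\<H>\<^sup>1\<close> restricted to the blow-ups \<open>(\<Gamma> - x) / r\<close> converge to \<open>\<H>\<^sup>1\<close> restricted to the line,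
  tested against continuous functions of compact support.\<close>

definition approx_tangent :: "(real^2) set \<Rightarrow> real^2 \<Rightarrow> real^2 \<Rightarrow> bool" where
  "approx_tangent \<Gamma> x \<tau> \<longleftrightarrow> norm \<tau> = 1 \<and>
     (\<forall>f :: real^2 \<Rightarrow> real. continuous_on UNIV f \<and> compactly_supported_in UNIV f \<longrightarrow>
        ((\<lambda>r. 1 / r * (LINT y:\<Gamma>|hausdorff1. f ((y - x) /\<^sub>R r)))
           \<longlongrightarrow> (LINT z:span {\<tau>}|hausdorff1. f z)) (at_right 0))"

text \<open>The divergence of \<open>X\<close> along the approximate tangent line. The line, hence \<open>\<tau>\<close> up to sign, is
  unique where it exists, and for a rectifiable \<open>\<Gamma>\<close> of locally finite \<open>\<H>\<^sup>1\<close>-measure it exists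
  \<open>\<H>\<^sup>1\<close>-almost everywhere on \<open>\<Gamma>\<close>; the value \<open>0\<close> elsewhere is irrelevant.\<close>

definition tangential_div :: "(real^2) set \<Rightarrow> (real^2 \<Rightarrow> real^2) \<Rightarrow> real^2 \<Rightarrow> real" where
  "tangential_div \<Gamma> X x =
     (if \<exists>\<tau>. approx_tangent \<Gamma> x \<tau>
      then (let \<tau> = (SOME \<tau>. approx_tangent \<Gamma> x \<tau>) in frechet_derivative X (at x) \<tau> \<bullet> \<tau>)
      else 0)"

definition first_variation :: "(real^2) set \<Rightarrow> (real^2 \<Rightarrow> real^2) \<Rightarrow> real" where
  "first_variation \<Gamma> X = (LINT x:\<Gamma>|hausdorff1. tangential_div \<Gamma> X x)"

definition locally_bounded_first_variation :: "(real^2) set \<Rightarrow> (real^2) set \<Rightarrow> bool" where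
  "locally_bounded_first_variation \<Omega> \<Gamma> \<longleftrightarrow>
     (\<forall>U. open U \<and> compactly_contained U \<Omega> \<longrightarrow>
        (\<exists>c>0. \<forall>X. C1_test_field U X \<and> (\<forall>x. norm (X x) \<le> 1) \<longrightarrow> \<bar>first_variation \<Gamma> X\<bar> \<le> c))"

text \<open>The vector measure \<open>H\<close> on \<open>\<Omega>\<close> representing the first variation, given by its polar
  decomposition \<open>dH = \<sigma> d\<mu>\<close>: since \<open>\<bar>\<sigma>\<bar> = 1\<close> \<open>\<mu>\<close>-almost everywhere, \<open>\<mu>\<close> is the total variation
  measure of \<open>H\<close>.\<close>

definition represents_first_variation ::
    "(real^2) set \<Rightarrow> (real^2) set \<Rightarrow> (real^2) measure \<Rightarrow> (real^2 \<Rightarrow> real^2) \<Rightarrow> bool" where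
  "represents_first_variation \<Omega> \<Gamma> \<mu> \<sigma> \<longleftrightarrow>
     sets \<mu> = sets borel \<and> emeasure \<mu> (- \<Omega>) = 0 \<and>
     (\<forall>K. compact K \<and> K \<subseteq> \<Omega> \<longrightarrow> emeasure \<mu> K < \<infinity>) \<and>
     \<sigma> \<in> borel_measurable \<mu> \<and> (AE x in \<mu>. norm (\<sigma> x) = 1) \<and>
     (\<forall>X. C1_test_field \<Omega> X \<longrightarrow> first_variation \<Gamma> X = - (LINT x|\<mu>. X x \<bullet> \<sigma> x))"

text \<open>By the Riesz representation theorem the following measure exists, and is unique, as soon as
  the first variation is locally bounded. Being a total variation it is nonnegative.\<close>

definition curvature_measure :: "(real^2) set \<Rightarrow> (real^2) set \<Rightarrow> (real^2) measure" where
  "curvature_measure \<Omega> \<Gamma> = (SOME \<mu>. \<exists>\<sigma>. represents_first_variation \<Omega> \<Gamma> \<mu> \<sigma>)"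


section \<open>Morse index\<close>

text \<open>The gradient of a Lipschitz function exists almost everywhere by Rademacher's theorem.\<close>

definition index_numerator ::
    "(real^2) set \<Rightarrow> real \<Rightarrow> (real^2 \<Rightarrow> real) \<Rightarrow> (real^2 \<Rightarrow> real) \<Rightarrow> real" where
  "index_numerator \<Omega> p u \<phi> =
     (LINT x:positivity_set \<Omega> u|lebesgue.
        pweight p (weak_grad \<Omega> u x) *
        ((norm (grad \<phi> x))^2 +
         (p - 2) * (weak_grad \<Omega> u x \<bullet> grad \<phi> x)^2 / (norm (weak_grad \<Omega> u x))^2))
     - (LINT x:free_boundary \<Omega> u|curvature_measure \<Omega> (free_boundary \<Omega> u). (\<phi> x)^2)"

definition index_denominator ::
    "(real^2) set \<Rightarrow> real \<Rightarrow> (real^2 \<Rightarrow> real) \<Rightarrow> (real^2 \<Rightarrow> real) \<Rightarrow> real" where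
  "index_denominator \<Omega> p u \<phi> =
     (LINT x:positivity_set \<Omega> u|lebesgue. pweight p (weak_grad \<Omega> u x) * (\<phi> x)^2)"

definition finite_Morse_index ::
    "(real^2) set \<Rightarrow> real \<Rightarrow> (real^2 \<Rightarrow> real) \<Rightarrow> real^2 \<Rightarrow> bool" where
  "finite_Morse_index \<Omega> p u x0 \<longleftrightarrow>
     (\<exists>C0>0. \<forall>\<phi>. (\<exists>L. L-lipschitz_on UNIV \<phi>) \<and> compactly_supported_in (\<Omega> - {x0}) \<phi> \<and>
        index_denominator \<Omega> p u \<phi> \<noteq> 0 \<longrightarrow>
        index_numerator \<Omega> p u \<phi> / index_denominator \<Omega> p u \<phi> \<ge> - C0)"


section \<open>Local finite connectedness\<close>

definition locally_finitely_connected :: "'a::topological_space set \<Rightarrow> bool" where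
  "locally_finitely_connected \<Gamma> \<longleftrightarrow>
     (\<forall>x\<in>\<Gamma>. \<exists>U. open U \<and> x \<in> U \<and> finite (components (\<Gamma> \<inter> U)))"

end

theory Submission
  imports Defs "HOL-Complex_Analysis.Complex_Analysis" "HOL-Real_Asymp.Real_Asymp"
begin

text \<open>
For a free boundary point \<open>x\<close>, Caccioppoli's inequality on the positivity set and a translation estimate,
which controls the \<open>L\<^sup>p\<close> mean of \<open>u\<close> by its \<open>L\<^sup>1\<close> mean and its energy, bound the energy of \<open>u\<close> in
\<open>ball x r\<close> by \<open>C r\<^sup>2\<close>. As the means of \<open>u\<close> grow linearly, \<open>{u > 0}\<close> has positive density at \<open>x\<close>. So has
\<open>{u = 0}\<close>, hence the perimeter of \<open>{u > 0}\<close> in \<open>ball x r\<close> is at least \<open>c r\<close>, and a covering argument shows that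
the free boundary has locally finite length. Therefore only finitely many components that meet a disc
leave a larger one. If infinitely many others met the disc, there would be many disjoint compact open
pieces \<open>K\<close> of small diameter \<open>d\<close>, each containing a continuum of diameter at least \<open>d / 2\<close>, because the free
boundary separates every disc around each of its points. The field that equals \<open>(z - a) / (2 d)\<close> near each
\<open>K\<close>, with \<open>a\<close> in \<open>K\<close>, is bounded by 1, but its first variation is at least a quarter of the number of pieces.\<close>

text \<open>The first variation does not see scale: a radial field of slope 1/(2 d) has divergence
  1/(2 d) along every line and meets a length of order d, so a piece costs a fixed amount however
  small it is. The obstacle is that \<open>tangential_div\<close> is 0 wherever no approximate
  tangent exists. Hence the tangent points of a piece must be shown to be measurable and, inside
  each continuum, to have length at least its diameter. Lipschitz arcs in continua, upper density of
  length and a description of tangents by closed conditions serve this purpose only. On the analytic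
  side growth is given for circular means alone, and no pointwise upper bound on \<open>u\<close> is
  derived: a mean from below and an L^p mean from above of the same order already keep
  \<open>u\<close> from living on a small set. The estimates are made for smooth approximants of
  \<open>u\<close>; the errors are driven below the natural order r^2 after the ball has been fixed,
  so that the constants do not depend on it. The perimeter is bounded below by fields whose
  divergence is the difference of a cutoff and its translate.\<close>

lemmas cont_borel = borel_measurable_continuous_onI
lemmas B_integrable_add = Bochner_Integration.integrable_add
lemmas B_integrable_bound = Bochner_Integration.integrable_bound
lemmas B_integrable_diff = Bochner_Integration.integrable_diff
lemmas B_integrable_sum = Bochner_Integration.integrable_sum
lemmas B_integral_add = Bochner_Integration.integral_add
lemmas B_integral_cong = Bochner_Integration.integral_cong
lemmas B_integral_diff = Bochner_Integration.integral_diff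
lemmas B_integral_mult_right_zero = Bochner_Integration.integral_mult_right_zero
lemmas B_integral_nonneg = Bochner_Integration.integral_nonneg
lemmas B_integral_sum = Bochner_Integration.integral_sum

notation scaleR (infixr "*R" 75)

abbreviation NN_lborel :: "('a::euclidean_space => ennreal) => ennreal" (binder "NN " 10)
  where "NN_lborel f == nn_integral lborel f"

abbreviation tends :: "(nat => 'a::topological_space) => 'a => bool" (infixr "---->" 60)
  where "X ----> l == X \<longlonglongrightarrow> l"

abbreviation ib :: "'a::metric_space => real => 'a => 'b::zero_neq_one"
  where "ib z r x == indicator (ball z r) x"

section \<open>Hausdorff measure\<close>

lemma hausdorff1_outer_leI:
 assumes "!!dl. 0 < dl ==> hausdorff1_delta dl A <= c"
 shows "hausdorff1_outer A <= c"
 unfolding hausdorff1_outer_def using assms by (intro SUP_least) auto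

lemma diameter_image_lipschitz:
 assumes "L-lipschitz_on A f" "bounded A"
 shows "diameter (f ` A) <= L * diameter A" "bounded (f ` A)"
proof -
 have L: "0 <= L" using assms(1) by (rule lipschitz_on_nonneg)
 have d: "dist (f x) (f y) <= L * diameter A" if "x : A" "y : A" for x y
  using lipschitz_onD[OF assms(1) that] diameter_bounded_bound[OF assms(2) that] L
  by (meson mult_left_mono order_trans)
 show "bounded (f ` A)"
 proof (cases "A = {}")
  case False
  then obtain a where "a : A" by blast
  then show ?thesis
   unfolding bounded_def by (intro exI[of _ "f a"] exI[of _ "L * diameter A"]) (auto intro: d)
 qed simp
 show "diameter (f ` A) <= L * diameter A"
 proof (cases "A = {}")
  case False
  have "(SUP (x,y)\<in>f ` A \<times> f ` A. dist x y) <= L * diameter A"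
   by (rule cSUP_least) (use False d in auto)
  then show ?thesis using False by (simp add: diameter_def[of "f ` A"])
 qed simp
qed

lemma hausdorff1_outer_lipschitz_image:
 assumes f: "L-lipschitz_on A f"
 shows "hausdorff1_outer (f ` A) <= ennreal L * hausdorff1_outer A"
proof (rule hausdorff1_outer_leI)
 fix dl :: real assume dl: "0 < dl"
 have L0: "0 <= L" using f by (rule lipschitz_on_nonneg)
 \<comment> \<open>\<open>K\<close> stays positive when L = 0, and the images of sets of diameter at
   most dl / K have diameter at most dl.\<close>
 define K where "K = max L 1"
 show "hausdorff1_delta dl (f ` A) <= ennreal L * hausdorff1_outer A"
 proof (cases "L = 0 & A = {}")
  case True then show ?thesis using hausdorff1_delta_le_outer[OF dl, of "{} :: 'b set"] by (simp add: hausdorff1_outer_empty)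
 next
  case False
  have bound: "hausdorff1_delta dl (f ` A) <= ennreal L * (\<Sum>i. ennreal (diameter (S i)))"
   if S: "A <= (\<Union>i. S i)" "!!i. bounded (S i)" "!!i. diameter (S i) <= dl / K" for S
  proof -
   have lip: "L-lipschitz_on (A Int S i) f" for i by (rule lipschitz_on_subset[OF f]) auto
   have dA: "diameter (f ` (A Int S i)) <= L * diameter (S i)" for i
   proof -
    have "diameter (f ` (A Int S i)) <= L * diameter (A Int S i)"
     using diameter_image_lipschitz[OF lip] S(2) bounded_subset[OF S(2)[of i], of "A Int S i"] by auto
    also have "... <= L * diameter (S i)" using L0 S(2) by (intro mult_left_mono diameter_subset) auto
    finally show ?thesis .
   qed
   have LS: "L * diameter (S i) <= dl" for i
   proof -
    have "L * diameter (S i) <= K * (dl / K)"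
     using S(3)[of i] S(2)[of i] L0 by (intro mult_mono) (auto simp: K_def diameter_ge_0)
    then show ?thesis by (simp add: K_def)
   qed
   have "hausdorff1_delta dl (f ` A) <= (\<Sum>i. ennreal (diameter (f ` (A Int S i))))"
   proof (intro hausdorff1_delta_le)
    show "f ` A <= (\<Union>i. f ` (A Int S i))" using S(1) by blast
    show "bounded (f ` (A Int S i))" for i
     by (rule diameter_image_lipschitz(2)[OF lip]) (use S(2) bounded_subset in blast)
    show "diameter (f ` (A Int S i)) <= dl" for i
     using LS dA order_trans by blast
   qed
   also have "... <= (\<Sum>i. ennreal L * ennreal (diameter (S i)))"
    using dA L0 S(2) by (intro suminf_le) (auto simp flip: ennreal_mult' simp: diameter_ge_0 intro!: ennreal_leI)
   also have "... = ennreal L * (\<Sum>i. ennreal (diameter (S i)))" by simp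
   finally show ?thesis .
  qed
  have "dl / K > 0" using dl by (simp add: K_def)
  have "hausdorff1_delta dl (f ` A) <= ennreal L * hausdorff1_delta (dl / K) A"
  \<comment> \<open>In \<open>ennreal\<close> 0 * top = 0, so for L = 0 an infinite content of
    \<open>A\<close> has to be treated by hand; the image is then a single point.\<close>
  proof (cases "L = 0")
   case True
   show ?thesis
   proof (cases "hausdorff1_delta (dl/K) A = top")
    case True
    have "hausdorff1_delta dl (f ` A) = 0"
    proof -
     obtain a where "a : A" using False \<open>L = 0\<close> by auto
     then have "f x = f a" if "x : A" for x
      using lipschitz_onD[OF f that, of a] \<open>L = 0\<close> by auto
     then have "hausdorff1_delta dl (f ` A) <= (\<Sum>i. ennreal (diameter ((%i::nat. {f a}) i)))"
      using dl by (intro hausdorff1_delta_le) auto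
     then show ?thesis by simp
    qed
    then show ?thesis by simp
   next
    case False
    then have "hausdorff1_delta (dl/K) A < top" by (simp add: less_top)
    then obtain S :: "nat => _" where "A <= (\<Union>i. S i)" "ALL i. bounded (S i) & diameter (S i) <= dl/K"
     unfolding hausdorff1_delta_def INF_less_iff by auto
    then have "hausdorff1_delta dl (f ` A) <= ennreal L * (\<Sum>i. ennreal (diameter (S i)))"
     by (intro bound) auto
    with True show ?thesis by simp
   qed
  next
   case False
   with L0 have L: "0 < L" by simp
   have "hausdorff1_delta dl (f ` A) / ennreal L <= hausdorff1_delta (dl / K) A"
    unfolding hausdorff1_delta_def[of "dl/K"]
   proof (rule INF_greatest, clarsimp)
    fix S :: "nat => 'a set" assume "A <= (\<Union>i. S i)" "ALL i. bounded (S i) & diameter (S i) <= dl/K"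
    then have "hausdorff1_delta dl (f ` A) <= ennreal L * (\<Sum>i. ennreal (diameter (S i)))"
     by (intro bound) auto
    then show "hausdorff1_delta dl (f ` A) / ennreal L <= (\<Sum>i. ennreal (diameter (S i)))"
     using L by (simp add: divide_le_posI_ennreal mult.commute)
   qed
   then have "ennreal L * (hausdorff1_delta dl (f ` A) / ennreal L) <= ennreal L * hausdorff1_delta (dl / K) A"
    by (intro mult_left_mono) auto
   then show ?thesis using L
    by (simp add: ennreal_times_divide mult.commute[of "ennreal L"] mult_divide_eq_ennreal)
  qed
  also have "... <= ennreal L * hausdorff1_outer A"
   by (intro mult_left_mono hausdorff1_delta_le_outer) (use \<open>dl/K > 0\<close> in auto)
  finally show ?thesis .
 qed
qed

lemma subset_Icc_diameter:
 fixes B :: "real set" assumes "bounded B"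
 shows "B <= {Inf B..Inf B + diameter B}"
proof
 fix x assume x: "x : B"
 have bb: "bdd_below B" using assms by (simp add: bounded_imp_bdd_below)
 have "Inf B <= x" by (rule cInf_lower[OF x bb])
 moreover have "x - diameter B <= Inf B"
 proof (rule cInf_greatest)
  fix y assume "y : B"
  from diameter_bounded_bound[OF assms x this] show "x - diameter B <= y"
   by (auto simp: dist_real_def)
 qed (use x in auto)
 ultimately show "x : {Inf B..Inf B + diameter B}" by auto
qed

text \<open>A bounded set of reals lies in an interval as long as its diameter, so each cover that
  competes for length yields a cover by intervals of the same total length.\<close>

lemma lebesgue_le_hausdorff1_outer:
 fixes B :: "real set"
 assumes "B : sets lebesgue"
 shows "emeasure lebesgue B <= hausdorff1_outer B"
proof -
 have "emeasure lebesgue B <= hausdorff1_delta 1 B"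
  unfolding hausdorff1_delta_def
 proof (rule INF_greatest, clarsimp)
  fix S :: "nat => real set" assume S: "B <= (\<Union>i. S i)" "ALL i. bounded (S i) & diameter (S i) <= 1"
  define a where "a i = Inf (S i)" for i
  have a: "S i <= {a i..a i + diameter (S i)}" for i
   unfolding a_def using S(2) by (intro subset_Icc_diameter) auto
  have "emeasure lebesgue B <= emeasure lebesgue (\<Union>i. {a i..a i + diameter (S i)})"
  proof (rule emeasure_mono)
   show "B <= (\<Union>i. {a i..a i + diameter (S i)})" using S(1) a by blast
  qed simp
  also have "... <= (\<Sum>i. emeasure lebesgue {a i..a i + diameter (S i)})"
   by (intro emeasure_subadditive_countably) auto
  also have "... = (\<Sum>i. ennreal (diameter (S i)))"
   using S(2) by (simp add: diameter_ge_0)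
  finally show "emeasure lebesgue B <= (\<Sum>i. ennreal (diameter (S i)))" .
 qed
 also have "... <= hausdorff1_outer B" by (rule hausdorff1_delta_le_outer) auto
 finally show ?thesis .
qed

text \<open>The source of the lower bounds on length below: a 1-Lipschitz shadow cannot be longer
  than the set. Measurability is asked of a subset \<open>B\<close> of the shadow, since the shadow
  itself may fail to have it.\<close>

lemma hausdorff1_outer_projection:
 fixes f :: "'a::metric_space => real"
 assumes "1-lipschitz_on A f" "B : sets lebesgue" "B <= f ` A"
 shows "emeasure lebesgue B <= hausdorff1_outer A"
proof -
 have "emeasure lebesgue B <= hausdorff1_outer B" by (rule lebesgue_le_hausdorff1_outer[OF assms(2)])
 also have "... <= hausdorff1_outer (f ` A)" by (rule hausdorff1_outer_mono[OF assms(3)])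
 also have "... <= ennreal 1 * hausdorff1_outer A" by (rule hausdorff1_outer_lipschitz_image[OF assms(1)])
 finally show ?thesis by simp
qed

lemma lipschitz_on_dist: "1-lipschitz_on A (%x. dist x a)"
 using abs_dist_diff_le[of _ a] by (intro lipschitz_onI) (auto simp: dist_real_def dist_commute)

text \<open>The distance from \<open>x\<close> is 1-Lipschitz, and on a connected set it takes all
  values between 0 and \<open>dist x y\<close>.\<close>

lemma hausdorff1_outer_connected:
 assumes "connected C" "x : C" "y : C"
 shows "ennreal (dist x y) <= hausdorff1_outer C"
proof -
 have "connected ((%z. dist z x) ` C)"
  by (intro connected_continuous_image assms continuous_intros)
 then have sub: "{0..dist x y} <= (%z. dist z x) ` C"
  by (intro connected_contains_Icc) (use assms in \<open>auto simp: dist_commute image_iff intro: bexI[of _ x]\<close>)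
 have "emeasure lebesgue {0..dist x y} <= hausdorff1_outer C"
  by (rule hausdorff1_outer_projection[OF lipschitz_on_dist _ sub]) auto
 then show ?thesis by simp
qed

lemma hausdorff1_delta_Icc:
 fixes a b :: real
 assumes "0 < dl" "a <= b"
 shows "hausdorff1_delta dl {a..b} <= ennreal (b - a)"
proof -
 obtain n :: nat where n: "(b - a) / dl < real n" using reals_Archimedean2 by blast
 then have n0: "0 < n" using assms by (cases n) (auto simp: divide_less_0_iff)
 define h where "h = (b - a) / n"
 have h: "0 <= h" "h <= dl" using n n0 assms by (auto simp: h_def field_simps)
 define S where "S i = (if i < n then {a + i * h..a + (i+1) * h} else {})" for i :: nat
 have dS: "diameter (S i) = (if i < n then h else 0)" for i
  using h by (auto simp: S_def diameter_closed_interval algebra_simps)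
 have cov: "{a..b} <= (\<Union>i. S i)"
 proof
  fix x assume x: "x : {a..b}"
  show "x : (\<Union>i. S i)"
  proof (cases "h = 0")
   case True
   then have "a = b" using n0 by (auto simp: h_def)
   then have "x : S 0" using x n0 True by (auto simp: S_def)
   then show ?thesis by blast
  next
   case False
   with h have hp: "0 < h" by simp
   \<comment> \<open>At the right end point the index found by rounding down would be n, where
     \<open>S\<close> is empty; that point belongs to the last interval.\<close>
   show ?thesis
   proof (cases "x = b")
    case True
    have "b = a + n * h" using n0 by (simp add: h_def)
    then have "x : S (n - 1)" using n0 True hp by (auto simp: S_def algebra_simps of_nat_diff)
    then show ?thesis by blast
   next
    case False
    define i where "i = nat \<lfloor>(x - a) / h\<rfloor>"
    have i0: "real i <= (x - a) / h" "(x - a) / h < real i + 1"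
     using x hp by (auto simp: i_def of_nat_nat)
    have "(x - a) / h < n" using x False hp n0 by (simp add: h_def field_simps)
    then have "i < n" using i0 by linarith
    then have "x : S i" using i0 hp by (auto simp: S_def field_simps)
    then show ?thesis by blast
   qed
  qed
 qed
 have "hausdorff1_delta dl {a..b} <= (\<Sum>i. ennreal (diameter (S i)))"
  using cov h assms dS by (intro hausdorff1_delta_le) (auto simp: S_def)
 also have "... = (\<Sum>i<n. ennreal (diameter (S i)))"
  by (rule suminf_finite) (auto simp: dS)
 also have "... = ennreal (n * h)"
  using h by (simp add: dS ennreal_of_nat_eq_real_of_nat ennreal_mult')
 also have "n * h = b - a" using n0 by (simp add: h_def)
 finally show ?thesis .
qed

lemma hausdorff1_outer_Icc:
 fixes a b :: real
 assumes "a <= b"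
 shows "hausdorff1_outer {a..b} = ennreal (b - a)"
proof (rule antisym)
 show "hausdorff1_outer {a..b} <= ennreal (b - a)"
  by (rule hausdorff1_outer_leI) (rule hausdorff1_delta_Icc[OF _ assms])
 show "ennreal (b - a) <= hausdorff1_outer {a..b}"
  using lebesgue_le_hausdorff1_outer[of "{a..b}"] assms by simp
qed

text \<open>A set of diameter d fits in a square of area 4 d^2, which is at most 4 dl times d once d
  is at most dl. Summed over a cover this is of order dl times the length, hence arbitrarily
  small.\<close>

lemma negligible_hausdorff1_finite:
 fixes A :: "(real^2) set"
 assumes "hausdorff1_outer A < top"
 shows "negligible A"
 unfolding negligible_outer
proof (intro allI impI)
 fix e :: real assume e: "0 < e"
 define H where "H = enn2real (hausdorff1_outer A)"
 have H: "hausdorff1_outer A = ennreal H" "0 <= H"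
  using assms by (auto simp: H_def)
 \<comment> \<open>The total area comes out as 4 dl (H + 1) = e / 2.\<close>
 define dl where "dl = e / (8 * (H + 1))"
 have dl: "0 < dl" using e H by (simp add: dl_def)
 have "hausdorff1_delta dl A < ennreal (H + 1)"
  using hausdorff1_delta_le_outer[OF dl, of A] H by (auto intro: le_less_trans simp: ennreal_less_iff)
 then obtain S where S: "A <= (\<Union>i. S i)" "!!i. bounded (S i)" "!!i. diameter (S i) <= dl"
  "(\<Sum>i. ennreal (diameter (S i))) < ennreal (H + 1)"
  by (rule hausdorff1_delta_close) (rule that)
 define x where "x i = (SOME x. x : S i)" for i
 define B where "B i = (if S i = {} then {} else cbox (x i - (\<chi> k. diameter (S i))) (x i + (\<chi> k. diameter (S i))))" for i
 have SB: "S i <= B i" for i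
 proof
  fix y assume y: "y : S i"
  then have "x i : S i" unfolding x_def by (rule someI)
  then have d: "norm (y - x i) <= diameter (S i)"
   using diameter_bounded_bound[OF S(2) y] by (simp add: dist_norm)
  have "\<bar>y $ k - x i $ k\<bar> <= diameter (S i)" for k
   using component_le_norm_cart[of "y - x i" k] d by simp
  then have "y $ k <= x i $ k + diameter (S i) & x i $ k - diameter (S i) <= y $ k" for k
   by (smt (verit) abs_le_iff)
  then show "y : B i" using y by (auto simp: B_def mem_box_cart)
 qed
 have emB: "emeasure lebesgue (B i) <= ennreal (4 * dl) * ennreal (diameter (S i))" for i
 proof (cases "S i = {}")
  case False
  let ?d = "diameter (S i)"
  have d0: "0 <= ?d" using S(2) by (simp add: diameter_ge_0)
  have "measure lebesgue (B i) = (2 * ?d) ^ 2"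
   using False d0 by (simp add: B_def content_cbox_cart interval_ne_empty_cart prod_constant power2_eq_square)
  moreover have "emeasure lebesgue (B i) = ennreal (measure lebesgue (B i))"
   by (rule emeasure_eq_ennreal_measure) (use False in \<open>simp add: B_def emeasure_lborel_cbox_eq\<close>)
  ultimately have "emeasure lebesgue (B i) = ennreal ((4 * ?d) * ?d)" by (simp add: power2_eq_square)
  also have "... <= ennreal ((4 * dl) * ?d)"
   using S(3)[of i] d0 by (intro ennreal_leI mult_right_mono) auto
  also have "... = ennreal (4 * dl) * ennreal ?d" using d0 dl by (simp add: ennreal_mult')
  finally show ?thesis .
 qed (simp add: B_def)
 have meas: "(\<Union>i. B i) : sets lebesgue" by (auto simp: B_def)
 have "emeasure lebesgue (\<Union>i. B i) <= (\<Sum>i. emeasure lebesgue (B i))"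
  by (intro emeasure_subadditive_countably) (auto simp: B_def)
 also have "... <= (\<Sum>i. ennreal (4 * dl) * ennreal (diameter (S i)))"
  by (intro suminf_le emB) auto
 also have "... = ennreal (4 * dl) * (\<Sum>i. ennreal (diameter (S i)))" by simp
 also have "... <= ennreal (4 * dl) * ennreal (H + 1)"
  using S(4) dl by (intro mult_left_mono less_imp_le) auto
 also have "... = ennreal (4 * dl * (H + 1))"
  using dl H by (simp only: ennreal_mult)
 also have "4 * dl * (H + 1) = e / 2"
  using H by (simp add: dl_def field_simps)
 finally have le: "emeasure lebesgue (\<Union>i. B i) <= ennreal (e/2)" .
 show "EX T. A <= T & T : lmeasurable & measure lebesgue T < e"
 proof (intro exI conjI)
  show "A <= (\<Union>i. B i)" using S(1) SB by blast
  show "(\<Union>i. B i) : lmeasurable"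
   using meas le by (intro fmeasurableI) (auto intro: le_less_trans)
  have "measure lebesgue (\<Union>i. B i) <= e/2"
   unfolding measure_def by (rule enn2real_leI) (use le e in auto)
  then show "measure lebesgue (\<Union>i. B i) < e" using e by linarith
 qed
qed

section \<open>Coverings and upper density\<close>

text \<open>Vitali's covering lemma in the form in which only a tail of the disjoint balls is
  enlarged. A point outside the first m closed balls has a small admissible ball that misses them,
  so the selected ball which its Vitali partner provides must come later. With m = 0 this is the
  usual five-fold cover. The indices form a set \<open>N\<close> because the family may be
  finite.\<close>

lemma fine_cover_sequence:
 fixes F :: "'a::euclidean_space set"
 assumes fine: "!!x d. x : F ==> 0 < d ==> EX r. 0 < r & r < d & P x r" and B: "0 < B"
 obtains N :: "nat set" and a :: "nat => 'a" and r :: "nat => real"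
 where "!!n. n : N ==> a n : F & 0 < r n & r n < B & P (a n) (r n)"
  "pairwise (%i j. disjnt (cball (a i) (r i)) (cball (a j) (r j))) N"
  "!!m. F <= (\<Union>n\<in>{n:N. n < m}. cball (a n) (r n)) Un (\<Union>n\<in>{n:N. m <= n}. cball (a n) (5 * r n))"
proof -
 define K where "K = {(x, r). x : F & 0 < r & r < B & P x r}"
 have KB: "0 < snd i & snd i <= B" if "i : K" for i using that by (auto simp: K_def)
 obtain C where C: "countable C" "C <= K"
  and pw: "pairwise (%i j. disjnt (cball (fst i) (snd i)) (cball (fst j) (snd j))) C"
  and cov: "!!i. i : K ==> EX j. j : C & ~ disjnt (cball (fst i) (snd i)) (cball (fst j) (snd j)) &
          cball (fst i) (snd i) <= ball (fst j) (5 * snd j)"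
  by (rule Vitali_covering_lemma_cballs_balls[of K snd B fst, OF KB]) (blast intro: that)+
 define N where "N = to_nat_on C ` C"
 define a where "a n = fst (from_nat_into C n)" for n
 define r where "r n = snd (from_nat_into C n)" for n
 have in_C: "from_nat_into C n : C" if "n : N" for n
  using that C(1) by (auto simp: N_def)
 have NK: "(a n, r n) : K" if "n : N" for n
  using in_C[OF that] C(2) by (auto simp: a_def r_def)
 show thesis
 proof (rule that[of N a r])
  show "a n : F & 0 < r n & r n < B & P (a n) (r n)" if "n : N" for n
   using NK[OF that] by (auto simp: K_def)
  show "pairwise (%i j. disjnt (cball (a i) (r i)) (cball (a j) (r j))) N"
  proof (rule pairwiseI)
   fix i j assume ij: "i : N" "j : N" "i ~= j"
   then have "from_nat_into C i ~= from_nat_into C j"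
    using C(1) by (auto simp: N_def)
   with ij pw in_C show "disjnt (cball (a i) (r i)) (cball (a j) (r j))"
    unfolding a_def r_def by (blast dest: pairwiseD)
  qed
  show "F <= (\<Union>n\<in>{n:N. n < m}. cball (a n) (r n)) Un (\<Union>n\<in>{n:N. m <= n}. cball (a n) (5 * r n))" for m
  proof
   fix x assume x: "x : F"
   let ?V = "\<Union>n\<in>{n:N. n < m}. cball (a n) (r n)"
   show "x : ?V Un (\<Union>n\<in>{n:N. m <= n}. cball (a n) (5 * r n))"
   proof (cases "x : ?V")
    case False
    have "closed ?V" by (intro closed_UN) auto
    then obtain d where d: "0 < d" "ball x d Int ?V = {}"
     using False by (meson ComplI disjoint_iff open_Compl open_contains_ball subsetD ComplD)
    obtain s where s: "0 < s" "s < min d B" "P x s" using fine[OF x, of "min d B"] d B by auto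
    then have "(x, s) : K" using x by (auto simp: K_def)
    from cov[OF this] obtain j where j: "j : C" "~ disjnt (cball x s) (cball (fst j) (snd j))"
     "cball x s <= ball (fst j) (5 * snd j)" by auto
    define n where "n = to_nat_on C j"
    have n: "n : N" "from_nat_into C n = j" using j C(1) by (auto simp: N_def n_def)
    have "cball x s <= ball x d" using s by auto
    then have "~ n < m" using d j n unfolding disjnt_def by (auto simp: a_def r_def)
    moreover have "x : cball (a n) (5 * r n)"
     using j(3) s n by (auto simp: a_def r_def subset_iff intro: less_imp_le)
    ultimately show ?thesis using n by auto
   qed auto
  qed
 qed
qed

text \<open>Length restricted to \<open>G\<close>, transported by the identity to the Borel sets, so
  that results on finite Borel measures such as outer regularity apply.\<close>

definition hm :: "'a::euclidean_space set => 'a measure" where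
 "hm G = distr (density hausdorff1 (indicator G)) borel (%x. x)"

lemma borel_in_hausdorff1: "A : sets borel ==> A : sets hausdorff1"
 using borel_subset_sets_hausdorff1 by blast

lemma sets_hm [simp, measurable_cong]: "sets (hm G) = sets borel"
 by (simp add: hm_def)

lemma space_hm [simp]: "space (hm G) = UNIV"
 by (simp add: hm_def)

lemma emeasure_hm:
 assumes "G : sets borel" "A : sets borel"
 shows "emeasure (hm G) A = hausdorff1_outer (G Int A)"
proof -
 have "(%x. x) : measurable hausdorff1 borel"
  by (rule measurableI) (auto intro: borel_in_hausdorff1)
 then have "(%x. x) : measurable (density hausdorff1 (indicator G)) borel" by simp
 then have "emeasure (hm G) A = emeasure (density hausdorff1 (indicator G)) A"
  using assms by (simp add: hm_def emeasure_distr)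
 also have "... = (\<integral>\<^sup>+x. indicator G x * indicator A x \<partial>hausdorff1)"
  using assms by (intro emeasure_density borel_measurable_indicator borel_in_hausdorff1)
 also have "... = (\<integral>\<^sup>+x. indicator (G Int A) x \<partial>hausdorff1)"
  by (intro nn_integral_cong) (auto simp: indicator_def)
 also have "... = emeasure hausdorff1 (G Int A)"
  using assms by (intro nn_integral_indicator) (auto intro: borel_in_hausdorff1)
 also have "... = hausdorff1_outer (G Int A)"
  using assms by (intro emeasure_hausdorff1) (auto intro: borel_in_hausdorff1)
 finally show ?thesis .
qed

lemma finite_measure_hm:
 assumes "G : sets borel" "hausdorff1_outer G < top"
 shows "finite_measure (hm G)"
 by (rule finite_measureI) (use emeasure_hm[OF assms(1), of UNIV] assms(2) in simp)

text \<open>Lower semicontinuity in the centre: the mass of an open ball is almost attained on a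
  slightly smaller concentric ball, and all nearby balls still contain that one.\<close>

lemma open_emeasure_ball_gt:
 fixes M :: "'a::euclidean_space measure"
 assumes M: "sets M = sets borel"
 shows "open {x. c < emeasure M (ball (x + v) r)}"
 unfolding open_contains_ball
proof (intro ballI)
 fix x assume "x : {x. c < emeasure M (ball (x + v) r)}"
 then have x: "c < emeasure M (ball (x + v) r)" by simp
 define R where "R n = r - 1 / real (Suc n)" for n
 have inc: "incseq (%n. ball (x + v) (R n))"
  by (intro incseq_SucI subset_ball) (auto simp: R_def field_simps)
 have "(\<Union>n. ball (x + v) (R n)) = ball (x + v) r"
 proof safe
  fix y assume "y : ball (x + v) r"
  then have "0 < r - dist (x+v) y" by simp
  from reals_Archimedean[OF this] obtain n where "1 / real (Suc n) < r - dist (x+v) y"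
   by (auto simp only: inverse_eq_divide)
  then have "y : ball (x+v) (R n)" by (auto simp: R_def)
  then show "y : (\<Union>n. ball (x + v) (R n))" by blast
 next
  fix y n assume "y : ball (x + v) (R n)"
  moreover have "R n < r" by (simp add: R_def)
  ultimately show "y : ball (x + v) r" by auto
 qed
 then have "(%n. emeasure M (ball (x + v) (R n))) ----> emeasure M (ball (x + v) r)"
  using Lim_emeasure_incseq[OF _ inc, of M] M by (simp add: image_subset_iff)
 then have "eventually (%n. c < emeasure M (ball (x + v) (R n))) sequentially"
  using x by (rule order_tendstoD)
 then obtain n where n: "c < emeasure M (ball (x + v) (R n))"
  by (auto simp: eventually_sequentially)
 have "c < emeasure M (ball (y + v) r)" if "dist x y < 1 / real (Suc n)" for y
 proof -
  have "ball (x + v) (R n) <= ball (y + v) r"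
  proof
   fix z assume "z : ball (x + v) (R n)"
   moreover have "dist (y + v) z <= dist (x + v) z + dist x y"
    using dist_triangle[of "y + v" z "x + v"] by (simp add: dist_commute)
   ultimately show "z : ball (y + v) r" using that by (simp add: R_def)
  qed
  then have "emeasure M (ball (x + v) (R n)) <= emeasure M (ball (y + v) r)"
   using M by (intro emeasure_mono) auto
  with n show ?thesis by simp
 qed
 then show "EX e>0. ball x e <= {x. c < emeasure M (ball (x + v) r)}"
  by (intro exI[of _ "1 / real (Suc n)"]) auto
qed

lemma suminf_disjoint_cballs_le:
 fixes M :: "'a::euclidean_space measure"
 assumes M: "sets M = sets borel"
  and pw: "pairwise (%i j. disjnt (cball (a i) (r i)) (cball (a j) (r j))) N"
  and lo: "!!n. n : N ==> ennreal (c * r n) <= emeasure M (cball (a n) (r n))"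
  and sub: "!!n. n : N ==> cball (a n) (r n) <= U" and U: "U : sets borel"
 shows "(\<Sum>n. ennreal (if n : N then c * r n else 0)) <= emeasure M U"
proof -
 define S where "S n = (if n : N then cball (a n) (r n) else {})" for n :: nat
 have dis: "disjoint_family S"
  using pw by (auto simp: disjoint_family_on_def S_def pairwise_def disjnt_def)
 have "(\<Sum>n. ennreal (if n : N then c * r n else 0)) <= (\<Sum>n. emeasure M (S n))"
  by (intro suminf_le) (auto simp: S_def lo)
 also have "... = emeasure M (\<Union>n. S n)"
 proof (rule suminf_emeasure[OF _ dis])
  have "S n : sets borel" for n by (simp add: S_def)
  then show "range S <= sets M" unfolding M by blast
 qed
 also have "... <= emeasure M U"
 proof (rule emeasure_mono)
  show "(\<Union>n. S n) <= U" using sub by (auto simp: S_def split: if_splits)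
 qed (use M U in simp)
 finally show ?thesis .
qed

text \<open>Let m be the length of the bad set. Cover it by disjoint balls inside an open set of
  mass less than m + e. Each diameter is at most the mass of its ball divided by 1 + eps, so the
  cover gives m <= (m + e) / (1 + eps) for every e, which forces m = 0.\<close>

lemma hausdorff1_upper_density_null:
 fixes G :: "'a::euclidean_space set"
 assumes G: "G : sets borel" "hausdorff1_outer G < top" and eps: "0 < eps"
 shows "hausdorff1_outer {x:G. ALL d>0. EX r. 0 < r & r < d &
  emeasure (hm G) (ball x r) > ennreal ((1 + eps) * (2 * r))} = 0"
proof -
 define F where "F = {x. ALL d>0. EX r. 0 < r & r < d &
  emeasure (hm G) (ball x r) > ennreal ((1 + eps) * (2 * r))}"
 interpret finite_measure "hm G" by (rule finite_measure_hm[OF G])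
 \<comment> \<open>\<open>F\<close> becomes a countable intersection of open sets, hence
   Borel.\<close>
 have "F = (\<Inter>n::nat. \<Union>r\<in>{0<..<1/real (Suc n)}. {x. ennreal ((1 + eps) * (2 * r)) < emeasure (hm G) (ball x r)})"
 proof safe
  fix x n assume "x : F"
  then show "x : (\<Union>r\<in>{0<..<1/real (Suc n)}. {x. ennreal ((1 + eps) * (2 * r)) < emeasure (hm G) (ball x r)})"
   unfolding F_def by (auto dest!: spec[of _ "1 / real (Suc n)"])
 next
  fix x assume x: "x : (\<Inter>n::nat. \<Union>r\<in>{0<..<1/real (Suc n)}. {x. ennreal ((1 + eps) * (2 * r)) < emeasure (hm G) (ball x r)})"
  show "x : F" unfolding F_def
  proof (intro CollectI allI impI)
   fix d :: real assume "0 < d"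
   from reals_Archimedean[OF this] obtain n where n: "1 / real (Suc n) < d"
    by (auto simp only: inverse_eq_divide)
   from x obtain r where "r : {0<..<1/real (Suc n)}" "ennreal ((1 + eps) * (2 * r)) < emeasure (hm G) (ball x r)"
    by blast
   with n show "EX r. 0 < r & r < d & ennreal ((1 + eps) * (2 * r)) < emeasure (hm G) (ball x r)"
    by (intro exI[of _ r]) auto
  qed
 qed
 moreover have "open (\<Union>r\<in>{0<..<1/real (Suc n)}. {x. ennreal ((1 + eps) * (2 * r)) < emeasure (hm G) (ball x r)})" for n
  using open_emeasure_ball_gt[of "hm G" _ 0] by (intro open_UN) auto
 ultimately have Fb: "F : sets borel" by (auto intro!: sets.countable_INT)
 define m where "m = measure (hm G) F"
 have m: "emeasure (hm G) F = ennreal m" "0 <= m"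
  by (simp_all add: m_def emeasure_eq_measure)
 have key: "m <= (m + e) / (1 + eps)" if e: "0 < e" for e
 proof -
  have "emeasure (hm G) F = (INF U\<in>{U. F <= U & open U}. emeasure (hm G) U)"
   using Fb by (intro outer_regular) auto
  moreover have "emeasure (hm G) F < ennreal (m + e)" using m e by (simp add: ennreal_less_iff)
  ultimately obtain U where U: "F <= U" "open U" "emeasure (hm G) U < ennreal (m + e)"
   by (auto simp: INF_less_iff)
  have "hausdorff1_outer (G Int F) <= ennreal ((m + e) / (1 + eps))"
  proof (rule hausdorff1_outer_leI)
   fix dl :: real assume dl: "0 < dl"
   define P where "P x r \<longleftrightarrow> cball x r <= U & ennreal ((1 + eps) * (2 * r)) < emeasure (hm G) (ball x r)" for x r
   have fine: "EX r. 0 < r & r < d & P x r" if x: "x : F" and d: "0 < d" for x d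
   proof -
    obtain e where e: "0 < e" "cball x e <= U" using x U by (meson open_contains_cball subsetD)
    obtain r where "0 < r" "r < min d e" "ennreal ((1 + eps) * (2 * r)) < emeasure (hm G) (ball x r)"
     using x d e unfolding F_def by (auto dest!: spec[of _ "min d e"])
    moreover from this have "cball x r <= U" using e(2) by (meson cball_subset_cball_iff less_imp_le min_less_iff_conj order_trans subset_cball)
    ultimately show ?thesis unfolding P_def by auto
   qed
   obtain N :: "nat set" and a :: "nat => 'a" and r :: "nat => real"
    where N: "!!n. n : N ==> a n : F & 0 < r n & r n < dl / 10 & P (a n) (r n)"
    and pw: "pairwise (%i j. disjnt (cball (a i) (r i)) (cball (a j) (r j))) N"
    and cov: "!!k. F <= (\<Union>n\<in>{n:N. n < k}. cball (a n) (r n)) Un (\<Union>n\<in>{n:N. k <= n}. cball (a n) (5 * r n))"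
    by (rule fine_cover_sequence[where F = F and P = P and B = "dl/10"]) (use fine dl in auto)
   have lo: "ennreal ((1+eps) * 2 * r n) <= emeasure (hm G) (cball (a n) (r n))" if "n : N" for n
   proof -
    have "ennreal ((1+eps) * (2 * r n)) <= emeasure (hm G) (ball (a n) (r n))"
     using N[OF that] by (auto simp: P_def)
    also have "... <= emeasure (hm G) (cball (a n) (r n))" by (intro emeasure_mono) auto
    finally show ?thesis by (simp only: mult.assoc)
   qed
   have bnd: "(\<Sum>n. ennreal (if n : N then (1+eps) * 2 * r n else 0)) <= ennreal (m + e)"
    using suminf_disjoint_cballs_le[OF sets_hm pw lo, of U] N U(2,3) by (force simp: P_def)
   define rh where "rh n = (if n : N then r n else 0)" for n
   have rh0: "0 <= rh n" for n using N by (auto simp: rh_def intro: less_imp_le)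
   have "(1+eps) * 2 * rh n = (if n : N then (1+eps) * 2 * r n else 0)" for n
    by (auto simp: rh_def)
   then have bnd': "(\<Sum>n. ennreal ((1+eps) * 2 * rh n)) <= ennreal (m + e)" using bnd by presburger
   have "summable (%n. (1+eps) * 2 * rh n)"
    by (rule summable_suminf_not_top) (use rh0 eps bnd' in \<open>auto simp: top_unique\<close>)
   then have sm: "summable rh" using eps by simp
   have "ennreal (\<Sum>n. (1+eps) * 2 * rh n) <= ennreal (m + e)"
   proof -
    have "(\<Sum>n. ennreal ((1+eps) * 2 * rh n)) = ennreal (\<Sum>n. (1+eps) * 2 * rh n)"
     by (rule suminf_ennreal2) (use rh0 eps \<open>summable (%n. (1+eps) * 2 * rh n)\<close> in auto)
    then show ?thesis using bnd' by (rule ord_eq_le_trans[OF sym])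
   qed
   then have "(\<Sum>n. (1+eps) * 2 * rh n) <= m + e" using m e by (subst (asm) ennreal_le_iff) auto
   then have s2: "2 * (\<Sum>n. rh n) <= (m + e) / (1 + eps)"
    unfolding suminf_mult[OF sm] using eps by (simp add: pos_le_divide_eq mult_ac)
   \<comment> \<open>The first k balls keep their radius and only the tail is enlarged five times;
     the tail vanishes as k grows because \<open>rh\<close> is summable.\<close>
   have step: "hausdorff1_delta dl (G Int F) <= ennreal (2 * (\<Sum>n. rh n) + 10 * (\<Sum>n. rh (n + k)))" for k
   proof -
    define S where "S n = (if n : N then cball (a n) (if n < k then r n else 5 * r n) else {})" for n
    have dS: "diameter (S n) <= (if n < k then 2 * rh n else 10 * rh n)" for n
     using N[of n] by (auto simp: S_def rh_def diameter_cball)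
    have "G Int F <= (\<Union>n. S n)"
    proof
     fix x assume "x : G Int F"
     then consider n where "n : N" "n < k" "x : cball (a n) (r n)" | n where "n : N" "k <= n" "x : cball (a n) (5 * r n)"
      using cov[of k] by blast
     then show "x : (\<Union>n. S n)"
     proof cases
      case 1
      then have "x : S n" by (simp add: S_def)
      then show ?thesis by blast
     next
      case 2
      then have "x : S n" by (simp add: S_def)
      then show ?thesis by blast
     qed
    qed
    moreover have "diameter (S n) <= dl" for n
     using dS[of n] N[of n] dl by (cases "n : N") (auto simp: rh_def S_def split: if_splits)
    ultimately have "hausdorff1_delta dl (G Int F) <= (\<Sum>n. ennreal (diameter (S n)))"
     by (intro hausdorff1_delta_le) (auto simp: S_def)
    also have "... <= (\<Sum>n. ennreal (if n < k then 2 * rh n else 10 * rh n))"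
     by (intro suminf_le ennreal_leI dS) auto
    also have "... = (\<Sum>n. ennreal (if n + k < k then 2 * rh (n+k) else 10 * rh (n+k)))
      + (\<Sum>n<k. ennreal (if n < k then 2 * rh n else 10 * rh n))"
     by (rule suminf_offset) auto
    also have "... = (\<Sum>n. ennreal (10 * rh (n+k))) + (\<Sum>n<k. ennreal (2 * rh n))"
     by simp
    also have "(\<Sum>n. ennreal (10 * rh (n+k))) = ennreal (\<Sum>n. 10 * rh (n + k))"
     using rh0 sm by (intro suminf_ennreal2) (auto simp: summable_iff_shift)
    also have "(\<Sum>n. 10 * rh (n + k)) = 10 * (\<Sum>n. rh (n + k))"
     using sm by (intro suminf_mult) (auto simp: summable_iff_shift)
    also have "(\<Sum>n<k. ennreal (2 * rh n)) = ennreal (2 * (\<Sum>n<k. rh n))"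
     using rh0 by (simp add: sum_ennreal sum_distrib_left)
    also have "... <= ennreal (2 * (\<Sum>n. rh n))"
     using sm rh0 by (intro ennreal_leI mult_left_mono sum_le_suminf) auto
    finally have "hausdorff1_delta dl (G Int F) <= ennreal (10 * (\<Sum>n. rh (n + k))) + ennreal (2 * (\<Sum>n. rh n))"
     by (simp add: add_left_mono)
    also have "... = ennreal (10 * (\<Sum>n. rh (n + k)) + 2 * (\<Sum>n. rh n))"
     using sm rh0 by (intro ennreal_plus[symmetric]) (auto intro!: suminf_nonneg mult_nonneg_nonneg simp: summable_iff_shift)
    finally show ?thesis by (simp add: add.commute)
   qed
   have "(%k. ennreal (2 * (\<Sum>n. rh n) + 10 * (\<Sum>n. rh (n + k)))) ----> ennreal (2 * (\<Sum>n. rh n) + 10 * 0)"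
    by (intro tendsto_intros suminf_exist_split2 tendsto_ennrealI sm)
   then have "hausdorff1_delta dl (G Int F) <= ennreal (2 * (\<Sum>n. rh n) + 10 * 0)"
    by (rule LIMSEQ_le_const) (use step in auto)
   also have "... <= ennreal ((m + e) / (1 + eps))" using s2 by (intro ennreal_leI) simp
   finally show "hausdorff1_delta dl (G Int F) <= ennreal ((m + e) / (1 + eps))" .
  qed
  then have "ennreal m <= ennreal ((m + e) / (1 + eps))"
   using emeasure_hm[OF G(1) Fb] m by simp
  then show ?thesis using m e eps by (simp add: ennreal_le_iff)
 qed
 have "m = 0"
 proof (rule ccontr)
  assume "m ~= 0"
  with m have "0 < m" by simp
  with key[of "m * eps / 2"] eps show False by (simp add: field_simps)
 qed
 then have "hausdorff1_outer (G Int F) = 0" using emeasure_hm[OF G(1) Fb] m by simp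
 moreover have "G Int F = {x:G. ALL d>0. EX r. 0 < r & r < d &
  emeasure (hm G) (ball x r) > ennreal ((1 + eps) * (2 * r))}" by (auto simp: F_def)
 ultimately show ?thesis by simp
qed

section \<open>Lipschitz paths in continua\<close>

lemma connected_imp_chain:
 fixes C :: "'a::metric_space set"
 assumes "connected C" "x : C" "y : C" "0 < dl"
 shows "(x, y) : {(a, b). a : C & b : C & dist a b < dl}\<^sup>*" (is "_ : ?R\<^sup>*")
proof (rule connected_equivalence_relation[OF assms(1-3), where R = "%a b. (a, b) : ?R\<^sup>*"])
 have "sym ?R" by (auto simp: sym_def dist_commute)
 then have "sym (?R\<^sup>*)" by (rule sym_rtrancl)
 then show "(b, a) : ?R\<^sup>*" if "(a, b) : ?R\<^sup>*" for a b using that by (auto dest: symD)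
 show "(a, c) : ?R\<^sup>*" if "(a, b) : ?R\<^sup>*" "(b, c) : ?R\<^sup>*" for a b c using that by auto
 show "EX T. openin (top_of_set C) T & a : T & (ALL z:T. (a, z) : ?R\<^sup>*)" if a: "a : C" for a
 proof (intro exI conjI ballI)
  show "openin (top_of_set C) (C Int ball a dl)" by (rule openin_open_Int) simp
  show "a : C Int ball a dl" using a assms by simp
  show "(a, z) : ?R\<^sup>*" if "z : C Int ball a dl" for z
   using that a by (intro r_into_rtrancl) auto
 qed
qed

lemma hausdorff1_outer_connected_ball:
 fixes C :: "'a::metric_space set"
 assumes "connected C" "x : C" "y : C" "r <= dist x y"
 shows "ennreal r <= hausdorff1_outer (C Int ball x r)"
proof (cases "0 < r")
 case True
 have "connected ((%z. dist z x) ` C)"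
  by (intro connected_continuous_image assms continuous_intros)
 then have sub: "{0..dist x y} <= (%z. dist z x) ` C"
  by (intro connected_contains_Icc) (use assms in \<open>auto simp: dist_commute image_iff intro: bexI[of _ x]\<close>)
 have "emeasure lebesgue {0..<r} <= hausdorff1_outer (C Int ball x r)"
 proof (rule hausdorff1_outer_projection[OF lipschitz_on_dist])
  show "{0..<r} <= (%z. dist z x) ` (C Int ball x r)"
  proof
   fix s assume s: "s : {0..<r}"
   then obtain z where "z : C" "s = dist z x" using sub assms(4) by fastforce
   with s show "s : (%z. dist z x) ` (C Int ball x r)" by (auto simp: dist_commute)
  qed
 qed auto
 then show ?thesis using True by simp
qed (simp add: ennreal_neg)

text \<open>Take a chain with the fewest links. Vertices whose indices differ by two or more are at
  least dl apart, as otherwise the chain could be shortened. So the balls of radius dl / 2 about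
  every second vertex are disjoint, and each of them holds length at least dl / 2 of
  \<open>C\<close>. This bounds the number of links by the length of \<open>C\<close>.\<close>

lemma connected_short_chain:
 fixes C :: "'a::euclidean_space set"
 assumes C: "connected C" "compact C" "hausdorff1_outer C < top" and xy: "x : C" "y : C"
  and dl: "0 < dl" "dl < dist x y"
 obtains n f where "f 0 = x" "f n = y" "0 < n" "!!i. i <= n ==> f i : C"
  "!!i. i < n ==> dist (f i) (f (Suc i)) < dl"
  "real n * dl <= 4 * enn2real (hausdorff1_outer C)"
proof -
 define R where "R = {(a, b). a : C & b : C & dist a b < dl}"
 have "(x, y) : R\<^sup>*" unfolding R_def by (rule connected_imp_chain[OF C(1) xy dl(1)])
 then have ex: "EX n. (x, y) : R ^^ n" by (rule rtrancl_imp_relpow)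
 define n where "n = (LEAST n. (x, y) : R ^^ n)"
 have n: "(x, y) : R ^^ n" unfolding n_def by (rule LeastI_ex[OF ex])
 have minimal: "n <= k" if "(x, y) : R ^^ k" for k unfolding n_def using that by (rule Least_le)
 from n obtain f where f: "f 0 = x" "f n = y" "!!i. i < n ==> (f i, f (Suc i)) : R"
  unfolding relpow_fun_conv by blast
 have n0: "0 < n" using f dl by (cases n) auto
 have fC: "f i : C" if "i <= n" for i
 proof (cases "i < n")
  case True then show ?thesis using f(3)[of i] by (auto simp: R_def)
 next
  case False then show ?thesis using that f(2) xy by simp
 qed
 have path: "(f i, f j) : R ^^ (j - i)" if "i <= j" "j <= n" for i j
  unfolding relpow_fun_conv using that f(3) by (intro exI[of _ "%k. f (i + k)"]) auto
 have sep: "dl <= dist (f i) (f j)" if ij: "i + 2 <= j" "j <= n" for i j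
 proof (rule ccontr)
  assume "~ ?thesis"
  then have "(f i, f j) : R" using fC ij by (auto simp: R_def)
  then have "(f i, f j) : R ^^ 1" by simp
  with path[of 0 i] have "(x, f j) : R ^^ (i + 1)"
   using ij f(1) by (auto simp: relpow_add)
  with path[of j n] have "(x, y) : R ^^ (i + 1 + (n - j))"
   using ij f(2) unfolding relpow_add[of "i+1"] by auto
  from minimal[OF this] ij show False by simp
 qed
 define m where "m = n div 2"
 define B where "B i = ball (f (2 * i)) (dl/2)" for i
 have disj: "disjoint_family_on B {..m}"
 proof -
  have "B i Int B j = {}" if "i < j" "j <= m" for i j
  proof -
   have "dl <= dist (f (2*i)) (f (2*j))" using that by (intro sep) (auto simp: m_def)
   then show ?thesis unfolding B_def by (intro disjoint_ballI) simp
  qed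
  then show ?thesis unfolding disjoint_family_on_def
   by (metis Int_commute atMost_iff linorder_neqE_nat)
 qed
 have Cb: "C : sets borel" using C(2) by (simp add: borel_compact)
 have mass: "ennreal (dl/2) <= emeasure (hm C) (B i)" if "i <= m" for i
 proof -
  have i: "f (2 * i) : C" using that by (intro fC) (simp add: m_def)
  \<comment> \<open>As dl < dist x y, one of the two end points is at distance at least dl / 2 from
    this vertex, so \<open>C\<close> leaves the ball.\<close>
  have "dist x y <= dist (f (2*i)) x + dist (f (2*i)) y" by (metis dist_commute dist_triangle)
  then have "dl/2 <= dist (f (2*i)) x | dl/2 <= dist (f (2*i)) y" using dl by linarith
  then have "ennreal (dl/2) <= hausdorff1_outer (C Int ball (f (2*i)) (dl/2))"
   using hausdorff1_outer_connected_ball[OF C(1) i] xy by blast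
  then show ?thesis by (simp add: emeasure_hm[OF Cb] B_def)
 qed
 have "of_nat (Suc m) * ennreal (dl/2) = (\<Sum>i\<le>m. ennreal (dl/2))" by simp
 also have "... <= (\<Sum>i\<le>m. emeasure (hm C) (B i))" by (intro sum_mono mass) auto
 also have "... = emeasure (hm C) (\<Union>i\<le>m. B i)"
  by (intro sum_emeasure disj) (auto simp: B_def)
 also have "... <= hausdorff1_outer C"
  by (subst emeasure_hm[OF Cb]) (auto simp: B_def intro!: hausdorff1_outer_mono)
 finally have le: "of_nat (Suc m) * ennreal (dl/2) <= hausdorff1_outer C" .
 define H where "H = enn2real (hausdorff1_outer C)"
 have H: "hausdorff1_outer C = ennreal H" "0 <= H" using C(3) by (auto simp: H_def)
 have "of_nat (Suc m) * ennreal (dl/2) = ennreal (real (Suc m) * (dl/2))"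
  using dl by (simp only: ennreal_of_nat_eq_real_of_nat[symmetric] ennreal_mult'' ennreal_mult)
 with le H have "real (Suc m) * (dl/2) <= H" by (metis ennreal_le_iff)
 moreover have "real n <= 2 * real (Suc m)" unfolding m_def by simp
 then have "real n * dl <= 2 * real (Suc m) * dl" using dl by (intro mult_right_mono) auto
 ultimately have "real n * dl <= 4 * H" by linarith
 then show ?thesis using that[of f n] f n0 fC by (auto simp: R_def H_def)
qed

text \<open>The fraction of a unit edge that has been travelled at time s. Summing clamped edges
  describes a polygon by one formula, without locating the current edge.\<close>

definition clamp01 :: "real => real" where "clamp01 s = max 0 (min 1 s)"

lemma sum_clamp01: "0 <= z ==> (\<Sum>i<n. clamp01 (z - real i)) = min z (real n)"
 by (induction n) (auto simp: clamp01_def)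

lemma clamp01_lipschitz: "1-lipschitz_on UNIV clamp01"
 by (rule lipschitz_onI) (auto simp: clamp01_def dist_real_def)

text \<open>All clamps are nondecreasing in time and their sum is \<open>min (n t) n\<close>, so the
  displacements between two times add up to n dl (t - s).\<close>

lemma polygon_lipschitz:
 fixes f :: "nat => 'a::real_normed_vector"
 assumes step: "!!i. i < n ==> dist (f i) (f (Suc i)) <= dl" and dl: "0 <= dl"
 shows "(real n * dl)-lipschitz_on {0..1}
  (%t. f 0 + (\<Sum>i<n. clamp01 (real n * t - real i) *R (f (Suc i) - f i)))" (is "_-lipschitz_on _ ?g")
proof -
 have le: "dist (?g s) (?g t) <= real n * dl * (t - s)" if st: "0 <= s" "s <= t" "t <= 1" for s t
 proof -
  have mono: "clamp01 (real n * s - real i) <= clamp01 (real n * t - real i)" for i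
   using mult_left_mono[OF st(2), of "real n"] by (auto simp: clamp01_def)
  have "dist (?g s) (?g t) = norm (\<Sum>i<n. (clamp01 (real n * t - real i) - clamp01 (real n * s - real i)) *R (f (Suc i) - f i))"
   by (simp add: dist_norm norm_minus_commute scaleR_diff_left sum_subtractf)
  also have "... <= (\<Sum>i<n. (clamp01 (real n * t - real i) - clamp01 (real n * s - real i)) * dl)"
  proof (rule sum_norm_le)
   fix i assume "i : {..<n}"
   then have "norm (f (Suc i) - f i) <= dl" using step[of i] by (simp add: dist_norm norm_minus_commute)
   then show "norm ((clamp01 (real n * t - real i) - clamp01 (real n * s - real i)) *R (f (Suc i) - f i))
     <= (clamp01 (real n * t - real i) - clamp01 (real n * s - real i)) * dl"
    using mono[of i] by (simp add: mult_left_mono)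
  qed
  also have "... = (min (real n * t) (real n) - min (real n * s) (real n)) * dl"
   using st by (simp add: sum_distrib_right[symmetric] sum_subtractf sum_clamp01)
  also have "... = real n * dl * (t - s)"
  proof -
   have "min (real n * t) (real n) = real n * t" "min (real n * s) (real n) = real n * s"
    using st by (auto intro!: min_absorb1 mult_left_le)
   then show ?thesis by (simp only: algebra_simps)
  qed
  finally show ?thesis .
 qed
 show ?thesis
 proof (rule lipschitz_onI)
  fix s t :: real assume st: "s : {0..1}" "t : {0..1}"
  show "dist (?g s) (?g t) <= real n * dl * dist s t"
  proof (cases "s <= t")
   case True then show ?thesis using le[of s t] st by (simp add: dist_real_def)
  next
   case False then show ?thesis using le[of t s] st by (simp add: dist_real_def dist_commute)
  qed
 qed (use dl in simp)
qed

lemma polygon_vertex: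
 fixes f :: "nat => 'a::real_normed_vector"
 assumes "i <= n"
 shows "f 0 + (\<Sum>j<n. clamp01 (real i - real j) *R (f (Suc j) - f j)) = f i"
proof -
 have "(\<Sum>j<n. clamp01 (real i - real j) *R (f (Suc j) - f j)) = (\<Sum>j<i. f (Suc j) - f j)"
 proof (rule sum.mono_neutral_cong_right)
  show "ALL j:{..<n} - {..<i}. clamp01 (real i - real j) *R (f (Suc j) - f j) = 0"
   by (auto simp: clamp01_def)
  show "clamp01 (real i - real j) *R (f (Suc j) - f j) = f (Suc j) - f j" if "j : {..<i}" for j
  proof -
   have "real j + 1 <= real i" using that by auto
   then have "clamp01 (real i - real j) = 1" by (auto simp: clamp01_def)
   then show ?thesis by simp
  qed
 qed (use assms in auto)
 also have "... = f i - f 0" by (rule sum_lessThan_telescope)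
 finally show ?thesis by simp
qed

text \<open>Polygons through short chains of finer and finer mesh share the Lipschitz constant 4
  times the length of \<open>C\<close> and run within one mesh of \<open>C\<close>. The theorem of
  Arzela and Ascoli gives a limit, and it lies in \<open>C\<close> because \<open>C\<close> is
  closed.\<close>

lemma continuum_lipschitz_path:
 fixes C :: "'a::euclidean_space set"
 assumes C: "connected C" "compact C" "hausdorff1_outer C < top" and xy: "x : C" "y : C" "x ~= y"
 obtains g L where "L-lipschitz_on {0..1} g" "g (0::real) = x" "g 1 = y" "g ` {0..1} <= C"
proof -
 define d where "d = dist x y"
 have d: "0 < d" using xy by (simp add: d_def)
 define H where "H = 4 * enn2real (hausdorff1_outer C)"
 \<comment> \<open>The shift k + 2 keeps the mesh strictly below dist x y, as the chain lemma
   requires.\<close>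
 define dl where "dl k = d / real (k + 2)" for k :: nat
 have dl: "0 < dl k" "dl k < dist x y" for k
  using d by (auto simp: dl_def d_def[symmetric] field_simps intro!: add_pos_nonneg)
 have "EX g. H-lipschitz_on {0..1} g & g (0::real) = x & g 1 = y & (ALL t:{0..1}. EX c:C. dist (g t) c <= dl k)" for k
 proof -
  obtain n f where f: "f 0 = x" "f n = y" "0 < n" "!!i. i <= n ==> f i : C"
   "!!i. i < n ==> dist (f i) (f (Suc i)) < dl k" "real n * dl k <= H"
   using connected_short_chain[OF C xy(1,2) dl[of k]] unfolding H_def by blast
  define g where "g t = f 0 + (\<Sum>i<n. clamp01 (real n * t - real i) *R (f (Suc i) - f i))" for t
  have lip: "(real n * dl k)-lipschitz_on {0..1} g"
   unfolding g_def by (rule polygon_lipschitz) (use f(5) dl in \<open>auto intro: less_imp_le\<close>)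
  have vert: "g (real i / real n) = f i" if "i <= n" for i
   using polygon_vertex[OF that, of f] f(3) by (simp add: g_def)
  have near: "EX c:C. dist (g t) c <= dl k" if t: "t : {0..1}" for t
  proof -
   define i where "i = nat \<lfloor>real n * t\<rfloor>"
   have i: "real i <= real n * t" "real n * t < real i + 1"
    using t by (auto simp: i_def of_nat_nat)
   have "real n * t <= real n" using t by (simp add: mult_left_le)
   then have "i <= n" using i by linarith
   have "real i / real n : {0..1}" using \<open>i <= n\<close> f(3) by auto
   then have "dist (g t) (g (real i / real n)) <= real n * dl k * dist t (real i / real n)"
    using lipschitz_onD[OF lip t] by blast
   also have "... = dl k * \<bar>real n * t - real i\<bar>"
   proof -
    have "t - real i / real n = (real n * t - real i) / real n" using f(3) by (simp add: diff_divide_distrib)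
    then have "dist t (real i / real n) = \<bar>real n * t - real i\<bar> / real n"
     by (simp add: dist_real_def)
    then show ?thesis using f(3) by simp
   qed
   also have "... <= dl k * 1" using i dl[of k] by (intro mult_left_mono) auto
   finally show ?thesis using vert[OF \<open>i <= n\<close>] f(4)[OF \<open>i <= n\<close>] by auto
  qed
  show ?thesis
   using lipschitz_on_le[OF lip f(6)] vert[of 0] vert[of n] f near by (intro exI[of _ g]) auto
 qed
 then obtain G where G: "!!k. H-lipschitz_on {0..1} (G k)" "!!k. G k (0::real) = x" "!!k. G k 1 = y"
  "!!k t. t : {0..1} ==> EX c:C. dist (G k t) c <= dl k"
  by metis
 have H0: "0 <= H" by (simp add: H_def)
 obtain B where B: "!!c. c : C ==> norm c <= B" using compact_imp_bounded[OF C(2)] by (auto simp: bounded_iff)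
 obtain g ka where g: "continuous_on {0..1} g" "strict_mono (ka :: nat => nat)"
  "!!e. 0 < e ==> EX N. ALL n t. n >= N & t : {0..1} --> norm (G (ka n) t - g t) < e"
 proof (rule Arzela_Ascoli[of "{0..1}" G "B + d"])
  show "norm (G k t) <= B + d" if t: "t : {0..1}" for k t
  proof -
   obtain c where "c : C" "dist (G k t) c <= dl k" using G(4)[OF t] by blast
   moreover have "norm (G k t) <= norm c + dist (G k t) c"
    by (metis dist_norm norm_triangle_sub)
   ultimately show ?thesis using B[of c] dl(2)[of k] by (simp add: d_def)
  qed
  show "EX et>0. ALL k s. s : {0..1} & norm (t - s) < et --> norm (G k t - G k s) < e"
   if t: "t : {0..1}" and e: "0 < e" for t e :: real
  proof (intro exI[of _ "e / (H + 1)"] conjI allI impI)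
   show "0 < e / (H + 1)" using e H0 by simp
   fix k s assume s: "s : {0..1} & norm (t - s) < e / (H + 1)"
   have "norm (G k t - G k s) <= H * norm (t - s)"
    using lipschitz_onD[OF G(1) t, of s k] s by (simp add: dist_norm)
   also have "... <= (H + 1) * norm (t - s)" by (intro mult_right_mono) auto
   also have "... < e" using s H0 by (simp add: field_simps)
   finally show "norm (G k t - G k s) < e" .
  qed
 qed auto
 have lim: "(%n. G (ka n) t) ----> g t" if "t : {0..1}" for t
  unfolding lim_sequentially dist_norm using g(3) that by blast
 have dllim: "(%n. dl (ka n)) ----> 0"
 proof -
  have "dl ----> 0" unfolding dl_def
   by real_asymp
  from LIMSEQ_subseq_LIMSEQ[OF this g(2)] show ?thesis by (simp add: o_def)
 qed
 show thesis
 proof (rule that)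
  show "H-lipschitz_on {0..1} g"
  proof (rule lipschitz_onI)
   fix s t :: real assume st: "s : {0..1}" "t : {0..1}"
   have "(%n. dist (G (ka n) s) (G (ka n) t)) ----> dist (g s) (g t)"
    by (intro tendsto_dist lim st)
   then show "dist (g s) (g t) <= H * dist s t"
    by (rule LIMSEQ_le_const2) (use lipschitz_onD[OF G(1) st] in auto)
  qed (rule H0)
  show "g 0 = x" using LIMSEQ_unique[OF lim[of 0]] G(2) by auto
  show "g 1 = y" using LIMSEQ_unique[OF lim[of 1]] G(3) by auto
  show "g ` {0..1} <= C"
  proof
   fix z assume "z : g ` {0..1}"
   then obtain t where t: "t : {0..1}" "z = g t" by auto
   have "(%n. infdist (G (ka n) t) C) ----> infdist (g t) C"
    by (intro tendsto_infdist lim t)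
   moreover have "(%n. infdist (G (ka n) t) C) ----> 0"
   proof (rule tendsto_sandwich[OF _ _ tendsto_const dllim])
    have "infdist (G (ka n) t) C <= dl (ka n)" for n
     using G(4)[OF t(1), of "ka n"] infdist_le order_trans by blast
    then show "\<forall>\<^sub>F n in sequentially. infdist (G (ka n) t) C <= dl (ka n)" by simp
   qed (simp add: infdist_nonneg)
   ultimately have "infdist (g t) C = 0" by (rule LIMSEQ_unique)
   then show "z : C"
    using in_closed_iff_infdist_zero[OF compact_imp_closed[OF C(2)], of z] xy t by auto
  qed
 qed
qed

section \<open>Differentiability of Lipschitz curves\<close>

lemma negligible_lipschitz_image:
 fixes f :: "'a::euclidean_space => 'b::euclidean_space"
 assumes "L-lipschitz_on S f" "negligible S" "DIM('a) <= DIM('b)"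
 shows "negligible (f ` S)"
proof (rule negligible_locally_Lipschitz_image[OF assms(3,2)])
 fix x assume "x : S"
 then show "EX T B. open T & x : T & (ALL y:S Int T. norm (f y - f x) <= B * norm (y - x))"
  using lipschitz_onD[OF assms(1)] by (intro exI[of _ UNIV] exI[of _ L]) (auto simp: dist_norm)
qed

lemma lipschitz_expanding_differentiable_AE:
 fixes F :: "real => real"
 assumes lip: "K-lipschitz_on UNIV F" and exp: "!!s t. s <= t ==> t - s <= F t - F s"
 obtains N where "negligible N" "!!t. t ~: N ==> F differentiable (at t)"
proof -
 have K0: "0 <= K" by (rule lipschitz_on_nonneg[OF lip])
 have contF: "continuous_on UNIV F" by (rule lipschitz_on_continuous_on[OF lip])
 have inj: "inj F"
 proof (rule injI)
  fix s t assume "F s = F t" then show "s = t" using exp[of s t] exp[of t s] by linarith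
 qed
 have mono: "F s <= F t \<longleftrightarrow> s <= t" for s t
  using exp[of s t] exp[of t s] by linarith
 have "EX t. F t = y" for y
 proof -
  define a where "a = \<bar>y - F 0\<bar> + 1"
  have a: "0 < a" by (simp add: a_def)
  have "F (-a) <= y" using exp[of "-a" 0] a unfolding a_def by linarith
  moreover have "y <= F a" using exp[of 0 a] a unfolding a_def by linarith
  ultimately show ?thesis
   using IVT'[of F "-a" y a] a continuous_on_subset[OF contF] by auto
 qed
 then have surj: "surj F" by (metis surjI)
 define P where "P = inv F"
 have FP: "F (P y) = y" for y unfolding P_def by (rule surj_f_inv_f[OF surj])
 have PF: "P (F t) = t" for t unfolding P_def by (rule inv_f_f[OF inj])
 have P_le: "P y <= t \<longleftrightarrow> y <= F t" for y t using mono[of "P y" t] by (simp add: FP)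
 have le_P: "s <= P y \<longleftrightarrow> F s <= y" for y s using mono[of s "P y"] by (simp add: FP)
 have Pm: "P : borel_measurable lborel"
 proof -
  have "mono P" by (rule monoI) (simp add: P_le FP)
  then show ?thesis by (simp add: borel_measurable_mono)
 qed
 define M where "M = distr lborel lborel P"
 have emM: "emeasure M A = emeasure lborel (P -` A)" if "A : sets borel" for A
  using that Pm by (simp add: M_def emeasure_distr)
 have MI: "emeasure M {a..b} = ennreal (F b - F a)" if "a <= b" for a b
 proof -
  have "P -` {a..b} = {F a..F b}" by (auto simp: P_le le_P)
  then show ?thesis using that mono[of a b] emM[of "{a..b}"] by simp
 qed
 have ac: "absolutely_continuous lborel M"
  unfolding absolutely_continuous_def
 proof
  fix A :: "real set" assume A: "A : null_sets lborel"
  then have "negligible A" by (simp add: negligible_iff_null_sets null_sets_completionI)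
  then have "negligible (F ` A)"
   by (intro negligible_lipschitz_image[OF lipschitz_on_subset[OF lip]]) auto
  moreover have "P -` A = F ` A" using FP PF by (auto simp: image_iff) metis
  ultimately have "P -` A : null_sets lebesgue" by (simp add: negligible_iff_null_sets)
  moreover have "P -` A : sets borel" using measurable_sets[OF Pm, of A] A by auto
  ultimately have "emeasure lborel (P -` A) = 0" by auto
  then show "A : null_sets M" using emM[of A] A by (auto simp: null_sets_def M_def)
 qed
 obtain h where h: "h : borel_measurable lborel" "density lborel h = M"
  using sigma_finite_measure.Radon_Nikodym[OF sigma_finite_lborel ac] by (auto simp: M_def)
 have nnI: "(NN x. h x * indicator {a..b} x) = ennreal (F b - F a)" if "a <= b" for a b
 proof -
  have "(NN x. h x * indicator {a..b} x) = emeasure (density lborel h) {a..b}"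
   using h(1) by (intro emeasure_density[symmetric]) auto
  also have "... = ennreal (F b - F a)" unfolding h(2) by (rule MI[OF that])
  finally show ?thesis .
 qed
 have fin: "AE x in lborel. h x ~= \<infinity>"
 proof -
  have "AE x in lborel. h x * indicator {- real n..real n} x ~= \<infinity>" for n
   by (rule nn_integral_PInf_AE) (use h nnI[of "- real n" "real n"] in auto)
  then have "AE x in lborel. ALL n. h x * indicator {- real n..real n} x ~= \<infinity>"
   by (simp add: AE_all_countable)
  then show ?thesis
  proof eventually_elim
   case (elim x)
   obtain n where "\<bar>x\<bar> <= real n" using real_arch_simple by blast
   then have "x : {- real n..real n}" by auto
   with elim[rule_format, of n] show ?case by simp
  qed
 qed
 define h' where "h' x = enn2real (h x)" for x
 have hI: "(h' has_integral (F b - F a)) {a..b}" if "a <= b" for a b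
 proof -
  have "(NN x. ennreal (h' x * indicator {a..b} x)) = (NN x. h x * indicator {a..b} x)"
   by (rule nn_integral_cong_AE) (use fin in eventually_elim, auto simp: h'_def indicator_def less_top)
  also have "... = ennreal (F b - F a)" by (rule nnI[OF that])
  finally have "((%x. h' x * indicator {a..b} x) has_integral (F b - F a)) UNIV"
   using h mono[of a b] that by (intro nn_integral_has_integral) (auto simp: h'_def)
  moreover have "(%x. h' x * indicator {a..b} x) = (%x. if x : {a..b} then h' x else 0)"
   by (auto simp: indicator_def)
  ultimately show ?thesis by (simp add: has_integral_restrict_UNIV del: atLeastAtMost_iff)
 qed
 have int1: "h' integrable_on cbox a b" for a b
  using hI[of a b] by (cases "a <= b") (auto simp: cbox_interval intro: has_integral_integrable)
 \<comment> \<open>The averages in \<open>integrable_ccontinuous_explicit\<close> extend to the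
   right of the point only; left difference quotients are read off from the reflected
   density.\<close>
 have hI2: "((%x. h' (- x)) has_integral (F (-a) - F (-b))) {a..b}" if "a <= b" for a b
  using hI[of "-b" "-a"] that has_integral_reflect_real[where f = h' and a = "-b" and b = "-a"] by simp
 have int2: "(%x. h' (- x)) integrable_on cbox a b" for a b
  using hI2[of a b] by (cases "a <= b") (auto simp: cbox_interval intro: has_integral_integrable)
 obtain N1 where N1: "negligible N1"
  "!!x e. x ~: N1 ==> 0 < e ==> EX d>0. ALL k. 0 < k & k < d -->
   norm (integral (cbox x (x + k *R One)) h' /\<^sub>R k ^ DIM(real) - h' x) < e"
  using integrable_ccontinuous_explicit[OF int1] by blast
 obtain N2 where N2: "negligible N2"
  "!!x e. x ~: N2 ==> 0 < e ==> EX d>0. ALL k. 0 < k & k < d -->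
   norm (integral (cbox x (x + k *R One)) (%x. h' (- x)) /\<^sub>R k ^ DIM(real) - h' (- x)) < e"
  using integrable_ccontinuous_explicit[OF int2] by blast
 show thesis
 proof (rule that)
  have "negligible (uminus ` N2)"
   by (rule negligible_lipschitz_image[of 1, OF _ N2(1)]) (auto intro!: lipschitz_onI simp: dist_real_def)
  then show "negligible (N1 Un uminus ` N2)" using N1 by simp
  fix t assume t: "t ~: N1 Un uminus ` N2"
  then have t1: "t ~: N1" and t2: "- t ~: N2" by (auto simp: image_iff)
  have "((%k. (F (t + k) - F t) / k) \<longlongrightarrow> h' t) (at 0)"
  proof (rule LIM_I)
   fix e :: real assume e: "0 < e"
   obtain d1 where d1: "0 < d1" "!!k. 0 < k ==> k < d1 ==>
     norm (integral (cbox t (t + k *R One)) h' /\<^sub>R k ^ DIM(real) - h' t) < e"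
    using N1(2)[OF t1 e] by blast
   obtain d2 where d2: "0 < d2" "!!k. 0 < k ==> k < d2 ==>
     norm (integral (cbox (-t) (-t + k *R One)) (%x. h' (- x)) /\<^sub>R k ^ DIM(real) - h' (- (- t))) < e"
    using N2(2)[OF t2 e] by blast
   show "EX s>0. ALL k::real. k ~= 0 & norm (k - 0) < s --> norm ((F (t + k) - F t) / k - h' t) < e"
   proof (intro exI[of _ "min d1 d2"] conjI allI impI)
    show "0 < min d1 d2" using d1 d2 by simp
    fix k :: real assume k: "k ~= 0 & norm (k - 0) < min d1 d2"
    show "norm ((F (t + k) - F t) / k - h' t) < e"
    proof (cases "0 < k")
     case True
     then have "integral {t..t + k} h' = F (t + k) - F t"
      by (intro integral_unique hI) simp
     then show ?thesis using d1(2)[of k] True k by (simp add: cbox_interval field_simps)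
    next
     case False
     define j where "j = - k"
     have j: "0 < j" "j < d2" using False k by (auto simp: j_def)
     have I: "integral {-t..j - t} (%x. h' (- x)) = F t - F (t - j)"
      using hI2[of "-t" "j - t"] j by (simp add: integral_unique)
     then have "norm ((F t - F (t - j)) / j - h' t) < e"
      using d2(2)[OF j] by (simp add: cbox_interval divide_inverse_commute)
     moreover have "(F t - F (t - j)) / j = (F (t + k) - F t) / k"
      using j by (simp add: j_def field_simps)
     ultimately show ?thesis by simp
    qed
   qed
  qed
  then have "(F has_field_derivative h' t) (at t)" by (simp add: DERIV_def)
  then show "F differentiable (at t)" by (auto simp: real_differentiable_def)
 qed
qed

text \<open>Adding (L + 1) t turns an L-Lipschitz function into an expanding one without affecting
  differentiability.\<close>

lemma lipschitz_real_differentiable_AE: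
 fixes f :: "real => real"
 assumes lip: "L-lipschitz_on UNIV f"
 obtains N where "negligible N" "!!t. t ~: N ==> f differentiable (at t)"
proof -
 have L: "0 <= L" by (rule lipschitz_on_nonneg[OF lip])
 have d: "\<bar>f s - f t\<bar> <= L * \<bar>s - t\<bar>" for s t
  using lipschitz_onD[OF lip, of s t] by (simp add: dist_real_def)
 define F where "F t = f t + (L + 1) * t" for t
 have "(2 * L + 1)-lipschitz_on UNIV F"
 proof (rule lipschitz_onI)
  fix s t :: real
  have "\<bar>F s - F t\<bar> <= \<bar>f s - f t\<bar> + \<bar>(L + 1) * (s - t)\<bar>" by (simp add: F_def algebra_simps)
  also have "... <= L * \<bar>s - t\<bar> + (L + 1) * \<bar>s - t\<bar>" using d[of s t] L by (simp add: abs_mult)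
  finally show "dist (F s) (F t) <= (2 * L + 1) * dist s t" by (simp add: dist_real_def algebra_simps)
 qed (use L in simp)
 moreover have "t - s <= F t - F s" if "s <= t" for s t
  using d[of s t] that by (simp add: F_def algebra_simps)
 ultimately obtain N where N: "negligible N" "!!t. t ~: N ==> F differentiable (at t)"
  using lipschitz_expanding_differentiable_AE by blast
 show thesis
 proof (rule that[OF N(1)])
  fix t assume "t ~: N"
  then have "(%t. F t - (L + 1) * t) differentiable (at t)"
   by (intro differentiable_diff N(2)) (auto intro!: derivative_intros)
  then show "f differentiable (at t)" by (simp add: F_def)
 qed
qed

lemma lipschitz_curve_differentiable_AE:
 fixes f :: "real => 'a::euclidean_space"
 assumes lip: "L-lipschitz_on UNIV f"
 obtains N where "negligible N" "!!t. t ~: N ==> f differentiable (at t)"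
proof -
 have "EX N. negligible N & (ALL t. t ~: N --> (%t. f t \<bullet> i) differentiable (at t))" if i: "i : Basis" for i
 proof -
  have "L-lipschitz_on UNIV (%t. f t \<bullet> i)"
  proof (rule lipschitz_onI)
   fix s t
   have "\<bar>(f s - f t) \<bullet> i\<bar> <= norm (f s - f t)" by (rule Basis_le_norm[OF i])
   also have "... <= L * dist s t" using lipschitz_onD[OF lip, of s t] by (simp add: dist_norm)
   finally show "dist (f s \<bullet> i) (f t \<bullet> i) <= L * dist s t" by (simp add: dist_real_def inner_diff_left)
  qed (rule lipschitz_on_nonneg[OF lip])
  then show ?thesis using lipschitz_real_differentiable_AE by metis
 qed
 then obtain N where N: "!!i. i : Basis ==> negligible (N i)"
  "!!i t. i : Basis ==> t ~: N i ==> (%t. f t \<bullet> i) differentiable (at t)" by metis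
 show thesis
 proof (rule that)
  show "negligible (\<Union>i\<in>Basis. N i)" using N(1) by (intro negligible_Union) auto
  show "f differentiable (at t)" if "t ~: (\<Union>i\<in>Basis. N i)" for t
   using that N(2) by (subst differentiable_componentwise_within) auto
 qed
qed

text \<open>Sard's lemma on the line. The function is carried over to \<open>real^1\<close> because
  \<open>baby_Sard\<close> is phrased with ranks of matrices.\<close>

lemma negligible_image_derivative_0:
 fixes h :: "real => real"
 assumes "!!t. t : D ==> (h has_real_derivative 0) (at t)"
 shows "negligible (h ` D)"
proof -
 define f :: "real^1 => real^1" where "f v = (\<chi> i. h (v $ 1))" for v
 have "negligible (f ` {v. v $ 1 : D})"
 proof (rule baby_Sard[where f' = "%_ _. 0"])
  fix v :: "real^1" assume v: "v : {v. v $ 1 : D}"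
  have "(h has_derivative (%_. 0)) (at (v $ 1))"
   using assms[of "v $ 1"] v by (simp add: has_field_derivative_def lambda_zero)
  moreover have "((%v :: real^1. v $ 1) has_derivative (%v. v $ 1)) (at v within {v. v $ 1 : D})"
   by (intro bounded_linear_imp_has_derivative bounded_linear_vec_nth)
  ultimately have "((%v. h (v $ 1)) has_derivative (%_. 0)) (at v within {v. v $ 1 : D})"
   using has_derivative_compose by blast
  then show "(f has_derivative (%_. 0)) (at v within {v. v $ 1 : D})"
   by (subst has_derivative_componentwise_within) (auto simp: f_def Basis_vec_def inner_axis)
  have "matrix (%_ :: real^1. 0 :: real^1) = 0" by (simp add: matrix_def vec_eq_iff)
  then show "rank (matrix (%_ :: real^1. 0 :: real^1)) < CARD(1)" by (simp add: rank_eq_0[THEN iffD2])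
 qed simp
 then have "negligible ((%v :: real^1. v $ 1) ` (f ` {v. v $ 1 : D}))"
  by (rule negligible_lipschitz_image[of 1, rotated])
   (auto intro!: lipschitz_onI simp: dist_norm component_le_norm_cart simp flip: vector_minus_component)
 moreover have "h ` D <= (%v :: real^1. v $ 1) ` (f ` {v. v $ 1 : D})"
 proof
  fix y assume "y : h ` D"
  then obtain t where "t : D" "y = h t" by auto
  then show "y : (%v :: real^1. v $ 1) ` (f ` {v. v $ 1 : D})"
   by (intro image_eqI[of _ _ "f (vec t)"] imageI) (auto simp: f_def)
 qed
 ultimately show ?thesis by (rule negligible_subset)
qed

section \<open>Approximate tangents\<close>

text \<open>Join \<open>x\<close> to \<open>y\<close> by a Lipschitz arc in \<open>C\<close> and
  project to the line through them. The levels reached at a time without derivative, at a time where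
  the projected derivative is zero, or at a point of \<open>Z\<close> form a null set. Every other
  level between 0 and dist x y is the shadow of a point of the required kind. \<open>Z\<close> is
  there to remove a set of bad density later.\<close>

lemma hausdorff1_outer_differentiable_points:
 fixes C :: "'a::euclidean_space set"
 assumes C: "connected C" "compact C" "hausdorff1_outer C < top" and xy: "x : C" "y : C"
  and Z: "hausdorff1_outer Z = 0"
 shows "ennreal (dist x y) <= hausdorff1_outer {z:C - Z. EX g v t. continuous_on UNIV g &
  range g <= C & g t = z & (g has_vector_derivative v) (at t) & v ~= 0}" (is "_ <= hausdorff1_outer ?S")
proof (cases "x = y")
 case False
 obtain g0 L where g0: "L-lipschitz_on {0..1} g0" "g0 (0::real) = x" "g0 1 = y" "g0 ` {0..1} <= C"
  using continuum_lipschitz_path[OF C xy False] .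
 have L: "0 <= L" by (rule lipschitz_on_nonneg[OF g0(1)])
 define g where "g t = g0 (clamp01 t)" for t
 have c01: "clamp01 t : {0..1}" for t by (auto simp: clamp01_def)
 have glip: "L-lipschitz_on UNIV g"
 proof (rule lipschitz_onI)
  fix s t :: real
  have "dist (g s) (g t) <= L * dist (clamp01 s) (clamp01 t)"
   unfolding g_def by (rule lipschitz_onD[OF g0(1) c01 c01])
  also have "... <= L * (1 * dist s t)"
   by (intro mult_left_mono lipschitz_onD[OF clamp01_lipschitz] L) auto
  finally show "dist (g s) (g t) <= L * dist s t" by simp
 qed (rule L)
 have grange: "range g <= C" using g0(4) c01 by (auto simp: g_def)
 have gcont: "continuous_on UNIV g" by (rule lipschitz_on_continuous_on[OF glip])
 obtain N where N: "negligible N" "!!t. t ~: N ==> g differentiable (at t)"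
  using lipschitz_curve_differentiable_AE[OF glip] by blast
 define e where "e = (y - x) /\<^sub>R norm (y - x)"
 have e: "norm e = 1" using False by (simp add: e_def)
 define q where "q z = (z - x) \<bullet> e" for z
 have qlip: "1-lipschitz_on A q" for A
 proof (rule lipschitz_onI)
  fix a b
  have "\<bar>(a - b) \<bullet> e\<bar> <= norm (a - b) * norm e" by (rule Cauchy_Schwarz_ineq2)
  then show "dist (q a) (q b) <= 1 * dist a b"
   using e by (simp add: q_def dist_real_def dist_norm inner_diff_left)
 qed simp
 define h where "h t = q (g t)" for t
 have hlip: "L-lipschitz_on UNIV h"
 proof (rule lipschitz_onI)
  fix s t :: real
  have "dist (h s) (h t) <= 1 * dist (g s) (g t)" unfolding h_def by (rule lipschitz_onD[OF qlip]) auto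
  also have "... <= L * dist s t" using lipschitz_onD[OF glip, of s t] by simp
  finally show "dist (h s) (h t) <= L * dist s t" .
 qed (rule L)
 define D0 where "D0 = {t. (h has_real_derivative 0) (at t)}"
 have neg0: "negligible (h ` D0)" by (rule negligible_image_derivative_0) (simp add: D0_def)
 have negN: "negligible (h ` N)"
  by (rule negligible_lipschitz_image[OF lipschitz_on_subset[OF hlip] N(1)]) auto
 have negZ: "negligible (q ` Z)"
 proof -
  have "hausdorff1_outer (q ` Z) <= ennreal 1 * hausdorff1_outer Z"
   by (rule hausdorff1_outer_lipschitz_image[OF qlip])
  then have "hausdorff1_outer (q ` Z) = 0" using Z by simp
  show ?thesis
   unfolding negligible_outer
  proof (intro allI impI)
   fix eps :: real assume eps: "0 < eps"
   have "hausdorff1_delta 1 (q ` Z) < ennreal eps"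
    using hausdorff1_delta_le_outer[of 1 "q ` Z"] \<open>hausdorff1_outer (q ` Z) = 0\<close> eps by simp
   then obtain S where S: "q ` Z <= (\<Union>i. S i)" "!!i. bounded (S i)" "!!i. diameter (S i) <= 1"
    "(\<Sum>i. ennreal (diameter (S i))) < ennreal eps"
    by (rule hausdorff1_delta_close) (rule that)
   define B where "B i = {Inf (S i)..Inf (S i) + diameter (S i)}" for i
   have "emeasure lebesgue (\<Union>i. B i) <= (\<Sum>i. emeasure lebesgue (B i))"
    by (intro emeasure_subadditive_countably) (auto simp: B_def)
   also have "... = (\<Sum>i. ennreal (diameter (S i)))"
    using S(2) by (simp add: B_def diameter_ge_0)
   finally have le: "emeasure lebesgue (\<Union>i. B i) < ennreal eps" using S(4) by simp
   show "EX T. q ` Z <= T & T : lmeasurable & measure lebesgue T < eps"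
   proof (intro exI conjI)
    show "q ` Z <= (\<Union>i. B i)"
     using S(1) subset_Icc_diameter[OF S(2)] unfolding B_def by blast
    show "(\<Union>i. B i) : lmeasurable"
     using le by (intro fmeasurableI) (auto simp: B_def intro: less_trans)
    show "measure lebesgue (\<Union>i. B i) < eps"
     using le eps unfolding measure_def by (simp add: enn2real_less_iff less_top less_trans[OF le])
   qed
  qed
 qed
 define W where "W = h ` D0 Un h ` N Un q ` Z"
 have negW: "negligible W" unfolding W_def by (intro negligible_Un neg0 negN negZ)
 define B where "B = {0..dist x y} - W"
 have WL: "W : null_sets lebesgue" using negW by (simp add: negligible_iff_null_sets)
 have BL: "B : sets lebesgue" using WL by (auto simp: B_def)
 have "emeasure lebesgue B = emeasure lebesgue {0..dist x y}"
  unfolding B_def by (rule emeasure_Diff_null_set[OF WL]) auto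
 then have eB: "emeasure lebesgue B = ennreal (dist x y)" by simp
 have "B <= q ` ?S"
 proof
  fix s assume s: "s : B"
  have h0: "h 0 = 0" using g0(2) by (simp add: h_def g_def clamp01_def q_def)
  have h1: "h 1 = dist x y" using g0(3) False
   by (simp add: h_def g_def clamp01_def q_def e_def dist_norm norm_minus_commute dot_square_norm power2_eq_square)
  have "continuous_on {0..1} h" by (rule continuous_on_subset[OF lipschitz_on_continuous_on[OF hlip]]) auto
  then obtain t where t: "h t = s"
   using IVT'[of h 0 s 1] h0 h1 s by (auto simp: B_def)
  have tN: "t ~: N" and tD: "t ~: D0" and tZ: "g t ~: Z"
   using s t unfolding B_def W_def h_def by auto
  obtain v where v: "(g has_vector_derivative v) (at t)"
   using N(2)[OF tN] vector_derivative_works by blast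
  have "((%t. (g t - x) \<bullet> e) has_vector_derivative ((v - 0) \<bullet> e)) (at t)"
   by (intro bounded_linear.has_vector_derivative[OF bounded_linear_inner_left]
     has_vector_derivative_diff v has_vector_derivative_const)
  then have "((%t. (g t - x) \<bullet> e) has_vector_derivative (v \<bullet> e)) (at t)" by simp
  then have "(h has_real_derivative (v \<bullet> e)) (at t)"
   by (simp add: h_def[abs_def] q_def has_real_derivative_iff_has_vector_derivative)
  then have "v ~= 0" using tD by (auto simp: D0_def)
  then have "g t : ?S" using v grange gcont tZ by blast
  then show "s : q ` ?S" using t by (auto simp: h_def)
 qed
 from hausdorff1_outer_projection[OF qlip BL this] eB show ?thesis by simp
qed simp

text \<open>A chart for the tangent line: \<open>2 k + 1\<close> disjoint discs of almost full mass along it.\<close>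

definition tiled :: "(real^2) measure => real^2 => real^2 => nat => real => real => bool" where
 "tiled M x ta k c r \<longleftrightarrow> (ALL j::int. \<bar>j\<bar> <= int k -->
  ennreal (r / real k * (1 - 3 / real k)) <= emeasure M (cball (x + (of_int j * r / real k) *R ta) (c * r / (2 * real k))))"

text \<open>Near t the curve stays close to its tangent line, and by the intermediate value theorem
  its coordinate along the line takes every value. So a small ball centred on the tangent line
  contains points of the curve that project onto almost a full diameter of the ball.\<close>

lemma emeasure_ball_curve:
 fixes G :: "'a::euclidean_space set"
 assumes G: "G : sets borel" and g: "continuous_on UNIV g" "range g <= G" "g t = x"
  "(g has_vector_derivative v) (at t)" "v ~= 0" and eps: "0 <= eps'" "eps' < eps" "eps <= 1"
 obtains rh where "0 < rh" "!!r a. 0 < r ==> r < rh ==> \<bar>a\<bar> <= 1 ==>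
  ennreal (2 * eps' * r) <= emeasure (hm G) (ball (x + (a * r) *R (v /\<^sub>R norm v)) (eps * r))"
proof -
 define w where "w = norm v"
 define ta where "ta = v /\<^sub>R w"
 have w: "0 < w" using g by (simp add: w_def)
 have ta: "norm ta = 1" "ta \<bullet> ta = 1" "w *R ta = v" using w by (simp_all add: ta_def w_def dot_square_norm power2_eq_square field_simps)
 \<comment> \<open>Two errors of size 3 ka r occur below, and 6 ka must stay below eps -
   eps'.\<close>
 define ka where "ka = (eps - eps') / 7"
 have ka: "0 < ka" "ka <= 1/7" using eps by (auto simp: ka_def)
 have "(g has_derivative (%s. s *R v)) (at t)" using g(4) by (simp add: has_vector_derivative_def)
 then obtain sg where sg: "0 < sg" "!!s. norm (s - t) < sg ==> norm (g s - g t - (s - t) *R v) <= (ka * w) * norm (s - t)"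
  using w ka unfolding has_derivative_at_alt by (metis mult_pos_pos)
 have appr: "norm (g (t + s) - x - (s * w) *R ta) <= ka * w * \<bar>s\<bar>" if "\<bar>s\<bar> < sg" for s
  using sg(2)[of "t + s"] that g(3) ta(3) by (simp flip: scaleR_scaleR)
 define q where "q z = (z - x) \<bullet> ta" for z
 have qlip: "1-lipschitz_on A q" for A
 proof (rule lipschitz_onI)
  fix a b
  have "\<bar>(a - b) \<bullet> ta\<bar> <= norm (a - b) * norm ta" by (rule Cauchy_Schwarz_ineq2)
  then show "dist (q a) (q b) <= 1 * dist a b"
   using ta by (simp add: q_def dist_real_def dist_norm inner_diff_left)
 qed simp
 have qappr: "\<bar>q (g (t + s)) - s * w\<bar> <= ka * w * \<bar>s\<bar>" if "\<bar>s\<bar> < sg" for s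
 proof -
  have "q (g (t + s)) - s * w = (g (t + s) - x - (s * w) *R ta) \<bullet> ta"
   using ta(2) by (simp add: q_def inner_diff_left)
  also have "\<bar>...\<bar> <= norm (g (t + s) - x - (s * w) *R ta) * norm ta" by (rule Cauchy_Schwarz_ineq2)
  finally show ?thesis using appr[OF that] ta by simp
 qed
 show thesis
 proof (rule that)
  show "0 < sg * w / 4" using sg w by simp
  fix r a :: real assume r: "0 < r" "r < sg * w / 4" and a: "\<bar>a\<bar> <= 1"
  let ?c = "x + (a * r) *R ta"
  have sub: "{a * r - eps' * r..a * r + eps' * r} <= q ` (G Int ball ?c (eps * r))"
  proof
   fix p assume p: "p : {a * r - eps' * r..a * r + eps' * r}"
   have p1: "\<bar>p - a * r\<bar> <= eps' * r" using p by auto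
   have "\<bar>a * r\<bar> <= r" "eps' * r <= r" using a r eps by (auto simp: abs_mult intro: mult_left_le_one_le)
   then have p2: "\<bar>p\<bar> <= 2 * r" using p1 by linarith
   \<comment> \<open>The parameter range reaches 3 r along the tangent; after an error of at most r
     / 2 it still covers every p with |p| at most 2 r.\<close>
   define S where "S = 3 * r / w"
   have S: "0 < S" "S < sg" "S * w = 3 * r" using r w by (auto simp: S_def field_simps)
   have k7: "ka * w * S <= r / 2" using S ka r mult_right_mono[of ka "1/7" "3 * r"] by (simp add: mult.assoc mult.commute[of w])
   have hi: "p <= q (g (t + S))" using qappr[of S] S k7 p2 by (auto simp: abs_le_iff)
   have lo: "q (g (t + - S)) <= p" using qappr[of "-S"] S k7 p2 by (auto simp: abs_le_iff)
   have "continuous_on {-S..S} (%s. q (g (t + s)))"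
    unfolding q_def by (intro continuous_intros continuous_on_compose2[OF g(1)]) auto
   from IVT'[OF lo hi _ this] S obtain s where s: "-S <= s" "s <= S" "q (g (t + s)) = p" by auto
   then have s': "\<bar>s\<bar> <= S" "\<bar>s\<bar> < sg" using S by auto
   have kS: "ka * w * \<bar>s\<bar> <= 3 * ka * r"
   proof -
    have "ka * w * \<bar>s\<bar> <= ka * w * S" using s' ka w by (intro mult_left_mono) auto
    also have "... = 3 * ka * r" using S(3) by (simp add: mult.assoc mult.commute[of w])
    finally show ?thesis .
   qed
   have "g (t + s) - ?c = (g (t + s) - x - (s * w) *R ta) + (s * w - p) *R ta + (p - a * r) *R ta"
    by (simp add: algebra_simps)
   also have "norm ... <= norm (g (t + s) - x - (s * w) *R ta) + norm ((s * w - p) *R ta) + norm ((p - a * r) *R ta)"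
    by (intro norm_triangle_le add_mono order_refl)
   also have "... <= 3 * ka * r + 3 * ka * r + eps' * r"
    using appr[OF s'(2)] qappr[OF s'(2)] kS p1 s(3) ta by (intro add_mono) (auto simp: abs_minus_commute)
   also have "... < eps * r"
   proof -
    have "3 * ka * r + 3 * ka * r + eps' * r = (6 * ka + eps') * r" by (simp add: algebra_simps)
    also have "... < eps * r"
    proof (rule mult_strict_right_mono[OF _ r(1)])
     have "7 * ka = eps - eps'" by (simp add: ka_def)
     with ka show "6 * ka + eps' < eps" by linarith
    qed
    finally show ?thesis .
   qed
   finally have "g (t + s) : G Int ball ?c (eps * r)"
    using g(2) by (auto simp: dist_norm norm_minus_commute)
   then show "p : q ` (G Int ball ?c (eps * r))" using s(3) by blast
  qed
  have "emeasure lebesgue {a * r - eps' * r..a * r + eps' * r} <= hausdorff1_outer (G Int ball ?c (eps * r))"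
   by (rule hausdorff1_outer_projection[OF qlip _ sub]) auto
  moreover have "emeasure lebesgue {a * r - eps' * r..a * r + eps' * r} = ennreal (2 * eps' * r)"
   using eps r by (simp add: algebra_simps)
  ultimately show "ennreal (2 * eps' * r) <= emeasure (hm G) (ball (x + (a * r) *R (v /\<^sub>R norm v)) (eps * r))"
   using emeasure_hm[OF G, of "ball ?c (eps * r)"] by (simp add: ta_def w_def)
 qed
qed

lemma tiled_curve:
 fixes G :: "(real^2) set"
 assumes G: "G : sets borel" and g: "continuous_on UNIV g" "range g <= G" "g t = x"
  "(g has_vector_derivative v) (at t)" "v ~= 0" and k: "0 < k"
 obtains rh where "0 < rh" "!!r. 0 < r ==> r < rh ==> tiled (hm G) x (v /\<^sub>R norm v) k (1 - 1 / real k) r"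
proof (cases "k <= 3")
 case True
 \<comment> \<open>For k up to 3 the mass demanded by \<open>tiled\<close> is not positive.\<close>
 have "1 - 3 / real k <= 0" using True k by (simp add: field_simps)
 then have "r / real k * (1 - 3 / real k) <= 0" if "0 < r" for r
  using that k by (intro mult_nonneg_nonpos) auto
 then show thesis using that[of 1] by (auto simp: tiled_def ennreal_neg)
next
 case False
 \<comment> \<open>2 eps' r is the mass demanded of a tile and eps r is its radius.\<close>
 define eps' where "eps' = (1 - 3 / real k) / (2 * real k)"
 define eps where "eps = (1 - 1 / real k) / (2 * real k)"
 have k4: "4 <= real k" using False by simp
 have eps: "0 <= eps'" "eps' < eps" "eps <= 1"
 proof -
  show "0 <= eps'" using k4 by (simp add: eps'_def)
  have "1 - 3 / real k < 1 - 1 / real k" using k4 by (simp add: divide_strict_right_mono)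
  then show "eps' < eps" unfolding eps'_def eps_def using k4 by (intro divide_strict_right_mono) auto
  have "1 - 1 / real k <= 1" by simp
  then have "1 - 1 / real k <= 2 * real k" using k4 by linarith
  then show "eps <= 1" using k4 by (simp add: eps_def)
 qed
 obtain rh where rh: "0 < rh" "!!r a. 0 < r ==> r < rh ==> \<bar>a\<bar> <= 1 ==>
  ennreal (2 * eps' * r) <= emeasure (hm G) (ball (x + (a * r) *R (v /\<^sub>R norm v)) (eps * r))"
  using emeasure_ball_curve[OF G g eps] by blast
 show thesis
 proof (rule that[OF rh(1)])
  fix r assume r: "0 < r" "r < rh"
  show "tiled (hm G) x (v /\<^sub>R norm v) k (1 - 1 / real k) r"
   unfolding tiled_def
  proof (intro allI impI)
   fix j :: int assume j: "\<bar>j\<bar> <= int k"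
   have "\<bar>of_int j :: real\<bar> <= real k" using j by linarith
   then have "\<bar>of_int j / real k\<bar> <= 1" using k by (simp add: field_simps)
   note rh(2)[OF r this]
   moreover have "2 * eps' * r = r / real k * (1 - 3 / real k)"
    unfolding eps'_def using k by (simp add: field_simps)
   ultimately
   have "ennreal (r / real k * (1 - 3 / real k)) <= emeasure (hm G) (ball (x + (of_int j / real k * r) *R (v /\<^sub>R norm v)) (eps * r))"
    by (simp only:)
   also have "... <= emeasure (hm G) (cball (x + (of_int j / real k * r) *R (v /\<^sub>R norm v)) (eps * r))"
    by (intro emeasure_mono) auto
   finally show "ennreal (r / real k * (1 - 3 / real k))
     <= emeasure (hm G) (cball (x + (of_int j * r / real k) *R (v /\<^sub>R norm v)) ((1 - 1 / real k) * r / (2 * real k)))"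
    using k by (simp add: eps_def mult_ac)
  qed
 qed
qed

section \<open>Riemann sums over tiles and convergence of blow-ups\<close>

lemma tile_subset_ball:
 fixes ta :: "'a::real_normed_vector"
 assumes "norm ta = 1" "0 < k" "0 < s" "\<bar>j\<bar> <= int k" "c <= 1"
 shows "cball (x + (of_int j * s / real k) *R ta) (c * s / (2 * real k)) <= ball x (s * (1 + 1 / real k))"
proof
 fix y assume y: "y : cball (x + (of_int j * s / real k) *R ta) (c * s / (2 * real k))"
 have "\<bar>of_int j :: real\<bar> <= real k" using assms by linarith
 then have "\<bar>of_int j * s / real k\<bar> <= s" using assms by (simp add: abs_mult field_simps)
 then have "dist x (x + (of_int j * s / real k) *R ta) <= s" using assms by (simp add: dist_norm)
 moreover have "c * s / (2 * real k) <= 1 * s / (2 * real k)"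
  using assms by (intro divide_right_mono mult_right_mono) auto
 moreover have "1 * s / (2 * real k) < s / real k" using assms by (simp add: field_simps)
 ultimately show "y : ball x (s * (1 + 1 / real k))"
  using y dist_triangle[of x y "x + (of_int j * s / real k) *R ta"] by (simp add: distrib_left)
qed

lemma tiles_disjoint:
 fixes ta :: "'a::real_normed_vector"
 assumes "norm ta = 1" "0 < k" "0 < s" "c < 1"
 shows "disjoint_family (%j. cball (x + (of_int j * s / real k) *R ta) (c * s / (2 * real k)))"
 unfolding disjoint_family_on_def
proof (intro ballI impI)
 fix i j :: int assume ij: "i ~= j"
 then have "1 <= \<bar>real_of_int i - real_of_int j\<bar>" by linarith
 then have "s / real k <= \<bar>real_of_int i - real_of_int j\<bar> * (s / real k)"
  using assms mult_right_mono[of 1 "\<bar>real_of_int i - real_of_int j\<bar>" "s / real k"] by simp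
 also have "... = dist (x + (of_int i * s / real k) *R ta) (x + (of_int j * s / real k) *R ta)"
  using assms by (simp add: dist_norm abs_mult flip: scaleR_left_diff_distrib diff_divide_distrib left_diff_distrib)
 finally have d: "s / real k <= dist (x + (of_int i * s / real k) *R ta) (x + (of_int j * s / real k) *R ta)" .
 have "c * s / (2 * real k) + c * s / (2 * real k) = c * (s / real k)" by (simp add: field_simps)
 also have "... < 1 * (s / real k)" using assms by (intro mult_strict_right_mono) auto
 finally show "cball (x + (of_int i * s / real k) *R ta) (c * s / (2 * real k)) \<inter>
   cball (x + (of_int j * s / real k) *R ta) (c * s / (2 * real k)) = {}"
  using d by (intro disjoint_cballI) simp
qed

lemma abs_integral_le:
 fixes f g :: "'a => real"
 assumes "integrable M f" "integrable M g" "!!x. \<bar>f x\<bar> <= g x"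
 shows "\<bar>\<integral>x. f x \<partial>M\<bar> <= (\<integral>x. g x \<partial>M)"
proof -
 have "\<bar>\<integral>x. f x \<partial>M\<bar> <= (\<integral>x. \<bar>f x\<bar> \<partial>M)" by (rule integral_abs_bound)
 also have "... <= (\<integral>x. g x \<partial>M)"
  using assms by (intro integral_mono integrable_abs) auto
 finally show ?thesis .
qed

text \<open>The lower bounds on the 2 k + 1 tiles add up to 2 s - O(s / k), and the upper bound on
  the ball is 2 s + O(s / k). So the tile masses differ from s / k by O(s / k) in total, and only
  that much mass lies off the tiles. Hence the integral is a Riemann sum with step s / k up to the
  oscillation of \<open>f\<close> on a tile.\<close>

lemma riemann_tiles:
 fixes M :: "(real^2) measure"
 assumes M: "sets M = sets borel" "finite_measure M" and ta: "norm ta = 1" and k: "0 < k" and s: "0 < s"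
  and tiled: "tiled M x ta k (1 - 1 / (2 * real k)) s"
  and upper: "emeasure M (ball x (s * (1 + 1 / real k))) <= ennreal (2 * s * (1 + 1 / real k)^2)"
  and f: "f : borel_measurable borel" "!!y. \<bar>f y\<bar> <= F" "!!y. y ~: ball x (s * (1 + 1 / real k)) ==> f y = 0"
  and osc: "!!j y. \<bar>j\<bar> <= int k ==> y : cball (x + (of_int j * s / real k) *R ta) (s / (2 * real k)) ==> \<bar>f y - c j\<bar> <= om"
  and om: "0 <= om" and c: "!!j. \<bar>c j\<bar> <= F"
 shows "\<bar>(\<integral>y. f y \<partial>M) - (\<Sum>j\<in>{- int k..int k}. c j * (s / real k))\<bar> <= s * (8 * om + 24 * F / real k)"
proof -
 interpret finite_measure M by fact
 have fM[measurable]: "f : borel_measurable M" using f(1) M(1) by (simp cong: measurable_cong_sets)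
 define J where "J = {- int k..int k}"
 define rh where "rh = (1 - 1 / (2 * real k)) * s / (2 * real k)"
 define B where "B j = cball (x + (of_int j * s / real k) *R ta) rh" for j :: int
 define D where "D = ball x (s * (1 + 1 / real k))"
 define R where "R = D - (\<Union>j\<in>J. B j)"
 have sm[measurable]: "B j : sets M" "D : sets M" for j using M by (auto simp: B_def D_def)
 have Rm[measurable]: "R : sets M" unfolding R_def by (intro sets.Diff sets.finite_UN) (auto simp: J_def)
 have c1: "1 - 1 / (2 * real k) < 1" "1 - 1 / (2 * real k) <= 1" using k by auto
 have dis: "disjoint_family B"
  unfolding B_def rh_def by (rule tiles_disjoint[OF ta k s c1(1)])
 have BD: "B j <= D" if "j : J" for j
  unfolding B_def rh_def D_def using that by (intro tile_subset_ball ta k s c1) (auto simp: J_def)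
 define m where "m j = measure M (B j)" for j
 have mlow: "s / real k * (1 - 3 / real k) <= m j" if "j : J" for j
 proof -
  have "ennreal (s / real k * (1 - 3 / real k)) <= ennreal (m j)"
   using tiled that unfolding tiled_def B_def rh_def J_def m_def
   by (auto simp: emeasure_eq_measure)
  then show ?thesis by (subst (asm) ennreal_le_iff) (simp_all add: m_def)
 qed
 have F0: "0 <= F" using f(2)[of 0] by linarith
 have intf: "integrable M f"
  by (rule integrable_const_bound[where B = F]) (use f in auto)
 have intS: "integrable M (%y. indicator S y * f y)" if "S : sets M" for S
  using integrable_mult_indicator[OF that intf] by simp
 have decomp: "f y = (\<Sum>j\<in>J. indicator (B j) y * f y) + indicator R y * f y" for y
 proof (cases "EX j:J. y : B j")
  case True
  then obtain j where j: "j : J" "y : B j" by blast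
  have "(\<Sum>i\<in>J. indicator (B i) y * f y) = (\<Sum>i\<in>J. if i = j then f y else 0)"
  proof (rule sum.cong)
   fix i assume "i : J"
   show "indicator (B i) y * f y = (if i = j then f y else 0)"
    using dis j by (auto simp: disjoint_family_on_def indicator_def)
  qed simp
  also have "... = f y" using j by (simp add: J_def)
  moreover have "y ~: R" using j by (auto simp: R_def)
  ultimately show ?thesis by simp
 next
  case False
  then have "(\<Sum>i\<in>J. indicator (B i) y * f y) = 0" by (intro sum.neutral) auto
  moreover have "indicator R y * f y = f y"
   using False f(3)[of y] by (cases "y : D") (auto simp: R_def D_def indicator_def)
  ultimately show ?thesis by simp
 qed
 have "(\<integral>y. f y \<partial>M) = (\<integral>y. (\<Sum>j\<in>J. indicator (B j) y * f y) + indicator R y * f y \<partial>M)"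
  by (subst decomp) simp
 also have "... = (\<integral>y. (\<Sum>j\<in>J. indicator (B j) y * f y) \<partial>M) + (\<integral>y. indicator R y * f y \<partial>M)"
  by (intro B_integral_add B_integrable_sum intS) auto
 also have "(\<integral>y. (\<Sum>j\<in>J. indicator (B j) y * f y) \<partial>M) = (\<Sum>j\<in>J. \<integral>y. indicator (B j) y * f y \<partial>M)"
  by (intro B_integral_sum intS) auto
 finally have split: "(\<integral>y. f y \<partial>M) = (\<Sum>j\<in>J. \<integral>y. indicator (B j) y * f y \<partial>M) + (\<integral>y. indicator R y * f y \<partial>M)" .
 have tileB: "\<bar>(\<integral>y. indicator (B j) y * f y \<partial>M) - c j * m j\<bar> <= om * m j" if j: "j : J" for j
 proof -
  have ic: "integrable M (%y. indicator (B j) y * c)" for c :: real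
   by (intro integrable_mult_left integrable_real_indicator) (auto simp: less_top[symmetric])
  have I: "(\<integral>y. indicator (B j) y * c \<partial>M) = c * m j" for c :: real
   by (simp add: m_def mult.commute)
  have "(\<integral>y. indicator (B j) y * f y \<partial>M) - c j * m j = (\<integral>y. indicator (B j) y * f y - indicator (B j) y * c j \<partial>M)"
   by (subst B_integral_diff[OF intS ic]) (auto simp: m_def)
  also have "\<bar>...\<bar> <= (\<integral>y. indicator (B j) y * om \<partial>M)"
  proof (rule abs_integral_le)
   show "integrable M (%y. indicator (B j) y * f y - indicator (B j) y * c j)"
    by (intro B_integrable_diff intS ic) auto
   fix y
   have "\<bar>f y - c j\<bar> <= om" if "y : B j"
   proof (rule osc[of j y])
    show "\<bar>j\<bar> <= int k" using j by (auto simp: J_def)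
    have "rh <= s / (2 * real k)" unfolding rh_def using s k c1 mult_right_mono[of _ 1 s] by (intro divide_right_mono) auto
    with that show "y : cball (x + (of_int j * s / real k) *R ta) (s / (2 * real k))"
     by (auto simp: B_def)
   qed
   then show "\<bar>indicator (B j) y * f y - indicator (B j) y * c j\<bar> <= indicator (B j) y * om"
    by (auto simp: indicator_def)
  qed (rule ic)
  also have "... = om * m j" by (rule I)
  finally show ?thesis .
 qed
 have rest: "\<bar>\<integral>y. indicator R y * f y \<partial>M\<bar> <= F * measure M R"
 proof -
  have "\<bar>\<integral>y. indicator R y * f y \<partial>M\<bar> <= (\<integral>y. indicator R y * F \<partial>M)"
  proof (rule abs_integral_le)
   show "integrable M (%y. indicator R y * F)"
    by (intro integrable_mult_left integrable_real_indicator) (auto simp: less_top[symmetric])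
   show "\<bar>indicator R y * f y\<bar> <= indicator R y * F" for y using f(2)[of y] by (auto simp: indicator_def)
  qed (rule intS, simp)
  then show ?thesis by (simp add: mult.commute)
 qed
 have cardJ: "real (card J) = 2 * real k + 1" by (simp add: J_def)
 have finJ: "finite J" by (simp add: J_def)
 have mD: "measure M D <= 2 * s * (1 + 1 / real k)^2"
  using upper s by (simp add: D_def emeasure_eq_measure ennreal_le_iff del: ennreal_plus)
 have mUn: "(\<Sum>j\<in>J. m j) = measure M (\<Union>j\<in>J. B j)"
  unfolding m_def using dis by (intro finite_measure_finite_Union[symmetric] finJ) (auto simp: disjoint_family_on_def)
 have mR: "(\<Sum>j\<in>J. m j) + measure M R = measure M D"
 proof -
  have "measure M R = measure M D - measure M (\<Union>j\<in>J. B j)"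
   unfolding R_def using BD by (intro finite_measure_Diff sets.finite_UN finJ) auto
  then show ?thesis using mUn by simp
 qed
 have sq: "(1 + 1 / real k)^2 <= 1 + 3 / real k" "(1 + 1 / real k)^2 <= 4"
 proof -
  have "1 / real k <= 1" "0 <= 1 / real k" using k by auto
  then have "(1 / real k)^2 <= 1 / real k" by (metis power2_eq_square mult_left_le_one_le)
  then show "(1 + 1 / real k)^2 <= 1 + 3 / real k" by (simp add: power2_sum)
  with \<open>1 / real k <= 1\<close> show "(1 + 1 / real k)^2 <= 4" by simp
 qed
 have "2 * s * (1 + 1 / real k)^2 <= 2 * s * 4" by (rule mult_left_mono[OF sq(2)]) (use s in simp)
 with mD have "measure M D <= 8 * s" by linarith
 have mono_m: "(\<Sum>j\<in>J. m j) <= 8 * s" using mR \<open>measure M D <= 8 * s\<close> measure_nonneg[of M R] by linarith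
 \<comment> \<open>The deficit of a tile is at most 3 s / k^2, so the absolute value is the signed
   difference plus at most twice that; the signed differences can then be summed against the total
   mass.\<close>
 have "\<bar>m j - s / real k\<bar> <= m j - s / real k + 6 * s / (real k)^2" if "j : J" for j
 proof -
  have "s / real k * (1 - 3 / real k) = s / real k - 3 * s / (real k)^2"
   by (simp add: right_diff_distrib power2_eq_square)
  moreover have "6 * s / (real k)^2 = 2 * (3 * s / (real k)^2)" "0 <= 3 * s / (real k)^2" using s by auto
  ultimately show ?thesis using mlow[OF that] by linarith
 qed
 then have "(\<Sum>j\<in>J. \<bar>m j - s / real k\<bar>) <= (\<Sum>j\<in>J. m j - s / real k + 6 * s / (real k)^2)"
  by (rule sum_mono)
 also have "... = (\<Sum>j\<in>J. m j) + real (card J) * (6 * s / (real k)^2 - s / real k)"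
  by (simp add: sum.distrib sum_subtractf algebra_simps)
 also have "real (card J) * (6 * s / (real k)^2 - s / real k) = s * (11 / real k + 6 / (real k)^2 - 2)"
  unfolding cardJ using k by (simp add: field_simps power2_eq_square)
 finally have dev: "(\<Sum>j\<in>J. \<bar>m j - s / real k\<bar>) + measure M R <= measure M D + s * (11 / real k + 6 / (real k)^2 - 2)"
  using mR by linarith
 also have "... <= 2 * s * (1 + 3 / real k) + s * (11 / real k + 6 / real k - 2)"
 proof (intro add_mono mult_left_mono)
  show "measure M D <= 2 * s * (1 + 3 / real k)"
  proof (rule order_trans[OF mD])
   show "2 * s * (1 + 1 / real k)^2 <= 2 * s * (1 + 3 / real k)"
    by (rule mult_left_mono[OF sq(1)]) (use s in simp)
  qed
  have "1 / (real k)^2 <= 1 / real k" using k by (simp add: field_simps power2_eq_square)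
  then show "11 / real k + 6 / (real k)^2 - 2 <= 11 / real k + 6 / real k - 2" by simp
 qed (use s in auto)
 \<comment> \<open>The terms 2 s cancel and 23 s / k is left.\<close>
 also have "... <= 24 * s / real k" using k s by (simp add: field_simps)
 finally have dev: "(\<Sum>j\<in>J. \<bar>m j - s / real k\<bar>) + measure M R <= 24 * s / real k" .
 have "(\<integral>y. f y \<partial>M) - (\<Sum>j\<in>J. c j * (s / real k)) =
  (\<Sum>j\<in>J. ((\<integral>y. indicator (B j) y * f y \<partial>M) - c j * m j) + c j * (m j - s / real k)) + (\<integral>y. indicator R y * f y \<partial>M)"
  unfolding split by (simp add: sum.distrib sum_subtractf right_diff_distrib)
 also have "\<bar>...\<bar> <= (\<Sum>j\<in>J. om * m j + F * \<bar>m j - s / real k\<bar>) + F * measure M R"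
 proof (rule order_trans[OF abs_triangle_ineq], rule add_mono[OF _ rest],
   rule order_trans[OF sum_abs], rule sum_mono)
  fix j assume "j : J"
  show "\<bar>((\<integral>y. indicator (B j) y * f y \<partial>M) - c j * m j) + c j * (m j - s / real k)\<bar> <= om * m j + F * \<bar>m j - s / real k\<bar>"
   using tileB[OF \<open>j : J\<close>] mult_right_mono[OF c[of j], of "\<bar>m j - s / real k\<bar>"]
   by (intro order_trans[OF abs_triangle_ineq] add_mono) (auto simp: abs_mult)
 qed
 also have "... = om * (\<Sum>j\<in>J. m j) + F * ((\<Sum>j\<in>J. \<bar>m j - s / real k\<bar>) + measure M R)"
  by (simp add: sum.distrib sum_distrib_left distrib_left)
 also have "... <= om * (8 * s) + F * (24 * s / real k)"
  using mono_m dev om F0 by (intro add_mono mult_left_mono) auto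
 also have "... = s * (8 * om + 24 * F / real k)" by (simp add: algebra_simps)
 finally show ?thesis unfolding J_def .
qed

lemma hausdorff1_outer_segment:
 fixes ta :: "'a::euclidean_space"
 assumes ta: "norm ta = 1" and "a <= b"
 shows "hausdorff1_outer ((%t. t *R ta) ` {a..b}) = ennreal (b - a)"
proof (rule antisym)
 have "1-lipschitz_on {a..b} (%t. t *R ta)"
  using ta by (intro lipschitz_onI) (auto simp: dist_norm real_norm_def simp flip: scaleR_left_diff_distrib)
 from hausdorff1_outer_lipschitz_image[OF this]
 show "hausdorff1_outer ((%t. t *R ta) ` {a..b}) <= ennreal (b - a)"
  by (simp add: hausdorff1_outer_Icc[OF assms(2)])
 have "1-lipschitz_on ((%t. t *R ta) ` {a..b}) (%z. z \<bullet> ta)"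
 proof (rule lipschitz_onI)
  fix x y
  have "\<bar>(x - y) \<bullet> ta\<bar> <= norm (x - y) * norm ta" by (rule Cauchy_Schwarz_ineq2)
  then show "dist (x \<bullet> ta) (y \<bullet> ta) <= 1 * dist x y"
   using ta by (simp add: dist_real_def dist_norm inner_diff_left)
 qed simp
 moreover have "{a..b} <= (%z. z \<bullet> ta) ` (%t. t *R ta) ` {a..b}"
  using ta by (force simp: image_iff dot_square_norm)
 ultimately have "emeasure lebesgue {a..b} <= hausdorff1_outer ((%t. t *R ta) ` {a..b})"
  by (intro hausdorff1_outer_projection) auto
 then show "ennreal (b - a) <= hausdorff1_outer ((%t. t *R ta) ` {a..b})" using assms by simp
qed

lemma integral_hm:
 fixes f :: "'a::euclidean_space => real"
 assumes G: "G : sets borel" and f: "f : borel_measurable borel"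
 shows "(\<integral>y. f y \<partial>hm G) = (LINT y:G|hausdorff1. f y)"
proof -
 have id: "(%x. x) : measurable hausdorff1 borel"
  by (rule measurableI) (auto intro: borel_in_hausdorff1)
 have fh: "f : borel_measurable hausdorff1" using measurable_comp[OF id f] by (simp add: o_def)
 have "(%x. x) : measurable (density hausdorff1 (indicator G)) borel" using id by simp
 then have "(\<integral>y. f y \<partial>hm G) = (\<integral>y. f y \<partial>density hausdorff1 (indicator G))"
  unfolding hm_def by (rule integral_distr[OF _ f])
 also have "(indicator G :: 'a => ennreal) = (%x. ennreal (indicator G x))" by (auto simp: indicator_def)
 also have "(\<integral>y. f y \<partial>density hausdorff1 (%x. ennreal (indicator G x))) = (\<integral>y. indicator G y *R f y \<partial>hausdorff1)"
  using borel_in_hausdorff1[OF G] fh by (intro integral_density) auto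
 finally show ?thesis by (simp add: set_lebesgue_integral_def)
qed

lemma norm_inverse_scaleR: "0 < r ==> norm (v /\<^sub>R r) = norm v / r"
 by (simp add: field_simps)

lemma hausdorff1_outer_line_cball:
 fixes ta :: "'a::euclidean_space"
 assumes ta: "norm ta = 1" and rh: "0 <= rh" "\<bar>a\<bar> + rh <= S"
 shows "ennreal (2 * rh) <= hausdorff1_outer (span {ta} Int cball 0 S Int cball (a *R ta) rh)"
proof -
 have "(%t. t *R ta) ` {a - rh..a + rh} <= span {ta} Int cball 0 S Int cball (a *R ta) rh"
  using ta rh by (auto simp: span_singleton dist_norm simp flip: scaleR_left_diff_distrib)
 then have "hausdorff1_outer ((%t. t *R ta) ` {a - rh..a + rh}) <= hausdorff1_outer (span {ta} Int cball 0 S Int cball (a *R ta) rh)"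
  by (rule hausdorff1_outer_mono)
 then show ?thesis using hausdorff1_outer_segment[OF ta, of "a - rh" "a + rh"] rh by simp
qed

lemma hausdorff1_outer_line_ball:
 fixes ta :: "'a::euclidean_space"
 assumes ta: "norm ta = 1" and s: "0 <= s" and A: "A <= span {ta} Int cball 0 s"
 shows "hausdorff1_outer A <= ennreal (2 * s)"
proof -
 have "A <= (%t. t *R ta) ` {-s..s}"
 proof
  fix z assume "z : A"
  then have "z : span {ta}" "norm z <= s" using A by auto
  then obtain t where "z = t *R ta" "norm z <= s" unfolding span_singleton by blast
  then show "z : (%t. t *R ta) ` {-s..s}" using ta by (auto intro!: image_eqI[of _ _ t])
 qed
 then have "hausdorff1_outer A <= hausdorff1_outer ((%t. t *R ta) ` {-s..s})" by (rule hausdorff1_outer_mono)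
 then show ?thesis using hausdorff1_outer_segment[OF ta, of "-s" s] s by simp
qed

lemma closed_line: "closed (span {ta :: 'a::euclidean_space})" by (rule closed_span)

text \<open>The rescaled measure and length on the line itself both satisfy the hypotheses of
  \<open>riemann_tiles\<close>, with the same Riemann sum, so the integral over the line never has
  to be evaluated. The line is cut at radius 2 R to have finite length.\<close>

lemma blowup_converges:
 fixes M :: "(real^2) measure" and f :: "real^2 => real"
 assumes M: "sets M = sets borel" "finite_measure M" and ta: "norm ta = 1"
  and tiled: "!!k. 0 < k ==> EX rh>0. ALL r. 0 < r & r < rh --> tiled M x ta k (1 - 1 / (2 * real k)) r"
  and upper: "!!eps. 0 < eps ==> EX rh>0. ALL r. 0 < r & r < rh --> emeasure M (ball x r) <= ennreal ((1 + eps) * (2 * r))"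
  and f: "continuous_on UNIV f" and R: "0 < R" "!!z. R <= norm z ==> f z = 0"
 shows "((%r. 1 / r * (\<integral>y. f ((y - x) /\<^sub>R r) \<partial>M)) \<longlongrightarrow> (\<integral>z. f z \<partial>hm (span {ta} Int cball 0 (2 * R)))) (at_right 0)"
proof -
 define L where "L = span {ta} Int cball 0 (2 * R)"
 have Lb: "L : sets borel" unfolding L_def by (intro borel_closed closed_Int closed_line) auto
 have Lfin: "hausdorff1_outer L < top"
 proof -
  have "hausdorff1_outer L <= ennreal (2 * (2 * R))"
   unfolding L_def by (rule hausdorff1_outer_line_ball[OF ta]) (use R in auto)
  then show ?thesis by (rule le_less_trans) simp
 qed
 have fm: "f : borel_measurable borel" using f by (rule cont_borel)
 have uc: "uniformly_continuous_on UNIV f"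
 proof -
  have "uniformly_continuous_on (cball 0 (R + 2)) f"
   by (intro compact_uniformly_continuous continuous_on_subset[OF f]) auto
  show ?thesis unfolding uniformly_continuous_on_def
  proof (intro allI impI)
   fix e :: real assume "0 < e"
   with \<open>uniformly_continuous_on (cball 0 (R + 2)) f\<close> obtain d where d: "0 < d"
    "!!y z. y : cball 0 (R+2) ==> z : cball 0 (R+2) ==> dist z y < d ==> dist (f z) (f y) < e"
    unfolding uniformly_continuous_on_def by metis
   have "dist (f z) (f y) < e" if "dist z y < min d 1" for y z
   proof (cases "norm y <= R + 1")
    case True
    then have "norm z <= R + 2" using that norm_triangle_sub[of z y] by (simp add: dist_norm)
    then show ?thesis using True that by (intro d(2)) auto
   next
    case False
    then have "R <= norm z" using that norm_triangle_sub[of y z] by (simp add: dist_norm norm_minus_commute)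
    then show ?thesis using False R \<open>0 < e\<close> by simp
   qed
   then show "EX d>0. ALL y:UNIV. ALL z:UNIV. dist z y < d --> dist (f z) (f y) < e"
    using d(1) by (intro exI[of _ "min d 1"]) auto
  qed
 qed
 obtain F where F: "!!z. \<bar>f z\<bar> <= F"
 proof -
  have "bounded (f ` cball 0 R)"
   by (intro compact_imp_bounded compact_continuous_image continuous_on_subset[OF f]) auto
  then obtain B where B: "!!z. norm z <= R ==> \<bar>f z\<bar> <= B"
   by (metis bounded_iff image_eqI mem_cball_0 real_norm_def)
  have "\<bar>f z\<bar> <= max B 0" for z using B[of z] R(2)[of z] by (cases "norm z <= R") auto
  then show ?thesis using that by blast
 qed
 have F0: "0 <= F" using F[of 0] by linarith
 show ?thesis
  unfolding L_def[symmetric]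
 proof (rule tendstoI)
  fix e :: real assume e: "0 < e"
  \<comment> \<open>This gives 8 om R = e / 8, and the choice of k makes the other error at most e /
    8 as well; each of the two comparisons with the sum then costs at most e / 4.\<close>
  define om where "om = e / (64 * R)"
  have om: "0 < om" using e R by (simp add: om_def)
  obtain d where d: "0 < d" "!!y z. dist z y < d ==> \<bar>f z - f y\<bar> < om"
   using uc om unfolding uniformly_continuous_on_def dist_real_def by (metis UNIV_I)
  obtain k :: nat where k: "max (R / d) (200 * R * F / e) < real k" using reals_Archimedean2 by blast
  then have kR: "R / d < real k" "200 * R * F / e < real k" by auto
  have k0: "0 < k" using kR(1) R d(1) by (cases k) (auto simp: divide_less_0_iff)
  have kd: "R / real k < d" using kR(1) d k0 R by (simp add: field_simps)
  have "200 * R * F <= e * real k" using kR(2) e by (simp add: field_simps)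
  moreover have "0 <= F * R" using F0 R by simp
  ultimately have kF: "24 * F / real k <= e / (8 * R)" using R k0 by (simp add: field_simps)
  define Sm where "Sm = (\<Sum>j\<in>{- int k..int k}. f ((of_int j * R / real k) *R ta) * (R / real k))"
  have est: "R * (8 * om + 24 * F / real k) <= e / 4"
  proof -
   have "8 * om + 24 * F / real k <= 8 * om + e / (8 * R)" using kF by simp
   then have "R * (8 * om + 24 * F / real k) <= R * (8 * om + e / (8 * R))" using R by (intro mult_left_mono) auto
   also have "... = e / 4" using R by (simp add: om_def field_simps)
   finally show ?thesis .
  qed
  have c1: "1 - 1 / (2 * real k) <= 1" "0 <= 1 - 1 / (2 * real k)" using k0 by (auto simp: field_simps)
  have k1: "1 <= real k" using k0 by simp
  have tL: "tiled (hm L) 0 ta k (1 - 1 / (2 * real k)) R"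
   unfolding tiled_def
  proof (intro allI impI)
   fix j :: int assume j: "\<bar>j\<bar> <= int k"
   have "\<bar>of_int j :: real\<bar> <= real k" using j by linarith
   then have jb: "\<bar>of_int j * R / real k\<bar> <= R" using R k0 by (simp add: abs_mult field_simps)
   define rh where "rh = (1 - 1 / (2 * real k)) * R / (2 * real k)"
   have rh0: "0 <= rh" unfolding rh_def using c1 R by (intro divide_nonneg_nonneg mult_nonneg_nonneg) auto
   have "rh <= 1 * R / (2 * real k)" unfolding rh_def using c1 R by (intro divide_right_mono mult_right_mono) auto
   also have "... <= R" using k1 R by (simp add: field_simps)
   finally have rh1: "rh <= R" .
   have "R / real k * (1 - 3 / real k) <= R / real k * (1 - 1 / (2 * real k))"
    using R k1 by (intro mult_left_mono) (auto simp: field_simps)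
   also have "... = 2 * rh" by (simp add: rh_def)
   finally have "ennreal (R / real k * (1 - 3 / real k)) <= ennreal (2 * rh)" by (rule ennreal_leI)
   also have "... <= hausdorff1_outer (L Int cball ((of_int j * R / real k) *R ta) rh)"
    unfolding L_def using jb rh0 rh1 by (intro hausdorff1_outer_line_cball[OF ta]) auto
   finally show "ennreal (R / real k * (1 - 3 / real k))
     <= emeasure (hm L) (cball (0 + (of_int j * R / real k) *R ta) ((1 - 1 / (2 * real k)) * R / (2 * real k)))"
    by (simp add: emeasure_hm[OF Lb] rh_def)
  qed
  have cj: "\<bar>f z - f y\<bar> <= om" if "norm (z - y) <= R / (2 * real k)" for y z
  proof -
   have "R / (2 * real k) < R / real k" using R k0 by (simp add: field_simps)
   then have "dist z y < d" using that kd by (simp add: dist_norm)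
   from d(2)[OF this] show ?thesis by simp
  qed
  have sq1: "1 + 1 / real k <= (1 + 1 / real k)^2"
   using k0 by (simp add: power2_eq_square field_simps)
  have uL: "emeasure (hm L) (ball 0 (R * (1 + 1 / real k))) <= ennreal (2 * R * (1 + 1 / real k)^2)"
  proof -
   have "hausdorff1_outer (L Int ball 0 (R * (1 + 1 / real k))) <= ennreal (2 * (R * (1 + 1 / real k)))"
    by (rule hausdorff1_outer_line_ball[OF ta]) (use R in \<open>auto simp: L_def\<close>)
   also have "... <= ennreal (2 * R * (1 + 1 / real k)^2)"
    using sq1 R by (intro ennreal_leI) (simp add: mult.assoc)
   finally show ?thesis by (simp add: emeasure_hm[OF Lb])
  qed
  have big: "R <= R * (1 + 1 / real k)" using R by simp
  have lineI: "\<bar>(\<integral>z. f z \<partial>hm L) - Sm\<bar> <= R * (8 * om + 24 * F / real k)"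
   unfolding Sm_def
  proof (rule riemann_tiles[OF _ finite_measure_hm[OF Lb Lfin] ta k0 R(1) tL uL fm F])
   show "f y = 0" if "y ~: ball 0 (R * (1 + 1 / real k))" for y using that big by (intro R(2)) auto
   show "\<bar>f y - f ((of_int j * R / real k) *R ta)\<bar> <= om"
    if "y : cball (0 + (of_int j * R / real k) *R ta) (R / (2 * real k))" for j y
    using that by (intro cj) (simp add: dist_norm norm_minus_commute)
  qed (use om F in auto)
  obtain rh1 where rh1: "0 < rh1" "!!r. 0 < r ==> r < rh1 ==> tiled M x ta k (1 - 1 / (2 * real k)) r"
   using tiled[OF k0] by blast
  obtain rh2 where rh2: "0 < rh2" "!!r. 0 < r ==> r < rh2 ==> emeasure M (ball x r) <= ennreal ((1 + 1 / real k) * (2 * r))"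
   using upper[of "1 / real k"] k0 by auto
  have close: "dist (1 / r * (\<integral>y. f ((y - x) /\<^sub>R r) \<partial>M)) (\<integral>z. f z \<partial>hm L) < e"
   if r: "0 < r" "r < min (rh1 / R) (rh2 / (2 * R))" for r
  proof -
   define s where "s = R * r"
   have s: "0 < s" "s < rh1" "s * (1 + 1 / real k) < rh2"
   proof -
    show "0 < s" "s < rh1" using r R by (auto simp: s_def field_simps)
    have "s * (1 + 1 / real k) <= s * 2" using \<open>0 < s\<close> k1 by (intro mult_left_mono) auto
    also have "... < rh2" using r R by (auto simp: s_def field_simps)
    finally show "s * (1 + 1 / real k) < rh2" .
   qed
   have u: "emeasure M (ball x (s * (1 + 1 / real k))) <= ennreal (2 * s * (1 + 1 / real k)^2)"
   proof -
    have "emeasure M (ball x (s * (1 + 1 / real k))) <= ennreal ((1 + 1 / real k) * (2 * (s * (1 + 1 / real k))))"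
     using s by (intro rh2(2)) (auto intro!: mult_pos_pos add_pos_nonneg)
    also have "(1 + 1 / real k) * (2 * (s * (1 + 1 / real k))) = 2 * s * (1 + 1 / real k)^2"
     unfolding power2_eq_square by (simp only: mult_ac)
    finally show ?thesis .
   qed
   have "\<bar>(\<integral>y. f ((y - x) /\<^sub>R r) \<partial>M) - (\<Sum>j\<in>{- int k..int k}. f ((of_int j * R / real k) *R ta) * (s / real k))\<bar>
     <= s * (8 * om + 24 * F / real k)"
   proof (rule riemann_tiles[OF M ta k0 s(1) rh1(2)[OF s(1,2)] u])
    show "(%y. f ((y - x) /\<^sub>R r)) : borel_measurable borel"
     by (intro cont_borel continuous_on_compose2[OF f] continuous_intros) auto
    show "f ((y - x) /\<^sub>R r) = 0" if "y ~: ball x (s * (1 + 1 / real k))" for y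
    proof (rule R(2))
     have "s <= s * (1 + 1 / real k)" using s by simp
     then have "R * r <= norm (y - x)" using that by (simp add: dist_norm norm_minus_commute s_def)
     moreover have "norm ((y - x) /\<^sub>R r) = norm (y - x) / r" using r by (simp only: norm_inverse_scaleR)
     ultimately show "R <= norm ((y - x) /\<^sub>R r)" using r by (simp add: pos_le_divide_eq)
    qed
    show "\<bar>f ((y - x) /\<^sub>R r) - f ((of_int j * R / real k) *R ta)\<bar> <= om"
     if "y : cball (x + (of_int j * s / real k) *R ta) (s / (2 * real k))" for j y
    proof (rule cj)
     have "(y - x) /\<^sub>R r - (of_int j * R / real k) *R ta = (y - (x + (of_int j * s / real k) *R ta)) /\<^sub>R r"
      using r by (simp add: s_def algebra_simps)
     then have "norm ((y - x) /\<^sub>R r - (of_int j * R / real k) *R ta) = norm (y - (x + (of_int j * s / real k) *R ta)) / r"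
      using r by (simp only: norm_inverse_scaleR)
     also have "... <= s / (2 * real k) / r"
      using that r by (intro divide_right_mono) (auto simp: dist_norm norm_minus_commute)
     also have "... = R / (2 * real k)" using r by (simp add: s_def)
     finally show "norm ((y - x) /\<^sub>R r - (of_int j * R / real k) *R ta) <= R / (2 * real k)" .
    qed
   qed (use F om in auto)
   also have "(\<Sum>j\<in>{- int k..int k}. f ((of_int j * R / real k) *R ta) * (s / real k)) = r * Sm"
    unfolding Sm_def sum_distrib_left by (intro sum.cong) (auto simp: s_def)
   also have "s * (8 * om + 24 * F / real k) = r * (R * (8 * om + 24 * F / real k))"
    by (simp only: s_def mult_ac)
   also have "... <= r * (e / 4)" using r by (intro mult_left_mono[OF est]) simp
   finally have "\<bar>(\<integral>y. f ((y - x) /\<^sub>R r) \<partial>M) - r * Sm\<bar> <= r * (e / 4)" .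
   moreover have "1 / r * (\<integral>y. f ((y - x) /\<^sub>R r) \<partial>M) - Sm = ((\<integral>y. f ((y - x) /\<^sub>R r) \<partial>M) - r * Sm) / r"
    using r by (simp add: field_simps)
   ultimately have "\<bar>1 / r * (\<integral>y. f ((y - x) /\<^sub>R r) \<partial>M) - Sm\<bar> <= e / 4"
    using r by (simp add: field_simps)
   with lineI est e show ?thesis unfolding dist_real_def by linarith
  qed
  have "0 < min (rh1 / R) (rh2 / (2 * R))" using rh1 rh2 R by simp
  then show "\<forall>\<^sub>F r in at_right 0. dist (1 / r * (\<integral>y. f ((y - x) /\<^sub>R r) \<partial>M)) (\<integral>z. f z \<partial>hm L) < e"
   unfolding eventually_at_right_field using close by blast
 qed
qed

lemma tiled_trivial:
 assumes "0 < k" "k <= 3" "0 < r" shows "tiled M x ta k c r"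
proof -
 have "1 - 3 / real k <= 0" using assms by (simp add: field_simps)
 then have "r / real k * (1 - 3 / real k) <= 0"
  using assms by (intro mult_nonneg_nonpos) auto
 then show ?thesis by (auto simp: tiled_def ennreal_neg)
qed

lemma compactly_supported_vanishes:
 fixes f :: "'a::euclidean_space => 'b::zero"
 assumes "compactly_supported_in U f"
 obtains R where "0 < R" "!!z. R <= norm z ==> f z = 0"
proof -
 have "bounded {x. f x ~= 0}"
  using assms unfolding compactly_supported_in_def by (meson bounded_subset closure_subset compact_imp_bounded)
 then obtain B where B: "!!x. f x ~= 0 ==> norm x <= B" by (auto simp: bounded_iff)
 show thesis
 proof (rule that[of "\<bar>B\<bar> + 1"])
  show "f z = 0" if "\<bar>B\<bar> + 1 <= norm z" for z
  proof (rule ccontr)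
   assume "f z ~= 0" from B[OF this] that show False by linarith
  qed
 qed simp
qed

text \<open>For small r the rescaled test function is supported in the ball in which
  \<open>Ga\<close> and \<open>G\<close> agree.\<close>

lemma LINT_blowup_local:
 fixes f :: "real^2 => real"
 assumes GW: "Ga Int ball x d = G Int ball x d" and G: "G : sets borel"
  and f: "continuous_on UNIV f" "!!z. R <= norm z ==> f z = 0" and r: "0 < r" "r * R <= d"
 shows "(LINT y:Ga|hausdorff1. f ((y - x) /\<^sub>R r)) = (\<integral>y. f ((y - x) /\<^sub>R r) \<partial>hm G)"
proof -
 have m: "(%y. f ((y - x) /\<^sub>R r)) : borel_measurable borel"
  by (intro cont_borel continuous_on_compose2[OF f(1)] continuous_intros) auto
 have "indicator Ga y *R f ((y - x) /\<^sub>R r) = indicator G y *R f ((y - x) /\<^sub>R r)" for y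
 proof (cases "R <= norm ((y - x) /\<^sub>R r)")
  case True then show ?thesis using f(2) by simp
 next
  case False
  moreover have "norm ((y - x) /\<^sub>R r) = norm (y - x) / r" using r by (simp only: norm_inverse_scaleR)
  ultimately have "norm (y - x) < r * R" using r by (simp add: not_le pos_divide_less_eq mult.commute)
  then have "y : ball x d" using r by (simp add: dist_norm norm_minus_commute)
  then have "y : Ga \<longleftrightarrow> y : G" using GW by blast
  then show ?thesis by (simp add: indicator_def)
 qed
 then show ?thesis unfolding integral_hm[OF G m] set_lebesgue_integral_def by presburger
qed

lemma LINT_line_local:
 fixes f :: "real^2 => real"
 assumes f: "continuous_on UNIV f" "!!z. R <= norm z ==> f z = 0" and R: "0 < R"
 shows "(LINT z:span {ta}|hausdorff1. f z) = (\<integral>z. f z \<partial>hm (span {ta} Int cball 0 (2 * R)))"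
proof -
 have L: "span {ta} Int cball 0 (2 * R) : sets borel"
  by (intro borel_closed closed_Int closed_line) auto
 have "indicator (span {ta}) z *R f z = indicator (span {ta} Int cball 0 (2 * R)) z *R f z" for z
  using f(2)[of z] R by (cases "R <= norm z") (auto simp: indicator_def)
 then show ?thesis
  unfolding integral_hm[OF L cont_borel[OF f(1)]] set_lebesgue_integral_def by presburger
qed

lemma approx_tangentI:
 assumes GW: "Ga Int ball x d = G Int ball x d" and d: "0 < d" and G: "G : sets borel" "hausdorff1_outer G < top"
  and ta: "norm ta = 1"
  and tiled: "!!k. 0 < k ==> EX rh>0. ALL r. 0 < r & r < rh --> tiled (hm G) x ta k (1 - 1 / (2 * real k)) r"
  and upper: "!!eps. 0 < eps ==> EX rh>0. ALL r. 0 < r & r < rh --> emeasure (hm G) (ball x r) <= ennreal ((1 + eps) * (2 * r))"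
 shows "approx_tangent Ga x ta"
 unfolding approx_tangent_def
proof (intro conjI ta allI impI)
 fix f :: "real^2 => real" assume f: "continuous_on UNIV f & compactly_supported_in UNIV f"
 then obtain R where R: "0 < R" "!!z. R <= norm z ==> f z = 0"
  using compactly_supported_vanishes by blast
 have "((%r. 1 / r * (\<integral>y. f ((y - x) /\<^sub>R r) \<partial>hm G)) \<longlongrightarrow> (\<integral>z. f z \<partial>hm (span {ta} Int cball 0 (2 * R)))) (at_right 0)"
  by (rule blowup_converges[OF sets_hm finite_measure_hm[OF G] ta tiled upper]) (use f R in auto)
 moreover have "(LINT z:span {ta}|hausdorff1. f z) = (\<integral>z. f z \<partial>hm (span {ta} Int cball 0 (2 * R)))"
  by (rule LINT_line_local) (use f R in auto)
 ultimately have "((%r. 1 / r * (\<integral>y. f ((y - x) /\<^sub>R r) \<partial>hm G)) \<longlongrightarrow> (LINT z:span {ta}|hausdorff1. f z)) (at_right 0)"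
  by (simp only:)
 moreover have "\<forall>\<^sub>F r in at_right 0. 1 / r * (\<integral>y. f ((y - x) /\<^sub>R r) \<partial>hm G) = 1 / r * (LINT y:Ga|hausdorff1. f ((y - x) /\<^sub>R r))"
  unfolding eventually_at_right_field
 proof (intro exI[of _ "d / R"] conjI allI impI)
  fix r assume "0 < r" "r < d / R"
  then have "r * R <= d" using R by (simp add: field_simps)
  with LINT_blowup_local[OF GW G(1) conjunct1[OF f] R(2)] \<open>0 < r\<close>
  show "1 / r * (\<integral>y. f ((y - x) /\<^sub>R r) \<partial>hm G) = 1 / r * (LINT y:Ga|hausdorff1. f ((y - x) /\<^sub>R r))" by simp
 qed (use d R in simp)
 ultimately show "((%r. 1 / r * (LINT y:Ga|hausdorff1. f ((y - x) /\<^sub>R r))) \<longlongrightarrow> (LINT z:span {ta}|hausdorff1. f z)) (at_right 0)"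
  by (rule Lim_transform_eventually)
qed

text \<open>Test the tangent with a tent function for each tile: it is at most the indicator of the
  tile after rescaling, and its integral over the line exceeds the mass that \<open>tiled\<close>
  demands. Finitely many tents are involved, so one scale serves all of them.\<close>

lemma approx_tangent_tiled:
 assumes tan: "approx_tangent Ga x ta" and GW: "Ga Int ball x d = G Int ball x d" and d: "0 < d"
  and G: "G : sets borel" "hausdorff1_outer G < top" and k: "0 < k"
 shows "EX rh>0. ALL r. 0 < r & r < rh --> tiled (hm G) x ta k (1 - 1 / real k) r"
proof (cases "k <= 3")
 case True then show ?thesis using tiled_trivial[OF k True] by (intro exI[of _ 1]) auto
next
 case False
 have ta: "norm ta = 1" using tan by (simp add: approx_tangent_def)
 interpret finite_measure "hm G" by (rule finite_measure_hm[OF G])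
 have k4: "4 <= real k" using False by simp
 define s where "s = (1 - 1 / real k) / (2 * real k)"
 \<comment> \<open>The width of the slope of the tent. It is small enough that 2 (s - dl) still
   exceeds the demanded mass, by 3 / (2 k^2).\<close>
 define dl where "dl = 1 / (4 * (real k)^2)"
 have dl: "0 < dl" using k4 by (simp add: dl_def)
 have s: "dl <= s" "s <= 1"
 proof -
  have "1 / (4 * (real k)^2) <= 1 / 4 / (2 * real k)" using k4 by (simp add: power2_eq_square field_simps)
  also have "... <= s" unfolding s_def using k4 by (intro divide_right_mono) (auto simp: field_simps)
  finally show "dl <= s" by (simp add: dl_def)
  have "1 - 1 / real k <= 1" by simp
  then have "1 - 1 / real k <= 2 * real k" using k4 by linarith
  then show "s <= 1" unfolding s_def using k4 by simp
 qed
 have gap: "1 / real k * (1 - 3 / real k) < 2 * (s - dl)"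
 proof -
  have "2 * (s - dl) = 1 / real k * (1 - 1 / real k) - 1 / (2 * (real k)^2)"
   unfolding s_def dl_def using k4 by (simp add: field_simps power2_eq_square)
  also have "... = 1 / real k * (1 - 3 / real k) + 3 / (2 * (real k)^2)"
   using k4 by (simp add: power2_eq_square field_simps)
  finally show ?thesis using k4 by simp
 qed
 define p where "p j = (of_int j / real k) *R ta" for j :: int
 define f where "f j z = max 0 (min 1 ((s - dist z (p j)) / dl))" for j :: int and z :: "real^2"
 have pj: "norm (p j) <= 1" if "\<bar>j\<bar> <= int k" for j
 proof -
  have "\<bar>of_int j :: real\<bar> <= real k" using that by linarith
  then show ?thesis using ta k by (simp add: p_def)
 qed
 have fc: "continuous_on UNIV (f j)" for j
  unfolding f_def using dl by (intro continuous_intros) auto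
 have f0: "f j z = 0" if "s <= dist z (p j)" for j z
 proof -
  have "(s - dist z (p j)) / dl <= 0" using that dl by (intro divide_nonpos_pos) auto
  then show ?thesis by (simp only: f_def min_absorb2 max_absorb1 order_trans[OF _ zero_le_one])
 qed
 have f01: "0 <= f j z" "f j z <= 1" for j z
  unfolding f_def by (rule max.cobounded1, rule max.boundedI[OF zero_le_one min.cobounded1])
 have f1: "f j z = 1" if "dist z (p j) <= s - dl" for j z
 proof -
  have "1 <= (s - dist z (p j)) / dl" using that dl by (simp add: pos_le_divide_eq)
  then show ?thesis by (simp only: f_def min_absorb1 max_absorb2 zero_le_one)
 qed
 have f2: "f j z = 0" if "\<bar>j\<bar> <= int k" "2 <= norm z" for j z
 proof (rule f0)
  have "2 <= norm (p j) + dist z (p j)" using that(2) norm_triangle_sub[of z "p j"] by (simp add: dist_norm)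
  then show "s <= dist z (p j)" using pj[OF that(1)] s by linarith
 qed
 have cs: "compactly_supported_in UNIV (f j)" if j: "\<bar>j\<bar> <= int k" for j
 proof -
  have "{z. f j z ~= 0} <= cball 0 2"
  proof
   fix z assume "z : {z. f j z ~= 0}"
   then show "z : cball 0 2" using f2[OF j, of z] by (cases "2 <= norm z") auto
  qed
  then have "closure {z. f j z ~= 0} <= cball 0 2" by (intro closure_minimal) auto
  then show ?thesis unfolding compactly_supported_in_def
   by (simp add: bounded_subset[OF bounded_cball] compact_eq_bounded_closed)
 qed
 have lim: "((%r. 1 / r * (LINT y:Ga|hausdorff1. f j ((y - x) /\<^sub>R r))) \<longlongrightarrow> (LINT z:span {ta}|hausdorff1. f j z)) (at_right 0)"
  if j: "\<bar>j\<bar> <= int k" for j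
  using tan fc cs[OF j] unfolding approx_tangent_def by blast
 define L where "L = span {ta} Int cball 0 (2 * 2)"
 have Lb: "L : sets borel" unfolding L_def by (intro borel_closed closed_Int closed_line) auto
 have Lfin: "hausdorff1_outer L < top"
 proof -
  have "hausdorff1_outer L <= ennreal (2 * (2 * 2))"
   unfolding L_def by (rule hausdorff1_outer_line_ball[OF ta]) auto
  then show ?thesis by (rule le_less_trans) simp
 qed
 have big: "2 * (s - dl) <= (LINT z:span {ta}|hausdorff1. f j z)" if j: "\<bar>j\<bar> <= int k" for j
 proof -
  interpret L: finite_measure "hm L" by (rule finite_measure_hm[OF Lb Lfin])
  have jb: "\<bar>of_int j / real k\<bar> <= 1"
  proof -
   have "\<bar>of_int j :: real\<bar> <= real k" using j by linarith
   then show ?thesis using k by simp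
  qed
  have "ennreal (2 * (s - dl)) <= hausdorff1_outer (L Int cball (p j) (s - dl))"
   unfolding L_def p_def using jb s dl by (intro hausdorff1_outer_line_cball[OF ta]) auto
  also have "... = ennreal (measure (hm L) (cball (p j) (s - dl)))"
   by (simp add: emeasure_hm[OF Lb, symmetric] L.emeasure_eq_measure)
  finally have "2 * (s - dl) <= measure (hm L) (cball (p j) (s - dl))"
   by (subst (asm) ennreal_le_iff) auto
  also have "... = (\<integral>z. indicator (cball (p j) (s - dl)) z \<partial>hm L)" by simp
  also have "... <= (\<integral>z. f j z \<partial>hm L)"
  proof (rule integral_mono)
   show "integrable (hm L) (indicator (cball (p j) (s - dl)) :: real^2 => real)"
    by (intro integrable_real_indicator) (auto simp: less_top[symmetric])
   show "integrable (hm L) (f j)"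
    by (rule L.integrable_const_bound[where B = 1])
     (use f01 cont_borel[OF fc] in \<open>auto cong: measurable_cong_sets\<close>)
   show "indicator (cball (p j) (s - dl)) z <= f j z" for z
    using f1[of z j] f01[of j z] by (auto simp: indicator_def dist_commute)
  qed
  also have "... = (LINT z:span {ta}|hausdorff1. f j z)"
   unfolding L_def by (rule LINT_line_local[OF fc f2[OF j], symmetric]) auto
  finally show ?thesis .
 qed
 have "\<forall>\<^sub>F r in at_right 0. ALL j:{- int k..int k}. 1 / real k * (1 - 3 / real k) < 1 / r * (LINT y:Ga|hausdorff1. f j ((y - x) /\<^sub>R r))"
 proof (intro eventually_ball_finite ballI)
  fix j assume "j : {- int k..int k}"
  then have j: "\<bar>j\<bar> <= int k" by auto
  show "\<forall>\<^sub>F r in at_right 0. 1 / real k * (1 - 3 / real k) < 1 / r * (LINT y:Ga|hausdorff1. f j ((y - x) /\<^sub>R r))"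
   by (rule order_tendstoD(1)[OF lim[OF j]]) (use gap big[OF j] in linarith)
 qed simp
 then obtain rh where rh: "0 < rh" "!!r j. 0 < r ==> r < rh ==> j : {- int k..int k} ==>
   1 / real k * (1 - 3 / real k) < 1 / r * (LINT y:Ga|hausdorff1. f j ((y - x) /\<^sub>R r))"
  unfolding eventually_at_right_field by blast
 show ?thesis
 proof (intro exI[of _ "min rh (d / 2)"] conjI allI impI)
  fix r assume r: "0 < r & r < min rh (d / 2)"
  show "tiled (hm G) x ta k (1 - 1 / real k) r"
   unfolding tiled_def
  proof (intro allI impI)
   fix j :: int assume j: "\<bar>j\<bar> <= int k"
   define B where "B = cball (x + (of_int j * r / real k) *R ta) ((1 - 1 / real k) * r / (2 * real k))"
   have "1 / real k * (1 - 3 / real k) < 1 / r * (LINT y:Ga|hausdorff1. f j ((y - x) /\<^sub>R r))"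
    by (rule rh(2)) (use r j in \<open>auto simp: abs_le_iff\<close>)
   then have "r * (1 / real k * (1 - 3 / real k)) <= r * (1 / r * (LINT y:Ga|hausdorff1. f j ((y - x) /\<^sub>R r)))"
    using r by (intro mult_left_mono) auto
   then have "r / real k * (1 - 3 / real k) <= (LINT y:Ga|hausdorff1. f j ((y - x) /\<^sub>R r))"
    using r by simp
   also have "... = (\<integral>y. f j ((y - x) /\<^sub>R r) \<partial>hm G)"
    by (rule LINT_blowup_local[OF GW G(1) fc f2[OF j]]) (use r in auto)
   also have "... <= (\<integral>y. indicator B y \<partial>hm G)"
   proof (rule integral_mono)
    show "integrable (hm G) (indicator B :: real^2 => real)"
     by (intro integrable_real_indicator) (auto simp: B_def less_top[symmetric])
    have "(%y. f j ((y - x) /\<^sub>R r)) : borel_measurable borel"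
     by (intro cont_borel continuous_on_compose2[OF fc] continuous_intros) auto
    then show "integrable (hm G) (%y. f j ((y - x) /\<^sub>R r))"
     by (intro integrable_const_bound[where B = 1]) (use f01 in \<open>auto cong: measurable_cong_sets\<close>)
    fix y
    show "f j ((y - x) /\<^sub>R r) <= indicator B y"
    proof (cases "y : B")
     case False
     have "y - (x + (of_int j * r / real k) *R ta) = r *R ((y - x) /\<^sub>R r - p j)"
      using r by (simp add: p_def algebra_simps)
     then have "dist y (x + (of_int j * r / real k) *R ta) = r * dist ((y - x) /\<^sub>R r) (p j)"
      using r by (simp add: dist_norm)
     moreover have "s * r < dist y (x + (of_int j * r / real k) *R ta)"
      using False by (simp add: B_def s_def dist_commute)
     ultimately have "s <= dist ((y - x) /\<^sub>R r) (p j)" using r by (simp add: mult.commute)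
     from f0[OF this] show ?thesis by simp
    qed (simp add: f01)
   qed
   also have "... = measure (hm G) B" by simp
   finally show "ennreal (r / real k * (1 - 3 / real k)) <= emeasure (hm G) B"
    by (simp add: emeasure_eq_measure ennreal_leI)
  qed
 qed (use rh d in auto)
qed

section \<open>Measurability and length of the set of tangent points\<close>

lemma emeasure_cball_limit:
 fixes M :: "'a::euclidean_space measure"
 assumes M: "sets M = sets borel" "finite_measure M"
  and x: "xs ----> x" and c: "!!n. c <= emeasure M (cball (xs n) s)"
 shows "c <= emeasure M (cball x s)"
proof -
 interpret finite_measure M by fact
 define B where "B m = cball x (s + 1 / real (Suc m))" for m
 have Bm: "c <= emeasure M (B m)" for m
 proof -
  obtain n where n: "dist (xs n) x < 1 / real (Suc m)"
   using x unfolding lim_sequentially by (metis divide_pos_pos le_refl of_nat_0_less_iff zero_less_Suc zero_less_one)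
  have "cball (xs n) s <= B m"
  proof
   fix y assume "y : cball (xs n) s"
   then show "y : B m" using n dist_triangle[of x y "xs n"] by (simp add: B_def dist_commute)
  qed
  then have "emeasure M (cball (xs n) s) <= emeasure M (B m)"
   using M by (intro emeasure_mono) (auto simp: B_def)
  with c[of n] show ?thesis by simp
 qed
 have dec: "decseq B"
  by (intro decseq_SucI) (auto simp: B_def intro!: subset_cball simp: field_simps)
 have "(%m. emeasure M (B m)) ----> emeasure M (\<Inter>m. B m)"
 proof (rule Lim_emeasure_decseq[OF _ dec])
  show "range B <= sets M" unfolding M(1) by (auto simp: B_def)
 qed simp
 moreover have "(\<Inter>m. B m) = cball x s"
 proof
  show "(\<Inter>m. B m) <= cball x s"
  proof
   fix y assume y: "y : (\<Inter>m. B m)"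
   have "(%m. s + 1 / real (Suc m)) ----> s + 0"
    by (intro tendsto_intros LIMSEQ_Suc[OF lim_1_over_n])
   then have "dist x y <= s + 0"
    by (rule LIMSEQ_le_const) (use y in \<open>auto simp: B_def\<close>)
   then show "y : cball x s" by simp
  qed
  show "cball x s <= (\<Inter>m. B m)"
  proof (intro INT_greatest subsetI)
   fix y m assume "y : cball x s"
   moreover have "0 <= 1 / real (Suc m)" by simp
   ultimately show "y : B m" unfolding B_def mem_cball by linarith
  qed
 qed
 ultimately show ?thesis using LIMSEQ_le_const[of _ _ c] Bm by fastforce
qed

text \<open>A uniform version of having a tangent: a single direction serves all resolutions up to k
  at all scales up to 1 / (m + 1). With the quantifiers bounded in this way the set is closed, and
  the condition for all k and some m is Borel.\<close>

definition tiled_upto :: "(real^2) measure => nat => nat => (real^2) set" where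
 "tiled_upto M k m = {x. EX ta. norm ta = 1 &
  (ALL i r. 0 < i & i <= k & 0 < r & r <= 1 / real (Suc m) --> tiled M x ta i (1 - 1 / real i) r)}"

text \<open>Directions have a convergent subsequence, and the mass of closed discs is upper
  semicontinuous in the centre; this is why the tiles are closed.\<close>

lemma closed_tiled_upto:
 assumes M: "sets M = sets borel" "finite_measure M"
 shows "closed (tiled_upto M k m)"
 unfolding closed_sequential_limits
proof (intro allI impI, elim conjE)
 fix xs x assume xs: "ALL n. xs n : tiled_upto M k m" and lim: "xs ----> x"
 then obtain T where T: "!!n. norm (T n) = 1" "!!n i r. 0 < i ==> i <= k ==> 0 < r ==> r <= 1 / real (Suc m) ==>
  tiled M (xs n) (T n) i (1 - 1 / real i) r"
  unfolding tiled_upto_def by (simp only: mem_Collect_eq) metis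
 have "ALL n. T n : sphere 0 1" using T(1) by simp
 then obtain ta sg where ta: "ta : sphere 0 1" "strict_mono sg" "(T \<circ> sg) ----> ta"
  using compact_sphere[of "0 :: real^2" 1] unfolding compact_def by blast
 have lim': "(xs \<circ> sg) ----> x" by (rule LIMSEQ_subseq_LIMSEQ[OF lim ta(2)])
 show "x : tiled_upto M k m"
  unfolding tiled_upto_def
 proof (intro CollectI exI[of _ ta] conjI allI impI)
  show "norm ta = 1" using ta(1) by simp
  fix i r assume ir: "0 < i & i <= k & 0 < r & r <= 1 / real (Suc m)"
  show "tiled M x ta i (1 - 1 / real i) r"
   unfolding tiled_def
  proof (intro allI impI)
   fix j :: int assume j: "\<bar>j\<bar> <= int i"
   have "(%n. (xs \<circ> sg) n + (of_int j * r / real i) *R (T \<circ> sg) n) ----> x + (of_int j * r / real i) *R ta"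
    by (intro tendsto_intros lim' ta(3))
   then show "ennreal (r / real i * (1 - 3 / real i)) <= emeasure M (cball (x + (of_int j * r / real i) *R ta) ((1 - 1 / real i) * r / (2 * real i)))"
    by (rule emeasure_cball_limit[OF M]) (use T(2)[of i r] ir j in \<open>auto simp: tiled_def\<close>)
  qed
 qed
qed

text \<open>The direction may change with k, so a limit direction is taken. A tile along a nearby
  direction fits into the slightly larger tile along the limit, which is the reason for the factor 1
  - 1 / (2 k) in place of 1 - 1 / k.\<close>

lemma tiled_all_limit:
 assumes M: "sets M = sets borel" and x: "x : (\<Inter>k. \<Union>m. tiled_upto M k m)"
 obtains ta where "norm ta = 1"
  "!!k. 0 < k ==> EX rh>0. ALL r. 0 < r & r < rh --> tiled M x ta k (1 - 1 / (2 * real k)) r"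
proof -
 have "ALL k. EX m. x : tiled_upto M k m" using x by blast
 then have "ALL k. EX m ta. norm ta = 1 &
  (ALL i r. 0 < i & i <= k & 0 < r & r <= 1 / real (Suc m) --> tiled M x ta i (1 - 1 / real i) r)"
  unfolding tiled_upto_def by simp
 then obtain m T where T: "!!k. norm (T k) = 1"
  "!!k i r. 0 < i ==> i <= k ==> 0 < r ==> r <= 1 / real (Suc (m k)) ==> tiled M x (T k) i (1 - 1 / real i) r"
  by metis
 have "ALL n. T n : sphere 0 1" using T(1) by simp
 then obtain ta sg where ta: "ta : sphere 0 1" "strict_mono (sg :: nat => nat)" "(T \<circ> sg) ----> ta"
  using compact_sphere[of "0 :: real^2" 1] unfolding compact_def by blast
 show thesis
 proof (rule that)
  show "norm ta = 1" using ta(1) by simp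
  fix i :: nat assume i: "0 < i"
  \<comment> \<open>A change of direction by this much moves a centre by at most r / (4 i^2), which
    is exactly the difference of the two tile radii.\<close>
  have "0 < 1 / (4 * (real i)^2)" using i by simp
  then obtain n0 where n0: "!!n. n >= n0 ==> dist ((T \<circ> sg) n) ta < 1 / (4 * (real i)^2)"
   using ta(3) unfolding lim_sequentially by blast
  define n where "n = max n0 i"
  define k where "k = sg n"
  have ik: "i <= k" using seq_suble[OF ta(2), of n] unfolding k_def n_def by linarith
  have near: "dist (T k) ta < 1 / (4 * (real i)^2)" using n0[of n] by (simp add: k_def n_def)
  show "EX rh>0. ALL r. 0 < r & r < rh --> tiled M x ta i (1 - 1 / (2 * real i)) r"
  proof (intro exI[of _ "1 / real (Suc (m k))"] conjI allI impI)
   fix r assume r: "0 < r & r < 1 / real (Suc (m k))"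
   show "tiled M x ta i (1 - 1 / (2 * real i)) r"
    unfolding tiled_def
   proof (intro allI impI)
    fix j :: int assume j: "\<bar>j\<bar> <= int i"
    have jb: "\<bar>of_int j * r / real i\<bar> <= r"
    proof -
     have "\<bar>of_int j :: real\<bar> <= real i" using j by linarith
     then show ?thesis using r i by (simp add: abs_mult field_simps)
    qed
    have "cball (x + (of_int j * r / real i) *R T k) ((1 - 1 / real i) * r / (2 * real i))
      <= cball (x + (of_int j * r / real i) *R ta) ((1 - 1 / (2 * real i)) * r / (2 * real i))"
    proof
     fix y assume y: "y : cball (x + (of_int j * r / real i) *R T k) ((1 - 1 / real i) * r / (2 * real i))"
     have "dist (x + (of_int j * r / real i) *R ta) (x + (of_int j * r / real i) *R T k) = \<bar>of_int j * r / real i\<bar> * dist ta (T k)"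
      by (simp add: dist_norm flip: scaleR_right_diff_distrib)
     also have "... <= r * (1 / (4 * (real i)^2))"
      using jb near r by (intro mult_mono) (auto simp: dist_commute)
     finally have "dist (x + (of_int j * r / real i) *R ta) (x + (of_int j * r / real i) *R T k) <= r / (4 * (real i)^2)" by simp
     moreover have "r / (4 * (real i)^2) + (1 - 1 / real i) * r / (2 * real i) = (1 - 1 / (2 * real i)) * r / (2 * real i)"
      using i by (simp add: field_simps power2_eq_square)
     ultimately show "y : cball (x + (of_int j * r / real i) *R ta) ((1 - 1 / (2 * real i)) * r / (2 * real i))"
      using y dist_triangle[of "x + (of_int j * r / real i) *R ta" y "x + (of_int j * r / real i) *R T k"]
      unfolding mem_cball by linarith
    qed
    then have "emeasure M (cball (x + (of_int j * r / real i) *R T k) ((1 - 1 / real i) * r / (2 * real i)))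
      <= emeasure M (cball (x + (of_int j * r / real i) *R ta) ((1 - 1 / (2 * real i)) * r / (2 * real i)))"
     using M by (intro emeasure_mono) auto
    moreover have "ennreal (r / real i * (1 - 3 / real i)) <= emeasure M (cball (x + (of_int j * r / real i) *R T k) ((1 - 1 / real i) * r / (2 * real i)))"
     using T(2)[OF i ik, of r] r j unfolding tiled_def by auto
    ultimately show "ennreal (r / real i * (1 - 3 / real i)) <= emeasure M (cball (x + (of_int j * r / real i) *R ta) ((1 - 1 / (2 * real i)) * r / (2 * real i)))"
     by (rule order_trans[rotated])
   qed
  qed simp
 qed
qed

lemma tiled_uptoI:
 assumes ta: "norm ta = 1" and t: "!!k. 0 < k ==> EX rh>0. ALL r. 0 < r & r < rh --> tiled M x ta k (1 - 1 / real k) r"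
 shows "x : (\<Inter>k. \<Union>m. tiled_upto M k m)"
proof
 fix k
 obtain rh where rh: "!!i. 0 < i ==> 0 < rh i" "!!i r. 0 < i ==> 0 < r ==> r < rh i ==> tiled M x ta i (1 - 1 / real i) r"
  using t by metis
 define R where "R = Min (insert 1 (rh ` {1..k}))"
 have R: "0 < R" "!!i. 0 < i ==> i <= k ==> R <= rh i"
 proof -
  show "0 < R" unfolding R_def by (subst Min_gr_iff) (auto simp: rh(1) Suc_le_eq)
  show "R <= rh i" if "0 < i" "i <= k" for i
   unfolding R_def using that by (intro Min_le) auto
 qed
 obtain m where m: "1 / real (Suc m) < R" using reals_Archimedean[OF R(1)] by (auto simp only: inverse_eq_divide)
 have "x : tiled_upto M k m"
  unfolding tiled_upto_def
 proof (intro CollectI exI[of _ ta] conjI ta allI impI)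
  fix i r assume a: "0 < i & i <= k & 0 < r & r <= 1 / real (Suc m)"
  then have "r < rh i" using R(2)[of i] m by linarith
  then show "tiled M x ta i (1 - 1 / real i) r" using a rh(2) by blast
 qed
 then show "x : (\<Union>m. tiled_upto M k m)" by blast
qed

lemma null_in_hausdorff1:
 assumes "hausdorff1_outer A = 0" shows "A : sets hausdorff1"
proof -
 have "hausdorff1_outer (A Int S) + hausdorff1_outer ((UNIV - A) Int S) = hausdorff1_outer S" for S
 proof (rule antisym)
  have z: "hausdorff1_outer (A Int S) = 0" using hausdorff1_outer_mono[of "A Int S" A] assms by simp
  show "hausdorff1_outer (A Int S) + hausdorff1_outer ((UNIV - A) Int S) <= hausdorff1_outer S"
   unfolding z by (simp add: hausdorff1_outer_mono)
  have "S = (A Int S) Un ((UNIV - A) Int S)" by blast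
  then show "hausdorff1_outer S <= hausdorff1_outer (A Int S) + hausdorff1_outer ((UNIV - A) Int S)"
   by (metis hausdorff1_outer_Un)
 qed
 then show ?thesis by (auto simp: sets_hausdorff1 lambda_system_def)
qed

text \<open>Up to the set \<open>Bad\<close> of upper density above 1, which has length zero, having
  an approximate tangent is the Borel condition \<open>Q\<close>. Arcs inside a continuum satisfy
  \<open>Q\<close> at their points of nonzero derivative, so the tangent points are as long as the
  continuum is wide. \<open>G\<close> is a set of finite length that agrees with \<open>Ga\<close>
  in \<open>W\<close>.\<close>

lemma tangent_points:
 fixes Ga G W K :: "(real^2) set"
 assumes GW: "Ga Int W = G Int W" and W: "open W" and G: "G : sets borel" "hausdorff1_outer G < top"
  and K: "K : sets borel" "K <= G Int W"
 shows "{x. EX ta. approx_tangent Ga x ta} Int K : sets hausdorff1" (is "?T Int K : _")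
  and "!!C x y. connected C ==> compact C ==> C <= K ==> x : C ==> y : C ==>
   ennreal (dist x y) <= hausdorff1_outer ({x. EX ta. approx_tangent Ga x ta} Int C)"
proof -
 define Bad where "Bad = (\<Union>n. {x:G. ALL d>0. EX r. 0 < r & r < d &
  emeasure (hm G) (ball x r) > ennreal ((1 + 1 / real (Suc n)) * (2 * r))})"
 have Bad0: "hausdorff1_outer Bad = 0"
 proof -
  have "hausdorff1_outer Bad <= (\<Sum>n. hausdorff1_outer {x:G. ALL d>0. EX r. 0 < r & r < d &
   emeasure (hm G) (ball x r) > ennreal ((1 + 1 / real (Suc n)) * (2 * r))})"
   unfolding Bad_def by (rule hausdorff1_outer_Union)
  also have "... = (\<Sum>n. 0)"
   by (intro suminf_cong hausdorff1_upper_density_null[OF G]) simp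
  finally show ?thesis by simp
 qed
 define Q where "Q = (\<Inter>k. \<Union>m. tiled_upto (hm G) k m)"
 have Qb: "Q : sets borel"
  unfolding Q_def using closed_tiled_upto[OF sets_hm finite_measure_hm[OF G]]
  by (intro sets.countable_INT sets.countable_UN) auto
 have loc: "EX d>0. Ga Int ball x d = G Int ball x d" if xW: "x : W" for x
 proof -
  obtain d where "0 < d" "ball x d <= W" using openE[OF W xW] .
  then show ?thesis using GW by (intro exI[of _ d]) blast
 qed
 have TQ: "x : Q" if x: "x : ?T" "x : W" for x
 proof -
  obtain d where d: "0 < d" "Ga Int ball x d = G Int ball x d" using loc[OF x(2)] by blast
  obtain ta where ta: "approx_tangent Ga x ta" using x by blast
  show ?thesis unfolding Q_def
   by (rule tiled_uptoI[of ta])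
    (use ta approx_tangent_tiled[OF ta d(2,1) G] in \<open>auto simp: approx_tangent_def\<close>)
 qed
 have QT: "x : ?T" if x: "x : Q" "x : W" "x : G" "x ~: Bad" for x
 proof -
  obtain d where d: "0 < d" "Ga Int ball x d = G Int ball x d" using loc[OF x(2)] by blast
  obtain ta where ta: "norm ta = 1"
   "!!k. 0 < k ==> EX rh>0. ALL r. 0 < r & r < rh --> tiled (hm G) x ta k (1 - 1 / (2 * real k)) r"
   using tiled_all_limit[OF sets_hm x(1)[unfolded Q_def]] by blast
  have "approx_tangent Ga x ta"
  proof (rule approx_tangentI[OF d(2,1) G ta])
   fix eps :: real assume eps: "0 < eps"
   obtain n where n: "1 / real (Suc n) < eps" using reals_Archimedean[OF eps] by (auto simp only: inverse_eq_divide)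
   from x(3,4) obtain rh where rh: "0 < rh" "!!r. 0 < r ==> r < rh ==>
     emeasure (hm G) (ball x r) <= ennreal ((1 + 1 / real (Suc n)) * (2 * r))"
    unfolding Bad_def by (auto simp: not_less) (metis not_less)
   show "EX rh>0. ALL r. 0 < r & r < rh --> emeasure (hm G) (ball x r) <= ennreal ((1 + eps) * (2 * r))"
   proof (intro exI[of _ rh] conjI allI impI rh(1))
    fix r assume r: "0 < r & r < rh"
    then have "emeasure (hm G) (ball x r) <= ennreal ((1 + 1 / real (Suc n)) * (2 * r))" using rh(2) by blast
    also have "... <= ennreal ((1 + eps) * (2 * r))"
     using r n by (intro ennreal_leI mult_right_mono) auto
    finally show "emeasure (hm G) (ball x r) <= ennreal ((1 + eps) * (2 * r))" .
   qed
  qed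
  then show ?thesis by blast
 qed
 have "?T Int K = (Q Int K - Bad) Un (?T Int K Int Bad)" using TQ QT K(2) by blast
 moreover have "?T Int K Int Bad : sets hausdorff1"
  using hausdorff1_outer_mono[of "?T Int K Int Bad" Bad] Bad0 by (intro null_in_hausdorff1) auto
 moreover have "Q Int K - Bad : sets hausdorff1"
  by (intro sets.Diff null_in_hausdorff1[OF Bad0] borel_in_hausdorff1 sets.Int Qb K(1))
 ultimately show "?T Int K : sets hausdorff1" by (metis sets.Un)
 fix C x y assume C: "connected C" "compact C" "C <= K" and xy: "x : C" "y : C"
 have CG: "C <= G" "C <= W" using C K by auto
 then have Cfin: "hausdorff1_outer C < top" using hausdorff1_outer_mono[of C G] G(2) by (auto intro: le_less_trans)
 have "ennreal (dist x y) <= hausdorff1_outer {z:C - Bad. EX g v t. continuous_on UNIV g &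
  range g <= C & g t = z & (g has_vector_derivative v) (at t) & v ~= 0}"
  by (rule hausdorff1_outer_differentiable_points[OF C(1,2) Cfin xy Bad0])
 also have "... <= hausdorff1_outer (?T Int C)"
 proof (rule hausdorff1_outer_mono, safe)
  fix g :: "real => real^2" and v t
  assume g: "g t : C" "g t ~: Bad" "continuous_on UNIV g" "range g <= C" "(g has_vector_derivative v) (at t)" "v ~= 0"
  have "g t : Q" unfolding Q_def
  proof (rule tiled_uptoI)
   show "norm (v /\<^sub>R norm v) = 1" using g by simp
   fix k :: nat assume k: "0 < k"
   show "EX rh>0. ALL r. 0 < r & r < rh --> tiled (hm G) (g t) (v /\<^sub>R norm v) k (1 - 1 / real k) r"
    using tiled_curve[OF G(1) g(3) order_trans[OF g(4) CG(1)] refl g(5,6) k] by metis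
  qed
  then show "EX ta. approx_tangent Ga (g t) ta" using QT[of "g t"] g CG by blast
 qed
 finally show "ennreal (dist x y) <= hausdorff1_outer (?T Int C)" .
qed

section \<open>Mollifiers\<close>

lemma Ck_SucI:
 assumes "!!x. (f has_derivative D x) (at x)" "!!v. Ck k (%x. D x v)"
 shows "Ck (Suc k) f"
proof -
 have "frechet_derivative f (at x) = D x" for x using frechet_derivative_at[OF assms(1)] by simp
 then show ?thesis using assms by (auto simp: differentiable_def)
qed

lemma Ck_SucD:
 assumes "Ck (Suc k) f"
 shows "(f has_derivative frechet_derivative f (at x)) (at x)" "Ck k (%x. frechet_derivative f (at x) v)"
 using assms by (auto simp: frechet_derivative_works)

lemma Ck_Suc_imp: "Ck (Suc k) f ==> Ck k f"
proof (induction k arbitrary: f)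
 case 0
 then show ?case using differentiable_imp_continuous_within by (auto simp: continuous_on_eq_continuous_within)
next
 case (Suc k)
 then show ?case by (metis Ck.simps(2))
qed

lemma Ck_const: "Ck k (%x. c)"
proof (induction k arbitrary: c)
 case (Suc k) then show ?case by (intro Ck_SucI[where D = "%_ _. 0"]) auto
qed simp

lemma Ck_add: "Ck k f ==> Ck k g ==> Ck k (%x. f x + g x)"
proof (induction k arbitrary: f g)
 case (Suc k)
 show ?case
  by (rule Ck_SucI[OF has_derivative_add[OF Ck_SucD(1)[OF Suc.prems(1)] Ck_SucD(1)[OF Suc.prems(2)]]])
   (intro Suc.IH Ck_SucD(2) Suc.prems)
qed (auto intro: continuous_intros)

lemma Ck_scaleR: "Ck k f ==> Ck k g ==> Ck k (%x. f x *R g x)"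
proof (induction k arbitrary: f g)
 case (Suc k)
 show ?case
  by (rule Ck_SucI[OF has_derivative_scaleR[OF Ck_SucD(1)[OF Suc.prems(1)] Ck_SucD(1)[OF Suc.prems(2)]]])
   (intro Ck_add Suc.IH Ck_SucD(2) Suc.prems Ck_Suc_imp)
qed (auto intro: continuous_intros)

lemma Ck_mult: "Ck k f ==> Ck k g ==> Ck k (%x. f x * g x :: real)"
 using Ck_scaleR[of k f g] by simp

lemma Ck_bounded_linear: "bounded_linear L ==> Ck k L"
proof (cases k)
 case 0 assume "bounded_linear L" with 0 show ?thesis
  by (simp add: linear_continuous_on)
next
 case (Suc j) assume "bounded_linear L" then show ?thesis unfolding Suc
  by (intro Ck_SucI[where D = "%_. L"] bounded_linear_imp_has_derivative Ck_const)
qed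

lemma Ck_sum: "(!!i. i : I ==> Ck k (f i)) ==> Ck k (%x. \<Sum>i\<in>I. f i x)"
 by (induction I rule: infinite_finite_induct) (auto intro: Ck_const Ck_add)

lemma Ck_inner_self: "Ck k (%x :: 'a::euclidean_space. x \<bullet> x)"
proof -
 have "Ck k (%x :: 'a. \<Sum>b\<in>Basis. (x \<bullet> b) * (x \<bullet> b))"
  by (intro Ck_sum Ck_mult Ck_bounded_linear bounded_linear_inner_left)
 then show ?thesis by (subst euclidean_inner)
qed

lemma Ck_affine: "Ck k f ==> Ck k (%x. f (a + c *R x))"
proof (induction k arbitrary: f)
 case 0
 then show ?case by (auto intro!: continuous_on_compose2[of UNIV f] continuous_intros)
next
 case (Suc k)
 show ?case
 proof (rule Ck_SucI[where D = "%x v. c *R frechet_derivative f (at (a + c *R x)) v"])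
  fix x
  note d = Ck_SucD(1)[OF Suc.prems, of "a + c *R x"]
  have "((%x. f (a + c *R x)) has_derivative (%v. frechet_derivative f (at (a + c *R x)) (c *R v))) (at x)"
   by (rule has_derivative_compose[where g = f and f = "%x. a + c *R x", OF _ d]) (auto intro!: derivative_eq_intros)
  moreover have "frechet_derivative f (at (a + c *R x)) (c *R v) = c *R frechet_derivative f (at (a + c *R x)) v" for v
   using has_derivative_linear[OF d] by (rule linear_scale)
  ultimately show "((%x. f (a + c *R x)) has_derivative (%v. c *R frechet_derivative f (at (a + c *R x)) v)) (at x)"
   by simp
  show "Ck k (%x. c *R frechet_derivative f (at (a + c *R x)) v)" for v
   by (intro Ck_scaleR[OF Ck_const] Suc.IH Ck_SucD(2)[OF Suc.prems])
 qed
qed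

text \<open>The power of t is carried along so that the family is closed under differentiation up to
  linear combinations; one induction for all m then shows that exp (-1/t), extended by 0, is
  smooth.\<close>

definition exp_flat :: "nat => real => real" where
 "exp_flat m t = (if t <= 0 then 0 else exp (- 1 / t) / t ^ m)"

lemma exp_flat_tendsto_0: "(exp_flat m \<longlongrightarrow> 0) (at 0)"
proof -
 have "((%x :: real. x ^ m / exp x) \<longlongrightarrow> 0) at_top" by (rule tendsto_power_div_exp_0)
 then have "((%t :: real. (inverse t) ^ m / exp (inverse t)) \<longlongrightarrow> 0) (at_right 0)"
  by (rule filterlim_compose) (rule filterlim_inverse_at_top_right)
 moreover have "\<forall>\<^sub>F t :: real in at_right 0. (inverse t) ^ m / exp (inverse t) = exp_flat m t"
  unfolding eventually_at_right_field
  by (intro exI[of _ 1]) (auto simp: exp_flat_def exp_minus field_simps)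
 ultimately have "(exp_flat m \<longlongrightarrow> 0) (at_right 0)" by (rule Lim_transform_eventually)
 moreover have "(exp_flat m \<longlongrightarrow> 0) (at_left 0)"
 proof (rule Lim_transform_eventually[OF tendsto_const])
  show "\<forall>\<^sub>F t in at_left 0. 0 = exp_flat m t"
   unfolding eventually_at_left_field by (intro exI[of _ "-1"]) (auto simp: exp_flat_def)
 qed
 ultimately show ?thesis by (simp add: filterlim_at_split)
qed

lemma exp_flat_has_derivative:
 "(exp_flat m has_real_derivative exp_flat (m + 2) t - real m * exp_flat (m + 1) t) (at t)"
proof -
 consider "t < 0" | "t = 0" | "0 < t" by linarith
 then show ?thesis
 proof cases
  case 1
  have "((%_. 0) has_real_derivative 0) (at t)" by simp
  then have "(exp_flat m has_real_derivative 0) (at t)"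
   by (rule has_field_derivative_transform_within_open[of _ _ _ "{..<0}"]) (use 1 in \<open>auto simp: exp_flat_def\<close>)
  then show ?thesis using 1 by (simp add: exp_flat_def)
 next
  case 2
  have "((%h. (exp_flat m (0 + h) - exp_flat m 0) / h) \<longlongrightarrow> 0) (at 0)"
  proof (rule Lim_transform_eventually[OF exp_flat_tendsto_0[of "m + 1"]])
   show "\<forall>\<^sub>F h in at 0. exp_flat (m + 1) h = (exp_flat m (0 + h) - exp_flat m 0) / h"
    unfolding eventually_at by (intro exI[of _ 1]) (auto simp: exp_flat_def)
  qed
  then show ?thesis using 2 by (simp add: DERIV_def exp_flat_def)
 next
  case 3
  have "((%t. exp (- 1 / t) / t ^ m) has_real_derivative exp (- 1 / t) / t ^ (m + 2) - real m * (exp (- 1 / t) / t ^ (m + 1))) (at t)"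
  proof -
   define P where "P = t ^ m"
   have P: "P ~= 0" using 3 by (simp add: P_def)
   have pm: "real m * t ^ (m - 1) = real m * (P / t)" using 3 by (cases m) (auto simp: P_def)
   have d1: "((%t. exp (- 1 / t)) has_real_derivative exp (- 1 / t) * (1 / t^2)) (at t)"
    using 3 by (auto intro!: derivative_eq_intros simp: power2_eq_square)
   have d2: "((%t. t ^ m) has_real_derivative real m * t ^ (m - 1)) (at t)"
    using DERIV_pow[of m t] by simp
   have "((%t. exp (- 1 / t) / t ^ m) has_real_derivative
     (exp (- 1 / t) * (1 / t^2) * P - exp (- 1 / t) * (real m * (P / t))) / (P * P)) (at t)"
    using DERIV_divide[OF d1 d2] P unfolding pm by (simp add: P_def)
   also have "(exp (- 1 / t) * (1 / t^2) * P - exp (- 1 / t) * (real m * (P / t))) / (P * P)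
     = exp (- 1 / t) / t ^ (m + 2) - real m * (exp (- 1 / t) / t ^ (m + 1))"
    using 3 P by (simp add: power_add P_def[symmetric] diff_divide_distrib mult.commute power2_eq_square)
   finally show ?thesis .
  qed
  then have "(exp_flat m has_real_derivative exp (- 1 / t) / t ^ (m + 2) - real m * (exp (- 1 / t) / t ^ (m + 1))) (at t)"
   by (rule has_field_derivative_transform_within_open[of _ _ _ "{0<..}"]) (use 3 in \<open>auto simp: exp_flat_def\<close>)
  then show ?thesis using 3 by (simp add: exp_flat_def)
 qed
qed

lemma Ck_exp_flat_compose:
 fixes q :: "'a::euclidean_space => real"
 assumes "!!k. Ck k q"
 shows "Ck k (%x. exp_flat m (q x))"
proof (induction k arbitrary: m)
 case 0
 have "continuous_on UNIV (exp_flat m)"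
  using DERIV_isCont[OF exp_flat_has_derivative] by (auto simp: continuous_on_eq_continuous_at)
 then show ?case using assms[of 0] by (auto intro: continuous_on_compose2)
next
 case (Suc k)
 show ?case
 proof (rule Ck_SucI[where D = "%x v. (exp_flat (m + 2) (q x) + (- real m) * exp_flat (m + 1) (q x)) * frechet_derivative q (at x) v"])
  fix x
  have "((%x. exp_flat m (q x)) has_derivative (%v. (exp_flat (m + 2) (q x) - real m * exp_flat (m + 1) (q x)) * frechet_derivative q (at x) v)) (at x)"
   by (rule has_derivative_compose[where g = "exp_flat m" and f = q,
      OF Ck_SucD(1)[OF assms[of 1, unfolded One_nat_def]] exp_flat_has_derivative[unfolded has_field_derivative_def]])
  then show "((%x. exp_flat m (q x)) has_derivative (%v. (exp_flat (m + 2) (q x) + (- real m) * exp_flat (m + 1) (q x)) * frechet_derivative q (at x) v)) (at x)"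
   by simp
  show "Ck k (%x. (exp_flat (m + 2) (q x) + (- real m) * exp_flat (m + 1) (q x)) * frechet_derivative q (at x) v)" for v
   by (intro Ck_mult Ck_add Ck_const Suc.IH Ck_SucD(2)[OF assms])
 qed
qed

definition bump :: "real => 'a::euclidean_space => real" where
 "bump e x = exp_flat 0 (1 - (x \<bullet> x) / e^2)"

lemma Ck_bump: "Ck k (bump e)"
proof -
 have "Ck k (%x :: 'a. 1 + (- 1 / e^2) * (x \<bullet> x))" for k
  by (intro Ck_add Ck_mult Ck_const Ck_inner_self)
 from Ck_exp_flat_compose[OF this, of k 0] show ?thesis by (simp add: bump_def[abs_def])
qed

lemma bump_nonneg: "0 <= bump e x" by (simp add: bump_def exp_flat_def)

lemma bump_pos: "0 < e ==> norm x < e ==> 0 < bump e x"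
 by (auto simp: bump_def exp_flat_def dot_square_norm divide_less_eq abs_square_less_1
   intro!: power_strict_mono simp: not_le)

lemma bump_eq_0: "0 < e ==> e <= norm x ==> bump e x = 0"
 by (auto simp: bump_def exp_flat_def dot_square_norm le_divide_eq power_mono)

lemma continuous_bump: "continuous_on UNIV (bump e)" using Ck_bump[of 0 e] by simp

lemma integrable_lebesgue_continuous_compact_support:
 fixes f :: "'a::euclidean_space => 'b::euclidean_space"
 assumes "continuous_on UNIV f" "!!x. e < norm x ==> f x = 0"
 shows "integrable lebesgue f"
proof -
 have "integrable lborel (%x. indicator (cball 0 e) x *R f x)"
  by (rule borel_integrable_compact) (auto intro: continuous_on_subset[OF assms(1)])
 moreover have "(%x. indicator (cball 0 e) x *R f x) = f"
  using assms(2) by (auto simp: indicator_def not_le)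
 ultimately have "integrable lborel f" by simp
 then show ?thesis using integrable_completion[of f lborel] by (simp add: cont_borel[OF assms(1)])
qed

lemma integrable_bump: "0 < e ==> integrable lebesgue (bump e)"
 by (rule integrable_lebesgue_continuous_compact_support[of "bump e" e, OF continuous_bump]) (auto intro: bump_eq_0)

lemma integral_bump_pos:
 assumes "0 < e" shows "0 < integral\<^sup>L lebesgue (bump e :: 'a::euclidean_space => real)"
proof (rule ccontr)
 assume "~ ?thesis"
 moreover have "0 <= integral\<^sup>L lebesgue (bump e :: 'a => real)" by (intro B_integral_nonneg) (auto simp: bump_nonneg)
 ultimately have "integral\<^sup>L lebesgue (bump e :: 'a => real) = 0" by simp
 then have "AE x in lebesgue. bump e (x :: 'a) = 0"
  by (subst (asm) integral_nonneg_eq_0_iff_AE) (auto simp: bump_nonneg integrable_bump[OF assms])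
 then have "AE x in lebesgue. (x :: 'a) ~: ball 0 e"
  by eventually_elim (use bump_pos[OF assms] in force)
 then have "ball 0 e : null_sets (lebesgue :: 'a measure)"
  by (subst AE_iff_null_sets) auto
 then have "negligible (ball (0 :: 'a) e)" by (simp add: negligible_iff_null_sets)
 then show False using assms open_not_negligible[of "ball (0 :: 'a) e"] by auto
qed

definition mollifier :: "real => 'a::euclidean_space => real" where
 "mollifier e x = bump e x / integral\<^sup>L lebesgue (bump e :: 'a => real)"

lemma mollifier:
 assumes "0 < e"
 shows Ck_mollifier: "Ck k (mollifier e :: 'a::euclidean_space => real)"
  and mollifier_nonneg: "0 <= mollifier e (x :: 'a)"
  and mollifier_eq_0: "e <= norm x ==> mollifier e x = 0"
  and integral_mollifier: "integral\<^sup>L lebesgue (mollifier e :: 'a => real) = 1"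
  and integrable_mollifier: "integrable lebesgue (mollifier e :: 'a => real)"
  and mollifier_uminus: "mollifier e (- x) = mollifier e x"
proof -
 let ?c = "integral\<^sup>L lebesgue (bump e :: 'a => real)"
 have c: "0 < ?c" by (rule integral_bump_pos[OF assms])
 have "Ck k (%x :: 'a. bump e x * (1 / ?c))" by (intro Ck_mult Ck_bump Ck_const)
 then show "Ck k (mollifier e :: 'a => real)" by (simp add: mollifier_def[abs_def])
 show "0 <= mollifier e x" using c by (simp add: mollifier_def bump_nonneg)
 show "e <= norm x ==> mollifier e x = 0" using assms by (simp add: mollifier_def bump_eq_0)
 show "integral\<^sup>L lebesgue (mollifier e :: 'a => real) = 1" using c by (simp add: mollifier_def[abs_def])
 show "integrable lebesgue (mollifier e :: 'a => real)"
  unfolding mollifier_def[abs_def] by (intro integrable_divide integrable_bump assms)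
 show "mollifier e (- x) = mollifier e x" by (simp add: mollifier_def bump_def)
qed

section \<open>Convolution with smooth kernels\<close>

definition conv :: "('a::euclidean_space => real) => ('a => 'b::euclidean_space) => 'a => 'b" where
 "conv et f x = (LINT y|lebesgue. et (x - y) *R f y)"

lemma bounded_continuous_compact_support:
 fixes et :: "'a::euclidean_space => 'b::real_normed_vector"
 assumes "continuous_on UNIV et" "!!x. e < norm x ==> et x = 0"
 obtains B where "0 <= B" "!!x. norm (et x) <= B"
proof -
 have "bounded (et ` cball 0 e)"
  by (intro compact_imp_bounded compact_continuous_image continuous_on_subset[OF assms(1)]) auto
 then obtain B where B: "!!x. x : cball 0 e ==> norm (et x) <= B" unfolding bounded_iff by blast
 have "norm (et x) <= max B 0" for x
  using B[of x] assms(2)[of x] by (cases "norm x <= e") auto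
 then show ?thesis using that[of "max B 0"] by auto
qed

lemma integrable_conv:
 fixes f :: "'a::euclidean_space => 'b::euclidean_space"
 assumes et: "continuous_on UNIV et" "!!x. e < norm x ==> et x = 0" and f: "integrable lebesgue f"
 shows "integrable lebesgue (%y. et (x - y) *R f y)"
proof -
 obtain B where B: "0 <= B" "!!x. norm (et x) <= B"
  using bounded_continuous_compact_support[OF et] by blast
 have "continuous_on UNIV (%y. et (x - y))"
  by (intro continuous_on_compose2[OF et(1)] continuous_intros) auto
 then have "(%y. et (x - y)) : borel_measurable borel" by (rule cont_borel)
 then have m: "(%y. et (x - y)) : borel_measurable lebesgue" by (intro measurable_completion) simp
 show ?thesis
 proof (rule B_integrable_bound[where f = "%y. B *R f y"])
  show "AE y in lebesgue. norm (et (x - y) *R f y) <= norm (B *R f y)"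
   using B by (auto intro!: mult_right_mono)
 qed (use f m in auto)
qed

lemma uniformly_continuous_compact_support:
 fixes f :: "'a::euclidean_space => 'b::real_normed_vector"
 assumes f: "continuous_on UNIV f" and R: "!!z. R < norm z ==> f z = 0"
 shows "uniformly_continuous_on UNIV f"
 unfolding uniformly_continuous_on_def
proof (intro allI impI)
 have "uniformly_continuous_on (cball 0 (R + 2)) f"
  by (intro compact_uniformly_continuous continuous_on_subset[OF f]) auto
 moreover fix e :: real assume "0 < e"
 ultimately obtain d where d: "0 < d"
  "!!y z. y : cball 0 (R+2) ==> z : cball 0 (R+2) ==> dist z y < d ==> dist (f z) (f y) < e"
  unfolding uniformly_continuous_on_def by metis
 have "dist (f z) (f y) < e" if "dist z y < min d 1" for y z
 proof (cases "norm y <= R + 1")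
  case True
  then have "norm z <= R + 2" using that norm_triangle_sub[of z y] by (simp add: dist_norm)
  then show ?thesis using True that by (intro d(2)) auto
 next
  case False
  then have "R < norm z" using that norm_triangle_sub[of y z] by (simp add: dist_norm norm_minus_commute)
  then show ?thesis using False R[of z] R[of y] \<open>0 < e\<close> by simp
 qed
 then show "EX d>0. ALL y:UNIV. ALL z:UNIV. dist z y < d --> dist (f z) (f y) < e"
  using d(1) by (intro exI[of _ "min d 1"]) auto
qed

text \<open>The partial derivatives are continuous with compact support, hence uniformly continuous,
  and the mean value theorem on the segment from a to a + h makes the first-order expansion uniform
  in a.\<close>

lemma uniform_derivative_bound:
 fixes et :: "'a::euclidean_space => real"
 assumes D: "!!x. (et has_derivative D x) (at x)" and Dc: "!!v. continuous_on UNIV (%x. D x v)"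
  and D0: "!!x v. e < norm x ==> D x v = 0" and eps: "0 < eps"
 obtains dl where "0 < dl" "!!a h. norm h < dl ==> \<bar>et (a + h) - et a - D a h\<bar> <= eps * norm h"
proof -
 have lin: "linear (D x)" for x using D by (rule has_derivative_linear)
 have expand: "D x h = (\<Sum>b\<in>Basis. (h \<bullet> b) * D x b)" for x h
 proof -
  have "D x h = D x (\<Sum>b\<in>Basis. (h \<bullet> b) *R b)" by (simp add: euclidean_representation)
  also have "... = (\<Sum>b\<in>Basis. (h \<bullet> b) * D x b)"
   by (simp add: linear_sum[OF lin] linear_scale[OF lin])
  finally show ?thesis .
 qed
 define eps' where "eps' = eps / DIM('a)"
 have eps': "0 < eps'" using eps by (simp add: eps'_def)
 have "EX dl>0. ALL x y. dist x y < dl --> \<bar>D x b - D y b\<bar> < eps'" for b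
  using uniformly_continuous_compact_support[OF Dc[of b] D0] eps'
  unfolding uniformly_continuous_on_def dist_real_def by (metis UNIV_I)
 then obtain dl where dl: "!!b. 0 < dl b" "!!b x y. dist x y < dl b ==> \<bar>D x b - D y b\<bar> < eps'" by metis
 define dlm where "dlm = Min (dl ` Basis)"
 have dlm: "0 < dlm" "!!b. b : Basis ==> dlm <= dl b"
  using dl(1) by (auto simp: dlm_def)
 show thesis
 proof (rule that[OF dlm(1)])
  fix a h :: 'a assume h: "norm h < dlm"
  have close: "\<bar>D (a + t *R h) h - D a h\<bar> <= eps * norm h" if t: "t : {0..1}" for t
  proof -
   have "D (a + t *R h) h - D a h = (\<Sum>b\<in>Basis. (h \<bullet> b) * (D (a + t *R h) b - D a b))"
    by (simp add: expand[of _ h] sum_subtractf right_diff_distrib)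
   also have "\<bar>...\<bar> <= (\<Sum>b\<in>(Basis :: 'a set). norm h * eps')"
   proof (rule order_trans[OF sum_abs sum_mono])
    fix b :: 'a assume b: "b : Basis"
    have "t * norm h <= norm h" using t by (auto intro: mult_left_le_one_le)
    then have "dist (a + t *R h) a < dl b" using t h dlm(2)[OF b] by (simp add: dist_norm)
    then have "\<bar>D (a + t *R h) b - D a b\<bar> <= eps'" using dl(2) less_imp_le by blast
    then show "\<bar>(h \<bullet> b) * (D (a + t *R h) b - D a b)\<bar> <= norm h * eps'"
     unfolding abs_mult using Basis_le_norm[OF b, of h] by (intro mult_mono) auto
   qed
   also have "... = eps * norm h" by (simp add: eps'_def)
   finally show ?thesis .
  qed
  define s where "s t = et (a + t *R h) - t * D a h" for t :: real
  have sd: "(s has_real_derivative (D (a + t *R h) h - D a h)) (at t)" for t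
  proof -
   have "((%t. et (a + t *R h)) has_derivative (%r. D (a + t *R h) (r *R h))) (at t)"
    by (rule has_derivative_compose[where g = et and f = "%t. a + t *R h", OF _ D]) (auto intro!: derivative_eq_intros)
   then have "((%t. et (a + t *R h)) has_real_derivative D (a + t *R h) h) (at t)"
    by (simp add: has_field_derivative_def linear_scale[OF lin] mult_commute_abs)
   then show ?thesis unfolding s_def by (auto intro!: derivative_eq_intros)
  qed
  obtain t where t: "0 < t" "t < 1" "s 1 - s 0 = (1 - 0) * (D (a + t *R h) h - D a h)"
   using MVT2[of 0 1 s "%t. D (a + t *R h) h - D a h"] sd by auto
  then show "\<bar>et (a + h) - et a - D a h\<bar> <= eps * norm h"
   using close[of t] by (simp add: s_def)
 qed
qed

lemma norm_integral_le:
 fixes f :: "'a => 'b::{banach, second_countable_topology}"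
 assumes "integrable M f" "integrable M g" "!!x. norm (f x) <= g x"
 shows "norm (\<integral>x. f x \<partial>M) <= (\<integral>x. g x \<partial>M)"
proof -
 have "norm (\<integral>x. f x \<partial>M) <= (\<integral>x. norm (f x) \<partial>M)" by (rule integral_norm_bound)
 also have "... <= (\<integral>x. g x \<partial>M)"
  using assms by (intro integral_mono integrable_norm) auto
 finally show ?thesis .
qed

text \<open>\<open>f\<close> is merely integrable, so the derivative passes under the integral by an
  expansion error of \<open>et\<close> that is uniform in the point.\<close>

lemma has_derivative_conv:
 fixes f :: "'a::euclidean_space => 'b::euclidean_space"
 assumes D: "!!x. (et has_derivative D x) (at x)" and Dc: "!!v. continuous_on UNIV (%x. D x v)"
  and et0: "!!x. e < norm x ==> et x = 0" and D0: "!!x v. e < norm x ==> D x v = 0"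
  and f: "integrable lebesgue f"
 shows "(conv et f has_derivative (%v. conv (%x. D x v) f x)) (at x)"
 unfolding has_derivative_at_alt
proof (intro conjI allI impI)
 have etc: "continuous_on UNIV et"
  using D by (auto simp: continuous_on_eq_continuous_at intro: has_derivative_continuous)
 have lin: "linear (D x)" for x using D by (rule has_derivative_linear)
 note intet = integrable_conv[OF etc et0 f]
 note intD = integrable_conv[OF Dc D0 f]
 show "bounded_linear (%v. conv (%x. D x v) f x)"
 proof (rule linear_conv_bounded_linear[THEN iffD1], rule linearI)
  show "conv (%x. D x (v + w)) f x = conv (%x. D x v) f x + conv (%x. D x w) f x" for v w
   unfolding conv_def by (simp add: linear_add[OF lin] scaleR_add_left intD)
  show "conv (%x. D x (r *R v)) f x = r *R conv (%x. D x v) f x" for r v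
   unfolding conv_def by (simp add: linear_scale[OF lin] flip: scaleR_scaleR)
 qed
 fix eps :: real assume eps: "0 < eps"
 define F where "F = (LINT y|lebesgue. norm (f y)) + 1"
 have F: "0 < F" unfolding F_def by (intro add_nonneg_pos B_integral_nonneg) auto
 have "0 < eps / F" using eps F by simp
 from uniform_derivative_bound[OF D Dc D0 this] obtain dl where dl: "0 < dl"
  "!!a h. norm h < dl ==> \<bar>et (a + h) - et a - D a h\<bar> <= eps / F * norm h" by blast
 show "EX d>0. ALL y. norm (y - x) < d --> norm (conv et f y - conv et f x - conv (%w. D w (y - x)) f x) <= eps * norm (y - x)"
 proof (intro exI[of _ dl] conjI allI impI dl(1))
  fix z assume z: "norm (z - x) < dl"
  have "conv et f z - conv et f x - conv (%w. D w (z - x)) f x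
    = (LINT y|lebesgue. (et (z - y) - et (x - y) - D (x - y) (z - x)) *R f y)"
   unfolding conv_def by (simp add: scaleR_diff_left intet intD)
  also have "norm ... <= (LINT y|lebesgue. eps / F * norm (z - x) * norm (f y))"
  proof (rule norm_integral_le)
   show "integrable lebesgue (%y. (et (z - y) - et (x - y) - D (x - y) (z - x)) *R f y)"
    by (simp add: scaleR_diff_left intet intD)
   show "integrable lebesgue (%y. eps / F * norm (z - x) * norm (f y))" using f by simp
   fix y
   have "\<bar>et (z - y) - et (x - y) - D (x - y) (z - x)\<bar> <= eps / F * norm (z - x)"
    using dl(2)[OF z, of "x - y"] by simp
   then show "norm ((et (z - y) - et (x - y) - D (x - y) (z - x)) *R f y) <= eps / F * norm (z - x) * norm (f y)"
    unfolding norm_scaleR by (intro mult_right_mono) auto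
  qed
  also have "... = eps / F * norm (z - x) * (F - 1)" by (simp add: F_def)
  also have "... <= eps / F * norm (z - x) * F" using eps F by (intro mult_left_mono) auto
  also have "... = eps * norm (z - x)" using F by simp
  finally show "norm (conv et f z - conv et f x - conv (%w. D w (z - x)) f x) <= eps * norm (z - x)" .
 qed
qed

lemma frechet_derivative_eq_0_outside:
 fixes et :: "'a::real_normed_vector => 'b::real_normed_vector"
 assumes "!!x. e < norm x ==> et x = 0" "e < norm x"
 shows "frechet_derivative et (at x) v = 0"
proof -
 have o: "open {x :: 'a. e < norm x}" by (intro open_Collect_less continuous_intros)
 have d: "((%_. 0) has_derivative (%_. 0)) (at x)" by simp
 have "(et has_derivative (%_. 0)) (at x)"
  by (rule has_derivative_transform_within_open[OF d o]) (use assms in auto)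
 from frechet_derivative_at[OF this] show ?thesis by (metis)
qed

lemma conv_smooth:
 fixes f :: "'a::euclidean_space => 'b::euclidean_space"
 assumes "!!j. Ck j et" "!!x. e < norm x ==> et x = 0" and f: "integrable lebesgue f"
 shows "(conv et f has_derivative (%v. conv (%x. frechet_derivative et (at x) v) f x)) (at x)"
  and "Ck k (conv et f)"
proof -
 have d: "(conv et f has_derivative (%v. conv (%x. frechet_derivative et (at x) v) f x)) (at x)"
  if "!!j. Ck j et" "!!x. e < norm x ==> et x = 0" for et x
 proof (rule has_derivative_conv[OF _ _ that(2) _ f])
  have "Ck (Suc 0) et" by (rule that)
  from Ck_SucD[OF this] show "(et has_derivative frechet_derivative et (at x)) (at x)"
   "continuous_on UNIV (%x. frechet_derivative et (at x) v)" for x v by simp_all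
  show "frechet_derivative et (at x) v = 0" if "e < norm x" for x v
   by (rule frechet_derivative_eq_0_outside[OF \<open>!!x. e < norm x ==> et x = 0\<close> that])
 qed
 show "(conv et f has_derivative (%v. conv (%x. frechet_derivative et (at x) v) f x)) (at x)"
  by (rule d[OF assms(1,2)])
 show "Ck k (conv et f)"
  using assms(1,2)
 proof (induction k arbitrary: et)
  case 0
  then show ?case
   using d[OF 0] by (auto simp: continuous_on_eq_continuous_at intro: has_derivative_continuous)
 next
  case (Suc k)
  show ?case
  proof (rule Ck_SucI[OF d[OF Suc.prems]])
   fix v
   show "Ck k (%x. conv (%x. frechet_derivative et (at x) v) f x)"
   proof (rule Suc.IH)
    show "Ck j (%x. frechet_derivative et (at x) v)" for j by (rule Ck_SucD(2)[OF Suc.prems(1)])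
    show "frechet_derivative et (at x) v = 0" if "e < norm x" for x
     by (rule frechet_derivative_eq_0_outside[OF Suc.prems(2) that])
   qed
  qed
 qed
qed

lemma distr_lborel_reflect: "distr lborel borel (%y. x - y) = (lborel :: 'a::euclidean_space measure)"
 using lborel_affine[of "-1" x] by (simp add: density_1)

lemma integrable_mollifier_shift:
 assumes "0 < e" shows "integrable lebesgue (%y. mollifier e (x - y :: 'a::euclidean_space))"
  and "(LINT y|lebesgue. mollifier e (x - y :: 'a)) = 1"
proof -
 have c: "continuous_on UNIV (mollifier e :: 'a => real)" using Ck_mollifier[OF assms, of 0] by simp
 have "continuous_on UNIV (%y. mollifier e (x - y :: 'a))"
  by (intro continuous_on_compose2[OF c] continuous_intros) auto
 then show "integrable lebesgue (%y. mollifier e (x - y :: 'a))"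
 proof (rule integrable_lebesgue_continuous_compact_support)
  fix y :: 'a assume "norm x + e < norm y"
  then have "e <= norm (x - y)" using norm_triangle_ineq2[of y x] by (simp add: norm_minus_commute)
  then show "mollifier e (x - y) = 0" by (rule mollifier_eq_0[OF assms])
 qed
 have cb: "mollifier e : borel_measurable (borel :: 'a measure)" by (rule cont_borel[OF c])
 have "(LINT y|lebesgue. mollifier e (x - y :: 'a)) = (LBINT y. mollifier e (x - y :: 'a))"
  by (intro integral_completion) (use cb in measurable)
 also have "... = (\<integral>y. mollifier e (y :: 'a) \<partial>distr lborel borel (%y. x - y))"
  by (rule integral_distr[symmetric]) (use cb in measurable)
 also have "... = (LINT y|lebesgue. mollifier e (y :: 'a))"
  unfolding distr_lborel_reflect by (rule integral_completion[symmetric]) (use cb in measurable)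
 finally show "(LINT y|lebesgue. mollifier e (x - y :: 'a)) = 1" using integral_mollifier[OF assms, where 'a = 'a] by simp
qed

lemma integrable_mollifier_scaleR:
 fixes f :: "'a::euclidean_space => 'b::euclidean_space"
 assumes "0 < e" "integrable lebesgue f"
 shows "integrable lebesgue (%y. mollifier e (x - y) *R f y)"
 by (rule integrable_conv[of "mollifier e" e]) (use Ck_mollifier[OF assms(1), of 0] assms in \<open>auto intro: mollifier_eq_0\<close>)

lemma conv_mollifier_diff:
 fixes f :: "'a::euclidean_space => 'b::euclidean_space"
 assumes e: "0 < e" and f: "integrable lebesgue f"
 shows "conv (mollifier e) f x - c = (LINT y|lebesgue. mollifier e (x - y) *R (f y - c))"
proof -
 have "(LINT y|lebesgue. mollifier e (x - y) *R c) = c"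
  using integrable_mollifier_shift[OF e, of x] by simp
 then show ?thesis
  unfolding conv_def scaleR_diff_right
  using integrable_mollifier_scaleR[OF e f] integrable_mollifier_shift(1)[OF e, of x] by simp
qed

lemma conv_mollifier_close:
 fixes f :: "'a::euclidean_space => 'b::euclidean_space"
 assumes e: "0 < e" and f: "integrable lebesgue f" and b: "!!y. dist x y < e ==> norm (f y - c) <= B"
 shows "norm (conv (mollifier e) f x - c) <= B"
proof -
 have "norm (conv (mollifier e) f x - c) <= (LINT y|lebesgue. mollifier e (x - y) * B)"
  unfolding conv_mollifier_diff[OF e f]
 proof (rule norm_integral_le)
  show "integrable lebesgue (%y. mollifier e (x - y) *R (f y - c))"
   unfolding scaleR_diff_right using integrable_mollifier_scaleR[OF e f] integrable_mollifier_shift(1)[OF e, of x] by simp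
  show "integrable lebesgue (%y. mollifier e (x - y) * B)"
   using integrable_mollifier_shift(1)[OF e, of x] by simp
  fix y
  show "norm (mollifier e (x - y) *R (f y - c)) <= mollifier e (x - y) * B"
   using b[of y] mollifier_nonneg[OF e, of "x - y"] mollifier_eq_0[OF e, of "x - y"]
   by (cases "dist x y < e") (auto simp: dist_norm mult_left_mono)
 qed
 also have "... = B" using integrable_mollifier_shift[OF e, of x] by simp
 finally show ?thesis .
qed

lemma conv_mollifier_const:
 fixes f :: "'a::euclidean_space => 'b::euclidean_space"
 assumes e: "0 < e" and f: "integrable lebesgue f" and b: "!!y. dist x y < e ==> f y = c"
 shows "conv (mollifier e) f x = c"
 using conv_mollifier_close[OF e f, of x c 0] b by simp

lemma Ck_conv_mollifier:
 fixes f :: "'a::euclidean_space => 'b::euclidean_space"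
 assumes e: "0 < e" and f: "integrable lebesgue f"
 shows "Ck k (conv (mollifier e) f)"
 by (rule conv_smooth(2)[of "mollifier e" e, OF Ck_mollifier[OF e] _ f]) (auto intro: mollifier_eq_0[OF e])

text \<open>Mollify at scale e the indicator of the closed 2 e-neighbourhood of \<open>K\<close>.
  The result is constant 1 within distance e and 0 beyond 3 e, where 3 e is a distance at which the
  neighbourhood still lies in \<open>W\<close>.\<close>

lemma smooth_cutoff:
 fixes K W :: "'a::euclidean_space set"
 assumes "compact K" "open W" "K <= W"
 obtains ps N where "!!k. Ck k ps" "!!x. 0 <= ps x" "!!x. ps x <= (1::real)" "open N" "K <= N"
  "!!x. x : N ==> ps x = 1" "compactly_supported_in W ps"
proof (cases "K = {}")
 case True
 then show thesis by (intro that[of "%_. 0" "{}"]) (auto simp: compactly_supported_in_def intro: Ck_const)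
next
 case False
 obtain d where d: "0 < d" "{x. infdist x K <= d} <= W"
  using compact_in_open_separated[OF False assms] by blast
 define e where "e = d / 3"
 have e: "0 < e" "d = 3 * e" using d by (auto simp: e_def)
 define S where "S = {x. infdist x K <= 2 * e}"
 have cS: "compact S" unfolding S_def using False assms(1) e by (intro compact_infdist_le) auto
 define f where "f = (indicator S :: 'a => real)"
 have f: "integrable lebesgue f"
  unfolding f_def using cS emeasure_compact_finite[OF cS]
  by (intro integrable_real_indicator) (auto simp: compact_imp_closed less_top)
 define ps where "ps = conv (mollifier e) f"
 have tri: "infdist y K <= infdist x K + dist x y" for x y
  using infdist_triangle[of y K x] by (simp add: dist_commute)
 show thesis
 proof (rule that)
  show "Ck k ps" for k unfolding ps_def by (rule Ck_conv_mollifier[OF e(1) f])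
  \<comment> \<open>An indicator is within 1/2 of 1/2, and averaging preserves this; both bounds on
    \<open>ps\<close> follow at once.\<close>
  have "norm (ps x - 1/2) <= 1/2" for x
   unfolding ps_def by (rule conv_mollifier_close[OF e(1) f]) (auto simp: f_def indicator_def)
  then have "\<bar>ps x - 1/2\<bar> <= 1/2" for x by simp
  then show "0 <= ps x" "ps x <= 1" for x by (smt (verit) field_sum_of_halves)+
  show "open {x. infdist x K < e}" by (intro open_Collect_less continuous_intros)
  show "K <= {x. infdist x K < e}" using e by auto
  show "ps x = 1" if "x : {x. infdist x K < e}" for x
   unfolding ps_def
  proof (rule conv_mollifier_const[OF e(1) f])
   fix y assume "dist x y < e"
   then have "infdist y K <= 2 * e" using tri[of y x] that by simp
   then show "f y = 1" by (simp add: f_def S_def)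
  qed
  have "{x. ps x ~= 0} <= {x. infdist x K <= d}"
  proof
   fix x assume x: "x : {x. ps x ~= 0}"
   show "x : {x. infdist x K <= d}"
   proof (rule ccontr)
    assume "~ ?thesis"
    then have far: "3 * e < infdist x K" using e by simp
    have "ps x = 0" unfolding ps_def
    proof (rule conv_mollifier_const[OF e(1) f])
     fix y assume "dist x y < e"
     then have "2 * e < infdist y K" using tri[of x y] far by (simp add: dist_commute)
     then show "f y = 0" by (simp add: f_def S_def)
    qed
    with x show False by simp
   qed
  qed
  moreover have cd: "compact {x. infdist x K <= d}" using False assms(1) d by (intro compact_infdist_le) auto
  ultimately have sub: "closure {x. ps x ~= 0} <= {x. infdist x K <= d}"
   by (intro closure_minimal compact_imp_closed)
  then have "compact (closure {x. ps x ~= 0})" using cd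
   by (meson bounded_subset closed_closure compact_eq_bounded_closed)
  then show "compactly_supported_in W ps"
   using sub d(2) unfolding compactly_supported_in_def by blast
 qed
qed

section \<open>Small pieces and the first variation\<close>

text \<open>In the plane a closed set that separates has a component that separates, and a single
  point does not. The disc is first mapped onto the whole plane, since \<open>K\<close> may reach
  across its boundary.\<close>

lemma connected_ball_diff_totally_disconnected:
 fixes K :: "(real^2) set"
 assumes K: "compact K" and td: "!!C. C : components K ==> EX a. C = {a}" and r: "0 < r"
 shows "connected (ball x r - K)"
proof -
 obtain h k where hk: "homeomorphism (ball x r) (UNIV :: (real^2) set) h k"
  using homeomorphic_ball_UNIV[OF r] unfolding homeomorphic_def by blast
 define S where "S = h ` (ball x r Int K)"
 have kh: "!!z. z : ball x r ==> k (h z) = z" and hk': "!!z. h (k z) = z"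
  and kb: "!!z. k z : ball x r" and hc: "continuous_on (ball x r) h" and kc: "continuous_on UNIV k"
  using hk by (auto simp: homeomorphism_def)
 have Seq: "S = k -` K"
 proof
  show "S <= k -` K" using kh by (auto simp: S_def)
  show "k -` K <= S" unfolding S_def using hk' kb by (auto intro!: image_eqI[of _ h "k _"])
 qed
 have clS: "closed S" unfolding Seq
  by (rule continuous_closed_vimage[OF compact_imp_closed[OF K]]) (use kc in \<open>simp add: continuous_on_eq_continuous_at\<close>)
 have "connected (- S)"
 proof (rule ccontr)
  assume "~ connected (- S)"
  then obtain C where C: "C : components S" "~ connected (- C)"
   using separation_by_component_closed[OF clS] by blast
  have conC: "connected C" and CS: "C <= S" and Cne: "C ~= {}"
   by (rule in_components_connected[OF C(1)], rule in_components_subset[OF C(1)], rule in_components_nonempty[OF C(1)])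
  have "connected (k ` C)" by (intro connected_continuous_image conC continuous_on_subset[OF kc]) auto
  moreover have "k ` C <= K" using CS Seq by auto
  ultimately obtain D where D: "D : components K" "k ` C <= D"
   using exists_component_superset[of "k ` C" K] Cne by blast
  then obtain a where "D = {a}" using td by blast
  then have "C = {h a}" using D(2) hk' Cne by force
  moreover have "connected (- {h a})" by (rule connected_punctured_universe) simp
  ultimately show False using C(2) by simp
 qed
 then have "connected (k ` (- S))" by (intro connected_continuous_image continuous_on_subset[OF kc]) auto
 moreover have "k ` (- S) = ball x r - K"
 proof
  show "k ` (- S) <= ball x r - K" using kb by (auto simp: Seq)
  show "ball x r - K <= k ` (- S)"
  proof
   fix z assume z: "z : ball x r - K"
   then have "k (h z) = z" using kh by blast
   then show "z : k ` (- S)" using z by (intro image_eqI[of _ k "h z"]) (auto simp: Seq)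
  qed
 qed
 ultimately show ?thesis by simp
qed

text \<open>Each piece contributes at least 1/4. The field \<open>(z - a j) / (2 d j)\<close> has
  divergence 1 / (2 d j) along every line, and the tangent points of \<open>K j\<close> have length
  at least the diameter of \<open>E j\<close>, which is at least d j / 2. The sum over the pieces
  remains admissible because the supports are disjoint.\<close>

lemma first_variation_pieces:
 fixes Ga :: "(real^2) set" and K E :: "'i => (real^2) set"
 assumes J: "finite J"
  and GW: "Ga Int W = G Int W" and W: "open W" and G: "G : sets borel" "hausdorff1_outer G < top"
  and K: "!!j. j : J ==> compact (K j)" "!!j. j : J ==> EX O'. open O' & O' <= W & Ga Int O' = K j"
  and disj: "!!i j. i : J ==> j : J ==> i ~= j ==> K i Int K j = {}"
  and E: "!!j. j : J ==> connected (E j)" "!!j. j : J ==> compact (E j)" "!!j. j : J ==> E j <= K j"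
   "!!j. j : J ==> 0 < diameter (E j)" "!!j. j : J ==> diameter (K j) <= 2 * diameter (E j)"
  and c: "!!X. C1_test_field W X ==> (!!x. norm (X x) <= 1) ==> \<bar>first_variation Ga X\<bar> <= c"
 shows "real (card J) / 4 <= c"
proof -
 define T where "T = {x. EX ta. approx_tangent Ga x ta}"
 define d where "d j = diameter (K j)" for j
 have bK: "bounded (K j)" if "j : J" for j using K(1)[OF that] by (rule compact_imp_bounded)
 have d0: "0 < d j" if j: "j : J" for j
  using diameter_subset[OF E(3)[OF j] bK[OF j]] E(4)[OF j] by (simp add: d_def)
 have Ene: "E j ~= {}" if "j : J" for j using E(4)[OF that] by auto
 define a where "a j = (SOME x. x : E j)" for j
 have aE: "a j : E j" if "j : J" for j unfolding a_def using Ene[OF that] by (simp add: some_in_eq)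
 have Ka: "dist (a j) z <= d j" if "j : J" "z : K j" for j z
  unfolding d_def using diameter_bounded_bound[OF bK[OF that(1)] _ that(2)] aE[OF that(1)] E(3)[OF that(1)] by auto
 have "EX O'. open O' & O' <= W & Ga Int O' = K j" if "j : J" for j by (rule K(2)[OF that])
 then obtain O' where O': "!!j. j : J ==> open (O' j)" "!!j. j : J ==> O' j <= W" "!!j. j : J ==> Ga Int O' j = K j"
  by metis
 have KG: "K j <= Ga" "K j <= O' j" "K j <= G Int W" if "j : J" for j using O'(2,3)[OF that] GW by auto
 have "EX dl>0. ALL x:K j. ALL y:(\<Union>i\<in>J - {j}. K i). dl <= dist x y" if j: "j : J" for j
 proof (rule separate_compact_closed)
  show "closed (\<Union>i\<in>J - {j}. K i)" using J K(1) by (intro closed_UN compact_imp_closed) auto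
  show "K j Int (\<Union>i\<in>J - {j}. K i) = {}" using disj j by blast
 qed (rule K(1)[OF j])
 then obtain dl where dl: "!!j. j : J ==> 0 < dl j"
  "!!i j x y. j : J ==> i : J ==> i ~= j ==> x : K j ==> y : K i ==> dl j <= dist x y"
  by (metis DiffI UN_I singletonD)
 \<comment> \<open>The three conditions make the \<open>V j\<close> disjoint, keep
   \<open>Ga Int V j\<close> inside \<open>K j\<close>, and bound \<open>(z - a j) / (2 d j)\<close>
   by 1.\<close>
 define V where "V j = {z. infdist z (K j) < dl j / 2} Int O' j Int ball (a j) (2 * d j)" for j
 have Vo: "open (V j)" if "j : J" for j
  unfolding V_def using O'(1)[OF that] by (intro open_Int open_Collect_less continuous_intros) auto
 have KV: "K j <= V j" if "j : J" for j
 proof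
  fix z assume z: "z : K j"
  then have "infdist z (K j) = 0" by simp
  then show "z : V j" using z dl(1)[OF that] KG(2)[OF that] Ka[OF that z] d0[OF that] by (auto simp: V_def)
 qed
 have Vdisj: "V i Int V j = {}" if ij: "i : J" "j : J" "i ~= j" for i j
 proof (rule ccontr)
  assume "V i Int V j ~= {}"
  then obtain z where z: "infdist z (K i) < dl i / 2" "infdist z (K j) < dl j / 2" by (auto simp: V_def)
  have ne: "K i ~= {}" "K j ~= {}" using ij Ene E(3) by blast+
  obtain x where x: "x : K i" "dist z x < dl i / 2" using z(1) ne(1) by (metis infdist_attains_inf compact_imp_closed K(1) ij(1))
  obtain y where y: "y : K j" "dist z y < dl j / 2" using z(2) ne(2) by (metis infdist_attains_inf compact_imp_closed K(1) ij(2))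
  have "dist x y < dl i / 2 + dl j / 2" using x y dist_triangle2[of x y z] by (simp add: dist_commute)
  moreover have "dl i <= dist x y" using dl(2)[of i j x y] ij x y by auto
  moreover have "dl j <= dist x y" using dl(2)[of j i y x] ij x y by (auto simp: dist_commute)
  ultimately show False by linarith
 qed
 have "EX ps N. (ALL k. Ck k ps) & (ALL x. 0 <= ps x & ps x <= (1::real)) & open N & K j <= N &
   (ALL x:N. ps x = 1) & compactly_supported_in (V j) ps" if "j : J" for j
  using smooth_cutoff[OF K(1)[OF that] Vo[OF that] KV[OF that]] by metis
 then obtain ps N where psN: "!!j. j : J ==> (ALL k. Ck k (ps j)) & (ALL x. 0 <= ps j x & ps j x <= (1::real)) & open (N j) &
   K j <= N j & (ALL x:N j. ps j x = 1) & compactly_supported_in (V j) (ps j)"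
  by metis
 then have ps: "!!j k. j : J ==> Ck k (ps j)" "!!j x. j : J ==> 0 <= ps j x & ps j x <= (1::real)"
   "!!j. j : J ==> open (N j)" "!!j. j : J ==> K j <= N j" "!!j x. j : J ==> x : N j ==> ps j x = 1"
   "!!j. j : J ==> compactly_supported_in (V j) (ps j)"
  by auto
 have psV: "ps j z = 0" if "j : J" "z ~: V j" for j z
  using ps(6)[OF that(1)] that(2) closure_subset[of "{x. ps j x ~= 0}"] by (auto simp: compactly_supported_in_def)
 define X where "X z = (\<Sum>j\<in>J. (ps j z * (1 / (2 * d j))) *R (z - a j))" for z
 have XV: "X z = (ps j z * (1 / (2 * d j))) *R (z - a j)" if j: "j : J" "z : V j" for j z
 proof -
  have "X z = (\<Sum>i\<in>J. if i = j then (ps j z * (1 / (2 * d j))) *R (z - a j) else 0)"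
   unfolding X_def
  proof (rule sum.cong)
   fix i assume i: "i : J"
   show "(ps i z * (1 / (2 * d i))) *R (z - a i) = (if i = j then (ps j z * (1 / (2 * d j))) *R (z - a j) else 0)"
    using psV[OF i, of z] Vdisj[OF i j(1)] j(2) by auto
  qed simp
  then show ?thesis using J j by simp
 qed
 have X0: "X z = 0" if "!!j. j : J ==> ps j z = 0" for z
  unfolding X_def using that by (intro sum.neutral) auto
 have Xle: "norm (X z) <= 1" for z
 proof (cases "EX j:J. z : V j")
  case True
  then obtain j where j: "j : J" "z : V j" by blast
  have "norm (X z) = ps j z * (norm (z - a j) / (2 * d j))"
   using XV[OF j] ps(2)[OF j(1), of z] d0[OF j(1)] by simp
  also have "... <= 1 * 1"
  proof (rule mult_mono)
   have "norm (z - a j) < 2 * d j" using j(2) by (simp add: V_def dist_norm norm_minus_commute)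
   then show "norm (z - a j) / (2 * d j) <= 1" using d0[OF j(1)] by simp
  qed (use ps(2)[OF j(1), of z] d0[OF j(1)] in auto)
  finally show ?thesis by simp
 next
  case False
  then have "X z = 0" using psV by (intro X0) blast
  then show ?thesis by simp
 qed
 define Sp where "Sp = (\<Union>j\<in>J. closure {x. ps j x ~= 0})"
 have cSp: "compact Sp" unfolding Sp_def using J ps(6) by (intro compact_UN) (auto simp: compactly_supported_in_def)
 have supX: "{z. X z ~= 0} <= Sp"
 proof
  fix z assume "z : {z. X z ~= 0}"
  then obtain j where "j : J" "ps j z ~= 0" using X0 by auto
  then show "z : Sp" unfolding Sp_def using closure_subset[of "{x. ps j x ~= 0}"] by blast
 qed
 have SpW: "Sp <= (\<Union>j\<in>J. V j)" unfolding Sp_def using ps(6) unfolding compactly_supported_in_def by blast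
 have tf: "C1_test_field W X"
  unfolding C1_test_field_def
 proof
  have lin: "Ck 1 (%z. z - a j)" for j
   using Ck_add[OF Ck_bounded_linear[OF bounded_linear_ident] Ck_const[of 1 "- a j"]] by simp
  show "Ck 1 X" unfolding X_def
   by (intro Ck_sum Ck_scaleR Ck_mult Ck_const ps(1) lin; assumption)
  have "closure {z. X z ~= 0} <= Sp" by (rule closure_minimal[OF supX compact_imp_closed[OF cSp]])
  moreover have "Sp <= W" using SpW O'(2) by (auto simp: V_def)
  ultimately show "compactly_supported_in W X" unfolding compactly_supported_in_def
   by (meson bounded_subset cSp closed_closure compact_eq_bounded_closed order_trans)
 qed
 \<comment> \<open>Near \<open>K j\<close> the field is exactly the radial one because
   \<open>ps j\<close> is 1 on the open set \<open>N j\<close>. A point of \<open>Ga\<close> outside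
   all pieces lies outside the support \<open>Sp\<close>, so the field vanishes near it.\<close>
 have td: "tangential_div Ga X z = (\<Sum>j\<in>J. indicator (T Int K j) z * (1 / (2 * d j)))" if z: "z : Ga" for z
 proof (cases "EX j:J. z : K j")
  case True
  then obtain j where j: "j : J" "z : K j" by blast
  have "(\<Sum>i\<in>J. indicator (T Int K i) z * (1 / (2 * d i))) = (\<Sum>i\<in>J. if i = j then indicator T z * (1 / (2 * d j)) else 0)"
  proof (rule sum.cong)
   fix i assume i: "i : J"
   show "indicator (T Int K i) z * (1 / (2 * d i)) = (if i = j then indicator T z * (1 / (2 * d j)) else 0)"
    using disj[OF i j(1)] j by (auto simp: indicator_def)
  qed simp
  then have rhs: "(\<Sum>i\<in>J. indicator (T Int K i) z * (1 / (2 * d i))) = indicator T z * (1 / (2 * d j))"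
   using J j by simp
  have o: "open (N j Int V j)" using ps(3) Vo j by auto
  have zN: "z : N j Int V j" using ps(4) KV j by blast
  have "((%y. (1 / (2 * d j)) *R (y - a j)) has_derivative (%v. (1 / (2 * d j)) *R v)) (at z)"
   by (auto intro!: derivative_eq_intros)
  then have "(X has_derivative (%v. (1 / (2 * d j)) *R v)) (at z)"
   by (rule has_derivative_transform_within_open[OF _ o zN]) (use XV[OF j(1)] ps(5)[OF j(1)] in auto)
  then have fd: "frechet_derivative X (at z) = (%v. (1 / (2 * d j)) *R v)"
   by (rule frechet_derivative_at[symmetric])
  show ?thesis
  proof (cases "z : T")
   case True
   define ta where "ta = (SOME ta. approx_tangent Ga z ta)"
   have "approx_tangent Ga z ta" unfolding ta_def using True by (auto simp: T_def intro: someI_ex)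
   then have "ta \<bullet> ta = 1" by (simp add: approx_tangent_def dot_square_norm)
   then have "tangential_div Ga X z = 1 / (2 * d j)"
    using True unfolding tangential_div_def fd ta_def[symmetric] by (simp add: T_def Let_def)
   then show ?thesis using rhs True by simp
  next
   case False
   then show ?thesis using rhs by (simp add: tangential_div_def T_def)
  qed
 next
  case False
  then have rhs: "(\<Sum>i\<in>J. indicator (T Int K i) z * (1 / (2 * d i))) = 0"
   by (intro sum.neutral) auto
  have "z ~: Sp"
  proof
   assume "z : Sp"
   then obtain j where "j : J" "z : V j" using SpW by blast
   then have "z : K j" using z O'(3) by (auto simp: V_def)
   then show False using False \<open>j : J\<close> by blast
  qed
  then have zo: "z : - Sp" by simp
  have o: "open (- Sp)" using cSp by (simp add: compact_imp_closed open_Compl)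
  have "((%y. 0 :: real^2) has_derivative (%v. 0)) (at z)" by simp
  then have "(X has_derivative (%v. 0)) (at z)"
   by (rule has_derivative_transform_within_open[OF _ o zo]) (use supX in auto)
  then have fd: "frechet_derivative X (at z) = (%v. 0)"
   by (rule frechet_derivative_at[symmetric])
  then show ?thesis unfolding rhs tangential_div_def by (simp add: Let_def)
 qed
 have Kb: "K j : sets borel" if "j : J" for j using K(1)[OF that] by (simp add: borel_compact)
 note tp = tangent_points[OF GW W G Kb KG(3), folded T_def]
 have TK: "T Int K j : sets hausdorff1" if "j : J" for j by (rule tp(1)[OF that that])
 have Tfin: "emeasure hausdorff1 (T Int K j) < top" if j: "j : J" for j
 proof -
  have "hausdorff1_outer (T Int K j) <= hausdorff1_outer G"
   using KG(3)[OF j] by (intro hausdorff1_outer_mono) auto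
  then show ?thesis using G(2) by (simp add: emeasure_hausdorff1[OF TK[OF j]] le_less_trans)
 qed
 have mlow: "d j / 2 <= measure hausdorff1 (T Int K j)" if j: "j : J" for j
 proof -
  obtain x y where xy: "x : E j" "y : E j" "dist x y = diameter (E j)"
   using diameter_compact_attained[OF E(2)[OF j] Ene[OF j]] by blast
  have "ennreal (diameter (E j)) <= hausdorff1_outer (T Int E j)"
   using tp(2)[OF j j E(1)[OF j] E(2)[OF j] E(3)[OF j] xy(1,2)] xy(3) by simp
  also have "... <= hausdorff1_outer (T Int K j)" using E(3)[OF j] by (intro hausdorff1_outer_mono) auto
  also have "... = ennreal (measure hausdorff1 (T Int K j))"
   using Tfin[OF j] by (simp add: emeasure_hausdorff1[OF TK[OF j], symmetric] emeasure_eq_ennreal_measure)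
  finally have "diameter (E j) <= measure hausdorff1 (T Int K j)" by (subst (asm) ennreal_le_iff) auto
  then show ?thesis using E(5)[OF j] by (simp add: d_def)
 qed
 have "first_variation Ga X = (\<integral>z. (\<Sum>j\<in>J. indicator (T Int K j) z * (1 / (2 * d j))) \<partial>hausdorff1)"
  unfolding first_variation_def set_lebesgue_integral_def
 proof (rule B_integral_cong)
  fix z
  show "indicator Ga z *R tangential_div Ga X z = (\<Sum>j\<in>J. indicator (T Int K j) z * (1 / (2 * d j)))"
  proof (cases "z : Ga")
   case True then show ?thesis using td by simp
  next
   case False
   then have "z ~: K j" if "j : J" for j using KG(1)[OF that] by blast
   then have "(\<Sum>j\<in>J. indicator (T Int K j) z * (1 / (2 * d j))) = 0" by (intro sum.neutral) auto
   then show ?thesis using False by simp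
  qed
 qed simp
 also have "... = (\<Sum>j\<in>J. \<integral>z. indicator (T Int K j) z * (1 / (2 * d j)) \<partial>hausdorff1)"
  using TK Tfin by (intro B_integral_sum integrable_mult_left integrable_real_indicator) auto
 also have "... = (\<Sum>j\<in>J. measure hausdorff1 (T Int K j) * (1 / (2 * d j)))"
  by (intro sum.cong) auto
 also have "... >= (\<Sum>j\<in>J. 1 / 4)"
 proof (rule sum_mono)
  fix j assume j: "j : J"
  have "d j / 2 * (1 / (2 * d j)) <= measure hausdorff1 (T Int K j) * (1 / (2 * d j))"
   using mlow[OF j] d0[OF j] by (intro mult_right_mono) auto
  then show "1 / 4 <= measure hausdorff1 (T Int K j) * (1 / (2 * d j))" using d0[OF j] by simp
 qed
 finally have "real (card J) / 4 <= first_variation Ga X" by simp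
 with c[OF tf Xle] show ?thesis by linarith
qed

section \<open>Components\<close>

lemma finite_components_Union:
 assumes "finite F" "!!C. C : F ==> connected C" "X = \<Union>F"
 shows "finite (components X)"
proof -
 have "components X <= (%C. connected_component_set X (SOME x. x : C)) ` F"
 proof
  fix D assume D: "D : components X"
  then obtain x where x: "x : X" "D = connected_component_set X x" by (auto simp: components_def)
  then obtain C where C: "C : F" "x : C" using assms(3) by blast
  define y where "y = (SOME y. y : C)"
  have y: "y : C" unfolding y_def using C(2) by (rule someI)
  have "connected_component X x y"
   unfolding connected_component_def using C y assms by (intro exI[of _ C]) auto
  then have "D = connected_component_set X y" using x(2) connected_component_eq by fastforce
  then show "D : (%C. connected_component_set X (SOME x. x : C)) ` F" using C(1) by (auto simp: y_def)
 qed
 then show ?thesis using assms(1) finite_surj by blast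
qed

lemma disjoint_compact_open_nbhds:
 fixes F :: "'a::euclidean_space set set"
 assumes "finite F" "!!E. E : F ==> compact E" "!!E D. E : F ==> D : F ==> E ~= D ==> E Int D = {}"
 obtains V where "!!E. E : F ==> open (V E)" "!!E. E : F ==> E <= V E"
  "!!E D. E : F ==> D : F ==> E ~= D ==> V E Int V D = {}"
proof -
 have "EX dl>0. ALL x:E. ALL y:\<Union>(F - {E}). dl <= dist x y" if E: "E : F" for E
 proof (rule separate_compact_closed)
  show "closed (\<Union>(F - {E}))" using assms(1,2) by (intro closed_Union) (auto intro: compact_imp_closed)
  show "E Int \<Union>(F - {E}) = {}" using assms(3) E by blast
 qed (rule assms(2)[OF E])
 then obtain dl where dl: "!!E. E : F ==> 0 < dl E"
  "!!E x y. E : F ==> x : E ==> y : \<Union>(F - {E}) ==> dl E <= dist x y"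
  by metis
 define V where "V E = (\<Union>x\<in>E. ball x (dl E / 2))" for E
 show thesis
 proof (rule that)
  show "open (V E)" if "E : F" for E unfolding V_def by auto
  show "E <= V E" if "E : F" for E unfolding V_def using dl(1)[OF that] by auto
  show "V E Int V D = {}" if ED: "E : F" "D : F" "E ~= D" for E D
  proof (rule ccontr)
   assume "V E Int V D ~= {}"
   then obtain z x y where z: "x : E" "dist x z < dl E / 2" "y : D" "dist y z < dl D / 2" by (auto simp: V_def)
   have "dist x y < dl E / 2 + dl D / 2" using z dist_triangle2[of x y z] by simp
   moreover have "dl E <= dist x y" using dl(2)[OF ED(1) z(1), of y] z ED by auto
   moreover have "dl D <= dist x y" using dl(2)[OF ED(2) z(3), of x] z ED by (auto simp: dist_commute)
   ultimately show False by linarith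
  qed
 qed
qed

lemma (in finite_measure) finite_disjoint_large:
 assumes "!!E. E : F ==> E : sets M" "!!E D. E : F ==> D : F ==> E ~= D ==> E Int D = {}"
  and "0 < m" "!!E. E : F ==> m <= measure M E"
 shows "finite F"
proof (rule ccontr)
 assume inf: "infinite F"
 obtain n :: nat where n: "measure M (space M) / m < real n" using reals_Archimedean2 by blast
 obtain G where G: "finite G" "card G = n" "G <= F" using infinite_arbitrarily_large[OF inf] by blast
 have "real n * m = (\<Sum>E\<in>G. m)" using G by simp
 also have "... <= (\<Sum>E\<in>G. measure M E)" using G assms(4) by (intro sum_mono) auto
 also have "... = measure M (\<Union>E\<in>G. E)"
 proof (intro finite_measure_finite_Union[symmetric] G(1))
  show "disjoint_family_on (%E. E) G"
   unfolding disjoint_family_on_def using G(3) assms(2) by blast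
 qed (use G(3) assms(1) in auto)
 also have "... <= measure M (space M)" by (rule bounded_measure)
 finally show False using n assms(3) by (simp add: field_simps)
qed

section \<open>From finite length, separation and bounded first variation to finitely many
  components\<close>

context
 fixes Om Ga :: "(real^2) set"
 assumes open_Om: "open Om" and closed_Ga: "closedin (top_of_set Om) Ga"
  and finite_length: "!!x r. cball x r <= Om ==> hausdorff1_outer (Ga Int cball x r) < top"
  and separates: "!!x r. x : Ga ==> 0 < r ==> ball x r <= Om ==> ~ connected (ball x r - Ga)"
  and lbfv: "locally_bounded_first_variation Om Ga"
begin

lemma closed_piece: "cball x r <= Om ==> closed (Ga Int cball x r)"
proof -
 assume s: "cball x r <= Om"
 obtain T where "closed T" "Ga = Om Int T" using closed_Ga by (auto simp: closedin_closed)
 then have "Ga Int cball x r = T Int cball x r" using s by auto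
 then show ?thesis using \<open>closed T\<close> by (simp add: closed_Int)
qed

text \<open>A compact relatively open \<open>K\<close> separates a small disc about each of its
  points, because \<open>Ga\<close> does; so \<open>K\<close> is not totally disconnected. A
  component \<open>E\<close> with more than one point is surrounded, by the theorem of Sura-Bura, by
  a clopen \<open>K'\<close> of comparable diameter.\<close>

lemma nondegenerate_piece:
 assumes K: "compact K" "K ~= {}" and O': "open O'" "O' <= Om" "Ga Int O' = K"
 obtains K' E O'' where "compact K'" "K' <= K" "open O''" "O'' <= O'" "Ga Int O'' = K'"
  "connected E" "compact E" "E <= K'" "0 < diameter E" "diameter K' <= 2 * diameter E"
proof -
 obtain x where x: "x : K" using K by blast
 then have "x : O'" using O' by auto
 then obtain r where r: "0 < r" "ball x r <= O'" using O'(1) open_contains_ball by blast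
 have "ball x r - Ga = ball x r - K" using r O'(3) by blast
 moreover have "~ connected (ball x r - Ga)" using separates[of x r] x O' r by blast
 ultimately have nc: "~ connected (ball x r - K)" by simp
 have "~ (ALL C:components K. EX a. C = {a})"
 proof
  assume "ALL C:components K. EX a. C = {a}"
  then have "connected (ball x r - K)"
   by (intro connected_ball_diff_totally_disconnected K(1) r(1)) blast
  with nc show False ..
 qed
 then obtain E where E: "E : components K" "!!a. E ~= {a}" by blast
 have Ec: "connected E" "E <= K" "E ~= {}" "compact E"
  by (rule in_components_connected[OF E(1)], rule in_components_subset[OF E(1)], rule in_components_nonempty[OF E(1)],
    rule compact_components[OF K(1) E(1)])
 obtain a where a: "a : E" using Ec by blast
 obtain b where b: "b : E" "b ~= a" using E(2)[of a] a by blast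
 have bE: "bounded E" using Ec(4) by (rule compact_imp_bounded)
 have d: "0 < diameter E" using diameter_bounded_bound[OF bE a b(1)] b(2) by (metis dist_pos_lt less_le_trans)
 \<comment> \<open>Two points of \<open>U\<close> are each within half a diameter of
   \<open>E\<close>, so they are at most two diameters of \<open>E\<close> apart.\<close>
 define U where "U = {z. infdist z E < diameter E / 2}"
 have "open U" unfolding U_def by (intro open_Collect_less continuous_intros)
 moreover have "E <= U" using d by (auto simp: U_def)
 ultimately obtain K' where K': "openin (top_of_set K) K'" "compact K'" "E <= K'" "K' <= U"
  using Sura_Bura_clopen_subset[OF closed_imp_locally_compact[OF compact_imp_closed[OF K(1)]] E(1) Ec(4)] by blast
 obtain V where V: "open V" "K' = K Int V" using K'(1) by (auto simp: openin_open)
 show thesis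
 proof (rule that[of K' "O' Int V" E])
  show "Ga Int (O' Int V) = K'" using V O' by auto
  show "diameter K' <= 2 * diameter E"
  proof (rule diameter_le)
   fix y z assume yz: "y : K'" "z : K'"
   then have "infdist y E < diameter E / 2" "infdist z E < diameter E / 2" using K'(4) by (auto simp: U_def)
   moreover obtain y' where "y' : E" "infdist y E = dist y y'"
    using infdist_attains_inf[OF compact_imp_closed[OF Ec(4)] Ec(3)] by blast
   moreover obtain z' where "z' : E" "infdist z E = dist z z'"
    using infdist_attains_inf[OF compact_imp_closed[OF Ec(4)] Ec(3)] by blast
   moreover have "dist y' z' <= diameter E" using diameter_bounded_bound[OF bE] calculation by blast
   moreover have "dist y z <= dist y y' + dist y' z' + dist z z'"
    using dist_triangle[of y z y'] dist_triangle2[of y' z z'] by (smt (verit) dist_commute)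
   ultimately show "norm (y - z) <= 2 * diameter E" unfolding dist_norm[symmetric] by linarith
  qed (use Ec K' in auto)
 qed (use V O' Ec K' d in auto)
qed

text \<open>A component of \<open>S\<close> that is not compact and meets the smaller disc must come
  close to the outer circle, which uses up a fixed amount of length. The compact components are
  finite in number altogether: each can be enclosed in a compact relatively open piece, and the
  first variation bounds the number of such disjoint pieces.\<close>

lemma finite_components_meeting:
 assumes s: "0 < s" "cball x s <= Om" and s': "s' < s"
 shows "finite {E : components (Ga Int ball x s). E Int cball x s' ~= {}}"
proof -
 define S where "S = Ga Int ball x s"
 define G where "G = Ga Int cball x s"
 have G: "closed G" "hausdorff1_outer G < top" using closed_piece[OF s(2)] finite_length[OF s(2)] by (auto simp: G_def)
 have Gb: "G : sets borel" using G by simp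
 interpret finite_measure "hm G" by (rule finite_measure_hm[OF Gb G(2)])
 have SG: "S = G Int ball x s" by (auto simp: S_def G_def)
 have lcS: "locally compact S"
  unfolding SG by (intro locally_compact_Int closed_imp_locally_compact open_imp_locally_compact G(1) open_ball)
 have comp: "connected E" "E <= S" "E ~= {}" "EX T. closed T & E = S Int T" if "E : components S" for E
  by (rule in_components_connected[OF that], rule in_components_subset[OF that], rule in_components_nonempty[OF that],
    use closedin_component[OF that] in \<open>auto simp: closedin_closed\<close>)
 have disj: "E Int D = {}" if "E : components S" "D : components S" "E ~= D" for E D
  using components_nonoverlap[OF that(1,2)] that(3) by auto
 have fin1: "finite {E : components S. ~ compact E & E Int cball x s' ~= {}}" (is "finite ?F")
 proof (rule finite_disjoint_large)
  show "0 < (s - s') / 2" using s' by simp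
  fix E assume E: "E : ?F"
  then obtain T where T: "closed T" "E = S Int T" using comp(4) by blast
  have Eeq: "E = G Int T Int ball x s" using T SG by auto
  then show "E : sets (hm G)" using G T by auto
  define t where "t = (s + s') / 2"
  have t: "s' < t" "t < s" using s' by (auto simp: t_def)
  obtain w where w: "w : E" "dist x w <= s'" using E by auto
  \<comment> \<open>Components are closed relative to the open disc; inside a smaller closed disc
    this would make \<open>E\<close> compact.\<close>
  have "~ E <= cball x t"
  proof
   assume "E <= cball x t"
   then have "E = G Int T Int cball x t" using Eeq t by auto
   moreover have "compact (G Int T Int cball x t)" using G T by (simp add: closed_Int_compact closed_Int)
   ultimately show False using E by simp
  qed
  then obtain z where z: "z : E" "t < dist x z" by (auto simp: subset_iff not_le)
  have "(s - s') / 2 <= dist w z"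
   using w z dist_triangle[of x z w] by (simp add: t_def field_simps)
  then have "ennreal ((s - s') / 2) <= ennreal (dist w z)" by (rule ennreal_leI)
  also have "... <= hausdorff1_outer E"
   using comp(1) E w z by (intro hausdorff1_outer_connected) auto
  also have "... = ennreal (measure (hm G) E)"
   using \<open>E : sets (hm G)\<close> Eeq by (subst emeasure_eq_measure[symmetric], subst emeasure_hm[OF Gb])
    (auto intro!: arg_cong[where f = hausdorff1_outer])
  finally show "(s - s') / 2 <= measure (hm G) E" by (subst (asm) ennreal_le_iff) auto
 next
  show "E Int D = {}" if "E : ?F" "D : ?F" "E ~= D" for E D using disj that by auto
 qed
 have "compactly_contained (ball x s) Om"
  using s by (simp add: compactly_contained_def closure_ball)
 then obtain c where c: "!!X. C1_test_field (ball x s) X ==> (!!z. norm (X z) <= 1) ==> \<bar>first_variation Ga X\<bar> <= c"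
  using lbfv unfolding locally_bounded_first_variation_def by (metis open_ball)
 have fin2: "finite {E : components S. compact E}"
 proof (rule ccontr)
  assume inf: "infinite {E : components S. compact E}"
  obtain n :: nat where n: "4 * c < real n" using reals_Archimedean2 by blast
  obtain J where J: "finite J" "card J = n" "J <= {E : components S. compact E}"
   using infinite_arbitrarily_large[OF inf] by blast
  obtain V where V: "!!E. E : J ==> open (V E)" "!!E. E : J ==> E <= V E"
   "!!E D. E : J ==> D : J ==> E ~= D ==> V E Int V D = {}"
  proof -
   have a: "compact E" if "E : J" for E using J(3) that by auto
   have b: "E Int D = {}" if "E : J" "D : J" "E ~= D" for E D
    by (rule disj) (use J(3) that in auto)
   show thesis using disjoint_compact_open_nbhds[OF J(1) a b] that by blast
  qed
  define good where "good E K F \<longleftrightarrow> compact K & K <= V E & (EX O'. open O' & O' <= ball x s & Ga Int O' = K) &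
   connected F & compact F & F <= K & 0 < diameter F & diameter K <= 2 * diameter F" for E K F
  have "EX K F. good E K F" if E: "E : J" for E
  proof -
   have EC: "E : components S" "compact E" using J(3) E by auto
   \<comment> \<open>A compact component of a locally compact set has arbitrarily small compact
     relatively open neighbourhoods.\<close>
   obtain K where K: "openin (top_of_set S) K" "compact K" "E <= K" "K <= V E"
    using Sura_Bura_clopen_subset[OF lcS EC V(1,2)[OF E]] by blast
   obtain W where W: "open W" "K = S Int W" using K(1) by (auto simp: openin_open)
   have "K ~= {}" using K(3) comp(3)[OF EC(1)] by auto
   moreover have "Ga Int (ball x s Int W) = K" using W by (auto simp: S_def)
   moreover have "ball x s Int W <= Om" using s ball_subset_cball by blast
   moreover have "open (ball x s Int W)" using W by auto
   ultimately obtain K' F O'' where "compact K'" "K' <= K" "open O''" "O'' <= ball x s Int W" "Ga Int O'' = K'"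
    "connected F" "compact F" "F <= K'" "0 < diameter F" "diameter K' <= 2 * diameter F"
    using nondegenerate_piece[OF K(2)] by metis
   then have "good E K' F" unfolding good_def using K(4) by blast
   then show ?thesis by blast
  qed
  then obtain K F where KF: "!!E. E : J ==> good E (K E) (F E)" by metis
  note KF' = KF[unfolded good_def]
  have k: "compact (K E)" "K E <= V E" "EX O'. open O' & O' <= ball x s & Ga Int O' = K E" if "E : J" for E
   using KF'[OF that] by simp_all
  have f: "connected (F E)" "compact (F E)" "F E <= K E" "0 < diameter (F E)" "diameter (K E) <= 2 * diameter (F E)"
   if "E : J" for E
   using KF'[OF that] by simp_all
  have "real (card J) / 4 <= c"
  proof (rule first_variation_pieces[where K = K and E = F, OF J(1) _ open_ball Gb G(2) k(1) k(3) _ f])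
   show "Ga Int ball x s = G Int ball x s" by (auto simp: G_def)
   show "K E Int K D = {}" if "E : J" "D : J" "E ~= D" for E D
    using V(3)[OF that] k(2)[OF that(1)] k(2)[OF that(2)] by blast
   show "\<bar>first_variation Ga X\<bar> <= c" if "C1_test_field (ball x s) X" "!!z. norm (X z) <= 1" for X
    by (rule c[OF that])
  qed
  then show False using n J(2) by simp
 qed
 have "{E : components S. E Int cball x s' ~= {}} <= ?F Un {E : components S. compact E}" by blast
 then show ?thesis using fin1 fin2 finite_subset unfolding S_def by blast
qed

text \<open>A plain disc can still have infinitely many components near its rim. They are cut out:
  the neighbourhood \<open>U\<close> is the disc without all components that stay away from the half
  disc, so that only those in \<open>near\<close> remain.\<close>

lemma locally_finitely_connected_of_curvature: "locally_finitely_connected Ga"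
 unfolding locally_finitely_connected_def
proof
 fix x assume x: "x : Ga"
 then have "x : Om" using closedin_subset[OF closed_Ga] by auto
 then obtain s where s: "0 < s" "cball x s <= Om" using open_Om open_contains_cball by blast
 define S where "S = Ga Int ball x s"
 have Gc: "closed (Ga Int cball x s)" by (rule closed_piece[OF s(2)])
 define near where "near = {E : components S. E Int cball x (s/2) ~= {}}"
 define rest where "rest = components S - near"
 define U where "U = ball x s - \<Union>rest"
 \<comment> \<open>Infinitely many closed pieces may be removed, but near each point only finitely
   many of them matter, by \<open>finite_components_meeting\<close> for a radius t strictly between
   the distance of the point and s.\<close>
 have "open U"
  unfolding open_contains_ball
 proof
  fix z assume z: "z : U"
  define t where "t = (max (dist x z) (s/2) + s) / 2"
  have t: "dist x z < t" "t < s" using z s(1) by (auto simp: t_def U_def)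
  define Q where "Q = {E : rest. E Int cball x t ~= {}}"
  have Qfin: "finite Q"
   using finite_components_meeting[OF s t(2)] by (rule finite_subset[rotated]) (auto simp: Q_def rest_def S_def)
  have "EX T. closed T & ball x t Int E = ball x t Int T & E <= T" if "E : Q" for E
  proof -
   have "closedin (top_of_set S) E" using that by (intro closedin_component) (auto simp: Q_def rest_def)
   then obtain T where T: "closed T" "E = S Int T" by (auto simp: closedin_closed)
   have "ball x t <= ball x s" using t by auto
   then have "ball x t Int E = ball x t Int ((Ga Int cball x s) Int T)" using T(2) by (auto simp: S_def)
   moreover have "E <= (Ga Int cball x s) Int T" using T(2) by (auto simp: S_def)
   ultimately show ?thesis using closed_Int[OF Gc T(1)] by blast
  qed
  then obtain T where T: "!!E. E : Q ==> closed (T E)" "!!E. E : Q ==> ball x t Int E = ball x t Int T E" by metis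
  have eq: "ball x t - \<Union>rest = ball x t - (\<Union>E\<in>Q. T E)"
  proof -
   have "ball x t Int \<Union>rest = (\<Union>E\<in>Q. ball x t Int E)"
   proof
    show "ball x t Int \<Union>rest\<le>(\<Union>E\<in>Q. ball x t Int E)"
    proof
     fix y assume "y : ball x t Int \<Union>rest"
     then obtain E where E: "E : rest" "y : E" "y : ball x t" by blast
     then have "y : E Int cball x t" by auto
     then have "E : Q" using E(1) unfolding Q_def by blast
     then show "y : (\<Union>E\<in>Q. ball x t Int E)" using E by blast
    qed
   qed (auto simp: Q_def)
   also have "... = (\<Union>E\<in>Q. ball x t Int T E)" using T(2) by auto
   finally show ?thesis by blast
  qed
  have "open (ball x t - (\<Union>E\<in>Q. T E))" using Qfin T(1) by (intro open_Diff closed_UN) auto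
  moreover have "z : ball x t - (\<Union>E\<in>Q. T E)" using z t eq by (auto simp: U_def)
  ultimately obtain e where "0 < e" "ball z e <= ball x t - (\<Union>E\<in>Q. T E)" using openE by blast
  moreover have "ball x t - \<Union>rest\<le>U" using t by (auto simp: U_def)
  ultimately show "EX e>0. ball z e <= U" using eq by blast
 qed
 moreover have "x : U"
 proof -
  have "x ~: \<Union>rest"
  proof
   assume "x : \<Union>rest"
   then obtain E where "E : components S" "E ~: near" "x : E" by (auto simp: rest_def)
   then show False using s(1) by (auto simp: near_def)
  qed
  then show ?thesis using s(1) by (simp add: U_def)
 qed
 moreover have "finite (components (Ga Int U))"
 proof (rule finite_components_Union)
  show "finite near" unfolding near_def S_def by (rule finite_components_meeting[OF s]) (use s in simp)
  show "connected C" if "C : near" for C using that in_components_connected by (auto simp: near_def)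
  have "S = \<Union>(components S)" by (rule Union_components[symmetric])
  moreover have "\<Union>near Int \<Union>rest = {}"
  proof -
   have "E Int D = {}" if "E : near" "D : rest" for E D
    using that components_nonoverlap[of E S D] by (auto simp: near_def rest_def)
   then show ?thesis by blast
  qed
  moreover have "components S = near Un rest" by (auto simp: near_def rest_def)
  ultimately have "S - \<Union>rest = \<Union>near" by blast
  then show "Ga Int U = \<Union>near" by (auto simp: S_def U_def)
 qed
 ultimately show "EX U. open U & x : U & finite (components (Ga Int U))" by blast
qed

end

text \<open>Without the free boundary a ball splits into two open sets, the positivity set and the
  exterior of its closure. If the remainder were connected, it would be contained in the positivity
  set, so zeros of \<open>u\<close> in the half ball would lie on the free boundary. That is a null
  set by finite length, which contradicts the density of \<open>{u = 0}\<close>.\<close>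

lemma free_boundary_separates:
 fixes u :: "real^2 => real"
 assumes Om: "open Om" and u: "continuous_on Om u" "!!x. x : Om ==> 0 <= u x"
  and fin: "!!x r. cball x r <= Om ==> hausdorff1_outer (free_boundary Om u Int cball x r) < top"
  and theta: "0 < th"
  and dens: "!!x r. [|x : free_boundary Om u; 0 < r; ball x r <= Om|] ==>
   measure lebesgue ({y : Om. u y = 0} Int ball x r) / measure lebesgue (ball x r) >= th"
  and x: "x : free_boundary Om u" and r: "0 < r" "ball x r <= Om"
 shows "~ connected (ball x r - free_boundary Om u)"
proof
 define A where "A = positivity_set Om u"
 define Ga where "Ga = free_boundary Om u"
 assume con: "connected (ball x r - free_boundary Om u)"
 have AOm: "A <= Om" by (auto simp: A_def positivity_set_def)
 have "A = Om Int u -` {0<..}" by (auto simp: A_def positivity_set_def)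
 then have oA: "open A" using continuous_open_preimage[OF u(1) Om, of "{0<..}"] by simp
 have Ga: "Ga = Om Int frontier A" by (simp add: Ga_def free_boundary_def A_def)
 have disj: "A Int Ga = {}" using oA by (auto simp: Ga frontier_def interior_open)
 have "ball x r - A - Ga = ball x r Int (- closure A)"
  using r oA closure_subset[of A] by (auto simp: Ga frontier_def interior_open)
 then have oc: "open (ball x r - A - Ga)" by auto
 have "x : closure A" using x by (auto simp: free_boundary_def frontier_def A_def)
 then have meets: "A Int ball x r ~= {}"
  using r(1) open_Int_closure_eq_empty[of "ball x r" A] by (auto simp: disjoint_iff)
 have "ball x r - A - Ga = {}"
 proof (rule ccontr)
  assume ne: "ball x r - A - Ga ~= {}"
  have oi: "open (A Int ball x r)" using oA by auto
  have "(A Int ball x r) Int (ball x r - Ga) ~= {}" using meets disj by blast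
  then show False
   using connectedD[OF con[folded Ga_def] oi oc] ne by blast
 qed
 then have zero: "{y : Om. u y = 0} Int ball x (r/2) <= Ga Int cball x (r/2)"
  using r(1) by (force simp: A_def positivity_set_def)
 have "cball x (r/2) <= Om" using r by (intro order_trans[OF _ r(2)]) auto
 then have "negligible (Ga Int cball x (r/2))" unfolding Ga_def by (intro negligible_hausdorff1_finite fin)
 then have "negligible ({y : Om. u y = 0} Int ball x (r/2))" using zero by (rule negligible_subset)
 then have "measure lebesgue ({y : Om. u y = 0} Int ball x (r/2)) = 0" by (simp add: negligible_imp_measure0)
 moreover have "ball x (r/2) <= Om" using r by (intro order_trans[OF _ r(2)]) auto
 ultimately show False using dens[OF x, of "r/2"] r(1) theta by simp
qed

section \<open>Approximation in Lebesgue and Sobolev spaces\<close>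

lemma lebesgue_measurable_continuous_limit:
 fixes f :: "'a::euclidean_space => 'b::euclidean_space"
 assumes "f : borel_measurable lebesgue"
 obtains g where "!!n. continuous_on UNIV (g n)" "AE x in lebesgue. (%n. g n x) ----> f x"
proof -
 have "f measurable_on UNIV" by (rule lebesgue_measurable_imp_measurable_on[OF assms]) simp
 then obtain N g where N: "negligible N" "!!n. continuous_on UNIV (g n)" "!!x. x ~: N ==> (%n. g n x) ----> f x"
  unfolding measurable_on_def by auto
 have "AE x in lebesgue. (%n. g n x) ----> f x"
  by (rule AE_I'[of N]) (use N in \<open>auto simp: negligible_iff_null_sets\<close>)
 with N(2) show thesis by (rule that)
qed

text \<open>Weak gradients are only Lebesgue measurable, while the arguments with Fubini's theorem
  and translations need Borel functions.\<close>

lemma lebesgue_measurable_borel_representative: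
 fixes f :: "'a::euclidean_space => 'b::euclidean_space"
 assumes "f : borel_measurable lebesgue"
 obtains f' where "f' : borel_measurable borel" "AE x in lebesgue. f' x = f x"
proof -
 obtain g where g: "!!n. continuous_on UNIV (g n)" "AE x in lebesgue. (%n. g n x) ----> f x"
  using lebesgue_measurable_continuous_limit[OF assms] by blast
 show thesis
 proof (rule that)
  show "(%x. lim (%n. g n x)) : borel_measurable borel"
   by (intro borel_measurable_lim_metric cont_borel g)
  show "AE x in lebesgue. lim (%n. g n x) = f x" using g(2) by eventually_elim (rule limI)
 qed
qed

text \<open>The p-th power of the L^p norm. No root is taken, so the triangle inequality holds with
  the factor \<open>2 powr p\<close>, which is harmless for limits.\<close>

definition Lpow :: "real => ('a::euclidean_space => 'b::real_normed_vector) => ennreal" where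
 "Lpow p f = (NN x. ennreal (norm (f x) powr p))"

lemma powr_add_le:
 fixes a b p :: real
 assumes "0 <= a" "0 <= b" "0 <= p"
 shows "(a + b) powr p <= 2 powr p * (a powr p + b powr p)"
proof -
 have "(a + b) powr p <= (2 * max a b) powr p" using assms by (intro powr_mono2) auto
 also have "... = 2 powr p * (max a b) powr p" by (simp add: powr_mult)
 also have "(max a b) powr p <= a powr p + b powr p" by (auto simp: max_def)
 finally show ?thesis by simp
qed

lemma Lpow_mono: "(!!x. norm (f x) <= norm (g x)) ==> 0 <= p ==> Lpow p f <= Lpow p g"
 unfolding Lpow_def by (intro nn_integral_mono ennreal_leI powr_mono2) auto

lemma Lpow_triangle:
 assumes f: "f : borel_measurable borel" and g: "g : borel_measurable borel" and p: "0 <= p"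
  and h: "!!x. norm (h x) <= norm (f x) + norm (g x)"
 shows "Lpow p h <= ennreal (2 powr p) * (Lpow p f + Lpow p g)"
proof -
 have "Lpow p h <= (NN x. ennreal (2 powr p) * (ennreal (norm (f x) powr p) + ennreal (norm (g x) powr p)))"
  unfolding Lpow_def
 proof (rule nn_integral_mono)
  fix x
  have "norm (h x) powr p <= (norm (f x) + norm (g x)) powr p" using h p by (intro powr_mono2) auto
  also have "... <= 2 powr p * (norm (f x) powr p + norm (g x) powr p)" using p by (intro powr_add_le) auto
  finally have "ennreal (norm (h x) powr p) <= ennreal (2 powr p * (norm (f x) powr p + norm (g x) powr p))" by (rule ennreal_leI)
  then show "ennreal (norm (h x) powr p) <= ennreal (2 powr p) * (ennreal (norm (f x) powr p) + ennreal (norm (g x) powr p))"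
   by (simp add: ennreal_mult)
 qed
 also have "... = ennreal (2 powr p) * (Lpow p f + Lpow p g)"
  unfolding Lpow_def using f g by (simp add: nn_integral_cmult nn_integral_add)
 finally show ?thesis .
qed

lemma Lpow_dominated_convergence:
 fixes h :: "nat => 'a::euclidean_space => 'b::{real_normed_vector, second_countable_topology}"
 assumes h: "!!n. h n : borel_measurable borel" and w: "w : borel_measurable borel" "(NN x. w x) < \<infinity>"
  and le: "!!n x. ennreal (norm (h n x) powr p) <= w x" and lim: "AE x in lborel. (%n. h n x) ----> 0"
  and p: "0 < p"
 shows "(%n. Lpow p (h n)) ----> 0"
proof -
 have "(%n. \<integral>\<^sup>+x. ennreal (norm (h n x) powr p) \<partial>lborel) ----> (\<integral>\<^sup>+x. 0 \<partial>(lborel :: 'a measure))"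
 proof (rule nn_integral_dominated_convergence[where w = w])
  show "(%x. ennreal (norm (h n x) powr p)) : borel_measurable lborel" for n using h by measurable
  show "AE x in lborel. (%n. ennreal (norm (h n x) powr p)) ----> 0"
   using lim
  proof eventually_elim
   case (elim x)
   have "(%n. norm (h n x)) ----> 0" using elim by (rule tendsto_norm_zero)
   then have "(%n. norm (h n x) powr p) ----> 0 powr p"
    using p by (intro tendsto_powr2 tendsto_const) auto
   then show ?case using tendsto_ennrealI by fastforce
  qed
 qed (use w le in auto)
 then show ?thesis by (simp add: Lpow_def)
qed

text \<open>The radial retraction onto the ball of radius \<open>Suc k\<close>; the maximum makes it
  continuous without a case distinction.\<close>

definition trunc :: "nat => 'b::real_normed_vector => 'b" where
 "trunc k v = (real (Suc k) / max (real (Suc k)) (norm v)) *R v"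

lemma norm_trunc: "norm (trunc k v) <= norm v" "norm (trunc k v) <= real (Suc k)"
proof -
 define a where "a = real (Suc k)"
 have a: "0 < a" by (simp add: a_def)
 have n: "norm (trunc k v) = a / max a (norm v) * norm v" using a by (simp add: trunc_def a_def)
 show "norm (trunc k v) <= norm v"
 proof (cases "norm v <= a")
  case True
  then have "max a (norm v) = a" by simp
  then show ?thesis unfolding n using a by simp
 next
  case False
  then have "max a (norm v) = norm v" "norm v ~= 0" using a by auto
  then show ?thesis unfolding n using False by simp
 qed
 show "norm (trunc k v) <= real (Suc k)"
 proof (cases "norm v <= a")
  case True
  then have "max a (norm v) = a" by simp
  then show ?thesis unfolding n a_def[symmetric] using a True by simp
 next
  case False
  then have "max a (norm v) = norm v" "norm v ~= 0" using a by auto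
  then show ?thesis unfolding n a_def[symmetric] by simp
 qed
qed

lemma trunc_eq: "norm v <= real (Suc k) ==> trunc k v = v" by (simp add: trunc_def max_def)

lemma trunc_0 [simp]: "trunc k 0 = 0" by (simp add: trunc_def)

lemma continuous_trunc: "continuous_on UNIV (trunc k)"
 unfolding trunc_def by (intro continuous_intros) (auto simp: max_def)

lemma Lpow_cball_bound:
 fixes h :: "'a::euclidean_space => 'b::real_normed_vector"
 assumes "!!x. norm (h x) <= B" "!!x. S < norm x ==> h x = 0" "0 <= p" "0 <= B"
 shows "Lpow p h <= ennreal (B powr p) * emeasure lborel (cball (0 :: 'a) S)"
proof -
 have "Lpow p h <= (NN x. ennreal (B powr p) * indicator (cball (0 :: 'a) S) x)"
  unfolding Lpow_def
 proof (rule nn_integral_mono)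
  fix x
  show "ennreal (norm (h x) powr p) <= ennreal (B powr p) * indicator (cball (0 :: 'a) S) x"
   using assms(1)[of x] assms(2)[of x] assms(3) by (cases "norm x <= S") (auto intro!: ennreal_leI powr_mono2)
 qed
 also have "... = ennreal (B powr p) * emeasure lborel (cball (0 :: 'a) S)"
  by (rule nn_integral_cmult_indicator) simp
 finally show ?thesis .
qed

text \<open>First truncate \<open>f\<close>. Then take continuous functions that converge to
  \<open>f\<close> almost everywhere, truncate them at the same height and cut them off outside the
  support; bounded functions on a bounded set converge by domination.\<close>

lemma Lpow_dense:
 fixes f :: "'a::euclidean_space => 'b::euclidean_space"
 assumes f: "f : borel_measurable borel" "Lpow p f < \<infinity>" "!!x. R < norm x ==> f x = 0"
  and p: "1 <= p" and eps: "0 < (eps :: real)"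
 obtains c where "continuous_on UNIV c" "!!x. R + 1 < norm x ==> c x = 0" "Lpow p (%x. f x - c x) < ennreal eps"
proof -
 \<comment> \<open>Two errors below dl, multiplied by the triangle constant \<open>M\<close>, give
   exactly eps.\<close>
 define dl where "dl = ennreal (eps / (2 * 2 powr p))"
 define M where "M = ennreal (2 powr p)"
 have M: "0 < M" "M < \<infinity>" by (auto simp: M_def)
 have "(%k. Lpow p (%x. f x - trunc k (f x))) ----> 0"
 proof (rule Lpow_dominated_convergence[where w = "%x. M * ennreal (norm (f x) powr p)"])
  show "(%x. f x - trunc k (f x)) : borel_measurable borel" for k
   using f(1) cont_borel[OF continuous_trunc] by measurable
  show "(NN x. M * ennreal (norm (f x) powr p)) < \<infinity>"
   using f M by (simp add: nn_integral_cmult Lpow_def ennreal_mult_less_top)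
  show "ennreal (norm (f x - trunc k (f x)) powr p) <= M * ennreal (norm (f x) powr p)" for k x
  proof -
   have "norm (f x - trunc k (f x)) <= 2 * norm (f x)"
    using norm_triangle_ineq4[of "f x" "trunc k (f x)"] norm_trunc(1)[of k "f x"] by linarith
   then have "norm (f x - trunc k (f x)) powr p <= (2 * norm (f x)) powr p" using p by (intro powr_mono2) auto
   also have "... = 2 powr p * norm (f x) powr p" by (simp add: powr_mult)
   finally show ?thesis unfolding M_def by (subst ennreal_mult[symmetric]) (auto intro: ennreal_leI)
  qed
  have "(%k. f x - trunc k (f x)) ----> 0" for x
  proof (rule tendsto_eventually)
   obtain n where "norm (f x) <= real n" using real_arch_simple by blast
   then have "f x - trunc k (f x) = 0" if "k >= n" for k using that by (simp add: trunc_eq)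
   then show "\<forall>\<^sub>F k in sequentially. f x - trunc k (f x) = 0" unfolding eventually_sequentially by blast
  qed
  then show "AE x in lborel. (%k. f x - trunc k (f x)) ----> 0" by simp
 qed (use f p in auto)
 moreover have e2: "0 < dl" using eps by (simp add: dl_def)
 ultimately have "\<forall>\<^sub>F k in sequentially. Lpow p (%x. f x - trunc k (f x)) < dl" by (rule order_tendstoD)
 then obtain k where k: "Lpow p (%x. f x - trunc k (f x)) < dl" by (auto simp: eventually_sequentially)
 have "f : borel_measurable lebesgue" using f(1) by (intro measurable_completion) simp
 then obtain g where g: "!!n. continuous_on UNIV (g n)" "AE x in lebesgue. (%n. g n x) ----> f x"
  using lebesgue_measurable_continuous_limit by blast
 define ct where "ct x = max 0 (min 1 (R + 1 - norm x))" for x :: 'a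
 define h where "h n x = ct x *R trunc k (g n x)" for n x
 have ct: "0 <= ct x" "ct x <= 1" "R + 1 < norm x ==> ct x = 0" "norm x <= R ==> ct x = 1" for x
  by (auto simp: ct_def)
 have hc: "continuous_on UNIV (h n)" for n
  unfolding h_def ct_def by (intro continuous_intros continuous_on_compose2[OF continuous_trunc g(1)]) auto
 have h0: "h n x = 0" if "R + 1 < norm x" for n x using ct(3)[OF that] by (simp add: h_def)
 have hk: "norm (h n x) <= real (Suc k)" for n x
 proof -
  have "norm (h n x) = ct x * norm (trunc k (g n x))" using ct by (simp add: h_def)
  also have "... <= 1 * real (Suc k)" using ct norm_trunc(2) by (intro mult_mono) auto
  finally show ?thesis by simp
 qed
 have tb: "(%x. trunc k (f x)) : borel_measurable borel"
  using f(1) cont_borel[OF continuous_trunc] by measurable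
 have "(%n. Lpow p (%x. trunc k (f x) - h n x)) ----> 0"
 proof (rule Lpow_dominated_convergence[where w = "%x. ennreal ((2 * real (Suc k)) powr p) * indicator (cball (0 :: 'a) (R + 1)) x"])
  show "(%x. trunc k (f x) - h n x) : borel_measurable borel" for n
   using tb cont_borel[OF hc] by measurable
  show "(NN x. ennreal ((2 * real (Suc k)) powr p) * indicator (cball (0 :: 'a) (R + 1)) x) < \<infinity>"
   using emeasure_compact_finite[of "cball (0::'a) (R+1)"]
   by (subst nn_integral_cmult_indicator) (simp_all add: ennreal_mult_less_top)
  show "ennreal (norm (trunc k (f x) - h n x) powr p) <= ennreal ((2 * real (Suc k)) powr p) * indicator (cball (0 :: 'a) (R + 1)) x" for n x
  proof (cases "norm x <= R + 1")
   case True
   have "norm (trunc k (f x) - h n x) <= 2 * real (Suc k)"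
    using norm_triangle_ineq4[of "trunc k (f x)" "h n x"] norm_trunc(2)[where k = k and v = "f x"] hk[of n x]
    unfolding mult_2 by (meson add_mono order_trans)
   then have "norm (trunc k (f x) - h n x) powr p <= (2 * real (Suc k)) powr p" using p by (intro powr_mono2) auto
   then show ?thesis using True by (auto intro: ennreal_leI)
  next
   case False
   then show ?thesis using h0[of x n] f(3)[of x] by simp
  qed
  have "AE x in lborel. (%n. g n x) ----> f x" using g(2) by (simp add: AE_completion_iff)
  then show "AE x in lborel. (%n. trunc k (f x) - h n x) ----> 0"
  proof eventually_elim
   case (elim x)
   have "(%n. trunc k (g n x)) ----> trunc k (f x)"
    by (rule continuous_on_tendsto_compose[OF continuous_trunc elim]) auto
   then have "(%n. trunc k (f x) - h n x) ----> trunc k (f x) - ct x *R trunc k (f x)"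
    unfolding h_def by (intro tendsto_intros)
   moreover have "trunc k (f x) - ct x *R trunc k (f x) = 0"
    using ct(4)[of x] f(3)[of x] by (cases "norm x <= R") auto
   ultimately show ?case by simp
  qed
  show "(%x. ennreal ((2 * real (Suc k)) powr p) * indicator (cball (0 :: 'a) (R + 1)) x) : borel_measurable borel"
   by (intro borel_measurable_times_ennreal borel_measurable_const borel_measurable_indicator borel_closed closed_cball)
  show "0 < p" using p by linarith
 qed
 then have "\<forall>\<^sub>F n in sequentially. Lpow p (%x. trunc k (f x) - h n x) < dl" using e2 by (rule order_tendstoD)
 then obtain n where n: "Lpow p (%x. trunc k (f x) - h n x) < dl" by (auto simp: eventually_sequentially)
 show thesis
 proof (rule that[OF hc[of n] h0])
  have "Lpow p (%x. f x - h n x) <= M * (Lpow p (%x. f x - trunc k (f x)) + Lpow p (%x. trunc k (f x) - h n x))"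
   unfolding M_def
  proof (rule Lpow_triangle)
   show "(%x. f x - trunc k (f x)) : borel_measurable borel" using f(1) tb by measurable
   show "(%x. trunc k (f x) - h n x) : borel_measurable borel"
    using tb cont_borel[OF hc] by measurable
   show "norm (f x - h n x) <= norm (f x - trunc k (f x)) + norm (trunc k (f x) - h n x)" for x
    using norm_triangle_ineq[of "f x - trunc k (f x)" "trunc k (f x) - h n x"] by simp
  qed (use p in auto)
  also have "... < M * (dl + dl)"
   using k n M by (intro ennreal_mult_strict_left_mono add_strict_mono) auto
  also have "... = ennreal eps"
   using eps unfolding M_def dl_def by (simp flip: ennreal_plus ennreal_mult)
  finally show "Lpow p (%x. f x - h n x) < ennreal eps" .
 qed
qed

text \<open>Bernoulli's inequality for a / b, scaled. The value a = 0 is separate because the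
  derivative of \<open>powr\<close> is used on the open half-line.\<close>

lemma powr_tangent:
 fixes a b p :: real
 assumes "0 <= a" "0 < b" "1 <= p"
 shows "b powr p + p * b powr (p - 1) * (a - b) <= a powr p"
proof (cases "a = 0")
 case True
 have "b powr (p - 1) * b = b powr p" using assms powr_add[of b "p - 1" 1] by simp
 then show ?thesis using True assms by (simp add: mult.assoc right_diff_distrib)
next
 case False
 have bern: "1 + p * x <= (1 + x) powr p" if "-1 < x" for x
 proof -
  have "(1 + x) powr p - 1 powr p >= p * ((1 + x) - 1)"
  proof (rule convex_on_imp_above_tangent[OF powr_convex[OF assms(3)]])
   show "((%y. y powr p) has_real_derivative p) (at 1 within {0<..})"
    by (rule has_field_derivative_at_within) (auto intro!: derivative_eq_intros)
  qed (use that in \<open>auto simp: interior_open\<close>)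
  then show ?thesis by simp
 qed
 define x where "x = a / b - 1"
 have x: "-1 < x" "1 + x = a / b" using False assms by (auto simp: x_def)
 have "b powr p * (1 + p * x) <= b powr p * (a / b) powr p"
  using bern[OF x(1)] x(2) by (intro mult_left_mono) auto
 also have "... = a powr p" using assms by (simp add: powr_divide)
 also have "b powr p * (1 + p * x) = b powr p + p * b powr (p - 1) * (a - b)"
 proof -
  have "b powr p = b powr (p - 1) * b" using assms powr_add[of b "p - 1" 1] by simp
  then show ?thesis using assms by (simp add: x_def field_simps)
 qed
 finally show ?thesis .
qed

text \<open>Integrate the tangent inequality at the mean against the weight. The right side is an
  extended integral, so no integrability of the power has to be known beforehand.\<close>

lemma jensen_powr:
 fixes w f :: "'a => real"
 assumes w: "integrable M w" "!!x. 0 <= w x" "(\<integral>x. w x \<partial>M) = 1"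
  and f: "integrable M (%x. w x * f x)" "!!x. 0 <= f x" "f : borel_measurable M" and p: "1 <= p"
 shows "ennreal ((\<integral>x. w x * f x \<partial>M) powr p) <= (\<integral>\<^sup>+x. ennreal (w x * f x powr p) \<partial>M)"
proof -
 define b where "b = (\<integral>x. w x * f x \<partial>M)"
 have b0: "0 <= b" unfolding b_def using w f by (intro B_integral_nonneg) auto
 have wm: "w : borel_measurable M" using w(1) by auto
 show ?thesis
 proof (cases "b = 0 | (\<integral>\<^sup>+x. ennreal (w x * f x powr p) \<partial>M) = \<infinity>")
  case True then show ?thesis by (auto simp: b_def[symmetric])
 next
  case False
  then have b: "0 < b" and fin: "(\<integral>\<^sup>+x. ennreal (w x * f x powr p) \<partial>M) < \<infinity>" using b0 by (auto simp: less_top)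
  have m: "(%x. w x * f x powr p) : borel_measurable M" using wm f(3) by measurable
  have ip: "integrable M (%x. w x * f x powr p)"
   by (rule integrableI_nonneg) (use m fin w(2) in auto)
  have "b powr p = (\<integral>x. (b powr p - p * b powr (p - 1) * b) * w x + p * b powr (p - 1) * (w x * f x) \<partial>M)"
   using w f by (simp add: b_def[symmetric])
  also have "... <= (\<integral>x. w x * f x powr p \<partial>M)"
  proof (rule integral_mono[OF _ ip])
   show "integrable M (%x. (b powr p - p * b powr (p - 1) * b) * w x + p * b powr (p - 1) * (w x * f x))"
    using w f by simp
   fix x
   have "w x * (b powr p + p * b powr (p - 1) * (f x - b)) <= w x * f x powr p"
    using powr_tangent[OF f(2) b p] w(2) by (intro mult_left_mono)
   then show "(b powr p - p * b powr (p - 1) * b) * w x + p * b powr (p - 1) * (w x * f x) <= w x * f x powr p"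
    by (simp add: algebra_simps)
  qed
  finally have "ennreal (b powr p) <= ennreal (\<integral>x. w x * f x powr p \<partial>M)" by (rule ennreal_leI)
  also have "... = (\<integral>\<^sup>+x. ennreal (w x * f x powr p) \<partial>M)"
   using w(2) ip by (intro nn_integral_eq_integral[symmetric]) auto
  finally show ?thesis by (simp add: b_def)
 qed
qed

lemma integrable_Lpow:
 fixes f :: "'a::euclidean_space => 'b::euclidean_space"
 assumes f: "f : borel_measurable borel" "Lpow p f < \<infinity>" "!!x. R < norm x ==> f x = 0" and p: "1 <= p"
 shows "integrable lebesgue f"
proof -
 have "(NN x. ennreal (norm (f x))) <= (NN x. indicator (cball (0 :: 'a) R) x + ennreal (norm (f x) powr p))"
 proof (rule nn_integral_mono)
  fix x
  show "ennreal (norm (f x)) <= indicator (cball (0 :: 'a) R) x + ennreal (norm (f x) powr p)"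
  proof (cases "norm x <= R")
   case True
   have "norm (f x) <= 1 + norm (f x) powr p"
   proof (cases "norm (f x) <= 1")
    case False
    then have "norm (f x) powr 1 <= norm (f x) powr p" using p by (intro powr_mono) auto
    then show ?thesis using False by simp
   qed (simp add: add_increasing2)
   then have "ennreal (norm (f x)) <= ennreal (1 + norm (f x) powr p)" by (rule ennreal_leI)
   then show ?thesis using True by simp
  next
   case False then show ?thesis using f(3)[of x] by simp
  qed
 qed
 also have "... = emeasure lborel (cball (0 :: 'a) R) + Lpow p f"
  unfolding Lpow_def using f(1) by (subst nn_integral_add) (auto intro!: borel_measurable_indicator)
 also have "... < \<infinity>" using emeasure_compact_finite[of "cball (0::'a) R"] f(2) by (simp add: less_top)
 finally have "integrable lborel f" using f(1) by (intro integrableI_bounded) auto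
 then show ?thesis using f(1) by (simp add: integrable_completion)
qed

lemma continuous_conv_mollifier:
 fixes f :: "'a::euclidean_space => 'b::euclidean_space"
 assumes "0 < e" "integrable lebesgue f" shows "continuous_on UNIV (conv (mollifier e) f)"
 using Ck_conv_mollifier[OF assms, of 0] by simp

lemma mollifier_borel: "0 < e ==> mollifier e : borel_measurable (borel :: 'a::euclidean_space measure)"
 using Ck_mollifier[of e 0] by (intro cont_borel) simp

text \<open>Jensen's inequality with the mollifier as weight, then an exchange of the
  integrals.\<close>

lemma Lpow_conv_le:
 fixes f :: "'a::euclidean_space => 'b::euclidean_space"
 assumes e: "0 < e" and f: "f : borel_measurable borel" "integrable lebesgue f" and p: "1 <= p"
 shows "Lpow p (conv (mollifier e) f) <= Lpow p f"
proof -
 note mb[measurable] = mollifier_borel[OF e]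
 note f(1)[measurable]
 have point: "ennreal (norm (conv (mollifier e) f x) powr p)
   <= (NN y. ennreal (mollifier e (x - y)) * ennreal (norm (f y) powr p))" for x
 proof -
  have i: "integrable lebesgue (%y. mollifier e (x - y) * norm (f y))"
   using integrable_norm[OF integrable_mollifier_scaleR[OF e f(2), of x]] by (simp add: mollifier_nonneg[OF e])
  have "norm (conv (mollifier e) f x) <= (LINT y|lebesgue. norm (mollifier e (x - y) *R f y))"
   unfolding conv_def by (rule integral_norm_bound)
  also have "... = (LINT y|lebesgue. mollifier e (x - y) * norm (f y))"
   by (simp add: mollifier_nonneg[OF e])
  finally have "norm (conv (mollifier e) f x) powr p <= (LINT y|lebesgue. mollifier e (x - y) * norm (f y)) powr p"
   using p by (intro powr_mono2) auto
  then have "ennreal (norm (conv (mollifier e) f x) powr p) <= ennreal ((LINT y|lebesgue. mollifier e (x - y) * norm (f y)) powr p)"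
   by (rule ennreal_leI)
  also have "... <= (\<integral>\<^sup>+y. ennreal (mollifier e (x - y) * norm (f y) powr p) \<partial>lebesgue)"
   by (rule jensen_powr) (use integrable_mollifier_shift[OF e, of x] i f p in \<open>auto simp: mollifier_nonneg[OF e] intro: measurable_completion\<close>)
  also have "... = (NN y. ennreal (mollifier e (x - y) * norm (f y) powr p))"
   by (rule nn_integral_completion)
  finally show ?thesis by (simp add: ennreal_mult' mollifier_nonneg[OF e])
 qed
 have "Lpow p (conv (mollifier e) f) <= (NN x. NN y. ennreal (mollifier e (x - y)) * ennreal (norm (f y) powr p))"
  unfolding Lpow_def by (intro nn_integral_mono point)
 also have "... = (NN y. NN x. ennreal (mollifier e (x - y)) * ennreal (norm (f y) powr p))"
  by (rule lborel_pair.Fubini') measurable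
 also have "... = (NN y. ennreal (norm (f y) powr p))"
 proof (rule nn_integral_cong)
  fix y :: 'a
  have "(NN x. ennreal (mollifier e (x - y))) = (NN x. ennreal (mollifier e (y - x)))"
  proof (rule nn_integral_cong)
   fix x :: 'a
   show "ennreal (mollifier e (x - y)) = ennreal (mollifier e (y - x))"
    using mollifier_uminus[OF e, of "x - y"] by simp
  qed
  also have "... = (\<integral>\<^sup>+x. ennreal (mollifier e (y - x)) \<partial>lebesgue)" by (rule nn_integral_completion[symmetric])
  also have "... = 1"
   using integrable_mollifier_shift[OF e, of y] by (subst nn_integral_eq_integral) (auto simp: mollifier_nonneg[OF e])
  finally have one: "(NN x. ennreal (mollifier e (x - y))) = 1" .
  have "(NN x. ennreal (mollifier e (x - y)) * ennreal (norm (f y) powr p)) = (NN x. ennreal (mollifier e (x - y))) * ennreal (norm (f y) powr p)"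
   by (rule nn_integral_multc) measurable
  then show "(NN x. ennreal (mollifier e (x - y)) * ennreal (norm (f y) powr p)) = ennreal (norm (f y) powr p)"
   by (simp add: one)
 qed
 also have "... = Lpow p f" by (simp add: Lpow_def)
 finally show ?thesis .
qed

lemma conv_diff:
 fixes f g :: "'a::euclidean_space => 'b::euclidean_space"
 assumes "0 < e" "integrable lebesgue f" "integrable lebesgue g"
 shows "conv (mollifier e) (%x. f x - g x) x = conv (mollifier e) f x - conv (mollifier e) g x"
 unfolding conv_def scaleR_diff_right
 by (intro B_integral_diff integrable_mollifier_scaleR assms)

lemma ennreal_pos_real:
 assumes "0 < (a :: ennreal)" obtains eps :: real where "0 < eps" "ennreal eps < a"
proof (cases a)
 case (real b)
 then show thesis using assms by (intro that[of "b / 2"]) (auto simp: ennreal_less_iff)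
next
 case top
 then show thesis by (intro that[of 1]) auto
qed

text \<open>Replace \<open>f\<close> by a continuous function of compact support: its mollifications
  converge uniformly, and mollification does not increase the L^p size of the difference.\<close>

lemma Lpow_conv_tendsto:
 fixes f :: "'a::euclidean_space => 'b::euclidean_space"
 assumes f: "f : borel_measurable borel" "Lpow p f < \<infinity>" "!!x. R < norm x ==> f x = 0" and p: "1 <= p"
  and e: "!!k. 0 < e k" "e ----> 0"
 shows "(%k. Lpow p (%x. conv (mollifier (e k)) f x - f x)) ----> 0"
proof -
 have fi: "integrable lebesgue f" by (rule integrable_Lpow[OF f p])
 define M where "M = 2 powr p"
 have M: "0 < M" by (simp add: M_def)
 have small: "\<forall>\<^sub>F k in sequentially. Lpow p (%x. conv (mollifier (e k)) f x - f x) < ennreal eps" if eps: "0 < eps" for eps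
 proof -
  \<comment> \<open>Three errors of size dl combined by two uses of the triangle inequality add up
    to (M * M + M * M + M) dl = eps / 2.\<close>
  define dl where "dl = eps / (2 * (M * M + M * M + M))"
  have dl: "0 < dl" using eps M by (simp add: dl_def add_pos_pos)
  obtain c where c: "continuous_on UNIV c" "!!x. R + 1 < norm x ==> c x = 0" "Lpow p (%x. f x - c x) < ennreal dl"
   using Lpow_dense[OF f p dl] by blast
  have cb: "c : borel_measurable borel" by (rule cont_borel[OF c(1)])
  have ci: "integrable lebesgue c" by (rule integrable_lebesgue_continuous_compact_support[OF c(1,2)])
  define V where "V = measure lborel (cball (0 :: 'a) (R + 2))"
  have V: "0 <= V" "emeasure lborel (cball (0 :: 'a) (R + 2)) = ennreal V"
   using emeasure_compact_finite[of "cball (0::'a) (R + 2)"] by (auto simp: V_def emeasure_eq_ennreal_measure)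
  \<comment> \<open>A uniform error om on a ball of volume V contributes om^p V, which is at most
    dl.\<close>
  define om where "om = (dl / (V + 1)) powr (1 / p)"
  have om: "0 < om" "om powr p * V <= dl"
  proof -
   show "0 < om" using dl V by (simp add: om_def)
   have omp: "om powr p = dl / (V + 1)" using dl V p by (simp add: om_def powr_powr)
   show "om powr p * V <= dl" unfolding omp using dl V by (simp add: pos_divide_le_eq)
  qed
  obtain d where d: "0 < d" "!!x y. dist x y < d ==> norm (c y - c x) <= om"
   using uniformly_continuous_compact_support[OF c(1,2)] om(1)
   unfolding uniformly_continuous_on_def dist_norm by (metis UNIV_I less_imp_le norm_minus_commute)
  have "\<forall>\<^sub>F k in sequentially. e k < min d 1" using order_tendstoD(2)[OF e(2), of "min d 1"] d by simp
  then show ?thesis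
  proof eventually_elim
   case (elim k)
   let ?C = "conv (mollifier (e k))"
   have A1: "Lpow p (%x. ?C (%x. f x - c x) x) <= ennreal dl"
    using Lpow_conv_le[OF e(1), of "%x. f x - c x" p k] f(1) cb fi ci p c(3) by (auto intro: order_trans less_imp_le)
   have A2: "Lpow p (%x. ?C c x - c x) <= ennreal dl"
   proof -
    have "Lpow p (%x. ?C c x - c x) <= ennreal (om powr p) * emeasure lborel (cball (0 :: 'a) (R + 2))"
    proof (rule Lpow_cball_bound)
     show "norm (?C c x - c x) <= om" for x
      by (rule conv_mollifier_close[OF e(1) ci]) (use d elim in auto)
     show "?C c x - c x = 0" if "R + 2 < norm x" for x
     proof -
      have "c y = 0" if "dist x y < e k" for y
       using \<open>R + 2 < norm x\<close> that elim norm_triangle_ineq2[of x y] by (intro c(2)) (simp add: dist_norm)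
      then show ?thesis using conv_mollifier_const[OF e(1) ci, of x k 0] c(2)[of x] that by simp
     qed
    qed (use p om in auto)
    also have "... <= ennreal dl" unfolding V(2) using om(2) V by (simp flip: ennreal_mult add: ennreal_leI)
    finally show ?thesis .
   qed
   have A3: "Lpow p (%x. c x - f x) <= ennreal dl"
    using c(3) by (simp add: Lpow_def norm_minus_commute)
   have b1: "(%x. ?C (%x. f x - c x) x) : borel_measurable borel"
    by (intro cont_borel continuous_conv_mollifier e(1) B_integrable_diff fi ci)
   have b2: "(%x. ?C c x - c x) : borel_measurable borel"
    by (intro cont_borel continuous_on_diff continuous_conv_mollifier e(1) ci c(1))
   have b3: "(%x. c x - f x) : borel_measurable borel" using cb f(1) by measurable
   have "Lpow p (%x. ?C (%x. f x - c x) x + (?C c x - c x)) <= ennreal M * (Lpow p (%x. ?C (%x. f x - c x) x) + Lpow p (%x. ?C c x - c x))"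
    unfolding M_def by (rule Lpow_triangle[OF b1 b2]) (use p in \<open>auto intro: norm_triangle_ineq\<close>)
   also have "... <= ennreal M * (ennreal dl + ennreal dl)" by (intro mult_left_mono add_mono A1 A2) auto
   finally have S1: "Lpow p (%x. ?C (%x. f x - c x) x + (?C c x - c x)) <= ennreal M * (ennreal dl + ennreal dl)" .
   have "Lpow p (%x. ?C f x - f x) <= ennreal M * (Lpow p (%x. ?C (%x. f x - c x) x + (?C c x - c x)) + Lpow p (%x. c x - f x))"
    unfolding M_def
   proof (rule Lpow_triangle[OF _ b3])
    show "(%x. ?C (%x. f x - c x) x + (?C c x - c x)) : borel_measurable borel" using b1 b2 by measurable
    show "norm (?C f x - f x) <= norm (?C (%x. f x - c x) x + (?C c x - c x)) + norm (c x - f x)" for x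
     using norm_triangle_ineq[of "?C (%x. f x - c x) x + (?C c x - c x)" "c x - f x"] conv_diff[OF e(1) fi ci, of k x] by simp
   qed (use p in simp)
   also have "... <= ennreal M * (ennreal M * (ennreal dl + ennreal dl) + ennreal dl)"
    by (intro mult_left_mono add_mono S1 A3) auto
   also have "... = ennreal ((M * M + M * M + M) * dl)"
    using M dl by (simp flip: ennreal_plus ennreal_mult add: algebra_simps)
   also have "... < ennreal eps"
   proof -
    have "(M * M + M * M + M) * dl = eps / 2"
    proof -
     have "0 < M * M + M * M + M" using M by (simp add: add_pos_pos)
     then have "M * M + M * M + M ~= 0" by simp
     moreover have "c * (eps / (2 * c)) = eps / 2" if "c ~= 0" for c using that by simp
     ultimately show ?thesis unfolding dl_def by blast
    qed
    then show ?thesis using eps by (simp add: ennreal_less_iff)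
   qed
   finally show ?case .
  qed
 qed
 show ?thesis
 proof (rule order_tendstoI)
  fix a :: ennreal assume "0 < a"
  then obtain eps where "0 < eps" "ennreal eps < a" by (rule ennreal_pos_real)
  then show "\<forall>\<^sub>F k in sequentially. Lpow p (%x. conv (mollifier (e k)) f x - f x) < a"
   using small[of eps] by (auto elim: eventually_mono)
 qed simp
qed

section \<open>Weak gradients and their mollification\<close>

lemma grad_inner:
 fixes f :: "'a::euclidean_space => real"
 assumes "f differentiable (at x)"
 shows "grad f x \<bullet> v = frechet_derivative f (at x) v"
proof -
 interpret bounded_linear "frechet_derivative f (at x)"
  using assms frechet_derivative_works has_derivative_bounded_linear by blast
 have "frechet_derivative f (at x) v = frechet_derivative f (at x) (\<Sum>b\<in>Basis. (v \<bullet> b) *R b)"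
  by (simp add: euclidean_representation)
 also have "... = (\<Sum>b\<in>Basis. (v \<bullet> b) *R frechet_derivative f (at x) b)" by (simp add: sum scaleR)
 also have "... = grad f x \<bullet> v" unfolding grad_def inner_sum_left
  by (rule sum.cong) (simp_all add: inner_commute)
 finally show ?thesis by simp
qed

lemma grad_eqI:
 fixes f :: "'a::euclidean_space => real"
 assumes "(f has_derivative (%v. G \<bullet> v)) (at x)"
 shows "grad f x = G"
proof -
 have "frechet_derivative f (at x) = (%v. G \<bullet> v)" using frechet_derivative_at[OF assms] by simp
 then show ?thesis by (simp add: grad_def euclidean_representation)
qed

text \<open>Test the weak gradient with the reflected and translated mollifier, whose support lies
  in \<open>K\<close>; this moves the derivative from the kernel to \<open>u\<close>. The indicators
  of \<open>K\<close> make both functions globally integrable and do not change the values at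
  x.\<close>

lemma weak_gradient_conv:
 fixes u :: "'a::euclidean_space => real"
 assumes wg: "is_weak_gradient Om u g" and K: "compact K" "K <= Om" and e: "0 < e" "cball x e <= K"
 shows "(conv (mollifier e) (%y. indicator K y *R u y) has_derivative
     (%v. conv (mollifier e) (%y. indicator K y *R g y) x \<bullet> v)) (at x)"
proof -
 let ?et = "mollifier e :: 'a => real"
 let ?D = "%z. frechet_derivative ?et (at z)"
 have iu: "integrable lebesgue (%y. indicator K y *R u y)" and ig: "integrable lebesgue (%y. indicator K y *R g y)"
  using wg K unfolding is_weak_gradient_def set_integrable_def by auto
 have et0: "?et z = 0" if "e <= norm z" for z using mollifier_eq_0[OF e(1) that] .
 have Dd: "(?et has_derivative ?D z) (at z)" for z by (rule Ck_SucD(1)[OF Ck_mollifier[OF e(1)]])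
 have Dc: "continuous_on UNIV (%z. ?D z v)" for v using Ck_SucD(2)[OF Ck_mollifier[OF e(1), of "Suc 0"], of v] by simp
 have D0: "?D z v = 0" if "e < norm z" for z v
  by (rule frechet_derivative_eq_0_outside[OF _ that]) (use et0 in auto)
 define ze where "ze y = ?et (x + (- 1) *R y)" for y
 have ze: "ze y = ?et (x - y)" for y by (simp add: ze_def)
 have zed: "(ze has_derivative (%v. - ?D (x - y) v)) (at y)" for y
 proof -
  have m: "?D (x - y) (- v) = - ?D (x - y) v" for v
   by (rule linear_neg[OF bounded_linear.linear[OF has_derivative_bounded_linear[OF Dd]]])
  have "((%y. x - y) has_derivative (%v. - v)) (at y)" by (auto intro!: derivative_eq_intros)
  from has_derivative_compose[OF this Dd] show ?thesis
   by (simp add: ze [abs_def] m)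
 qed
 have gz: "grad ze y \<bullet> v = - ?D (x - y) v" for y v
 proof -
  have "grad ze y \<bullet> v = frechet_derivative ze (at y) v"
   by (rule grad_inner) (use zed in \<open>auto simp: differentiable_def\<close>)
  then show ?thesis using frechet_derivative_at[OF zed, of y] by metis
 qed
 have supp: "{y. ze y ~= 0} <= cball x e"
  using et0 by (force simp: ze dist_norm not_le[symmetric] intro: ccontr)
 have "closure {y. ze y ~= 0} <= cball x e" by (rule closure_minimal[OF supp]) simp
 then have "compactly_supported_in Om ze"
  unfolding compactly_supported_in_def using e K by (auto simp: compact_eq_bounded_closed intro: bounded_subset[OF bounded_cball])
 then have "test_function Om ze"
  unfolding test_function_def using Ck_affine[OF Ck_mollifier[OF e(1)], of _ x "- 1"] by (auto simp: ze_def [abs_def])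
 then have eq: "(LINT y:Om|lebesgue. u y *R grad ze y) = - (LINT y:Om|lebesgue. ze y *R g y)"
  using wg unfolding is_weak_gradient_def by blast
 have grad0: "grad ze y = 0" if "y ~: K" for y
 proof -
  have "~ norm (x - y) <= e" using that e by (auto simp: subset_iff dist_norm)
  then have "e < norm (x - y)" by simp
  then have "grad ze y \<bullet> v = 0" for v unfolding gz by (simp add: D0)
  then show ?thesis by (metis inner_eq_zero_iff)
 qed
 \<comment> \<open>The gradient of the kernel times \<open>u\<close>, assembled from components; up
   to sign it is the left integrand of the weak formulation.\<close>
 define F where "F y = (\<Sum>b\<in>Basis. (?D (x - y) b *R (indicator K y *R u y)) *R b)" for y
 have Fi: "integrable lebesgue F"
  unfolding F_def by (intro B_integrable_sum integrable_scaleR_left integrable_conv[OF Dc _ iu]) (use D0 in auto)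
 have FK: "F y = - (indicator Om y *R (u y *R grad ze y))" for y
 proof -
  have "F y \<bullet> b = (- (indicator Om y *R (u y *R grad ze y))) \<bullet> b" if "b : Basis" for b
  proof -
   have "F y \<bullet> b = ?D (x - y) b * (indicator K y * u y)"
    unfolding F_def using that by (simp add: inner_sum_left inner_Basis if_distrib[of "%z. _ * z"] sum.delta cong: if_cong)
   also have "... = - (indicator Om y * (u y * (grad ze y \<bullet> b)))"
    using K grad0[of y] gz[of y b] by (cases "y : K") (auto simp: indicator_def)
   finally show ?thesis by simp
  qed
  then show ?thesis by (rule euclidean_eqI)
 qed
 have G: "conv ?et (%y. indicator K y *R g y) x = (LINT y:Om|lebesgue. ze y *R g y)"
  unfolding conv_def set_lebesgue_integral_def
 proof (rule B_integral_cong[OF refl])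
  fix y
  show "?et (x - y) *R indicator K y *R g y = indicator Om y *R ze y *R g y"
  proof (cases "y : K")
   case False
   then have "ze y = 0" using e supp by blast
   then show ?thesis using False by simp
  qed (use K in \<open>auto simp: ze\<close>)
 qed
 have Fint: "integral\<^sup>L lebesgue F = conv ?et (%y. indicator K y *R g y) x"
  unfolding G using eq unfolding set_lebesgue_integral_def FK[abs_def] by simp
 have "conv (%z. ?D z v) (%y. indicator K y *R u y) x = integral\<^sup>L lebesgue F \<bullet> v" for v
 proof -
  have "integral\<^sup>L lebesgue F \<bullet> v = (LINT y|lebesgue. F y \<bullet> v)"
   using Fi by (intro integral_inner_left[symmetric]) auto
  also have "... = (LINT y|lebesgue. ?D (x - y) v *R (indicator K y *R u y))"
  proof (rule B_integral_cong[OF refl])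
   fix y
   have "F y \<bullet> v = - (indicator Om y * (u y * (grad ze y \<bullet> v)))" unfolding FK by simp
   also have "... = ?D (x - y) v * (indicator K y * u y)"
    using K grad0[of y] gz[of y v] by (cases "y : K") (auto simp: indicator_def)
   finally show "F y \<bullet> v = ?D (x - y) v *R (indicator K y *R u y)" by simp
  qed
  finally show ?thesis by (simp add: conv_def)
 qed
 moreover have "(conv ?et (%y. indicator K y *R u y) has_derivative (%v. conv (%z. ?D z v) (%y. indicator K y *R u y) x)) (at x)"
  by (rule conv_smooth(1)[where e = e]) (use Ck_mollifier[OF e(1)] iu et0 in auto)
 ultimately show ?thesis by (simp add: Fint)
qed

lemma conv_mollifier_cong_AE:
 fixes f g :: "'a::euclidean_space => 'b::euclidean_space"
 assumes "0 < e" "integrable lebesgue f" "integrable lebesgue g" "AE x in lebesgue. f x = g x"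
 shows "conv (mollifier e) f x = conv (mollifier e) g x"
 unfolding conv_def
proof (rule integral_cong_AE)
 show "(%y. mollifier e (x - y) *R f y) : borel_measurable lebesgue" "(%y. mollifier e (x - y) *R g y) : borel_measurable lebesgue"
  using integrable_mollifier_scaleR[OF assms(1,2)] integrable_mollifier_scaleR[OF assms(1,3)] by (auto simp: borel_measurable_integrable)
 show "AE y in lebesgue. mollifier e (x - y) *R f y = mollifier e (x - y) *R g y"
  using assms(4) by eventually_elim simp
qed

lemma borel_representative_cball:
 fixes h :: "'a::euclidean_space => 'b::euclidean_space"
 assumes "(%x. indicator (cball z r) x *R h x) : borel_measurable lebesgue"
 obtains h' where "h' : borel_measurable borel" "AE x in lebesgue. h' x = indicator (cball z r) x *R h x"
  "!!x. norm z + r < norm x ==> h' x = 0"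
proof -
 obtain f' where f': "f' : borel_measurable borel" "AE x in lebesgue. f' x = indicator (cball z r) x *R h x"
  using lebesgue_measurable_borel_representative[OF assms] by blast
 show thesis
 proof (rule that[of "%x. indicator (cball z r) x *R f' x"])
  show "(%x. indicator (cball z r) x *R f' x) : borel_measurable borel"
   by (intro borel_measurable_scaleR f' borel_measurable_indicator borel_closed closed_cball)
  show "AE x in lebesgue. indicator (cball z r) x *R f' x = indicator (cball z r) x *R h x"
   using f'(2) by eventually_elim (simp add: indicator_def)
  fix x :: 'a assume x: "norm z + r < norm x"
  have "norm x <= norm z + dist z x" using norm_triangle_ineq2[of x z] by (simp add: dist_norm norm_minus_commute)
  then have "x ~: cball z r" using x by simp
  then show "indicator (cball z r) x *R f' x = 0" by simp
 qed
qed

lemma Lpow_1_integrable: "integrable lebesgue f ==> f : borel_measurable borel ==> Lpow 1 f < \<infinity>"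
 for f :: "'a::euclidean_space => 'b::euclidean_space"
 unfolding Lpow_def integrable_iff_bounded nn_integral_completion by simp

text \<open>Both mollified gradients are the gradient of the same mollified function, so the
  mollified difference is zero at every scale and its L^1 limit vanishes. This is needed because
  \<open>weak_grad\<close> is selected by a choice operator.\<close>

lemma weak_gradient_unique:
 fixes u :: "'a::euclidean_space => real"
 assumes "is_weak_gradient Om u g1" "is_weak_gradient Om u g2" "cball z r <= Om" "s < r"
 shows "AE x in lebesgue. x : ball z s --> g1 x = g2 x"
proof -
 let ?K = "cball z r"
 define h where "h x = g1 x - g2 x" for x
 have ig: "integrable lebesgue (%x. indicator ?K x *R g1 x)" "integrable lebesgue (%x. indicator ?K x *R g2 x)"
  using assms compact_cball[of z r] unfolding is_weak_gradient_def set_integrable_def by auto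
 have eqh: "(%x. indicator ?K x *R h x) = (%x. indicator ?K x *R g1 x - indicator ?K x *R g2 x)"
  by (simp add: h_def scaleR_diff_right)
 have ih: "integrable lebesgue (%x. indicator ?K x *R h x)"
  unfolding eqh by (intro B_integrable_diff ig)
 obtain h' where h': "h' : borel_measurable borel" "AE x in lebesgue. h' x = indicator ?K x *R h x"
  "!!x. norm z + r < norm x ==> h' x = 0"
  using borel_representative_cball[OF borel_measurable_integrable[OF ih]] by blast
 have "h' : borel_measurable lebesgue" using h'(1) by (intro measurable_completion) simp
 then have ih': "integrable lebesgue h'"
  using h'(2) ih borel_measurable_integrable[OF ih] by (subst integrable_cong_AE) auto
 define e where "e k = (r - s) / real (k + 1)" for k
 have e: "0 < e k" "e k <= r - s" for k using assms(4) by (auto simp: e_def divide_le_eq mult_le_cancel_left1)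
 have e0: "e ----> 0" unfolding e_def by real_asymp
 have zero: "conv (mollifier (e k)) h' x = 0" if "x : ball z s" for k x
 proof -
  have sub: "cball x (e k) <= ?K"
  proof
   fix y assume "y : cball x (e k)"
   then show "y : ?K" using that e(2)[of k] dist_triangle[of z y x] by (simp add: dist_commute)
  qed
  have d: "(conv (mollifier (e k)) (%y. indicator ?K y *R u y) has_derivative
    (%v. conv (mollifier (e k)) (%y. indicator ?K y *R g y) x \<bullet> v)) (at x)"
   if "is_weak_gradient Om u g" for g
   by (rule weak_gradient_conv[OF that compact_cball assms(3) e(1) sub])
  have "conv (mollifier (e k)) (%y. indicator ?K y *R g1 y) x = conv (mollifier (e k)) (%y. indicator ?K y *R g2 y) x"
   using grad_eqI[OF d[OF assms(1)]] grad_eqI[OF d[OF assms(2)]] by simp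
  then have "conv (mollifier (e k)) (%x. indicator ?K x *R h x) x = 0"
   unfolding eqh conv_diff[OF e(1) ig] by simp
  then show ?thesis using conv_mollifier_cong_AE[OF e(1) ih' ih h'(2)] by simp
 qed
 have "(%k. Lpow 1 (%x. conv (mollifier (e k)) h' x - h' x)) ----> 0"
  by (rule Lpow_conv_tendsto[OF h'(1) Lpow_1_integrable[OF ih' h'(1)] h'(3) order_refl e(1) e0])
 moreover have "Lpow 1 (%x. ib z s x *R h' x) <= Lpow 1 (%x. conv (mollifier (e k)) h' x - h' x)" for k
  by (rule Lpow_mono) (auto simp: indicator_def zero)
 ultimately have "Lpow 1 (%x. ib z s x *R h' x) <= 0"
  by (intro LIMSEQ_le_const) auto
 then have "(NN x. ennreal (norm (ib z s x *R h' x))) = 0"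
  by (simp add: Lpow_def)
 moreover have m: "(%x. ib z s x *R h' x) : borel_measurable lborel"
  using h'(1) by (simp add: borel_measurable_indicator borel_measurable_scaleR)
 ultimately have "AE x in lborel. ennreal (norm (ib z s x *R h' x)) = 0"
  using nn_integral_0_iff_AE[OF measurable_compose[OF measurable_compose[OF m borel_measurable_norm] measurable_ennreal]] by blast
 then have "AE x in lborel. ib z s x *R h' x = 0"
  by (rule eventually_mono) simp
 then have "AE x in lebesgue. ib z s x *R h' x = 0" by (rule AE_completion)
 then show ?thesis
  using h'(2)
 proof eventually_elim
  case (elim x)
  show ?case
  proof
   assume x: "x : ball z s"
   then have "x : ?K" using assms(4) by auto
   with elim x show "g1 x = g2 x" by (auto simp: h_def)
  qed
 qed
qed

text \<open>Uniform closeness of \<open>v\<close> to \<open>u\<close> will keep test functions built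
  from \<open>v\<close> inside the positivity set, and L^p closeness of the gradients will make the
  error terms small. \<open>g\<close> is a Borel function with a global p-th power integral that
  agrees with \<open>weak_grad\<close> in the ball.\<close>

lemma sobolev_approx:
 fixes u :: "'a::euclidean_space => real"
 assumes W: "sobolev_W1 Om p u" and cu: "continuous_on Om u" and p: "1 <= p" and K: "cball z r <= Om" and s: "s < r"
 obtains g where "g : borel_measurable borel" "Lpow p g < \<infinity>"
  "AE x in lebesgue. x : ball z s --> weak_grad Om u x = g x"
  "!!et :: real. 0 < et ==> EX v G. (ALL k. Ck k v) & continuous_on UNIV G &
   (ALL x:ball z s. (v has_derivative (%w. G x \<bullet> w)) (at x)) &
   (ALL x:ball z s. \<bar>v x - u x\<bar> <= et) & Lpow p (%x. G x - g x) <= ennreal et"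
proof -
 let ?K = "cball z r"
 obtain g0 where g0: "is_weak_gradient Om u g0" "set_integrable lebesgue Om (%x. norm (g0 x) powr p)"
  using W unfolding sobolev_W1_def by blast
 have iu: "integrable lebesgue (%y. indicator ?K y *R u y)" and ig: "integrable lebesgue (%y. indicator ?K y *R g0 y)"
  using g0(1) K compact_cball[of z r] unfolding is_weak_gradient_def set_integrable_def by auto
 obtain g where g: "g : borel_measurable borel" "AE x in lebesgue. g x = indicator ?K x *R g0 x"
  "!!x. norm z + r < norm x ==> g x = 0"
  using borel_representative_cball[OF borel_measurable_integrable[OF ig]] by blast
 have Lg: "Lpow p g < \<infinity>"
 proof -
  have "Lpow p g = (\<integral>\<^sup>+x. ennreal (norm (g x) powr p) \<partial>lebesgue)" unfolding Lpow_def by (rule nn_integral_completion[symmetric])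
  also have "... <= (\<integral>\<^sup>+x. ennreal (norm (indicator Om x *R norm (g0 x) powr p)) \<partial>lebesgue)"
  proof (rule nn_integral_mono_AE)
   show "AE x in lebesgue. ennreal (norm (g x) powr p) <= ennreal (norm (indicator Om x *R norm (g0 x) powr p))"
    using g(2) by eventually_elim (use K p in \<open>auto simp: indicator_def\<close>)
  qed
  also have "... < \<infinity>" using g0(2) unfolding set_integrable_def integrable_iff_bounded by auto
  finally show ?thesis .
 qed
 have wg: "is_weak_gradient Om u (weak_grad Om u)" unfolding weak_grad_def by (rule someI[of _ g0]) (rule g0(1))
 have ig': "integrable lebesgue g" by (rule integrable_Lpow[OF g(1) Lg g(3) p])
 have ae: "AE x in lebesgue. x : ball z s --> weak_grad Om u x = g x"
  using weak_gradient_unique[OF wg g0(1) K s] g(2)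
  by eventually_elim (use s in \<open>auto simp: indicator_def\<close>)
 show thesis
 proof (rule that[OF g(1) Lg ae])
  fix et :: real assume et: "0 < et"
  have uc: "uniformly_continuous_on ?K u"
   by (rule compact_uniformly_continuous[OF continuous_on_subset[OF cu K]]) simp
  then obtain d where d: "0 < d" "!!x y. x : ?K ==> y : ?K ==> dist y x < d ==> dist (u y) (u x) < et"
   using et unfolding uniformly_continuous_on_def by metis
  define e where "e k = (r - s) / real (k + 1)" for k
  have e: "0 < e k" "e k <= r - s" for k using s by (auto simp: e_def divide_le_eq mult_le_cancel_left1)
  have e0: "e ----> 0" unfolding e_def by real_asymp
  have "(%k. Lpow p (%x. conv (mollifier (e k)) g x - g x)) ----> 0"
   by (rule Lpow_conv_tendsto[OF g(1) Lg g(3) p e(1) e0])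
  then have "\<forall>\<^sub>F k in sequentially. Lpow p (%x. conv (mollifier (e k)) g x - g x) < ennreal et"
   using et by (intro order_tendstoD(2)) auto
  moreover have "\<forall>\<^sub>F k in sequentially. e k < d" using e0 d(1) by (rule order_tendstoD)
  ultimately have "\<forall>\<^sub>F k in sequentially. Lpow p (%x. conv (mollifier (e k)) g x - g x) < ennreal et & e k < d"
   by (rule eventually_conj)
  then obtain k where k: "Lpow p (%x. conv (mollifier (e k)) g x - g x) < ennreal et" "e k < d"
   by (auto simp: eventually_sequentially)
  let ?v = "conv (mollifier (e k)) (%y. indicator ?K y *R u y)" and ?G = "conv (mollifier (e k)) g"
  have sub: "cball x (e k) <= ?K" if "x : ball z s" for x
  proof
   fix y assume "y : cball x (e k)"
   then show "y : ?K" using that e(2)[of k] dist_triangle[of z y x] by (simp add: dist_commute)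
  qed
  have Geq: "?G x = conv (mollifier (e k)) (%y. indicator ?K y *R g0 y) x" for x
   by (rule conv_mollifier_cong_AE[OF e(1) ig' ig g(2)])
  have P1: "(?v has_derivative (%w. ?G x \<bullet> w)) (at x)" if "x : ball z s" for x
   unfolding Geq by (rule weak_gradient_conv[OF g0(1) compact_cball K e(1) sub[OF that]])
  have P2: "\<bar>?v x - u x\<bar> <= et" if x: "x : ball z s" for x
   unfolding real_norm_def[symmetric]
  proof (rule conv_mollifier_close[OF e(1) iu])
   fix y assume y: "dist x y < e k"
   then have "y : ?K" using subsetD[OF sub[OF x], of y] by (simp add: mem_cball)
   moreover have "x : ?K" using subsetD[OF sub[OF x], of x] e(1)[of k] by (simp add: mem_cball)
   ultimately show "norm (indicator ?K y *R u y - u x) <= et"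
    using d(2)[of x y] y k(2) by (simp add: dist_real_def dist_commute)
  qed
  show "EX v G. (ALL k. Ck k v) & continuous_on UNIV G &
   (ALL x:ball z s. (v has_derivative (%w. G x \<bullet> w)) (at x)) &
   (ALL x:ball z s. \<bar>v x - u x\<bar> <= et) & Lpow p (%x. G x - g x) <= ennreal et"
   using P1 P2 k(1) Ck_conv_mollifier[OF e(1) iu] continuous_conv_mollifier[OF e(1) ig']
   by (intro exI[of _ ?v] exI[of _ ?G]) (auto intro: less_imp_le)
 qed
qed

section \<open>The Caccioppoli inequality\<close>

text \<open>A smooth convex version of the positive part of \<open>t - eps\<close>; as a multiplier in the equation it needs
\<open>soft_cut <= t * soft_cut'\<close> and to vanish near the free boundary.\<close>

definition soft_cut :: "real => real => real" where
 "soft_cut eps t = (t - eps) * exp_flat 0 ((t - eps) / eps)"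

definition soft_cut' :: "real => real => real" where
 "soft_cut' eps t = exp_flat 0 ((t - eps) / eps) + ((t - eps) / eps) * exp_flat 2 ((t - eps) / eps)"

lemma soft_cut_has_derivative: "0 < eps ==> (soft_cut eps has_real_derivative soft_cut' eps t) (at t)"
 unfolding soft_cut_def [abs_def] soft_cut'_def
 by (rule derivative_eq_intros refl exp_flat_has_derivative[THEN DERIV_chain2] | simp add: numeral_2_eq_2)+

lemma continuous_exp_flat: "continuous_on UNIV (exp_flat m)"
 by (rule DERIV_continuous_on) (rule has_field_derivative_at_within, rule exp_flat_has_derivative)

lemma continuous_soft_cut':
 assumes "continuous_on S v" shows "0 < eps ==> continuous_on S (%x. soft_cut' eps (v x))"
 unfolding soft_cut'_def
 by (intro continuous_intros continuous_on_compose2[OF continuous_exp_flat] assms) auto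

lemma soft_cut_bounds:
 assumes eps: "0 < eps"
 shows "t <= eps ==> soft_cut eps t = 0" "t <= eps ==> soft_cut' eps t = 0"
  and "0 <= soft_cut' eps t" "soft_cut' eps t <= 1" "0 <= soft_cut eps t" "soft_cut eps t <= \<bar>t\<bar> * soft_cut' eps t"
  and "t - 2 * eps <= soft_cut eps t" "soft_cut eps t <= \<bar>t\<bar>"
proof -
 show 0: "soft_cut eps t = 0" "soft_cut' eps t = 0" if "t <= eps"
  using that eps by (auto simp: soft_cut_def soft_cut'_def exp_flat_def divide_le_0_iff)
 \<comment> \<open>In this variable \<open>soft_cut'\<close> is exp (-y) (1 + y), which is at most 1
   since 1 + y <= exp y; and 1 - y <= exp (-y) gives the lower bound t - 2 eps.\<close>
 define y where "y = eps / (t - eps)"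
 have *: "0 <= soft_cut' eps t & soft_cut' eps t <= 1 & 0 <= soft_cut eps t & soft_cut eps t <= \<bar>t\<bar> * soft_cut' eps t & t - 2 * eps <= soft_cut eps t"
  if t: "eps < t"
 proof -
  have y: "0 < y" using t eps by (simp add: y_def)
  have xy: "(t - eps) / eps = 1 / y" using t eps by (simp add: y_def)
  have s: "soft_cut eps t = (t - eps) * exp (- y)" using y by (simp add: soft_cut_def xy exp_flat_def)
  have s': "soft_cut' eps t = exp (- y) * (1 + y)"
   using y by (simp add: soft_cut'_def xy exp_flat_def field_simps power2_eq_square)
  have e1: "exp (- y) * (1 + y) <= 1"
   using exp_ge_add_one_self[of y] by (simp add: exp_minus field_simps)
  have "(t - eps) * (1 - y) <= (t - eps) * exp (- y)"
   using t exp_ge_add_one_self[of "- y"] by (intro mult_left_mono) auto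
  moreover have "(t - eps) * (1 - y) = t - 2 * eps" using t by (simp add: y_def field_simps)
  ultimately have lo: "t - 2 * eps <= soft_cut eps t" unfolding s by linarith
  have "(t - eps) * exp (- y) <= t * (exp (- y) * (1 + y))"
   using t eps y by (intro mult_mono) (auto simp: mult_le_cancel_left1)
  then show ?thesis using lo e1 t eps y by (auto simp: s s')
 qed
 show a: "0 <= soft_cut' eps t" "soft_cut' eps t <= 1" "0 <= soft_cut eps t" "soft_cut eps t <= \<bar>t\<bar> * soft_cut' eps t" "t - 2 * eps <= soft_cut eps t"
  using * 0 eps by (cases "t <= eps"; force)+
 show "soft_cut eps t <= \<bar>t\<bar>"
  using a(4) mult_left_mono[OF a(2), of "\<bar>t\<bar>"] by simp
qed

lemma Ck_soft_cut:
 assumes "!!k. Ck k v" shows "Ck k (%x. soft_cut eps (v x))"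
proof -
 have 1: "Ck k (%x. v x - eps)" for k using Ck_add[OF assms Ck_const[of _ "- eps"]] by simp
 have "Ck k (%x. (v x - eps) / eps)" for k using Ck_scaleR[OF Ck_const[of _ "1 / eps"] 1] by simp
 then have "Ck k (%x. exp_flat 0 ((v x - eps) / eps))" by (rule Ck_exp_flat_compose)
 with 1 show ?thesis unfolding soft_cut_def by (rule Ck_mult)
qed

text \<open>If b <= dl a the first term dominates, otherwise the second. The weights come out
  explicitly without conjugate exponents.\<close>

lemma young_powr:
 fixes a b p dl :: real
 assumes "0 <= a" "0 <= b" "0 < dl" "1 < p"
 shows "a powr (p - 1) * b <= dl * a powr p + dl powr (1 - p) * b powr p"
proof (cases "b <= dl * a")
 case True
 then have "a powr (p - 1) * b <= a powr (p - 1) * (dl * a)" by (intro mult_left_mono) auto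
 also have "... = dl * a powr p" using assms by (cases "a = 0") (auto simp: powr_mult_base[symmetric] powr_diff)
 finally show ?thesis by (simp add: add_increasing2)
next
 case False
 then have "a <= b / dl" and b: "0 < b" using assms by (auto simp: field_simps not_le intro: le_less_trans[of 0 "dl * a"])
 then have "a powr (p - 1) * b <= (b / dl) powr (p - 1) * b" using assms by (intro mult_right_mono powr_mono2) auto
 also have "... = dl powr (1 - p) * b powr p"
  using assms b by (simp add: powr_divide powr_diff field_simps)
 finally show ?thesis using assms by (simp add: add_increasing)
qed

text \<open>An explicit radial bump, so that the gradient bound 2 / (R - r) is explicit too. It is
  only at least 1/3 on the inner ball, from exp (-1) >= 1/3; this is where the factor 3 in the
  Caccioppoli estimate comes from.\<close>

lemma cutoff_ball:
 fixes z :: "'a::euclidean_space"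
 assumes r: "0 < r" "r < R"
 obtains ps :: "'a => real" where "!!k. Ck k ps" "!!x. 0 <= ps x" "!!x. ps x <= 1"
  "!!x. x : ball z r ==> 1 / 3 <= ps x" "!!x. x ~: ball z R ==> ps x = 0"
  "!!x. x ~: ball z R ==> grad ps x = 0" "!!x. norm (grad ps x) <= 2 / (R - r)"
proof -
 define D where "D = R^2 - r^2"
 have D2: "D = (R - r) * (R + r)" by (simp add: D_def power2_eq_square algebra_simps)
 have D: "0 < D" "D = (R - r) * (R + r)" using r by (simp_all add: D2)
 define q where "q x = R^2 / D + (- 1 / D) * ((x - z) \<bullet> (x - z))" for x
 define ps where "ps x = exp_flat 0 (q x)" for x
 have qa: "q x = (R^2 - (dist z x)^2) / D" for x
  using D(1) by (simp add: q_def dist_norm norm_minus_commute power2_norm_eq_inner diff_divide_distrib)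
 have Ckq: "Ck k q" for k
  unfolding q_def using Ck_affine[OF Ck_inner_self, of k "- z" 1]
  by (intro Ck_add Ck_mult Ck_const) (simp add: add.commute)
 have qd: "(q has_derivative (%v. ((- 2 / D) *R (x - z)) \<bullet> v)) (at x)" for x
  unfolding q_def using D(1) by (auto intro!: derivative_eq_intros simp: inner_commute algebra_simps)
 have "(ps has_derivative (%v. (exp_flat 2 (q x) *R ((- 2 / D) *R (x - z))) \<bullet> v)) (at x)" for x
  unfolding ps_def
  by (rule has_derivative_eq_rhs, rule DERIV_compose_FDERIV[OF exp_flat_has_derivative qd])
   (auto simp: numeral_2_eq_2 fun_eq_iff)
 then have gr: "grad ps x = exp_flat 2 (q x) *R ((- 2 / D) *R (x - z))" for x by (rule grad_eqI)
 have q0: "q x <= 0" if "x ~: ball z R" for x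
  using that r D power_mono[of R "dist z x" 2] unfolding qa by (auto simp: divide_le_0_iff)
 have e2: "0 <= exp_flat 2 t" "exp_flat 2 t <= 1" for t
 proof -
  show "0 <= exp_flat 2 t" by (simp add: exp_flat_def)
  show "exp_flat 2 t <= 1"
  proof (cases "t <= 0")
   case False
   \<comment> \<open>With x = 1 / t: x <= 2 exp (-1) exp (x / 2) <= exp (x / 2), and then
     square.\<close>
   have "(1 / t)^2 <= exp (1 / t)"
   proof -
    have "1 / (2 * t) <= exp (1 / (2 * t) - 1)" using exp_ge_add_one_self[of "1 / (2 * t) - 1"] by simp
    then have "1 / t <= 2 * exp (- 1) * exp (1 / (2 * t))" by (simp add: exp_diff exp_minus field_simps)
    also have "... <= 1 * exp (1 / (2 * t))"
    proof (intro mult_right_mono)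
     have "2 <= exp (1 :: real)" using exp_ge_add_one_self[of 1] by simp
     then show "2 * exp (- 1) <= (1 :: real)" by (simp add: exp_minus field_simps)
    qed simp
    finally have "(1 / t)^2 <= (exp (1 / (2 * t)))^2" using False by (intro power_mono) auto
    also have "... = exp (1 / t)" by (simp add: power2_eq_square exp_add[symmetric])
    finally show ?thesis .
   qed
   then show ?thesis using False by (simp add: exp_flat_def exp_minus field_simps)
  qed (simp add: exp_flat_def)
 qed
 have gb: "norm (grad ps x) <= 2 / (R - r)" for x
 proof (cases "x : ball z R")
  case True
  have "norm (grad ps x) = exp_flat 2 (q x) * (2 / D * dist z x)" using e2 D by (simp add: gr dist_norm norm_minus_commute)
  also have "... <= 1 * (2 / D * (R + r))" using True r D e2 by (intro mult_mono) auto
  also have "... = 2 / (R - r)"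
  proof -
   have "1 * (2 / (a * b) * b) = 2 / a" if "b ~= 0" for a b :: real using that by simp
   from this[of "R + r" "R - r"] show ?thesis using r unfolding D(2) by linarith
  qed
  finally show ?thesis .
 next
  case False
  then show ?thesis using q0[OF False] r by (simp add: gr exp_flat_def)
 qed
 show thesis
 proof (rule that[OF _ _ _ _ _ _ gb])
  show "Ck k ps" for k unfolding ps_def by (rule Ck_exp_flat_compose[OF Ckq])
  show "0 <= ps x" "ps x <= 1" for x by (auto simp: ps_def exp_flat_def)
  show "ps x = 0" "grad ps x = 0" if "x ~: ball z R" for x
   using q0[OF that] by (auto simp: gr ps_def exp_flat_def)
  show "1 / 3 <= ps x" if "x : ball z r" for x
  proof -
   have "(dist z x)^2 <= r^2" using that by (intro power_mono) auto
   then have q1: "1 <= q x" using D unfolding qa by (simp add: le_divide_eq D_def)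
   then have "exp (- 1) <= exp (- 1 / q x)" by (simp add: divide_le_eq)
   moreover have "1 / 3 <= exp (- 1 :: real)" using exp_le by (simp add: exp_minus field_simps)
   moreover have "ps x = exp (- 1 / q x)" using q1 by (simp add: ps_def exp_flat_def)
   ultimately show ?thesis by linarith
  qed
 qed
qed

lemma borel_ball [measurable]: "ball z r : sets (borel :: 'a::euclidean_space measure)"
 by simp

lemma integrable_ball_continuous:
 fixes f :: "'a::euclidean_space => real"
 assumes "continuous_on UNIV f"
 shows "integrable lborel (%x. ib z r x * f x)"
proof (rule B_integrable_bound)
 show "integrable lborel (%x. indicator (cball z r) x *R f x)"
  by (rule borel_integrable_compact) (use assms in \<open>auto intro: continuous_on_subset\<close>)
 show "(%x. ib z r x * f x) : borel_measurable lborel"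
  by (intro borel_measurable_times borel_measurable_indicator) (use cont_borel[OF assms] in auto)
qed (auto simp: indicator_def)

lemma lebesgue_measurable_cong_AE:
 fixes f g :: "'a::euclidean_space => 'b::euclidean_space"
 assumes "f : borel_measurable lebesgue" "AE x in lebesgue. f x = g x"
 shows "g : borel_measurable lebesgue"
proof -
 obtain N where N: "N : null_sets lebesgue" "{x. f x ~= g x} <= N"
  using assms(2) by (auto simp: eventually_ae_filter)
 have "f measurable_on UNIV" by (rule lebesgue_measurable_imp_measurable_on[OF assms(1)]) simp
 moreover have "g x = f x" if "x ~: N" for x using that N(2) by (metis (mono_tags) mem_Collect_eq subsetD)
 moreover have "negligible N" using N(1) by (simp add: negligible_iff_null_sets)
 ultimately have "g measurable_on UNIV" using measurable_on_spike[of f UNIV N g] by blast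
 then show ?thesis by (rule measurable_on_imp_borel_measurable_lebesgue_UNIV)
qed

lemma norm_pflux:
 assumes "2 <= p"
 shows "norm (pweight p v *R v) = norm v powr (p - 1)" "(pweight p v *R v) \<bullet> v = norm v powr p"
proof -
 have *: "pweight p v * norm v = norm v powr (p - 1)"
 proof (cases "v = 0")
  case False
  then show ?thesis using powr_mult_base[of "norm v" "p - 2"]
   by (auto simp: pweight_def mult.commute)
 qed simp
 moreover have "0 <= pweight p v" by (simp add: pweight_def)
 ultimately show "norm (pweight p v *R v) = norm v powr (p - 1)" by simp
 have "(pweight p v *R v) \<bullet> v = pweight p v * norm v * norm v"
  by (simp add: power2_norm_eq_inner[symmetric] power2_eq_square)
 also have "... = norm v powr p" unfolding * using powr_mult_base[of "norm v" "p - 1"]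
  by (simp add: mult.commute)
 finally show "(pweight p v *R v) \<bullet> v = norm v powr p" .
qed

lemma integrable_Lpow_iff:
 "f : borel_measurable borel ==> integrable lborel (%x. norm (f x) powr p) \<longleftrightarrow> Lpow p f < \<infinity>"
 for f :: "'a::euclidean_space => 'b::euclidean_space"
 unfolding integrable_iff_bounded Lpow_def by simp

text \<open>The equation is tested with a smooth cut of \<open>v\<close> times a cutoff. The
  parameter dl weighs the term with the gradient of the cutoff, and sg the error of replacing
  \<open>G\<close> by \<open>g\<close>. The energy on the larger ball stays on the right with a
  small factor and is absorbed later by iteration over radii. The weight \<open>soft_cut'\<close>
  appears in every main term because \<open>soft_cut\<close> is at most |t| times it.\<close>

lemma caccioppoli:
 fixes u :: "real^2 => real"
 assumes harm: "weakly_p_harmonic_on_positivity_set Om p u" and p: "2 <= p"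
  and g: "g : borel_measurable borel" "Lpow p g < \<infinity>" "AE x in lebesgue. x : ball z s --> weak_grad Om u x = g x"
  and v: "!!k. Ck k v" "continuous_on UNIV G" "!!x. x : ball z s ==> (v has_derivative (%w. G x \<bullet> w)) (at x)"
  and close: "!!x. x : ball z s ==> \<bar>v x - u x\<bar> <= et" "et < eps" "0 < eps" and sub: "ball z s <= Om"
  and Lfin: "Lpow p (%x. G x - g x) < \<infinity>"
  and r: "0 < r" "r < R" "R < s" and dl: "0 < dl" and sg: "0 < sg"
 shows "(LBINT x. ib z r x * (soft_cut' eps (v x) * norm (g x) powr p))
  <= 3 * (dl * (LBINT x. ib z R x * (soft_cut' eps (v x) * norm (g x) powr p))
   + dl powr (1 - p) * (2 / (R - r)) powr p * (LBINT x. ib z R x * (soft_cut' eps (v x) * \<bar>v x\<bar> powr p))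
   + sg * (LBINT x. norm (g x) powr p) + sg powr (1 - p) * (LBINT x. norm (G x - g x) powr p))"
proof -
 define e where "e x = soft_cut' eps (v x)" for x
 define H where "H x = soft_cut eps (v x)" for x
 define P where "P x = pweight p (g x) *R g x" for x
 define l where "l = 2 / (R - r)"
 note sb = soft_cut_bounds[OF close(3)]
 have e01: "0 <= e x" "e x <= 1" and H0: "0 <= H x" "H x <= \<bar>v x\<bar> * e x" "H x <= \<bar>v x\<bar>" for x
  using sb(3,4,5,6,8)[of "v x"] by (auto simp: e_def H_def)
 have l: "0 < l" using r by (simp add: l_def)
 have vc: "continuous_on UNIV v" using v(1)[of 0] by simp
 have ec: "continuous_on UNIV e" unfolding e_def by (rule continuous_soft_cut'[OF vc close(3)])
 have Hc: "continuous_on UNIV H" using Ck_soft_cut[OF v(1), of 0 eps] by (simp add: H_def [abs_def])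
 obtain ps :: "real^2 => real" where ps: "!!k. Ck k ps" "!!x. 0 <= ps x" "!!x. ps x <= 1"
  "!!x. x : ball z r ==> 1 / 3 <= ps x" "!!x. x ~: ball z R ==> ps x = 0"
  "!!x. x ~: ball z R ==> grad ps x = 0" "!!x. norm (grad ps x) <= l"
  using cutoff_ball[OF r(1,2), of z] unfolding l_def by blast
 have psc: "continuous_on UNIV ps" using ps(1)[of 0] by simp
 have psd: "(ps has_derivative (%w. grad ps x \<bullet> w)) (at x)" for x
 proof -
  have d: "(ps has_derivative frechet_derivative ps (at x)) (at x)" by (rule Ck_SucD(1)[OF ps(1)])
  have "frechet_derivative ps (at x) = (%w. grad ps x \<bullet> w)"
   by (rule ext) (use grad_inner[of ps x] d in \<open>metis differentiable_def\<close>)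
  with d show ?thesis by simp
 qed
 have gpsc: "continuous_on UNIV (grad ps)"
 proof -
  have "continuous_on UNIV (%x. frechet_derivative ps (at x) b)" for b
   using Ck_SucD(2)[OF ps(1)[of "Suc 0"], of b] by simp
  then show ?thesis unfolding grad_def [abs_def] by (intro continuous_intros)
 qed
 \<comment> \<open>Where \<open>ze\<close> is nonzero, v > eps; since |v - u| <= et < eps this
   forces u > 0, so the support is compact inside the positivity set.\<close>
 define ze where "ze x = H x * ps x" for x
 have supp: "{x. ze x ~= 0} <= cball z R Int {x. eps <= v x}"
 proof
  fix x assume "x : {x. ze x ~= 0}"
  then have "x : ball z R" "~ v x <= eps" using ps(5)[of x] sb(1)[of "v x"] by (auto simp: ze_def H_def)
  then show "x : cball z R Int {x. eps <= v x}" by auto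
 qed
 have cl: "closed (cball z R Int {x. eps <= v x})"
  by (intro closed_Int closed_cball closed_Collect_le continuous_intros vc)
 have pos: "cball z R Int {x. eps <= v x} <= positivity_set Om u"
 proof
  fix x assume x: "x : cball z R Int {x. eps <= v x}"
  then have "x : ball z s" using r by auto
  then show "x : positivity_set Om u" using close(1)[of x] close(2) x sub by (auto simp: positivity_set_def)
 qed
 have "closure {x. ze x ~= 0} <= cball z R Int {x. eps <= v x}" by (rule closure_minimal[OF supp cl])
 then have "compactly_supported_in (positivity_set Om u) ze"
  unfolding compactly_supported_in_def using pos
  by (auto simp: compact_eq_bounded_closed intro: bounded_subset[OF bounded_cball])
 moreover have "Ck k ze" for k
  unfolding ze_def H_def by (intro Ck_mult Ck_soft_cut v(1) ps(1))
 ultimately have "test_function (positivity_set Om u) ze" by (simp add: test_function_def)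
 then have eq: "(LINT x:positivity_set Om u|lebesgue. pweight p (weak_grad Om u x) * (weak_grad Om u x \<bullet> grad ze x)) = 0"
  using harm unfolding weakly_p_harmonic_on_positivity_set_def by blast
 have gz: "grad ze x = (e x * ps x) *R G x + H x *R grad ps x" for x
 proof (cases "x : ball z s")
  case True
  have "(H has_derivative (%w. (G x \<bullet> w) * e x)) (at x)"
   unfolding H_def e_def
   by (rule has_derivative_eq_rhs, rule DERIV_compose_FDERIV[OF soft_cut_has_derivative[OF close(3)] v(3)[OF True]]) auto
  from has_derivative_mult[OF this psd[of x]]
  have "(ze has_derivative (%w. H x * (grad ps x \<bullet> w) + (G x \<bullet> w) * e x * ps x)) (at x)"
   unfolding ze_def .
  then have "(ze has_derivative (%w. ((e x * ps x) *R G x + H x *R grad ps x) \<bullet> w)) (at x)"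
   by (rule has_derivative_eq_rhs) (auto simp: fun_eq_iff algebra_simps)
  then show ?thesis by (rule grad_eqI)
 next
  case False
  have "((%x. 0 :: real) has_derivative (%w. 0 \<bullet> w)) (at x)" by simp
  from has_derivative_transform_within_open[OF this open_Compl[OF closed_cball[of z R]]]
  have "(ze has_derivative (%w. 0 \<bullet> w)) (at x)"
   using False r ps(5) by (force simp: ze_def)
  then have "grad ze x = 0" by (rule grad_eqI)
  moreover have "x ~: ball z R" using False r by auto
  ultimately show ?thesis using ps(5,6)[of x] by simp
 qed
 define T where "T x = P x \<bullet> grad ze x" for x
 have T: "T x = e x * ps x * (P x \<bullet> G x) + H x * (P x \<bullet> grad ps x)" for x
  by (simp add: T_def gz inner_add_right)
 have Tout: "T x = 0" if "x ~: ball z R" for x using ps(5,6)[OF that] by (simp add: T)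
 note P = norm_pflux[OF p, of "g x" for x, folded P_def]
 note [measurable] = g(1) cont_borel[OF ec] cont_borel[OF Hc]
  cont_borel[OF psc] cont_borel[OF gpsc] cont_borel[OF v(2)]
  cont_borel[OF vc]
 have Pm[measurable]: "P : borel_measurable borel"
  unfolding P_def pweight_def by (cases "p = 2") simp_all
 have Tm: "T : borel_measurable borel" unfolding T [abs_def] by measurable
 have ig: "integrable lborel (%x. norm (g x) powr p)" using g by (simp add: integrable_Lpow_iff)
 have iG: "integrable lborel (%x. norm (G x - g x) powr p)" using Lfin by (subst integrable_Lpow_iff) simp_all
 define W where "W x = norm (G x) + l * \<bar>v x\<bar>" for x
 have iW: "integrable lborel (%x. ib z R x * W x powr p)"
  unfolding W_def by (rule integrable_ball_continuous) (intro continuous_on_powr' continuous_intros vc v(2), use l p in auto)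
 have iT: "integrable lborel T"
 proof (rule B_integrable_bound)
  show "integrable lborel (%x. norm (g x) powr p + ib z R x * W x powr p)"
   using ig iW by (rule B_integrable_add)
  show "AE x in lborel. norm (T x) <= norm (norm (g x) powr p + ib z R x * W x powr p)"
  proof (rule AE_I2)
   fix x
   show "norm (T x) <= norm (norm (g x) powr p + ib z R x * W x powr p)"
   proof (cases "x : ball z R")
    case True
    have "\<bar>T x\<bar> <= norm (P x) * norm (grad ze x)" unfolding T_def by (rule Cauchy_Schwarz_ineq2)
    also have "norm (grad ze x) <= W x"
    proof -
     have "norm (grad ze x) <= e x * ps x * norm (G x) + H x * norm (grad ps x)"
      unfolding gz using norm_triangle_ineq[of "(e x * ps x) *R G x" "H x *R grad ps x"] e01[of x] ps(2)[of x] H0[of x] by (simp add: abs_mult)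
     also have "... <= 1 * 1 * norm (G x) + \<bar>v x\<bar> * l"
      by (intro add_mono mult_mono e01 ps H0) auto
     finally show ?thesis by (simp add: W_def mult.commute)
    qed
    also have "norm (P x) * W x <= 1 * norm (g x) powr p + 1 powr (1 - p) * W x powr p"
     unfolding P(1) by (rule young_powr) (use p l in \<open>auto simp: W_def\<close>)
    finally show ?thesis using True by (simp add: mult_left_mono)
   next
    case False then show ?thesis by (simp add: Tout)
   qed
  qed
 qed (use Tm in simp)
 have T0: "integral\<^sup>L lborel T = 0"
 proof -
  have ae: "AE x in lebesgue. T x = indicator (positivity_set Om u) x *R (pweight p (weak_grad Om u x) * (weak_grad Om u x \<bullet> grad ze x))"
   using g(3)
  proof eventually_elim
   case (elim x)
   show ?case
   proof (cases "x : ball z s")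
    case True
    show ?thesis
    proof (cases "x : positivity_set Om u")
     case True
     then show ?thesis using elim \<open>x : ball z s\<close> by (simp add: T_def P_def)
    next
     case False
     \<comment> \<open>Outside the positivity set the weights vanish, so the integral may be taken
       over all of the plane.\<close>
     then have "v x <= eps" using True close(1)[OF True] close(2) sub by (auto simp: positivity_set_def)
     then have "e x = 0" "H x = 0" using sb(1,2) by (auto simp: e_def H_def)
     then show ?thesis using False by (simp add: T)
    qed
   next
    case False
    then have "x ~: ball z R" using r by auto
    then show ?thesis using ps(5,6)[of x] by (simp add: T gz)
   qed
  qed
  have Tl: "T : borel_measurable lebesgue" using Tm by (intro measurable_completion) simp
  have "integral\<^sup>L lborel T = integral\<^sup>L lebesgue T" by (rule integral_completion[symmetric]) (use Tm in simp)
  also have "... = (LINT x|lebesgue. indicator (positivity_set Om u) x *R (pweight p (weak_grad Om u x) * (weak_grad Om u x \<bullet> grad ze x)))"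
   by (rule integral_cong_AE[OF Tl lebesgue_measurable_cong_AE[OF Tl ae] ae])
  finally show ?thesis using eq by (simp add: set_lebesgue_integral_def)
 qed
 have iE: "integrable lborel (%x. ib z a x * (e x * norm (g x) powr p))" for a
 proof (rule B_integrable_bound[OF ig])
  show "AE x in lborel. norm (ib z a x * (e x * norm (g x) powr p)) <= norm (norm (g x) powr p)"
  proof (rule AE_I2)
   fix x
   show "norm (ib z a x * (e x * norm (g x) powr p)) <= norm (norm (g x) powr p)"
    using mult_left_le_one_le[of "norm (g x) powr p" "e x"] e01[of x] by (cases "x : ball z a") auto
  qed
 qed simp
 have iV: "integrable lborel (%x. ib z R x * (e x * \<bar>v x\<bar> powr p))"
  by (rule integrable_ball_continuous) (intro continuous_on_powr' continuous_intros vc ec, use p in auto)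
 have ips: "integrable lborel (%x. e x * ps x * norm (g x) powr p)"
 proof (rule B_integrable_bound[OF ig])
  show "AE x in lborel. norm (e x * ps x * norm (g x) powr p) <= norm (norm (g x) powr p)"
  proof (rule AE_I2)
   fix x
   have "0 <= e x * ps x" "e x * ps x <= 1" using e01[of x] ps(2,3)[of x] by (auto intro: mult_le_one)
   then show "norm (e x * ps x * norm (g x) powr p) <= norm (norm (g x) powr p)"
    using mult_left_le_one_le[of "norm (g x) powr p" "e x * ps x"] by simp
  qed
 qed simp
 let ?Y = "%x. sg * norm (g x) powr p + sg powr (1 - p) * norm (G x - g x) powr p"
 let ?Z = "%x. dl * (ib z R x * (e x * norm (g x) powr p)) + dl powr (1 - p) * l powr p * (ib z R x * (e x * \<bar>v x\<bar> powr p))"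
 \<comment> \<open>Write |g|^p as \<open>P\<close> times \<open>G\<close> plus \<open>P\<close>
   times \<open>g - G\<close>. Up to the weights, the first part is \<open>T\<close> minus the term
   with the gradient of the cutoff; Young's inequality bounds that term by \<open>?Z\<close> and the
   second part by \<open>?Y\<close>.\<close>
 have point: "e x * ps x * norm (g x) powr p <= T x + ?Z x + ?Y x" for x
 proof -
  have Y: "norm (g x) powr (p - 1) * norm (G x - g x) <= ?Y x" "0 <= ?Y x"
   by (rule young_powr) (use p sg in auto)
  show ?thesis
  proof (cases "x : ball z R")
   case False
   then show ?thesis using ps(5)[of x] Tout[of x] Y(2) by simp
  next
   case True
   have ep: "0 <= e x * ps x" "e x * ps x <= 1" using e01[of x] ps(2,3)[of x] by (auto intro: mult_le_one)
   have "P x \<bullet> (g x - G x) <= norm (P x) * norm (g x - G x)" by (rule norm_cauchy_schwarz)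
   also have "... <= ?Y x" using Y(1) by (simp add: P(1) norm_minus_commute)
   finally have "e x * ps x * (P x \<bullet> (g x - G x)) <= e x * ps x * ?Y x" using ep by (intro mult_left_mono)
   also have "... <= ?Y x" using ep Y(2) by (intro mult_left_le_one_le)
   finally have 1: "e x * ps x * (P x \<bullet> (g x - G x)) <= ?Y x" .
   have "- (H x * (P x \<bullet> grad ps x)) <= H x * (norm (P x) * norm (grad ps x))"
    using mult_left_mono[OF norm_cauchy_schwarz[of "- P x" "grad ps x"] H0(1)[of x]] by simp
   also have "... <= (\<bar>v x\<bar> * e x) * (norm (P x) * l)"
    by (intro mult_mono H0 ps(7)) (auto simp: e01)
   also have "... = e x * (norm (g x) powr (p - 1) * (l * \<bar>v x\<bar>))" by (simp add: P(1))
   also have "... <= e x * (dl * norm (g x) powr p + dl powr (1 - p) * (l * \<bar>v x\<bar>) powr p)"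
    by (intro mult_left_mono young_powr e01) (use p dl l in auto)
   also have "... = ?Z x" using True by (simp add: powr_mult algebra_simps)
   finally have 2: "- (H x * (P x \<bullet> grad ps x)) <= ?Z x" .
   have "e x * ps x * norm (g x) powr p = e x * ps x * (P x \<bullet> G x) + e x * ps x * (P x \<bullet> (g x - G x))"
    using P(2)[of x] by (simp add: inner_diff_right algebra_simps)
   with 1 2 show ?thesis unfolding T by linarith
  qed
 qed
 have "(1 / 3) * (LBINT x. ib z r x * (e x * norm (g x) powr p))
   = (LBINT x. (1 / 3) * (ib z r x * (e x * norm (g x) powr p)))"
  by (rule B_integral_mult_right_zero[symmetric])
 also have "... <= (LBINT x. e x * ps x * norm (g x) powr p)"
 proof (rule integral_mono[OF _ ips])
  show "integrable lborel (%x. (1 / 3) * (ib z r x * (e x * norm (g x) powr p)))"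
   using iE by (rule integrable_mult_right)
  fix x
  show "(1 / 3) * (ib z r x * (e x * norm (g x) powr p)) <= e x * ps x * norm (g x) powr p"
  proof (cases "x : ball z r")
   case True
   have "(1 / 3) * (e x * norm (g x) powr p) <= ps x * (e x * norm (g x) powr p)"
    using ps(4)[OF True] e01 by (intro mult_right_mono) auto
   then show ?thesis using True by (simp add: mult_ac)
  qed (use e01 ps(2) in auto)
 qed
 also have "... <= (LBINT x. T x + ?Z x + ?Y x)"
 proof (rule integral_mono[OF ips _ point])
  show "integrable lborel (%x. T x + ?Z x + ?Y x)"
   by (intro B_integrable_add integrable_mult_right iT iE iV ig iG)
 qed
 also have "... = integral\<^sup>L lborel T + (dl * (LBINT x. ib z R x * (e x * norm (g x) powr p))
   + dl powr (1 - p) * l powr p * (LBINT x. ib z R x * (e x * \<bar>v x\<bar> powr p)))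
   + (sg * (LBINT x. norm (g x) powr p) + sg powr (1 - p) * (LBINT x. norm (G x - g x) powr p))"
  by (subst B_integral_add
    | intro B_integrable_add integrable_mult_right iT iE iV ig iG
    | simp only: B_integral_mult_right_zero)+
 finally show ?thesis unfolding T0 e_def l_def by simp
qed

section \<open>Mean values\<close>

lemma nn_integral_lborel_translate:
 fixes f :: "'a::euclidean_space => ennreal"
 assumes [measurable]: "f : borel_measurable borel"
 shows "(NN x. f (x - c)) = (NN x. f x)"
proof -
 have "(NN x. f x) = (\<integral>\<^sup>+x. f x \<partial>distr lborel borel ((+) (- c)))" by (simp add: lborel_distr_plus)
 also have "... = (NN x. f (- c + x))" by (rule nn_integral_distr) simp_all
 finally show ?thesis by simp
qed

text \<open>Integrate the gradient along the segment from x to x - w, apply Jensen's inequality in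
  the segment parameter, and exchange the integrals; each translate stays in the ball enlarged by
  h.\<close>

lemma translation_estimate:
 fixes f :: "'a::euclidean_space => real"
 assumes F: "continuous_on UNIV F" and fd: "!!x. x : ball z s ==> (f has_derivative (%w. F x \<bullet> w)) (at x)"
  and fc: "continuous_on UNIV f" and p: "1 <= p" and h: "0 <= h" "R + h <= s" and w: "norm w <= h"
 shows "(NN x. ib z R x * ennreal (\<bar>f x - f (x - w)\<bar> powr p))
  <= ennreal (h powr p) * (NN x. ib z (R + h) x * ennreal (norm (F x) powr p))"
  (is "_ <= _ * ?I")
proof -
 note [measurable] = cont_borel[OF F] cont_borel[OF fc]
 have inb: "x - t *R w : ball z (R + h)" if "x : ball z R" "t : {0..1}" for x t
 proof -
  have "norm (t *R w) <= 1 * h" using that w mult_left_le_one_le[of "norm w" t] by simp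
  then show ?thesis using that(1) norm_triangle_ineq[of "z - x" "t *R w"] by (simp add: dist_norm algebra_simps)
 qed
 have point: "ennreal (\<bar>f x - f (x - w)\<bar> powr p)
   <= (NN t. indicator {0..1} t * ennreal ((norm (F (x - t *R w)) * h) powr p))" if x: "x : ball z R" for x
 proof -
  have c: "continuous_on UNIV (%t. F (x - t *R w))" by (intro continuous_on_compose2[OF F] continuous_intros) auto
  have c1: "continuous_on S (%t. F (x - t *R w) \<bullet> (- w))" for S
   by (intro continuous_intros continuous_on_subset[OF c]) auto
  have c2: "continuous_on S (%t. norm (F (x - t *R w)) * h)" for S
   by (intro continuous_intros continuous_on_subset[OF c]) auto
  have "(LBINT t. indicator {0..1} t *R (F (x - t *R w) \<bullet> (- w))) = f (x - 1 *R w) - f (x - 0 *R w)"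
  proof (rule integral_FTC_Icc[OF _ _ c1])
   fix t :: real assume t: "0 <= t" "t <= 1"
   have "((%t. x - t *R w) has_derivative (%a. - (a *R w))) (at t within {0..1})"
    by (auto intro!: derivative_eq_intros)
   moreover have "(f has_derivative (%w'. F (x - t *R w) \<bullet> w')) (at (x - t *R w))"
    by (rule fd) (use inb[OF x, of t] t h(2) in auto)
   ultimately have "((%t. f (x - t *R w)) has_derivative (%a. F (x - t *R w) \<bullet> (- (a *R w)))) (at t within {0..1})"
    by (rule has_derivative_compose)
   then show "((%t. f (x - t *R w)) has_vector_derivative (F (x - t *R w) \<bullet> (- w))) (at t within {0..1})"
    by (simp add: has_vector_derivative_def)
  qed simp
  then have "\<bar>f x - f (x - w)\<bar> = norm (LBINT t. indicator {0..1} t *R (F (x - t *R w) \<bullet> (- w)))" by simp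
  also have "... <= (LBINT t. indicator {0..1} t * (norm (F (x - t *R w)) * h))"
  proof (rule norm_integral_le)
   show "integrable lborel (%t. indicator {0..1} t *R (F (x - t *R w) \<bullet> (- w)))"
    by (rule borel_integrable_compact[OF _ c1]) simp
   show "integrable lborel (%t. indicator {0..1} t * (norm (F (x - t *R w)) * h))"
    using borel_integrable_compact[OF _ c2, of "{0..1}"] by simp
   show "norm (indicator {0..1} t *R (F (x - t *R w) \<bullet> (- w))) <= indicator {0..1} t * (norm (F (x - t *R w)) * h)" for t :: real
   proof -
    have "\<bar>F (x - t *R w) \<bullet> w\<bar> <= norm (F (x - t *R w)) * h"
     using Cauchy_Schwarz_ineq2[of "F (x - t *R w)" w] mult_left_mono[OF w norm_ge_zero] by (rule order_trans)
    then show ?thesis by (auto simp: indicator_def)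
   qed
  qed
  finally have "ennreal (\<bar>f x - f (x - w)\<bar> powr p) <= ennreal ((LBINT t. indicator {0..1} t * (norm (F (x - t *R w)) * h)) powr p)"
   using p by (intro ennreal_leI powr_mono2) auto
  also have "... <= (NN t. ennreal (indicator {0..1} t * (norm (F (x - t *R w)) * h) powr p))"
  proof (rule jensen_powr[OF _ _ _ _ _ _ p])
   show "integrable lborel (%t. indicator {0..1} t * (norm (F (x - t *R w)) * h))"
    using borel_integrable_compact[OF _ c2, of "{0..1}"] by simp
   show "(%t. norm (F (x - t *R w)) * h) : borel_measurable lborel" by measurable
  qed (use h in \<open>auto simp: less_top[symmetric]\<close>)
  finally show ?thesis by (simp add: ennreal_mult' ennreal_indicator)
 qed
 have "(NN x. ib z R x * ennreal (\<bar>f x - f (x - w)\<bar> powr p))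
  <= (NN x. NN t. ib z R x * (indicator {0..1} t * ennreal ((norm (F (x - t *R w)) * h) powr p)))"
 proof (rule nn_integral_mono)
  fix x
  show "ib z R x * ennreal (\<bar>f x - f (x - w)\<bar> powr p)
   <= (NN t. ib z R x * (indicator {0..1} t * ennreal ((norm (F (x - t *R w)) * h) powr p)))"
   using point[of x] by (cases "x : ball z R") auto
 qed
 also have "... = (NN t. NN x. ib z R x * (indicator {0..1} t * ennreal ((norm (F (x - t *R w)) * h) powr p)))"
  by (rule lborel_pair.Fubini'[symmetric]) measurable
 also have "... <= (\<integral>\<^sup>+t. ennreal (h powr p) * ?I * indicator {0..1} t \<partial>(lborel :: real measure))"
 proof (rule nn_integral_mono)
  fix t :: real
  show "(NN x. ib z R x * (indicator {0..1} t * ennreal ((norm (F (x - t *R w)) * h) powr p)))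
   <= ennreal (h powr p) * ?I * indicator {0..1} t"
  proof (cases "t : {0..1}")
   case True
   have "(NN x. ib z R x * (indicator {0..1} t * ennreal ((norm (F (x - t *R w)) * h) powr p)))
    <= (NN x. ennreal (h powr p) * (ib z (R + h) (x - t *R w) * ennreal (norm (F (x - t *R w)) powr p)))"
   proof (rule nn_integral_mono)
    fix x
    show "ib z R x * (indicator {0..1} t * ennreal ((norm (F (x - t *R w)) * h) powr p))
     <= ennreal (h powr p) * (ib z (R + h) (x - t *R w) * ennreal (norm (F (x - t *R w)) powr p))"
     using inb[of x t] True
     by (cases "x : ball z R") (simp_all add: powr_mult ennreal_mult' mult.commute)
   qed
   also have "... = ennreal (h powr p) * (NN x. ib z (R + h) (x - t *R w) * ennreal (norm (F (x - t *R w)) powr p))"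
    by (rule nn_integral_cmult) measurable
   also have "... = ennreal (h powr p) * ?I"
    by (subst nn_integral_lborel_translate[where f = "%y. ib z (R + h) y * ennreal (norm (F y) powr p)"]) simp_all
   finally show ?thesis using True by simp
  qed simp
 qed
 also have "... = ennreal (h powr p) * ?I" by (subst nn_integral_cmult_indicator) auto
 finally show ?thesis .
qed

text \<open>Compare f x with its average over the ball of radius h. The average is bounded by the
  L^1 mass, and the deviation by h times the gradient in L^p. A small h thus buys a small factor in
  front of the gradient at the price of a large one in front of the mass.\<close>

lemma sobolev_average:
 fixes f :: "'a::euclidean_space => real"
 assumes F: "continuous_on UNIV F" and fd: "!!x. x : ball z s ==> (f has_derivative (%w. F x \<bullet> w)) (at x)"
  and fc: "continuous_on UNIV f" and f0: "!!x. 0 <= f x" and p: "1 <= p" and h: "0 < h" "R + h <= s"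
  and a: "(LBINT y. ib z (R + h) y * f y) <= a"
  and V: "V = measure lborel (ball (0 :: 'a) h)"
 shows "(NN x. ib z R x * ennreal (f x powr p))
  <= ennreal (2 powr p) * (ennreal (h powr p) * (NN x. ib z (R + h) x * ennreal (norm (F x) powr p))
    + ennreal ((a / V) powr p) * emeasure lborel (ball z R))"
  (is "_ <= _ * (_ * ?I + _)")
proof -
 note fm[measurable] = cont_borel[OF fc]
 have V0: "0 < V" using content_ball_pos[OF h(1), of "0 :: 'a"] by (simp add: V)
 have Ve: "emeasure lborel (ball (0 :: 'a) h) = ennreal V"
  using emeasure_bounded_finite[of "ball (0 :: 'a) h"] by (simp add: V emeasure_eq_ennreal_measure)
 \<comment> \<open>The normalised indicator of the ball, used as a probability density for the shift
   w.\<close>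
 define rh where "rh w = ib (0 :: 'a) h w / V" for w
 have rh0: "0 <= rh w" for w using V0 by (simp add: rh_def)
 have rhm[measurable]: "rh : borel_measurable borel" unfolding rh_def
  by (intro borel_measurable_divide borel_measurable_const borel_measurable_indicator borel_open open_ball)
 have irh: "integrable lborel (%w. rh w * k w)" if "continuous_on UNIV k" for k :: "'a => real"
  using integrable_divide[OF integrable_ball_continuous[OF that, of 0 h], of V] by (simp add: rh_def)
 have rhi: "integrable lborel rh" using irh[of "%_. 1"] by simp
 have rh1: "(LBINT w. rh w) = 1" using V0 V by (simp add: rh_def)
 have a0: "0 <= a" by (rule order_trans[OF B_integral_nonneg a]) (simp add: f0)
 have point: "ennreal (f x powr p) <= ennreal (2 powr p) * ((NN w. ennreal (rh w) * ennreal (\<bar>f x - f (x - w)\<bar> powr p)) + ennreal ((a / V) powr p))"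
  if x: "x : ball z R" for x
 proof -
  have c: "continuous_on UNIV (%w. f (x - w))" by (intro continuous_on_compose2[OF fc] continuous_intros) auto
  have cd: "continuous_on UNIV (%w. \<bar>f x - f (x - w)\<bar>)" by (intro continuous_intros c)
  let ?d = "\<integral>w. rh w * \<bar>f x - f (x - w)\<bar> \<partial>lborel"
  have d0: "0 <= ?d" by (intro B_integral_nonneg) (simp add: rh0)
  have "f x = (LBINT w. rh w * f x)" using rh1 by simp
  also have "... <= (LBINT w. rh w * \<bar>f x - f (x - w)\<bar> + rh w * f (x - w))"
  proof (rule integral_mono)
   show "rh w * f x <= rh w * \<bar>f x - f (x - w)\<bar> + rh w * f (x - w)" for w
    unfolding distrib_left[symmetric] by (rule mult_left_mono[OF _ rh0]) linarith
   show "integrable lborel (%w. rh w * f x)" by (rule irh) simp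
   show "integrable lborel (%w. rh w * \<bar>f x - f (x - w)\<bar> + rh w * f (x - w))"
    by (intro B_integrable_add irh cd c)
  qed
  also have "... = ?d + (LBINT w. rh w * f (x - w))"
   by (intro B_integral_add irh cd c)
  also have "(LBINT w. rh w * f (x - w)) <= a / V"
  proof -
   have "(LBINT w. rh w * f (x - w)) = (LBINT w. rh (x - (x - w)) * f (x - w))" by simp
   also have "... = (\<integral>y. rh (x - y) * f y \<partial>distr lborel borel (%y. x - y))"
    by (rule integral_distr[symmetric]) measurable
   also have "... = (LBINT y. rh (x - y) * f y)" by (simp add: distr_lborel_reflect)
   also have "... <= (LBINT y. (ib z (R + h) y * f y) / V)"
   proof (rule integral_mono)
    have *: "rh (x - y) = ib x h y / V" for y by (simp add: rh_def indicator_def dist_norm norm_minus_commute[of x y])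
    show "integrable lborel (%y. rh (x - y) * f y)"
     using integrable_divide[OF integrable_ball_continuous[OF fc, of x h], of V] by (simp add: *)
    show "integrable lborel (%y. (ib z (R + h) y * f y) / V)"
     by (rule integrable_divide[OF integrable_ball_continuous[OF fc]])
    show "rh (x - y) * f y <= (ib z (R + h) y * f y) / V" for y
    proof (cases "y : ball x h")
     case True
     then have "y : ball z (R + h)" using x dist_triangle[of z y x] by (simp add: dist_commute)
     then show ?thesis using True by (simp add: *)
    next
     case False
     then show ?thesis using f0[of y] V0 by (simp add: *)
    qed
   qed
   also have "... <= a / V" using a V0 by (simp add: divide_right_mono)
   finally show ?thesis .
  qed
  finally have "f x <= ?d + a / V" by simp
  then have "f x powr p <= (?d + a / V) powr p" using f0 p by (intro powr_mono2) auto
  also have "... <= 2 powr p * (?d powr p + (a / V) powr p)" using d0 a0 V0 p by (intro powr_add_le) auto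
  finally have "ennreal (f x powr p) <= ennreal (2 powr p * (?d powr p + (a / V) powr p))" by (rule ennreal_leI)
  also have "... = ennreal (2 powr p) * (ennreal (?d powr p) + ennreal ((a / V) powr p))" by (simp add: ennreal_mult)
  also have "ennreal (?d powr p) <= (NN w. ennreal (rh w * \<bar>f x - f (x - w)\<bar> powr p))"
   by (rule jensen_powr[OF rhi rh0 rh1 irh[OF cd] _ _ p]) simp_all
  finally show ?thesis by (simp add: ennreal_mult' rh0 mult_left_mono)
 qed
 have swap: "(NN x. ib z R x * (NN w. ennreal (rh w) * ennreal (\<bar>f x - f (x - w)\<bar> powr p)))
   <= ennreal (h powr p) * ?I"
 proof -
  have "(NN x. ib z R x * (NN w. ennreal (rh w) * ennreal (\<bar>f x - f (x - w)\<bar> powr p)))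
   = (NN x. NN w. ennreal (rh w) * (ib z R x * ennreal (\<bar>f x - f (x - w)\<bar> powr p)))"
   by (intro nn_integral_cong) (subst nn_integral_cmult[symmetric], measurable, simp add: mult_ac)
  also have "... = (NN w. NN x. ennreal (rh w) * (ib z R x * ennreal (\<bar>f x - f (x - w)\<bar> powr p)))"
   by (rule lborel_pair.Fubini'[symmetric]) measurable
  also have "... <= (NN w. ennreal (rh w) * (ennreal (h powr p) * ?I))"
  proof (rule nn_integral_mono)
   fix w
   have "(NN x. ennreal (rh w) * (ib z R x * ennreal (\<bar>f x - f (x - w)\<bar> powr p)))
    = ennreal (rh w) * (NN x. ib z R x * ennreal (\<bar>f x - f (x - w)\<bar> powr p))"
    by (rule nn_integral_cmult) measurable
   also have "... <= ennreal (rh w) * (ennreal (h powr p) * ?I)"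
   proof (cases "w : ball 0 h")
    case True
    then show ?thesis
     by (intro mult_left_mono translation_estimate[OF F fd fc p]) (use h in auto)
   qed (simp add: rh_def)
   finally show "(NN x. ennreal (rh w) * (ib z R x * ennreal (\<bar>f x - f (x - w)\<bar> powr p)))
    <= ennreal (rh w) * (ennreal (h powr p) * ?I)" .
  qed
  also have "... = (NN w. ennreal (rh w)) * (ennreal (h powr p) * ?I)" by (rule nn_integral_multc) measurable
  also have "(NN w. ennreal (rh w)) = 1" using rhi rh0 rh1 by (subst nn_integral_eq_integral) auto
  finally show ?thesis by simp
 qed
 have "(NN x. ib z R x * ennreal (f x powr p))
  <= (NN x. ennreal (2 powr p) * (ib z R x * (NN w. ennreal (rh w) * ennreal (\<bar>f x - f (x - w)\<bar> powr p)) + ennreal ((a / V) powr p) * ib z R x))"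
 proof (rule nn_integral_mono)
  fix x
  show "ib z R x * ennreal (f x powr p) <= ennreal (2 powr p) * (ib z R x * (NN w. ennreal (rh w) * ennreal (\<bar>f x - f (x - w)\<bar> powr p)) + ennreal ((a / V) powr p) * ib z R x)"
   using point[of x] by (cases "x : ball z R") auto
 qed
 also have "... = ennreal (2 powr p) * ((NN x. ib z R x * (NN w. ennreal (rh w) * ennreal (\<bar>f x - f (x - w)\<bar> powr p))) + ennreal ((a / V) powr p) * emeasure lborel (ball z R))"
  by (subst nn_integral_cmult, measurable, subst nn_integral_add, measurable, subst nn_integral_cmult_indicator) simp_all
 also have "... <= ennreal (2 powr p) * (ennreal (h powr p) * ?I + ennreal ((a / V) powr p) * emeasure lborel (ball z R))"
  by (intro mult_left_mono add_right_mono swap) simp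
 finally show ?thesis .
qed

section \<open>Growth of energy and density of the positivity set\<close>

text \<open>The radii r (2 - 2^-n) have gaps r 2^-(n+1), so (r / d)^bet grows like 2^(bet n). The
  absorbed factor 2^-bet / 2 cancels this growth and leaves 2^-n, which is summable. The bound
  \<open>N\<close>, however large, disappears in the limit.\<close>

lemma iterate_absorb:
 fixes f :: "real => real"
 assumes step: "!!rh d. r <= rh ==> 0 < d ==> rh + d <= 2 * r ==> f rh <= (2 powr - bet / 2) * f (rh + d) + A * (r / d) powr bet + B"
  and N: "!!rh. f rh <= N" and nn: "0 <= A" "0 <= B" "0 <= bet" "0 < r"
 shows "f r <= 2 * (2 powr bet * A + B)"
proof -
 define q where "q = 2 powr - bet / (2 :: real)"
 have q: "0 < q" "q <= 1 / 2" using powr_mono[of "- bet" 0 2] nn by (auto simp: q_def)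
 define R where "R n = r * (2 - (1 / 2) ^ n)" for n :: nat
 have ind: "f r <= q ^ n * f (R n) + (2 powr bet * A + B) * (2 - 2 * (1 / 2) ^ n)" for n
 proof (induction n)
  case 0 then show ?case by (simp add: R_def)
 next
  case (Suc n)
  define d where "d = r * (1 / 2) ^ Suc n"
  have d: "0 < d" using nn by (simp add: d_def)
  have R1: "R n + d = R (Suc n)" by (simp add: R_def d_def algebra_simps)
  have "r <= R n" using nn power_le_one[of "1 / 2 :: real" n] by (simp add: R_def mult_le_cancel_left1)
  moreover have "R n + d <= 2 * r" using nn by (simp add: R1) (simp add: R_def mult.commute)
  ultimately have "f (R n) <= q * f (R (Suc n)) + A * (r / d) powr bet + B"
   using step[OF _ d] unfolding q_def R1[symmetric] by blast
  then have "q ^ n * f (R n) <= q ^ n * (q * f (R (Suc n)) + A * (r / d) powr bet + B)"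
   using q by (intro mult_left_mono) auto
  also have "... = q ^ Suc n * f (R (Suc n)) + A * (q ^ n * (r / d) powr bet) + q ^ n * B" by (simp add: algebra_simps)
  also have "q ^ n * (r / d) powr bet = 2 powr bet * (1 / 2) ^ n"
  proof -
   have "r / d = 2 ^ Suc n" using nn by (simp add: d_def power_divide)
   then have "r / d = 2 powr (real (Suc n))" using powr_realpow[of 2 "Suc n"] by simp
   then have a: "(r / d) powr bet = 2 powr (real (Suc n) * bet)" by (simp add: powr_powr)
   have "q ^ n = (2 powr (- bet - 1)) powr real n" using q by (simp add: q_def powr_diff powr_realpow)
   also have "... = 2 powr ((- bet - 1) * real n)" by (simp add: powr_powr)
   finally have "q ^ n * (r / d) powr bet = 2 powr (bet - real n)"
    unfolding a by (simp add: powr_add[symmetric] algebra_simps)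
   then show ?thesis by (simp add: powr_diff powr_realpow power_divide)
  qed
  also have "q ^ n * B <= (1 / 2) ^ n * B" using q nn by (intro mult_right_mono power_mono) auto
  finally show ?case using Suc.IH by (simp add: algebra_simps)
 qed
 have N': "f r <= q ^ n * max 0 N + 2 * (2 powr bet * A + B)" for n
 proof -
  have "q ^ n * f (R n) <= q ^ n * max 0 N" using q N[of "R n"] by (intro mult_left_mono) auto
  moreover have "(2 powr bet * A + B) * (2 - 2 * (1 / 2) ^ n) <= (2 powr bet * A + B) * 2"
   using nn by (intro mult_left_mono) auto
  ultimately show ?thesis using ind[of n] by linarith
 qed
 have "(%n. q ^ n * max 0 N + 2 * (2 powr bet * A + B)) ----> 0 * max 0 N + 2 * (2 powr bet * A + B)"
  by (intro tendsto_intros LIMSEQ_realpow_zero) (use q in auto)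
 then show ?thesis using N' by (intro LIMSEQ_le_const[of _ "2 * (2 powr bet * A + B)"]) auto
qed

section \<open>The energy estimate for an approximant on one disc\<close>

lemma measure_ball_plane: "0 <= r ==> measure lborel (ball (z :: real^2) r) = pi * r^2"
 using content_ball[of r z] by (simp add: unit_ball_vol_2)

lemma emeasure_ball_plane: "0 <= r ==> emeasure lborel (ball (z :: real^2) r) = ennreal (pi * r^2)"
 using emeasure_bounded_finite[of "ball z r"] measure_ball_plane[of r z] by (simp add: emeasure_eq_ennreal_measure)

text \<open>Radii up to 2 r are used; the factor 5/2 leaves room for the strict inequality R < s of
  \<open>caccioppoli\<close>.\<close>

context
 fixes Om :: "(real^2) set" and u v :: "real^2 => real" and g G :: "real^2 => real^2" and z :: "real^2" and p r et C :: real
 assumes harm: "weakly_p_harmonic_on_positivity_set Om p u" and p: "2 <= p"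
  and g: "g : borel_measurable borel" "Lpow p g < \<infinity>" "AE x in lebesgue. x : ball z (5 / 2 * r) --> weak_grad Om u x = g x"
  and v: "!!k. Ck k v" "continuous_on UNIV G" "!!x. x : ball z (5 / 2 * r) ==> (v has_derivative (%w. G x \<bullet> w)) (at x)"
  and close: "!!x. x : ball z (5 / 2 * r) ==> \<bar>v x - u x\<bar> <= et" "et < r" "0 < r" and sub: "ball z (5 / 2 * r) <= Om"
  and Lfin: "Lpow p (%x. G x - g x) < \<infinity>"
  and mass: "(LBINT x. ib z (2 * r) x * \<bar>v x\<bar>) <= C * r ^ 3" and C: "0 <= C"
begin

text \<open>The cut level is r itself, the natural size of \<open>u\<close> in the disc: what is
  lost below level 2 r contributes only the order that is allowed for the result.\<close>

private definition "e x = soft_cut' r (v x)"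
private definition "H x = soft_cut r (v x)"
private definition "E rh = (LBINT x. ib z rh x * (e x * norm (g x) powr p))"
private definition "HI R = (LBINT x. ib z R x * H x powr p)"
private definition "N = (LBINT x. norm (g x) powr p)"
private definition "M = (LBINT x. norm (G x - g x) powr p)"

private lemma basic:
 shows e01: "0 <= e x" "e x <= 1" and H0: "0 <= H x" "H x <= \<bar>v x\<bar>" "v x - 2 * r <= H x" "v x <= r ==> e x = 0"
  and vc: "continuous_on UNIV v" and ec: "continuous_on UNIV e" and Hc: "continuous_on UNIV H"
 using soft_cut_bounds[OF close(3), of "v x"] v(1)[of 0] continuous_soft_cut'[OF _ close(3), of UNIV v] Ck_soft_cut[OF v(1), of 0 r]
 by (auto simp: e_def H_def e_def [abs_def] H_def [abs_def])

private lemma ig: "integrable lborel (%x. norm (g x) powr p)" and iG: "integrable lborel (%x. norm (G x - g x) powr p)"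
proof -
 have "(%x. G x - g x) : borel_measurable borel"
  by (intro borel_measurable_diff cont_borel v(2) g(1))
 then show "integrable lborel (%x. norm (g x) powr p)" "integrable lborel (%x. norm (G x - g x) powr p)"
  using g Lfin by (simp_all add: integrable_Lpow_iff)
qed

private lemma iE: "integrable lborel (%x. ib z a x * (e x * norm (g x) powr p))"
proof (rule B_integrable_bound[OF ig])
 show "AE x in lborel. norm (ib z a x * (e x * norm (g x) powr p)) <= norm (norm (g x) powr p)"
 proof (rule AE_I2)
  fix x
  show "norm (ib z a x * (e x * norm (g x) powr p)) <= norm (norm (g x) powr p)"
   using mult_left_le_one_le[of "norm (g x) powr p" "e x"] e01[of x] by (cases "x : ball z a") auto
 qed
 have [measurable]: "e : borel_measurable borel" "g : borel_measurable borel"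
  using ec g(1) by (auto intro: cont_borel)
 show "(%x. ib z a x * (e x * norm (g x) powr p)) : borel_measurable lborel" by simp
qed

private lemma E_mono: "a <= b ==> E a <= E b"
 unfolding E_def by (intro integral_mono iE) (auto simp: indicator_def e01)

private lemma E_le_N: "E a <= N"
 unfolding E_def N_def
proof (intro integral_mono iE ig)
 fix x
 show "ib z a x * (e x * norm (g x) powr p) <= norm (g x) powr p"
  using mult_left_le_one_le[of "norm (g x) powr p" "e x"] e01[of x] by (cases "x : ball z a") auto
qed

private lemma nonneg: "0 <= E a" "0 <= N" "0 <= M" "0 <= HI a"
 by (auto simp: E_def N_def M_def HI_def e01 intro!: B_integral_nonneg)

private lemma iH: "integrable lborel (%x. ib z R x * H x powr p)"
 by (rule integrable_ball_continuous) (intro continuous_on_powr' continuous_intros Hc, use H0 p in auto)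

text \<open>The gradient of \<open>H\<close> is \<open>e *R G\<close>. As e is between 0 and 1, e^p
  <= e, so the weighted energy \<open>E\<close> reappears; passing from \<open>G\<close> to
  \<open>g\<close> costs \<open>M\<close>.\<close>

private lemma H_average:
 assumes h: "0 < h" "0 < R" "R + h <= 2 * r"
 shows "HI R <= 2 powr p * (h powr p * (2 powr p * (E (R + h) + M)) + (C * r ^ 3 / (pi * h^2)) powr p * (pi * R^2))"
proof -
 have Fc: "continuous_on UNIV (%x. e x *R G x)" by (intro continuous_intros ec v(2))
 have iGE: "integrable lborel (%x. ib z (R + h) x * (e x * norm (g x) powr p) + norm (G x - g x) powr p)"
  by (intro B_integrable_add iE iG)
 have I: "(NN x. ib z (R + h) x * ennreal (norm (e x *R G x) powr p)) <= ennreal (2 powr p * (E (R + h) + M))"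
 proof -
  have "(NN x. ib z (R + h) x * ennreal (norm (e x *R G x) powr p))
   <= (NN x. ennreal (2 powr p * (ib z (R + h) x * (e x * norm (g x) powr p) + norm (G x - g x) powr p)))"
  proof (rule nn_integral_mono)
   fix x
   have "norm (e x *R G x) powr p = e x powr p * norm (G x) powr p" using e01[of x] by (simp add: powr_mult)
   also have "... <= e x * norm (G x) powr p"
   proof (rule mult_right_mono)
    have "e x powr p <= e x powr 1" using e01[of x] p by (intro powr_mono') auto
    then show "e x powr p <= e x" using e01[of x] by simp
   qed simp
   also have "... <= e x * (2 powr p * (norm (g x) powr p + norm (G x - g x) powr p))"
   proof (rule mult_left_mono[OF _ e01(1)])
    have "norm (G x) powr p <= (norm (g x) + norm (G x - g x)) powr p"
     using norm_triangle_ineq[of "g x" "G x - g x"] p by (intro powr_mono2) auto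
    also have "... <= 2 powr p * (norm (g x) powr p + norm (G x - g x) powr p)" using p by (intro powr_add_le) auto
    finally show "norm (G x) powr p <= 2 powr p * (norm (g x) powr p + norm (G x - g x) powr p)" .
   qed
   also have "... <= 2 powr p * (e x * norm (g x) powr p + norm (G x - g x) powr p)"
    using mult_right_mono[OF e01(2)[of x], of "2 powr p * norm (G x - g x) powr p"] by (simp add: algebra_simps)
   finally have *: "norm (e x *R G x) powr p <= 2 powr p * (e x * norm (g x) powr p + norm (G x - g x) powr p)" .
   show "ib z (R + h) x * ennreal (norm (e x *R G x) powr p)
    <= ennreal (2 powr p * (ib z (R + h) x * (e x * norm (g x) powr p) + norm (G x - g x) powr p))"
    using * by (cases "x : ball z (R + h)") (simp_all add: ennreal_leI)
  qed
  also have "... = ennreal (LBINT x. 2 powr p * (ib z (R + h) x * (e x * norm (g x) powr p) + norm (G x - g x) powr p))"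
   by (rule nn_integral_eq_integral[OF integrable_mult_right[OF iGE]]) (simp add: e01)
  also have "(LBINT x. 2 powr p * (ib z (R + h) x * (e x * norm (g x) powr p) + norm (G x - g x) powr p)) = 2 powr p * (E (R + h) + M)"
   unfolding E_def M_def B_integral_mult_right_zero
   by (subst B_integral_add[OF iE iG]) (rule refl)
  finally show ?thesis .
 qed
 have der: "(H has_derivative (%w. (e x *R G x) \<bullet> w)) (at x)" if "x : ball z (5 / 2 * r)" for x
  unfolding H_def e_def
  by (rule has_derivative_eq_rhs, rule DERIV_compose_FDERIV[OF soft_cut_has_derivative[OF close(3)] v(3)[OF that]])
   (auto simp: mult.commute)
 have a: "(LBINT y. ib z (R + h) y * H y) <= C * r ^ 3"
 proof -
  have "(LBINT y. ib z (R + h) y * H y) <= (LBINT x. ib z (2 * r) x * \<bar>v x\<bar>)"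
  proof (rule integral_mono[OF integrable_ball_continuous[OF Hc] integrable_ball_continuous])
   show "continuous_on UNIV (%x. \<bar>v x\<bar>)" by (intro continuous_intros vc)
   show "ib z (R + h) x * H x <= ib z (2 * r) x * \<bar>v x\<bar>" for x
    using h H0(1,2)[of x] by (auto simp: indicator_def)
  qed
  then show ?thesis using mass by simp
 qed
 have V: "pi * h^2 = measure lborel (ball (0 :: real^2) h)" using measure_ball_plane[of h 0] h by simp
 have "ennreal (HI R) = (NN x. ennreal (ib z R x * H x powr p))"
  unfolding HI_def by (rule nn_integral_eq_integral[symmetric, OF iH]) simp
 also have "... = (NN x. ib z R x * ennreal (H x powr p))"
  by (intro nn_integral_cong) (simp add: indicator_def)
 also have "... <= ennreal (2 powr p) * (ennreal (h powr p) * (NN x. ib z (R + h) x * ennreal (norm (e x *R G x) powr p))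
    + ennreal ((C * r ^ 3 / (pi * h^2)) powr p) * emeasure lborel (ball z R))"
  by (rule sobolev_average[OF Fc der Hc H0(1) _ h(1) _ a V]) (use p h in auto)
 also have "... <= ennreal (2 powr p) * (ennreal (h powr p) * ennreal (2 powr p * (E (R + h) + M))
    + ennreal ((C * r ^ 3 / (pi * h^2)) powr p) * ennreal (pi * R^2))"
  using I h by (intro mult_left_mono add_mono) (auto simp: emeasure_ball_plane)
 also have "... = ennreal (2 powr p * (h powr p * (2 powr p * (E (R + h) + M)) + (C * r ^ 3 / (pi * h^2)) powr p * (pi * R^2)))"
  using nonneg by (simp add: ennreal_mult[symmetric] ennreal_plus[symmetric] del: ennreal_plus)
 finally show ?thesis using nonneg by (subst (asm) ennreal_le_iff) auto
qed

text \<open>Caccioppoli from rh to halfway, then averaging on the other half with the short step ka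
  d / 2. The energy returns with the factor ka^p, which can be made small. The mass term carries (1
  / d)^p (r^3 / d^2)^p besides powers of ka, and this accounts for the exponent 3 p.\<close>

private lemma energy_step:
 assumes d: "r <= rh" "0 < d" "rh + d <= 2 * r" and dl: "0 < dl" and sg: "0 < sg" and ka: "0 < ka" "ka <= 1"
 shows "E rh <= (3 * dl + 3 * dl powr (1 - p) * 16 powr p * ka powr p) * E (rh + d)
  + 3 * dl powr (1 - p) * (4 * pi) * (16 powr p + (64 * C / (pi * ka^2)) powr p) * r^2 * (r / d) powr (3 * p)
  + (3 * (dl powr (1 - p) * 16 powr p * ka powr p + sg powr (1 - p)) * M + 3 * sg * N)"
proof -
 define R where "R = rh + d / 2"
 define h where "h = ka * d / 2"
 define D where "D = 3 * dl powr (1 - p)"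
 define t where "t = (r / d) powr (3 * p)"
 have D0: "0 <= D" by (simp add: D_def)
 have R: "rh < R" "0 < R" "R <= 2 * r" "R <= rh + d" and h: "0 < h" "R + h <= rh + d"
 proof -
  show "rh < R" "0 < R" "R <= 2 * r" "R <= rh + d" "0 < h" using d close(3) ka by (auto simp: R_def h_def)
  have "ka * d <= d" using ka d by simp
  then show "R + h <= rh + d" by (simp add: R_def h_def)
 qed
 let ?V = "\<integral>x. ib z R x * (e x * \<bar>v x\<bar> powr p) \<partial>lborel"
 have cac: "E rh <= 3 * (dl * E R + dl powr (1 - p) * (4 / d) powr p * ?V + sg * N + sg powr (1 - p) * M)"
 proof -
  have "2 / (R - rh) = 4 / d" by (simp add: R_def)
  moreover have "0 < rh" "R < 5 / 2 * r" using d R close(3) by auto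
  ultimately show ?thesis
   using caccioppoli[OF harm p g v close(1) close(2,3) sub Lfin _ R(1) _ dl sg]
   by (simp add: E_def N_def M_def e_def)
 qed
 have V: "?V <= 2 powr p * (HI R + (2 * r) powr p * (pi * (2 * r)^2))"
 proof -
  have "?V <= (LBINT x. 2 powr p * (ib z R x * H x powr p + (2 * r) powr p * (ib z R x * 1)))"
  proof (rule integral_mono)
   show "integrable lborel (%x. ib z R x * (e x * \<bar>v x\<bar> powr p))"
    by (rule integrable_ball_continuous) (intro continuous_on_powr' continuous_intros vc ec, use p in auto)
   show "integrable lborel (%x. 2 powr p * (ib z R x * H x powr p + (2 * r) powr p * (ib z R x * 1)))"
    by (intro integrable_mult_right B_integrable_add iH integrable_ball_continuous) simp
   fix x
   have "e x * \<bar>v x\<bar> powr p <= 2 powr p * (H x powr p + (2 * r) powr p)"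
   proof (cases "v x <= r")
    case True
    then show ?thesis using H0(4)[of x] by (auto intro!: mult_nonneg_nonneg add_nonneg_nonneg)
   next
    case False
    then have vx: "0 <= v x" using close(3) by simp
    have "e x * \<bar>v x\<bar> powr p <= 1 * \<bar>v x\<bar> powr p" using e01 by (intro mult_right_mono) auto
    also have "... <= (H x + 2 * r) powr p" using vx H0(3)[of x] p by (simp, intro powr_mono2) auto
    also have "... <= 2 powr p * (H x powr p + (2 * r) powr p)" using H0(1)[of x] close(3) p by (intro powr_add_le) auto
    finally show ?thesis .
   qed
   then show "ib z R x * (e x * \<bar>v x\<bar> powr p) <= 2 powr p * (ib z R x * H x powr p + (2 * r) powr p * (ib z R x * 1))"
    by (cases "x : ball z R") auto
  qed
  also have "... = 2 powr p * (HI R + (2 * r) powr p * (pi * R^2))"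
   unfolding HI_def B_integral_mult_right_zero
   by (subst B_integral_add[OF iH integrable_mult_right[OF integrable_ball_continuous]])
    (use R measure_ball_plane[of R z] in simp_all)
  also have "... <= 2 powr p * (HI R + (2 * r) powr p * (pi * (2 * r)^2))"
   using R by (intro mult_left_mono add_left_mono power_mono) auto
  finally show ?thesis .
 qed
 have Rh: "R + h <= 2 * r" using h d by linarith
 have HIle: "HI R <= 2 powr p * (h powr p * (2 powr p * (E (rh + d) + M)) + (C * r ^ 3 / (pi * h^2)) powr p * (pi * (2 * r)^2))"
 proof -
  have "HI R <= 2 powr p * (h powr p * (2 powr p * (E (R + h) + M)) + (C * r ^ 3 / (pi * h^2)) powr p * (pi * R^2))"
   by (rule H_average[OF h(1) R(2) Rh])
  also have "... <= 2 powr p * (h powr p * (2 powr p * (E (rh + d) + M)) + (C * r ^ 3 / (pi * h^2)) powr p * (pi * (2 * r)^2))"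
   using R E_mono[OF h(2)] by (intro mult_left_mono add_mono power_mono add_right_mono) auto
  finally show ?thesis .
 qed
 have rd: "0 < r / d" "1 <= r / d" using d close(3) by auto
 have t1: "(r / d) powr p <= t" unfolding t_def using rd p by (intro powr_mono) auto
 \<comment> \<open>With h = ka d / 2 the bases multiply to 16 ka, independently of d.\<close>
 have p1: "(4 / d) powr p * (2 powr p * (2 powr p * (h powr p * 2 powr p))) = 16 powr p * ka powr p"
 proof -
  have "4 / d * (2 * (2 * (h * 2))) = 16 * ka" using d by (simp add: h_def)
  then have "(4 / d * (2 * (2 * (h * 2)))) powr p = (16 * ka) powr p" by (rule arg_cong)
  then show ?thesis by (simp only: powr_mult)
 qed
 have p2: "(4 / d) powr p * (2 powr p * (2 * r) powr p) <= 16 powr p * t"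
 proof -
  have "4 / d * (2 * (2 * r)) = 16 * (r / d)" by simp
  then have "(4 / d * (2 * (2 * r))) powr p = (16 * (r / d)) powr p" by (rule arg_cong)
  then have "(4 / d) powr p * (2 powr p * (2 * r) powr p) = 16 powr p * (r / d) powr p" by (simp only: powr_mult)
  also have "... <= 16 powr p * t" using t1 by (intro mult_left_mono) auto
  finally show ?thesis .
 qed
 have p3: "(4 / d) powr p * (2 powr p * (2 powr p * (C * r ^ 3 / (pi * h^2)) powr p)) = (64 * C / (pi * ka^2)) powr p * t"
 proof -
  have "4 / d * (2 * (2 * (C * r ^ 3 / (pi * h^2)))) = 64 * C / (pi * ka^2) * (r / d) ^ 3"
   using d ka by (simp add: h_def field_simps power2_eq_square power3_eq_cube)
  then have "(4 / d * (2 * (2 * (C * r ^ 3 / (pi * h^2))))) powr p = (64 * C / (pi * ka^2) * (r / d) ^ 3) powr p" by (rule arg_cong)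
  moreover have "((r / d) ^ 3) powr p = t"
   unfolding t_def using rd powr_powr[of "r / d" 3 p] by simp
  ultimately show ?thesis by (simp only: powr_mult)
 qed
 have key: "(4 / d) powr p * ?V <= 16 powr p * ka powr p * (E (rh + d) + M) + (4 * pi) * (16 powr p + (64 * C / (pi * ka^2)) powr p) * r^2 * t"
 proof -
  let ?X = "(4 / d) powr p"
  have "?X * ?V <= ?X * (2 powr p * (2 powr p * (h powr p * (2 powr p * (E (rh + d) + M)) + (C * r ^ 3 / (pi * h^2)) powr p * (pi * (2 * r)^2)) + (2 * r) powr p * (pi * (2 * r)^2)))"
   using V HIle by (intro mult_left_mono) (auto intro: order_trans mult_left_mono add_right_mono)
  also have "... = (?X * (2 powr p * (2 powr p * (h powr p * 2 powr p)))) * (E (rh + d) + M)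
    + (?X * (2 powr p * (2 powr p * (C * r ^ 3 / (pi * h^2)) powr p))) * (pi * (2 * r)^2)
    + (?X * (2 powr p * (2 * r) powr p)) * (pi * (2 * r)^2)"
   by (simp only: distrib_left distrib_right mult_ac)
  also have "... <= (16 powr p * ka powr p) * (E (rh + d) + M)
    + ((64 * C / (pi * ka^2)) powr p * t) * (pi * (2 * r)^2) + (16 powr p * t) * (pi * (2 * r)^2)"
   unfolding p1 p3 using p2 by (intro add_left_mono mult_right_mono) auto
  finally show ?thesis by (simp add: algebra_simps power2_eq_square)
 qed
 have "E rh <= 3 * (dl * E (rh + d) + dl powr (1 - p) * (16 powr p * ka powr p * (E (rh + d) + M) + (4 * pi) * (16 powr p + (64 * C / (pi * ka^2)) powr p) * r^2 * t) + sg * N + sg powr (1 - p) * M)"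
 proof -
  have f1: "dl * E R <= dl * E (rh + d)" using dl E_mono[OF R(4)] by simp
  have f2: "dl powr (1 - p) * (4 / d) powr p * ?V <= dl powr (1 - p) * (16 powr p * ka powr p * (E (rh + d) + M) + (4 * pi) * (16 powr p + (64 * C / (pi * ka^2)) powr p) * r^2 * t)"
   unfolding mult.assoc[of "dl powr (1 - p)"] using key by (intro mult_left_mono) (auto simp: mult.assoc)
  show ?thesis
   by (rule order_trans[OF cac mult_left_mono[OF add_right_mono[OF add_right_mono[OF add_mono[OF f1 f2]]]]]) simp
 qed
 then show ?thesis unfolding t_def by (simp add: algebra_simps)
qed

text \<open>Absorption with bet = 3 p bounds the energy on the disc of radius r, and one more
  averaging with step r / 2 turns it into an L^p bound on the half disc.\<close>

lemma energy_bound: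
 assumes ka: "0 < ka" "ka <= 1" and dl: "0 < dl" and q: "3 * dl + 3 * dl powr (1 - p) * 16 powr p * ka powr p <= 2 powr (- (3 * p)) / 2"
  and sg: "0 < sg"
 defines "A \<equiv> 3 * dl powr (1 - p) * (4 * pi) * (16 powr p + (64 * C / (pi * ka^2)) powr p)"
  and "B \<equiv> 3 * (dl powr (1 - p) * 16 powr p * ka powr p + sg powr (1 - p)) * (LBINT x. norm (G x - g x) powr p) + 3 * sg * (LBINT x. norm (g x) powr p)"
 shows "(LBINT x. ib z (r / 2) x * soft_cut r (v x) powr p)
  <= 2 powr p * (r powr p * (2 * (2 powr (3 * p) * (A * r^2) + B) + (LBINT x. norm (G x - g x) powr p)) + (4 * C * r / pi) powr p * (pi * r^2))"
proof -
 have Er: "E r <= 2 * (2 powr (3 * p) * (A * r^2) + B)"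
 proof (rule iterate_absorb[where N = N and f = E and r = r])
  fix rh d assume d: "r <= rh" "0 < d" "rh + d <= 2 * r"
  have "E rh <= (3 * dl + 3 * dl powr (1 - p) * 16 powr p * ka powr p) * E (rh + d) + A * r^2 * (r / d) powr (3 * p) + B"
   using energy_step[OF d dl sg ka] by (simp only: A_def B_def M_def N_def)
  moreover have "(3 * dl + 3 * dl powr (1 - p) * 16 powr p * ka powr p) * E (rh + d) <= (2 powr (- (3 * p)) / 2) * E (rh + d)"
   by (rule mult_right_mono[OF q nonneg(1)])
  ultimately show "E rh <= (2 powr (- (3 * p)) / 2) * E (rh + d) + A * r^2 * (r / d) powr (3 * p) + B" by linarith
 qed (use E_le_N close(3) p sg nonneg in \<open>auto simp: A_def B_def M_def[symmetric] N_def[symmetric]\<close>)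
 have "HI (r / 2) <= 2 powr p * ((r / 2) powr p * (2 powr p * (E (r / 2 + r / 2) + M)) + (C * r ^ 3 / (pi * (r / 2)^2)) powr p * (pi * (r / 2)^2))"
  by (rule H_average) (use close(3) in auto)
 also have "(r / 2) powr p * (2 powr p * (E (r / 2 + r / 2) + M)) = r powr p * (E r + M)"
 proof -
  have "(r / 2 * 2) powr p = (r / 2) powr p * 2 powr p" by (rule powr_mult)
  then show ?thesis by (simp add: mult.assoc[symmetric])
 qed
 also have "C * r ^ 3 / (pi * (r / 2)^2) = 4 * C * r / pi" using close(3) by (simp add: field_simps power2_eq_square power3_eq_cube)
 also have "2 powr p * (r powr p * (E r + M) + (4 * C * r / pi) powr p * (pi * (r / 2)^2))
  <= 2 powr p * (r powr p * (2 * (2 powr (3 * p) * (A * r^2) + B) + M) + (4 * C * r / pi) powr p * (pi * r^2))"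
  using Er close(3) by (intro mult_left_mono add_mono power_mono) auto
 finally show ?thesis by (simp only: HI_def H_def M_def)
qed

end

lemma absorption_parameters:
 fixes p :: real
 assumes p: "2 <= p"
 obtains dl ka :: real where "0 < dl" "0 < ka" "ka <= 1"
  "3 * dl + 3 * dl powr (1 - p) * 16 powr p * ka powr p <= 2 powr (- (3 * p)) / 2"
proof -
 define Q where "Q = 2 powr (- (3 * p)) / (2 :: real)"
 \<comment> \<open>Half of \<open>Q\<close> is given to each term: 3 dl = Q / 2, and
   \<open>ka\<close> is solved from the second one.\<close>
 define dl where "dl = Q / 6"
 define ka where "ka = (Q * dl powr (p - 1) / 6) powr (1 / p) / 16"
 have Q: "0 < Q" "Q <= 1" using powr_mono[of "- (3 * p)" 0 2] p by (auto simp: Q_def)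
 have dl: "0 < dl" "dl <= 1" using Q by (auto simp: dl_def)
 have "dl powr (p - 1) <= 1" using dl p by (intro powr_le1) auto
 then have "Q * dl powr (p - 1) <= 1" using Q by (intro mult_le_one) auto
 then have "(Q * dl powr (p - 1) / 6) powr (1 / p) <= 1" using Q p by (intro powr_le1) auto
 then have ka: "0 < ka" "ka <= 1" using Q dl by (auto simp: ka_def)
 have "16 * ka = (Q * dl powr (p - 1) / 6) powr (1 / p)" by (simp add: ka_def)
 then have "(16 * ka) powr p = ((Q * dl powr (p - 1) / 6) powr (1 / p)) powr p" by simp
 also have "... = Q * dl powr (p - 1) / 6" using Q dl p by (simp add: powr_powr)
 finally have "16 powr p * ka powr p = Q * dl powr (p - 1) / 6" by (simp add: powr_mult)
 then have e: "3 * dl powr (1 - p) * 16 powr p * ka powr p = 3 * dl powr (1 - p) * (Q * dl powr (p - 1) / 6)"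
  by (simp only: mult.assoc)
 have one: "dl powr (1 - p) * dl powr (p - 1) = 1" using dl by (simp add: powr_add[symmetric])
 have "3 * a * (Q * b / 6) = Q / 2 * (a * b)" for a b :: real by simp
 then have "3 * dl powr (1 - p) * 16 powr p * ka powr p = Q / 2" unfolding e by (simp only: one mult_1_right)
 then have "3 * dl + 3 * dl powr (1 - p) * 16 powr p * ka powr p <= Q" by (simp add: dl_def)
 with dl(1) ka show thesis unfolding Q_def by (rule that)
qed

lemma borel_measurable_ball_continuous:
 fixes u :: "'a::euclidean_space => real"
 assumes "continuous_on Om u" "ball z r <= Om"
 shows "(%x. ib z r x * u x) : borel_measurable borel"
proof -
 have "(%x. ib z r x *R u x) : borel_measurable borel"
  by (rule borel_measurable_continuous_on_indicator) (use continuous_on_subset[OF assms] in auto)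
 then show ?thesis by simp
qed

lemma integrable_ball_continuous_on:
 fixes u :: "'a::euclidean_space => real"
 assumes "continuous_on Om u" "cball z r <= Om"
 shows "integrable lborel (%x. ib z r x * u x)"
proof (rule B_integrable_bound)
 show "integrable lborel (%x. indicator (cball z r) x *R u x)"
  by (rule borel_integrable_compact) (use continuous_on_subset[OF assms] in auto)
 have "ball z r <= Om" using assms(2) ball_subset_cball by blast
 then show "(%x. ib z r x * u x) : borel_measurable lborel"
  using borel_measurable_ball_continuous[OF assms(1)] by simp
qed (auto simp: indicator_def)

text \<open>\<open>K\<close> has to be independent of the disc, although no bound on the p-energy of
  \<open>g\<close> of the right order is known. Therefore sg and the quality et of the approximation
  are chosen last, depending on the disc, so that all error terms are at most r^2.\<close>

lemma Lp_growth:
 fixes u :: "real^2 => real"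
 assumes harm: "weakly_p_harmonic_on_positivity_set Om p u" and p: "2 <= p"
  and W: "sobolev_W1 Om p u" and cu: "continuous_on Om u" and u0: "!!x. x : Om ==> 0 <= u x" and C: "0 <= C"
 obtains K where "0 < K" "!!z r. 0 < r ==> cball z (3 * r) <= Om ==>
  (LBINT x. ib z (2 * r) x * u x) <= C * r ^ 3 ==>
  (NN x. ib z (r / 2) x * ennreal (u x powr p)) <= ennreal (K * r powr (p + 2))"
proof -
 obtain dl ka :: real where dl: "0 < dl" and ka: "0 < ka" "ka <= 1"
  and q: "3 * dl + 3 * dl powr (1 - p) * 16 powr p * ka powr p <= 2 powr (- (3 * p)) / 2"
  using absorption_parameters[OF p] by blast
 \<comment> \<open>Replacing \<open>u\<close> by \<open>v\<close> adds at most (r / 2) * 4 * (2 r)^2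
   = 8 r^3 to the mass.\<close>
 define C' where "C' = C + 8"
 define A where "A = 3 * dl powr (1 - p) * (4 * pi) * (16 powr p + (64 * C' / (pi * ka^2)) powr p)"
 define D where "D = dl powr (1 - p) * 16 powr p * ka powr p"
 define K1 where "K1 = 2 powr p * (2 * (2 powr (3 * p) * A + 1) + 1 + (4 * C' / pi) powr p * pi)"
 define K where "K = 2 powr p * (K1 + 3 powr p * pi)"
 have A0: "0 <= A" and D0: "0 <= D" by (auto simp: A_def D_def)
 have K10: "0 <= K1" using A0 by (simp add: K1_def)
 have K0: "0 < K" using K10 by (simp add: K_def add_nonneg_pos)
 show thesis
 proof (rule that[OF K0])
  fix z :: "real^2" and r :: real
  assume r: "0 < r" and sub: "cball z (3 * r) <= Om" and mass: "(LBINT x. ib z (2 * r) x * u x) <= C * r ^ 3"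
  have s: "5 / 2 * r < 3 * r" using r by simp
  obtain g where g: "g : borel_measurable borel" "Lpow p g < \<infinity>"
   "AE x in lebesgue. x : ball z (5 / 2 * r) --> weak_grad Om u x = g x"
   and approx: "!!et :: real. 0 < et ==> EX v G. (ALL k. Ck k v) & continuous_on UNIV G &
   (ALL x:ball z (5 / 2 * r). (v has_derivative (%w. G x \<bullet> w)) (at x)) &
   (ALL x:ball z (5 / 2 * r). \<bar>v x - u x\<bar> <= et) & Lpow p (%x. G x - g x) <= ennreal et"
  proof -
   have "1 <= p" using p by simp
   from sobolev_approx[OF W cu this sub s] that show thesis by blast
  qed
  define N where "N = (LBINT x. norm (g x) powr p)"
  have N0: "0 <= N" unfolding N_def by (intro B_integral_nonneg) simp
  \<comment> \<open>\<open>N\<close> is finite but not controlled; this makes its term at most r^2 /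
    2.\<close>
  define sg where "sg = r^2 / (6 * (N + 1))"
  have sg: "0 < sg" "3 * sg * N <= r^2 / 2"
  proof -
   show "0 < sg" using r N0 by (simp add: sg_def)
   have "3 * sg * N = r^2 / 2 * (N / (N + 1))" using N0 by (simp add: sg_def field_simps)
   also have "... <= r^2 / 2 * 1" using N0 by (intro mult_left_mono) auto
   finally show "3 * sg * N <= r^2 / 2" by simp
  qed
  define P where "P = D + sg powr (1 - p) + 1"
  have P: "1 <= P" using D0 by (simp add: P_def)
  \<comment> \<open>The second bound makes 3 P M at most r^2 / 2, the first keeps et below the cut
    level r.\<close>
  define et where "et = min (r / 2) (r^2 / (6 * P))"
  have et: "0 < et" "et < r" "et <= r / 2" "et <= r^2 / (6 * P)" using r P by (auto simp: et_def)
  obtain v G where v: "!!k. Ck k v" "continuous_on UNIV G"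
   "!!x. x : ball z (5 / 2 * r) ==> (v has_derivative (%w. G x \<bullet> w)) (at x)"
   and close: "!!x. x : ball z (5 / 2 * r) ==> \<bar>v x - u x\<bar> <= et" and Lle: "Lpow p (%x. G x - g x) <= ennreal et"
   using approx[OF et(1)] by blast
  have Lfin: "Lpow p (%x. G x - g x) < \<infinity>" using Lle by (rule le_less_trans) simp
  define M where "M = (LBINT x. norm (G x - g x) powr p)"
  have Gg: "(%x. G x - g x) : borel_measurable borel"
   by (intro borel_measurable_diff cont_borel v(2) g(1))
  have M: "0 <= M" "M <= et"
  proof -
   show M0: "0 <= M" unfolding M_def by (intro B_integral_nonneg) simp
   have "integrable lborel (%x. norm (G x - g x) powr p)" using integrable_Lpow_iff[OF Gg] Lfin by simp
   then have "Lpow p (%x. G x - g x) = ennreal M" unfolding Lpow_def M_def by (intro nn_integral_eq_integral) auto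
   then show "M <= et" using Lle et(1) by simp
  qed
  have sub': "ball z (5 / 2 * r) <= Om" "cball z (2 * r) <= Om" "ball z (2 * r) <= ball z (5 / 2 * r)" "ball z (r / 2) <= ball z (5 / 2 * r)"
   using sub r by (auto intro!: subset_trans[OF _ sub] simp: subset_ball subset_iff)
  have vc: "continuous_on UNIV v" using v(1)[of 0] by simp
  have mass': "(LBINT x. ib z (2 * r) x * \<bar>v x\<bar>) <= C' * r ^ 3"
  proof -
   have i1: "integrable lborel (%x. ib z (2 * r) x * u x)" by (rule integrable_ball_continuous_on[OF cu sub'(2)])
   have i2: "integrable lborel (%x. et * (ib z (2 * r) x * 1))"
    by (rule integrable_mult_right[OF integrable_ball_continuous]) simp
   have "(LBINT x. ib z (2 * r) x * \<bar>v x\<bar>)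
    <= (LBINT x. ib z (2 * r) x * u x + et * (ib z (2 * r) x * 1))"
   proof (rule integral_mono)
    show "integrable lborel (%x. ib z (2 * r) x * \<bar>v x\<bar>)"
     by (rule integrable_ball_continuous) (intro continuous_intros vc)
    show "integrable lborel (%x. ib z (2 * r) x * u x + et * (ib z (2 * r) x * 1))"
     by (rule B_integrable_add[OF i1 i2])
    show "ib z (2 * r) x * \<bar>v x\<bar> <= ib z (2 * r) x * u x + et * (ib z (2 * r) x * 1)" for x
    proof (cases "x : ball z (2 * r)")
     case True
     then have x: "x : ball z (5 / 2 * r)" using sub'(3) by blast
     then have "0 <= u x" using sub'(1) u0 by blast
     then show ?thesis using close[OF x] True by simp
    qed simp
   qed
   also have "... = (LBINT x. ib z (2 * r) x * u x) + et * (pi * (2 * r)^2)"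
    by (subst B_integral_add[OF i1 i2]) (use r measure_ball_plane[of "2 * r" z] in simp)
   also have "... <= C * r ^ 3 + r / 2 * (4 * (2 * r)^2)"
    using mass et pi_less_4 by (intro add_mono mult_mono) auto
   also have "... = C' * r ^ 3" by (simp add: C'_def power2_eq_square power3_eq_cube algebra_simps)
   finally show ?thesis .
  qed
  define B where "B = 3 * (D + sg powr (1 - p)) * M + 3 * sg * N"
  have C': "0 <= C'" using C by (simp add: C'_def)
  have eb: "(LBINT x. ib z (r / 2) x * soft_cut r (v x) powr p)
   <= 2 powr p * (r powr p * (2 * (2 powr (3 * p) * (A * r^2) + B) + M) + (4 * C' * r / pi) powr p * (pi * r^2))"
   using energy_bound[OF harm p g v close et(2) r sub'(1) Lfin mass' C' ka dl q sg(1)]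
   by (simp only: A_def B_def D_def M_def N_def)
  have B: "B <= r^2" and Mr: "M <= r^2"
  proof -
   have PM: "P * M <= r^2 / 6"
   proof -
    have "P * M <= P * (r^2 / (6 * P))" using M(2) et(4) P by (intro mult_left_mono) auto
    then show ?thesis using P by simp
   qed
   have "(D + sg powr (1 - p)) * M <= P * M" using M by (intro mult_right_mono) (auto simp: P_def)
   moreover have "B = 3 * ((D + sg powr (1 - p)) * M) + 3 * sg * N" by (simp only: B_def mult.assoc)
   ultimately show "B <= r^2" using PM sg(2) by linarith
   have "1 * M <= P * M" using P M by (intro mult_right_mono) auto
   then show "M <= r^2" using PM zero_le_power2[of r] by linarith
  qed
  have eb2: "(LBINT x. ib z (r / 2) x * soft_cut r (v x) powr p) <= K1 * r powr (p + 2)"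
  proof -
   have "(LBINT x. ib z (r / 2) x * soft_cut r (v x) powr p)
    <= 2 powr p * (r powr p * (2 * (2 powr (3 * p) * (A * r^2) + r^2) + r^2) + (4 * C' * r / pi) powr p * (pi * r^2))"
    by (rule order_trans[OF eb]) (intro mult_left_mono add_right_mono add_mono add_left_mono B Mr; simp)
   also have "(4 * C' * r / pi) powr p = (4 * C' / pi) powr p * r powr p"
    using powr_mult[of "4 * C' / pi" r p] by simp
   also have "2 powr p * (r powr p * (2 * (2 powr (3 * p) * (A * r^2) + r^2) + r^2) + (4 * C' / pi) powr p * r powr p * (pi * r^2)) = K1 * (r powr p * r^2)"
    by (simp add: K1_def algebra_simps)
   also have "r powr p * r^2 = r powr (p + 2)" using r by (simp add: powr_add powr_numeral)
   finally show ?thesis .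
  qed
  define H where "H x = soft_cut r (v x)" for x
  have Hc: "continuous_on UNIV H" unfolding H_def using Ck_soft_cut[OF v(1), of 0 r] by simp
  have H0: "0 <= H x" "v x - 2 * r <= H x" for x using soft_cut_bounds(5,7)[OF r, of "v x"] by (auto simp: H_def)
  have iH: "integrable lborel (%x. ib z (r / 2) x * H x powr p)"
   by (rule integrable_ball_continuous) (intro continuous_on_powr' continuous_intros Hc, use H0 p in auto)
  have i3: "integrable lborel (%x. (3 * r) powr p * (ib z (r / 2) x * 1))"
   by (rule integrable_mult_right[OF integrable_ball_continuous]) simp
  have "(NN x. ib z (r / 2) x * ennreal (u x powr p))
   <= (NN x. ennreal (2 powr p * (ib z (r / 2) x * H x powr p + (3 * r) powr p * (ib z (r / 2) x * 1))))"
  proof (rule nn_integral_mono)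
   fix x
   show "ib z (r / 2) x * ennreal (u x powr p)
    <= ennreal (2 powr p * (ib z (r / 2) x * H x powr p + (3 * r) powr p * (ib z (r / 2) x * 1)))"
   proof (cases "x : ball z (r / 2)")
    case True
    then have x: "x : ball z (5 / 2 * r)" using sub'(4) by blast
    then have "0 <= u x" using sub'(1) u0 by blast
    moreover have "u x <= H x + 3 * r" using close[OF x] et(2) H0(2)[of x] by linarith
    ultimately have "u x powr p <= (H x + 3 * r) powr p" using p by (intro powr_mono2) auto
    also have "... <= 2 powr p * (H x powr p + (3 * r) powr p)" using H0(1)[of x] r p by (intro powr_add_le) auto
    finally show ?thesis using True by (simp add: ennreal_leI)
   qed simp
  qed
  also have "... = ennreal (LBINT x. 2 powr p * (ib z (r / 2) x * H x powr p + (3 * r) powr p * (ib z (r / 2) x * 1)))"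
   by (rule nn_integral_eq_integral[OF integrable_mult_right[OF B_integrable_add[OF iH i3]]]) simp
  also have "(LBINT x. 2 powr p * (ib z (r / 2) x * H x powr p + (3 * r) powr p * (ib z (r / 2) x * 1)))
   = 2 powr p * ((LBINT x. ib z (r / 2) x * H x powr p) + (3 * r) powr p * (pi * (r / 2)^2))"
   unfolding B_integral_mult_right_zero
   by (subst B_integral_add[OF iH i3]) (use r measure_ball_plane[of "r / 2" z] in simp)
  also have "... <= 2 powr p * (K1 * r powr (p + 2) + 3 powr p * pi * r powr (p + 2))"
  proof (intro mult_left_mono add_mono)
   show "(LBINT x. ib z (r / 2) x * H x powr p) <= K1 * r powr (p + 2)" using eb2 by (simp add: H_def)
   have "(3 * r) powr p * (pi * (r / 2)^2) <= (3 powr p * r powr p) * (pi * r^2)"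
    unfolding powr_mult using r by (intro mult_left_mono power_mono) auto
   also have "... = 3 powr p * pi * r powr (p + 2)" using r by (simp add: powr_add powr_numeral)
   finally show "(3 * r) powr p * (pi * (r / 2)^2) <= 3 powr p * pi * r powr (p + 2)" .
  qed simp
  also have "... = K * r powr (p + 2)" by (simp add: K_def algebra_simps)
  finally show "(NN x. ib z (r / 2) x * ennreal (u x powr p)) <= ennreal (K * r powr (p + 2))"
   by (simp add: ennreal_leI)
 qed
qed

text \<open>Pointwise \<open>u\<close> is at most T r on the positivity set plus (T r)^(1-p) u^p:
  below T r use the first term, above it the second. After integration the second term uses up only
  half of the lower bound, so the positivity set must account for the rest.\<close>

lemma positivity_density:
 fixes u :: "real^2 => real"
 assumes cu: "continuous_on Om u" and u0: "!!x. x : Om ==> 0 <= u x" and sub: "cball z s <= Om" and op: "open Om"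
  and r: "0 < r" and K: "0 < K" and c: "0 < c" and p: "2 <= p"
  and Lp: "(NN x. ib z s x * ennreal (u x powr p)) <= ennreal (K * r powr (p + 2))"
  and lower: "c * r ^ 3 <= (LBINT x. ib z s x * u x)"
 shows "c / (2 * (2 * K / c) powr (1 / (p - 1))) * r^2 <= measure lborel (positivity_set Om u Int ball z s)"
proof -
 \<comment> \<open>Chosen so that T^(1-p) K = c / 2.\<close>
 define T where "T = (2 * K / c) powr (1 / (p - 1))"
 have T: "0 < T" "T powr (1 - p) = c / (2 * K)"
 proof -
  show "0 < T" using K c by (simp add: T_def)
  have "1 / (p - 1) * (1 - p) = - 1" using p by (simp add: field_simps)
  then have "T powr (1 - p) = (2 * K / c) powr (- 1)" by (simp only: T_def powr_powr)
  then show "T powr (1 - p) = c / (2 * K)" using K c by (simp add: powr_minus powr_one)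
 qed
 let ?A = "positivity_set Om u"
 have bs: "ball z s <= Om" using sub ball_subset_cball by blast
 have Am: "?A Int ball z s : sets borel"
 proof -
  have "open (Om Int u -` {0<..})" using cu op by (metis continuous_on_open_vimage open_greaterThan Int_commute)
  moreover have "?A = Om Int u -` {0<..}" by (auto simp: positivity_set_def)
  ultimately show ?thesis by (auto intro: borel_open)
 qed
 have fin: "emeasure lborel (?A Int ball z s) < \<infinity>"
  using emeasure_mono[of "?A Int ball z s" "ball z s" lborel] emeasure_bounded_finite[of "ball z s"] by (auto intro: le_less_trans)
 have um: "(%x. ib z s x * u x) : borel_measurable borel" by (rule borel_measurable_ball_continuous[OF cu bs])
 have pm: "(%x. ib z s x * ennreal (u x powr p)) : borel_measurable borel"
 proof -
  have "(%x. ennreal ((ib z s x * u x) powr p)) : borel_measurable borel" using um by simp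
  moreover have "ennreal ((ib z s x * u x) powr p) = ib z s x * ennreal (u x powr p)" for x
   by (simp add: indicator_def)
  ultimately show ?thesis by simp
 qed
 define m where "m = measure lborel (?A Int ball z s)"
 have em: "emeasure lborel (?A Int ball z s) = ennreal m" using fin by (simp add: m_def emeasure_eq_ennreal_measure less_top)
 have "ennreal (c * r ^ 3) <= ennreal (LBINT x. ib z s x * u x)" by (rule ennreal_leI[OF lower])
 also have "... = (NN x. ennreal (ib z s x * u x))"
  by (rule nn_integral_eq_integral[symmetric, OF integrable_ball_continuous_on[OF cu sub]], rule AE_I2) (use u0 bs in \<open>auto simp: indicator_def\<close>)
 also have "... <= (NN x. ennreal (T * r) * indicator (?A Int ball z s) x + ennreal ((T * r) powr (1 - p)) * (ib z s x * ennreal (u x powr p)))"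
 proof (rule nn_integral_mono)
  fix x
  show "ennreal (ib z s x * u x) <= ennreal (T * r) * indicator (?A Int ball z s) x + ennreal ((T * r) powr (1 - p)) * (ib z s x * ennreal (u x powr p))"
  proof (cases "x : ball z s & 0 < u x")
   case True
   then have xA: "x : ?A Int ball z s" using bs by (auto simp: positivity_set_def)
   have "u x <= T * r + (T * r) powr (1 - p) * u x powr p"
   proof (cases "u x <= T * r")
    case False
    have t: "0 < T * r" using T r by simp
    have "1 = (T * r) powr (1 - p) * (T * r) powr (p - 1)" using t T(1) r by (simp add: powr_add[symmetric])
    also have "... <= (T * r) powr (1 - p) * u x powr (p - 1)" using False t p by (intro mult_left_mono powr_mono2) auto
    finally have "u x * 1 <= u x * ((T * r) powr (1 - p) * u x powr (p - 1))" using True by (intro mult_left_mono) auto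
    also have "... = (T * r) powr (1 - p) * u x powr p" using True powr_mult_base[of "u x" "p - 1"] by (simp add: mult.left_commute)
    finally show ?thesis using t by simp
   qed (simp add: add_increasing2)
   then have "ennreal (u x) <= ennreal (T * r + (T * r) powr (1 - p) * u x powr p)" by (rule ennreal_leI)
   then show ?thesis using True xA T r by (simp add: ennreal_mult)
  next
   case False
   then have "ib z s x * u x <= 0" by (auto simp: indicator_def)
   then show ?thesis by (simp add: ennreal_neg)
  qed
 qed
 also have "... = ennreal (T * r) * emeasure lborel (?A Int ball z s) + ennreal ((T * r) powr (1 - p)) * (NN x. ib z s x * ennreal (u x powr p))"
 proof -
  have 1: "(%x. ennreal (T * r) * indicator (?A Int ball z s) x) : borel_measurable lborel"
   using Am by (intro borel_measurable_times_ennreal borel_measurable_const borel_measurable_indicator) simp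
  have 2: "(%x. ib z s x * ennreal (u x powr p)) : borel_measurable lborel" using pm by simp
  show ?thesis
   using Am by (simp add: nn_integral_add[OF 1 borel_measurable_times_ennreal[OF borel_measurable_const 2]] nn_integral_cmult_indicator nn_integral_cmult[OF 2])
 qed
 also have "... <= ennreal (T * r) * ennreal m + ennreal ((T * r) powr (1 - p)) * ennreal (K * r powr (p + 2))"
  unfolding em by (intro add_left_mono mult_left_mono Lp) simp
 also have "... = ennreal (T * r * m + (T * r) powr (1 - p) * (K * r powr (p + 2)))"
  using T r K by (simp add: m_def ennreal_mult[symmetric] ennreal_plus[symmetric] del: ennreal_plus)
 finally have "c * r ^ 3 <= T * r * m + (T * r) powr (1 - p) * (K * r powr (p + 2))"
  using T r K by (subst (asm) ennreal_le_iff) (auto simp: m_def intro!: add_nonneg_nonneg mult_nonneg_nonneg)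
 also have "(T * r) powr (1 - p) * (K * r powr (p + 2)) = c / 2 * r ^ 3"
 proof -
  have "(T * r) powr (1 - p) * (K * r powr (p + 2)) = T powr (1 - p) * K * (r powr (1 - p) * r powr (p + 2))"
   by (simp add: powr_mult)
  also have "r powr (1 - p) * r powr (p + 2) = r powr 3" by (simp add: powr_add[symmetric])
  also have "r powr 3 = r ^ 3" using r by (simp add: powr_numeral)
  finally show ?thesis using K by (simp add: T(2))
 qed
 finally have "c / 2 * r^2 * r <= T * m * r" by (simp add: power2_eq_square power3_eq_cube mult_ac)
 then have "c / 2 * r^2 <= T * m" using r by simp
 then show ?thesis unfolding T_def[symmetric] m_def[symmetric] using T(1) by (simp add: field_simps)
qed

section \<open>The relative isoperimetric inequality\<close>

text \<open>The uniform first-order expansion of \<open>ph\<close> allows differentiation under the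
  integral.\<close>

lemma has_derivative_line_average:
 fixes ph :: "'a::euclidean_space => real"
 assumes D: "!!x. (ph has_derivative D x) (at x)" and Dc: "!!v. continuous_on UNIV (%x. D x v)"
  and D0: "!!x v. e < norm x ==> D x v = 0"
 shows "((%y. integral {0..1} (%t. ph (y - t *R w))) has_derivative (%v. integral {0..1} (%t. D (y - t *R w) v))) (at y)"
 unfolding has_derivative_at_alt
proof (intro conjI allI impI)
 have phc: "continuous_on UNIV ph" by (rule has_derivative_continuous_on[of UNIV ph D]) (use D in auto)
 have iph: "(%t. ph (y - t *R w)) integrable_on {0..1}" for y
  by (intro integrable_continuous_real continuous_on_compose2[OF phc] continuous_intros) auto
 have iD: "(%t. D (y - t *R w) v) integrable_on {0..1}" for y v
  by (intro integrable_continuous_real continuous_on_compose2[OF Dc] continuous_intros) auto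
 have lin: "linear (D x)" for x using has_derivative_bounded_linear[OF D] by (rule bounded_linear.linear)
 have "linear (%v. integral {0..1} (%t. D (y - t *R w) v))"
 proof (rule linearI)
  show "integral {0..1} (%t. D (y - t *R w) (v + v')) = integral {0..1} (%t. D (y - t *R w) v) + integral {0..1} (%t. D (y - t *R w) v')" for v v'
   unfolding linear_add[OF lin] by (rule integral_add[OF iD iD])
  show "integral {0..1} (%t. D (y - t *R w) (c *R v)) = c *R integral {0..1} (%t. D (y - t *R w) v)" for c v
   unfolding linear_scale[OF lin] by (rule integral_cmul)
 qed
 then show "bounded_linear (%v. integral {0..1} (%t. D (y - t *R w) v))" by (rule linear_conv_bounded_linear[THEN iffD1])
 fix eps :: real assume eps: "0 < eps"
 obtain d where d: "0 < d" "!!a h. norm h < d ==> \<bar>ph (a + h) - ph a - D a h\<bar> <= eps * norm h"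
  using uniform_derivative_bound[OF D Dc D0 eps] by blast
 have "norm (integral {0..1} (%t. ph (y' - t *R w)) - integral {0..1} (%t. ph (y - t *R w)) - integral {0..1} (%t. D (y - t *R w) (y' - y))) <= eps * norm (y' - y)"
  if "norm (y' - y) < d" for y'
 proof -
  have eq: "integral {0..1} (%t. ph (y' - t *R w)) - integral {0..1} (%t. ph (y - t *R w)) - integral {0..1} (%t. D (y - t *R w) (y' - y))
   = integral {0..1} (%t. ph (y' - t *R w) - ph (y - t *R w) - D (y - t *R w) (y' - y))"
   by (simp only: integral_diff[OF iph iph] integral_diff[OF integrable_diff[OF iph iph] iD])
  have "norm (integral (cbox 0 1) (%t. ph (y' - t *R w) - ph (y - t *R w) - D (y - t *R w) (y' - y))) <= (eps * norm (y' - y)) * measure lborel (cbox 0 (1 :: real))"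
  proof (rule integrable_bound)
   show "0 <= eps * norm (y' - y)" using eps by simp
   show "(%t. ph (y' - t *R w) - ph (y - t *R w) - D (y - t *R w) (y' - y)) integrable_on cbox 0 1"
    unfolding cbox_interval by (intro integrable_diff iph iD)
   show "norm (ph (y' - t *R w) - ph (y - t *R w) - D (y - t *R w) (y' - y)) <= eps * norm (y' - y)" for t
    using d(2)[OF that, of "y - t *R w"] by (simp add: algebra_simps)
  qed
  then show ?thesis unfolding eq by (simp add: cbox_interval)
 qed
 then show "EX d>0. ALL y'. norm (y' - y) < d --> norm (integral {0..1} (%t. ph (y' - t *R w)) - integral {0..1} (%t. ph (y - t *R w)) - integral {0..1} (%t. D (y - t *R w) (y' - y))) <= eps * norm (y' - y)"
  using d(1) by blast
qed

text \<open>The difference of \<open>ph\<close> and its translate by \<open>w\<close> is the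
  derivative along \<open>w\<close> of the averages of \<open>ph\<close> over segments of direction
  \<open>w\<close>. So it is the divergence of a multiple of \<open>w\<close>, and |w| < 2 r makes
  division by 2 r sufficient for norm at most 1.\<close>

lemma translation_field:
 fixes ph :: "'a::euclidean_space => real"
 assumes ph: "!!k. Ck k ph" "!!x. 0 <= ph x" "!!x. ph x <= 1" and supp: "compactly_supported_in (ball x (2 * r)) ph"
  and w: "w : ball 0 (2 * r)" and r: "0 < r"
 obtains X where "C1_test_field (ball x (4 * r)) X" "!!y. norm (X y) <= 1"
  "!!y. divergence X y = (ph (y - w) - ph y) / (2 * r)"
proof -
 define D where "D y = frechet_derivative ph (at y)" for y
 have Dd: "(ph has_derivative D y) (at y)" for y unfolding D_def by (rule Ck_SucD(1)[OF ph(1)])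
 have Dc: "continuous_on UNIV (%y. D y v)" for v using Ck_SucD(2)[OF ph(1)[of "Suc 0"], of v] by (simp add: D_def)
 have phc: "continuous_on UNIV ph" using ph(1)[of 0] by simp
 define S where "S = closure {y. ph y ~= 0}"
 have S: "compact S" "S <= ball x (2 * r)" using supp by (auto simp: compactly_supported_in_def S_def)
 have ph0: "ph y = 0" if "y ~: S" for y using that closure_subset[of "{y. ph y ~= 0}"] by (auto simp: S_def)
 have "bounded S" using S(1) by (rule compact_imp_bounded)
 then obtain e where e: "!!y. y : S ==> norm y <= e" unfolding bounded_iff by blast
 have D0: "D y v = 0" if "e < norm y" for y v
  unfolding D_def by (rule frechet_derivative_eq_0_outside[OF _ that]) (use ph0 e in \<open>auto simp: not_le[symmetric]\<close>)
 define J where "J y = integral {0..1} (%t. ph (y - t *R w))" for y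
 define J' where "J' y v = integral {0..1} (%t. D (y - t *R w) v)" for y v
 have Jd: "(J has_derivative J' y) (at y)" for y
  unfolding J_def [abs_def] J'_def [abs_def] by (rule has_derivative_line_average[OF Dd Dc D0])
 have J'c: "continuous_on UNIV (%y. J' y v)" for v
 proof -
  have "continuous_on (UNIV \<times> cbox 0 (1 :: real)) (%(y, t). D (y - t *R w) v)"
   unfolding case_prod_beta by (intro continuous_on_compose2[OF Dc] continuous_intros) auto
  from integral_continuous_on_param[OF this] show ?thesis unfolding J'_def by (simp add: cbox_interval)
 qed
 have J01: "0 <= J y" "J y <= 1" for y
 proof -
  have i: "(%t. ph (y - t *R w)) integrable_on {0..1}"
   by (intro integrable_continuous_real continuous_on_compose2[OF phc] continuous_intros) auto
  show "0 <= J y" unfolding J_def by (rule integral_nonneg[OF i]) (simp add: ph)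
  have "J y <= integral {0..1} (%t :: real. 1)" unfolding J_def by (rule integral_le[OF i]) (auto simp: ph)
  then show "J y <= 1" by simp
 qed
 have Jw: "J' y w = ph y - ph (y - w)" for y
 proof -
  have "((%t. D (y - t *R w) w) has_integral (- ph (y - 1 *R w) - - ph (y - 0 *R w))) {0..1}"
  proof (rule fundamental_theorem_of_calculus)
   fix t :: real
   have lin: "linear (D (y - t *R w))" using has_derivative_bounded_linear[OF Dd] by (rule bounded_linear.linear)
   have "((%t. y - t *R w) has_derivative (%a. - (a *R w))) (at t within {0..1})" by (auto intro!: derivative_eq_intros)
   from has_derivative_minus[OF has_derivative_compose[OF this Dd]]
   show "((%t. - ph (y - t *R w)) has_vector_derivative D (y - t *R w) w) (at t within {0..1})"
    by (simp add: has_vector_derivative_def linear_neg[OF lin] linear_scale[OF lin])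
  qed simp
  then show ?thesis unfolding J'_def by (simp add: integral_unique)
 qed
 have linJ: "linear (J' y)" for y using has_derivative_bounded_linear[OF Jd] by (rule bounded_linear.linear)
 define X where "X y = (- (J y) / (2 * r)) *R w" for y
 have Xd: "(X has_derivative (%v. (- (J' y v) / (2 * r)) *R w)) (at y)" for y
  unfolding X_def using r by (auto intro!: derivative_eq_intros Jd)
 have "Ck 1 X"
  unfolding One_nat_def
  by (rule Ck_SucI[OF Xd]) (use r in \<open>auto intro!: continuous_intros J'c\<close>)
 moreover have "compactly_supported_in (ball x (4 * r)) X"
 proof -
  define T where "T = (%(s, t). s + t *R w) ` (S \<times> {0..1 :: real})"
  have Tc: "compact T" unfolding T_def
   by (intro compact_continuous_image compact_Times S(1) compact_Icc) (auto simp: case_prod_beta intro!: continuous_intros)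
  have "{y. X y ~= 0} <= T"
  proof
   fix y assume "y : {y. X y ~= 0}"
   then have "J y ~= 0" by (auto simp: X_def)
   have "EX t:{0..1}. y - t *R w : S"
   proof (rule ccontr)
    assume nt: "~ ?thesis"
    have "integral {0..1} (%t. ph (y - t *R w)) = integral {0..1} (%t :: real. 0)"
     by (rule Henstock_Kurzweil_Integration.integral_cong) (use ph0 nt in blast)
    then show False using \<open>J y ~= 0\<close> by (simp add: J_def)
   qed
   then obtain t where "t : {0..1}" "y - t *R w : S" by blast
   then show "y : T" unfolding T_def by (intro image_eqI[of _ _ "(y - t *R w, t)"]) auto
  qed
  then have cl: "closure {y. X y ~= 0} <= T" by (rule closure_minimal) (rule compact_imp_closed[OF Tc])
  moreover have "T <= ball x (4 * r)"
  proof
   fix y assume "y : T"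
   then obtain s t where y: "y = s + t *R w" "s : S" "0 <= t" "t <= 1" by (auto simp: T_def)
   have "norm (t *R w) <= norm w" using y mult_left_le_one_le[of "norm w" t] by simp
   then have "norm (t *R w) < 2 * r" using w by simp
   moreover have "norm (x - s) < 2 * r" using S(2) y(2) by (auto simp: dist_norm)
   moreover have "norm (x - y) <= norm (x - s) + norm (t *R w)"
    using norm_triangle_ineq4[of "x - s" "t *R w"] by (simp add: y(1) algebra_simps)
   ultimately show "y : ball x (4 * r)" by (simp add: dist_norm)
  qed
  moreover have "compact (closure {y. X y ~= 0})"
   using bounded_subset[OF compact_imp_bounded[OF Tc] cl] by (simp add: compact_eq_bounded_closed)
  ultimately show ?thesis unfolding compactly_supported_in_def by blast
 qed
 ultimately have "C1_test_field (ball x (4 * r)) X" by (simp add: C1_test_field_def)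
 moreover have "norm (X y) <= 1" for y
 proof -
  have "norm (X y) = J y * norm w / (2 * r)" using r J01[of y] by (simp add: X_def)
  also have "... <= 1 * (2 * r) / (2 * r)" using w r J01[of y] by (intro divide_right_mono mult_mono) auto
  finally show ?thesis using r by simp
 qed
 moreover have "divergence X y = (ph (y - w) - ph y) / (2 * r)" for y
 proof -
  have fd: "frechet_derivative X (at y) = (%v. (- (J' y v) / (2 * r)) *R w)" using frechet_derivative_at[OF Xd, of y] by simp
  have "divergence X y = (\<Sum>b\<in>Basis. - (J' y b) / (2 * r) * (w \<bullet> b))" by (simp add: divergence_def fd)
  also have "... = - (\<Sum>b\<in>Basis. (w \<bullet> b) * J' y b) / (2 * r)"
   by (simp add: sum_negf sum_divide_distrib mult_ac)
  also have "(\<Sum>b\<in>Basis. (w \<bullet> b) * J' y b) = J' y (\<Sum>b\<in>Basis. (w \<bullet> b) *R b)"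
   by (simp add: linear_sum[OF linJ] linear_scale[OF linJ])
  finally show ?thesis by (simp add: euclidean_representation Jw)
 qed
 ultimately show thesis by (rule that)
qed

text \<open>On average over shifts w, the translate of \<open>K\<close> overlaps \<open>A\<close> in
  the ball by at least al bet / V. Fix a good shift and a cutoff close to the indicator of
  \<open>K\<close>. The integral over \<open>A\<close> of the translated cutoff is then large,
  whereas that of the cutoff itself is small because \<open>A\<close> and \<open>K\<close> are
  disjoint; their difference is a divergence.\<close>

lemma isoperimetric_field:
 fixes A :: "'a::euclidean_space set"
 assumes A: "open A" and r: "0 < r" and V: "V = measure lborel (ball (0 :: 'a) (2 * r))"
  and al: "0 < al" "al <= measure lborel (A Int ball x r)" and bet: "0 < bet" "bet <= measure lborel (cball x r - A)"
 obtains X where "C1_test_field (ball x (4 * r)) X" "!!y. norm (X y) <= 1"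
  "al * bet / (8 * V * r) <= (LINT y:A|lebesgue. divergence X y)"
proof -
 define K where "K = cball x r - A"
 have K: "compact K" unfolding K_def by (intro compact_diff compact_cball A)
 have Kb: "K : sets borel" using K by (intro borel_closed compact_imp_closed)
 have Ab: "A : sets borel" using A by (rule borel_open)
 have V0: "0 < V" using content_ball_pos[of "2 * r" "0 :: 'a"] r by (simp add: V)
 have Ve: "emeasure lborel (ball (0 :: 'a) (2 * r)) = ennreal V"
  using emeasure_bounded_finite[of "ball (0 :: 'a) (2 * r)"] by (simp add: V emeasure_eq_ennreal_measure)
 \<comment> \<open>2 s is half of the average overlap, and s is allowed for the part of the cutoff
   outside \<open>K\<close>.\<close>
 define s where "s = al * bet / (4 * V)"
 have s: "0 < s" using al bet V0 by (simp add: s_def)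
 obtain W0 where W0: "open W0" "K <= W0" "(W0 - K) : lmeasurable" "emeasure lebesgue (W0 - K) < ennreal s"
  using sets_lebesgue_outer_open[OF _ s, of K] Kb by (metis sets_completionI_sets sets_lborel)
 define W where "W = W0 Int ball x (2 * r)"
 have W: "open W" "K <= W" using W0 r by (auto simp: W_def K_def)
 obtain ph N where ph: "!!k. Ck k ph" "!!x. 0 <= ph x" "!!x. ph x <= (1::real)" "K <= N"
  "!!x. x : N ==> ph x = 1" and sW: "compactly_supported_in W ph"
  using smooth_cutoff[OF K W] by metis
 have supp: "compactly_supported_in (ball x (2 * r)) ph" using sW by (auto simp: compactly_supported_in_def W_def)
 have phc: "continuous_on UNIV ph" using ph(1)[of 0] by simp
 have phm[measurable]: "ph : borel_measurable borel" by (rule cont_borel[OF phc])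
 note [measurable] = Ab Kb
 have ph0: "ph y = 0" if "y ~: W" for y
  using that sW closure_subset[of "{y. ph y ~= 0}"] by (auto simp: compactly_supported_in_def)
 let ?Q = "%w. \<integral>\<^sup>+y. indicator (A Int ball x r) y * indicator K (y - w) \<partial>lborel"
 have em: "emeasure lborel (A Int ball x r) = ennreal (measure lborel (A Int ball x r))"
  using emeasure_mono[of "A Int ball x r" "ball x r" lborel] emeasure_bounded_finite[of "ball x r"] Ab
  by (intro emeasure_eq_ennreal_measure) (auto simp: less_top[symmetric] top_unique)
 have emK: "emeasure lborel K = ennreal (measure lborel K)"
  using emeasure_compact_finite[OF K] by (intro emeasure_eq_ennreal_measure) auto
 \<comment> \<open>Otherwise integration over w, with the order exchanged, would give al bet <= 2 s
   V = al bet / 2. Shifts below 2 r in length suffice because two points of the ball of radius r are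
   never farther apart.\<close>
 have "EX w:ball 0 (2 * r). ennreal (2 * s) < ?Q w"
 proof (rule ccontr)
  assume "~ ?thesis"
  then have le: "?Q w <= ennreal (2 * s)" if "w : ball 0 (2 * r)" for w using that by (auto simp: not_less)
  have "ennreal (al * bet) <= emeasure lborel (A Int ball x r) * emeasure lborel K"
   unfolding em emK using al bet by (simp add: ennreal_mult[symmetric] K_def ennreal_leI mult_mono)
  also have "... = (NN y. indicator (A Int ball x r) y * emeasure lborel K)"
   using Ab by (simp add: nn_integral_multc)
  also have "... <= (NN y. NN w. ib 0 (2 * r) w * (indicator (A Int ball x r) y * indicator K (y - w)))"
  proof (rule nn_integral_mono)
   fix y
   show "indicator (A Int ball x r) y * emeasure lborel K <= (NN w. ib 0 (2 * r) w * (indicator (A Int ball x r) y * indicator K (y - w)))"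
   proof (cases "y : A Int ball x r")
    case True
    have "emeasure lborel K = (NN k. indicator K k)" using Kb by simp
    also have "... = (\<integral>\<^sup>+k. indicator K k \<partial>distr lborel borel (%w. y - w))" by (simp add: distr_lborel_reflect)
    also have "... = (NN w. indicator K (y - w))" by (rule nn_integral_distr) measurable
    also have "... <= (NN w. ib 0 (2 * r) w * (indicator (A Int ball x r) y * indicator K (y - w)))"
    proof (rule nn_integral_mono)
     fix w
     show "indicator K (y - w) <= (ib 0 (2 * r) w * (indicator (A Int ball x r) y * indicator K (y - w)) :: ennreal)"
     proof (cases "y - w : K")
      case True': True
      have "norm w <= norm (x - (y - w)) + norm (x - y)" using norm_triangle_ineq4[of "x - (y - w)" "x - y"] by (simp add: algebra_simps)
      then have "w : ball 0 (2 * r)" using True True' by (auto simp: K_def dist_norm)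
      then show ?thesis using True by simp
     qed simp
    qed
    finally show ?thesis using True by simp
   qed simp
  qed
  also have "... = (NN w. NN y. ib 0 (2 * r) w * (indicator (A Int ball x r) y * indicator K (y - w)))"
   by (rule lborel_pair.Fubini') measurable
  also have "... <= (NN w. ennreal (2 * s) * ib (0 :: 'a) (2 * r) w)"
  proof (rule nn_integral_mono)
   fix w :: 'a
   show "(NN y. ib 0 (2 * r) w * (indicator (A Int ball x r) y * indicator K (y - w))) <= ennreal (2 * s) * ib 0 (2 * r) w"
    using le[of w] by (cases "w : ball 0 (2 * r)") auto
  qed
  also have "... = ennreal (2 * s) * ennreal V" by (subst nn_integral_cmult_indicator) (simp_all add: Ve)
  also have "... = ennreal (al * bet / 2)" using V0 s al bet by (simp add: ennreal_mult[symmetric] s_def)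
  finally show False using al bet by (simp add: ennreal_le_iff)
 qed
 then obtain w where w: "w : ball 0 (2 * r)" "ennreal (2 * s) < ?Q w" by blast
 obtain X where X: "C1_test_field (ball x (4 * r)) X" "!!y. norm (X y) <= 1"
  "!!y. divergence X y = (ph (y - w) - ph y) / (2 * r)"
  using translation_field[OF ph(1-3) supp w(1) r] by blast
 have bound: "ph y ~= 0 ==> norm y <= norm x + 2 * r" for y
 proof -
  assume "ph y ~= 0"
  then have "y : ball x (2 * r)" using ph0[of y] by (auto simp: W_def)
  then show ?thesis using norm_triangle_ineq2[of y x] by (simp add: dist_norm norm_minus_commute)
 qed
 have i0: "integrable lborel ph"
 proof -
  have "integrable lebesgue ph" by (rule integrable_lebesgue_continuous_compact_support[OF phc, of "norm x + 2 * r"]) (use bound in force)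
  then show ?thesis by (simp add: integrable_completion)
 qed
 have i1: "integrable lborel (%y. ph (y - w))"
 proof -
  have "integrable lebesgue (%y. ph (y - w))"
  proof (rule integrable_lebesgue_continuous_compact_support[of _ "norm x + 2 * r + norm w"])
   show "continuous_on UNIV (%y. ph (y - w))" by (intro continuous_on_compose2[OF phc] continuous_intros) auto
   fix y :: 'a assume "norm x + 2 * r + norm w < norm y"
   then have "norm x + 2 * r < norm (y - w)" using norm_triangle_ineq2[of y w] by linarith
   then show "ph (y - w) = 0" using bound[of "y - w"] by force
  qed
  then show ?thesis by (simp add: integrable_completion)
 qed
 have iA: "integrable lborel (%y. indicator A y * f y)" if "integrable lborel f" for f :: "'a => real"
  using integrable_mult_indicator[of A lborel f] Ab that by simp
 have I1: "2 * s <= (LBINT y. indicator A y * ph (y - w))"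
 proof -
  have "ennreal (2 * s) <= ?Q w" using w(2) by simp
  also have "... <= (NN y. ennreal (indicator A y * ph (y - w)))"
  proof (rule nn_integral_mono)
   fix y
   show "indicator (A Int ball x r) y * indicator K (y - w) <= ennreal (indicator A y * ph (y - w))"
    using ph(4,5) by (cases "y - w : K") (auto simp: indicator_def subset_iff)
  qed
  also have "... = ennreal (LBINT y. indicator A y * ph (y - w))"
   by (rule nn_integral_eq_integral[OF iA[OF i1]]) (simp add: ph)
  finally show ?thesis
   by (subst (asm) ennreal_le_iff) (auto intro!: B_integral_nonneg simp: ph)
 qed
 have I2: "(LBINT y. indicator A y * ph y) <= s"
 proof -
  have "ennreal (LBINT y. indicator A y * ph y) = (NN y. ennreal (indicator A y * ph y))"
   by (rule nn_integral_eq_integral[symmetric, OF iA[OF i0]]) (simp add: ph)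
  also have "... <= (NN y. indicator (W0 - K) y)"
  proof (rule nn_integral_mono)
   fix y
   show "ennreal (indicator A y * ph y) <= indicator (W0 - K) y"
    using ph0[of y] ph(3)[of y] by (cases "y : A & y : W") (auto simp: indicator_def W_def K_def)
  qed
  also have "... = emeasure lebesgue (W0 - K)" using W0(1) Kb by (simp add: borel_open sets.Diff)
  also have "... <= ennreal s" using W0(4) by simp
  finally show ?thesis using s by (subst (asm) ennreal_le_iff) auto
 qed
 have "(LINT y:A|lebesgue. divergence X y) = (LBINT y. indicator A y *R ((ph (y - w) - ph y) / (2 * r)))"
  unfolding set_lebesgue_integral_def X(3) by (rule integral_completion) measurable
 also have "... = (LBINT y. (indicator A y * ph (y - w) - indicator A y * ph y) / (2 * r))"
  by (simp add: algebra_simps)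
 also have "... = ((LBINT y. indicator A y * ph (y - w)) - (LBINT y. indicator A y * ph y)) / (2 * r)"
  by (simp add: B_integral_diff[OF iA[OF i1] iA[OF i0]])
 finally have eq: "(LINT y:A|lebesgue. divergence X y) = ((LBINT y. indicator A y * ph (y - w)) - (LBINT y. indicator A y * ph y)) / (2 * r)" .
 have "s / (2 * r) <= (LINT y:A|lebesgue. divergence X y)" unfolding eq using I1 I2 r by (intro divide_right_mono) auto
 moreover have "s / (2 * r) = al * bet / (8 * V * r)" by (simp add: s_def mult_ac)
 ultimately show thesis using that[OF X(1,2)] by simp
qed

section \<open>Spherical means\<close>

definition quarter_turn :: "real^2 => real^2" where
 "quarter_turn y = vector [- (y $ 2), y $ 1]"

definition rotation :: "real => real^2 => real^2" where
 "rotation th y = cos th *R y + sin th *R quarter_turn y"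

lemma rotation_nth: "rotation th y $ 1 = cos th * y $ 1 - sin th * y $ 2" "rotation th y $ 2 = cos th * y $ 2 + sin th * y $ 1"
 by (simp_all add: rotation_def quarter_turn_def)

lemma norm_vec2: "(norm (y :: real^2))^2 = (y $ 1)^2 + (y $ 2)^2"
 unfolding power2_norm_eq_inner inner_vec_def sum_2 inner_real_def by (simp only: power2_eq_square)

lemma rotation_add: "rotation a (rotation b y) = rotation (a + b) y"
 by (simp add: vec_eq_iff forall_2 rotation_nth cos_add sin_add algebra_simps)

lemma rotation_0 [simp]: "rotation 0 y = y" by (simp add: rotation_def)

lemma rotation_inverse [simp]: "rotation (- th) (rotation th y) = y" "rotation th (rotation (- th) y) = y"
 by (simp_all add: rotation_add)

lemma norm_rotation [simp]: "norm (rotation th y) = norm y"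
proof -
 have "(norm (rotation th y))^2 = ((cos th)^2 + (sin th)^2) * ((y $ 1)^2 + (y $ 2)^2)"
  unfolding norm_vec2 rotation_nth by algebra
 then have "(norm (rotation th y))^2 = (norm y)^2" by (simp add: norm_vec2)
 then show ?thesis by simp
qed

lemma linear_rotation: "linear (rotation th)"
 by (rule linearI) (simp_all add: vec_eq_iff forall_2 rotation_nth algebra_simps)

lemma rotation_transitive:
 assumes "norm a = norm b" "a ~= 0"
 obtains al where "0 <= al" "al <= 2 * pi" "b = rotation al a"
proof -
 define n where "n = (a $ 1)^2 + (a $ 2)^2"
 have n: "n ~= 0" using assms(2) norm_vec2[of a] by (auto simp: n_def)
 have nb: "n = (b $ 1)^2 + (b $ 2)^2" using assms(1) by (simp add: n_def norm_vec2[symmetric])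
 define c s where "c = (b $ 1 * a $ 1 + b $ 2 * a $ 2) / n" and "s = (b $ 2 * a $ 1 - b $ 1 * a $ 2) / n"
 have "c^2 + s^2 = (((b $ 1)^2 + (b $ 2)^2) * n) / n^2"
  by (simp add: c_def s_def n_def power_divide add_divide_distrib[symmetric]) (simp add: power2_eq_square algebra_simps)
 then have "c^2 + s^2 = 1" unfolding nb[symmetric] using n by (simp add: power2_eq_square)
 then obtain t where t: "0 <= t" "t < 2 * pi" "c = cos t" "s = sin t" using sincos_total_2pi by metis
 have "n * (c * a $ 1 - s * a $ 2) = n * b $ 1"
  using n by (simp add: c_def s_def right_diff_distrib) (simp add: n_def power2_eq_square algebra_simps)
 moreover have "n * (c * a $ 2 + s * a $ 1) = n * b $ 2"
  using n by (simp add: c_def s_def distrib_left) (simp add: n_def power2_eq_square algebra_simps)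
 ultimately have "b = rotation t a" using n by (simp add: vec_eq_iff forall_2 rotation_nth t(3,4)[symmetric])
 then show thesis using t by (intro that) auto
qed

lemma continuous_rotation: "continuous_on UNIV (%z. rotation (fst z) (snd z))"
proof -
 have "linear quarter_turn" by (rule linearI) (simp_all add: vec_eq_iff forall_2 quarter_turn_def)
 then have "continuous_on UNIV quarter_turn" by (simp add: linear_continuous_on linear_conv_bounded_linear)
 then have "continuous_on UNIV (%z :: real \<times> (real^2). quarter_turn (snd z))"
  by (rule continuous_on_compose2) (auto intro: continuous_intros)
 then show ?thesis unfolding rotation_def by (intro continuous_intros)
qed

lemma distr_lborel_rotation: "distr lborel borel (rotation th) = lborel"
proof (rule lborel_eqI[symmetric])
 fix l u :: "real^2" assume lu: "!!b. b : Basis ==> l \<bullet> b <= u \<bullet> b"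
 have bl: "bounded_linear (rotation th)" for th by (rule linear_conv_bounded_linear[THEN iffD1, OF linear_rotation])
 have m: "rotation th : borel_measurable borel"
  by (intro cont_borel linear_continuous_on bl)
 have im: "rotation th -` box l u = rotation (- th) ` box l u"
 proof (intro set_eqI iffI)
  fix y assume "y : rotation th -` box l u"
  then show "y : rotation (- th) ` box l u" by (intro image_eqI[of _ _ "rotation th y"]) auto
 qed auto
 have ot: "orthogonal_transformation (rotation (- th))"
  unfolding orthogonal_transformation using linear_rotation by simp
 have b: "rotation (- th) ` box l u : sets borel" using measurable_sets_borel[OF m, of "box l u"] by (simp add: im[symmetric])
 have fin: "emeasure lborel (rotation (- th) ` box l u) ~= \<infinity>"
  using emeasure_bounded_finite[OF bounded_linear_image[OF bounded_box[of l u] bl[of "- th"]]] by (simp add: less_top)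
 have "emeasure (distr lborel borel (rotation th)) (box l u) = emeasure lborel (rotation (- th) ` box l u)"
  using m by (simp add: emeasure_distr im)
 also have "... = ennreal (measure lebesgue (rotation (- th) ` box l u))"
  using fin b by (simp add: emeasure_eq_ennreal_measure)
 also have "measure lebesgue (rotation (- th) ` box l u) = measure lebesgue (box l u)"
  by (rule measure_orthogonal_image[OF ot]) simp
 also have "ennreal (measure lebesgue (box l u)) = emeasure lborel (box l u)"
  using emeasure_lborel_box_finite[of l u] by (simp add: emeasure_eq_ennreal_measure less_top)
 also have "... = ennreal (prod ((\<bullet>) (u - l)) Basis)" using lu by (simp add: emeasure_lborel_box inner_diff_left)
 finally show "emeasure (distr lborel borel (rotation th)) (box l u) = ennreal (prod ((\<bullet>) (u - l)) Basis)" .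
qed simp

text \<open>A rotation and its inverse are both 1-Lipschitz, so neither can increase length.\<close>

lemma hm_sphere_rotation:
 "distr (hm (sphere x s)) borel (%y. x + rotation th (y - x)) = hm (sphere x s)"
proof (rule measure_eqI)
 let ?S = "sphere x s"
 have Sb: "?S : sets borel" by (simp add: borel_closed)
 let ?R = "%th y. x + rotation th (y - x)"
 have c: "continuous_on UNIV (?R th)" for th
  by (intro continuous_intros continuous_on_compose2[OF linear_continuous_on[OF linear_conv_bounded_linear[THEN iffD1, OF linear_rotation]]]) auto
 have m: "?R th : borel_measurable borel" for th by (rule cont_borel[OF c])
 have lip: "1-lipschitz_on T (?R th)" for T th
 proof (rule lipschitz_onI)
  fix y y' :: "real^2"
  have "rotation th (y - x) - rotation th (y' - x) = rotation th (y - y')"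
   using linear_diff[OF linear_rotation, of th "y - x" "y' - x"] by simp
  then show "dist (?R th y) (?R th y') <= 1 * dist y y'" by (simp add: dist_norm)
 qed simp
 have inv: "?R (- th) (?R th y) = y" "?R th (?R (- th) y) = y" for th y by simp_all
 have S: "?R th y : ?S \<longleftrightarrow> y : ?S" for th y
  by (simp add: dist_norm norm_minus_commute[of x])
 fix B assume "B : sets (distr (hm ?S) borel (?R th))"
 then have B: "B : sets borel" by simp
 have "emeasure (distr (hm ?S) borel (?R th)) B = emeasure (hm ?S) (?R th -` B)"
  using B m by (simp add: emeasure_distr)
 also have "... = hausdorff1_outer (?S Int ?R th -` B)"
  using measurable_sets_borel[OF m B] by (intro emeasure_hm Sb)
 also have "... = hausdorff1_outer (?S Int B)"
 proof (rule antisym)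
  have "?S Int ?R th -` B <= ?R (- th) ` (?S Int B)"
  proof
   fix y assume y: "y : ?S Int ?R th -` B"
   then have "?R th y : ?S Int B" using S[of th y] by blast
   then show "y : ?R (- th) ` (?S Int B)" using inv(1)[of th y] by (metis imageI)
  qed
  then have "hausdorff1_outer (?S Int ?R th -` B) <= hausdorff1_outer (?R (- th) ` (?S Int B))" by (rule hausdorff1_outer_mono)
  also have "... <= ennreal 1 * hausdorff1_outer (?S Int B)" by (rule hausdorff1_outer_lipschitz_image[OF lip])
  finally show "hausdorff1_outer (?S Int ?R th -` B) <= hausdorff1_outer (?S Int B)" by simp
  have "?S Int B <= ?R th ` (?S Int ?R th -` B)"
  proof
   fix y assume y: "y : ?S Int B"
   then have "?R (- th) y : ?S Int ?R th -` B" using S[of "- th" y] inv(2)[of th y] by auto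
   then show "y : ?R th ` (?S Int ?R th -` B)" using inv(2)[of th y] by (metis imageI)
  qed
  then have "hausdorff1_outer (?S Int B) <= hausdorff1_outer (?R th ` (?S Int ?R th -` B))" by (rule hausdorff1_outer_mono)
  also have "... <= ennreal 1 * hausdorff1_outer (?S Int ?R th -` B)" by (rule hausdorff1_outer_lipschitz_image[OF lip])
  finally show "hausdorff1_outer (?S Int B) <= hausdorff1_outer (?S Int ?R th -` B)" by simp
 qed
 also have "... = emeasure (hm ?S) B" by (rule emeasure_hm[OF Sb B, symmetric])
 finally show "emeasure (distr (hm ?S) borel (?R th)) B = emeasure (hm ?S) B" .
qed simp

text \<open>Crude bounds that are enough for growth estimates: the projection to a diameter from
  below, a 2 s-Lipschitz parametrisation by the angle from above.\<close>

lemma hausdorff1_outer_circle: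
 assumes s: "0 < s"
 shows "ennreal (2 * s) <= hausdorff1_outer (sphere (x :: real^2) s)" "hausdorff1_outer (sphere x s) <= ennreal (4 * pi * s)"
proof -
 let ?e = "axis 1 1 :: real^2"
 have "emeasure lebesgue {x $ 1 - s..x $ 1 + s} <= hausdorff1_outer (sphere x s)"
 proof (rule hausdorff1_outer_projection[where f = "%y :: real^2. y $ 1"])
  show "1-lipschitz_on (sphere x s) (%y :: real^2. y $ 1)"
   by (rule lipschitz_onI) (use dist_vec_nth_le in auto)
  show "{x $ 1 - s..x $ 1 + s} <= (%y :: real^2. y $ 1) ` sphere x s"
  proof
   fix t assume t: "t : {x $ 1 - s..x $ 1 + s}"
   define a where "a = t - x $ 1"
   have a: "a^2 <= s^2" using t s by (intro power2_le_iff_abs_le[THEN iffD2]) (auto simp: a_def abs_le_iff)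
   define y :: "real^2" where "y = x + vector [a, sqrt (s^2 - a^2)]"
   have "(norm (y - x))^2 = s^2" using a unfolding norm_vec2 by (simp add: y_def)
   then have "norm (y - x) = s" using s by (simp add: power2_eq_iff_nonneg)
   then have "y : sphere x s" by (simp add: dist_norm norm_minus_commute)
   moreover have "y $ 1 = t" by (simp add: y_def a_def)
   ultimately show "t : (%y :: real^2. y $ 1) ` sphere x s" by force
  qed
 qed simp
 then show "ennreal (2 * s) <= hausdorff1_outer (sphere x s)" using s by simp
 have "sphere x s <= (%t. x + rotation t (s *R ?e)) ` {0..2 * pi}"
 proof
  fix y assume "y : sphere x s"
  then have "norm (s *R ?e) = norm (y - x)" using s by (simp add: dist_norm norm_minus_commute)
  then obtain al where "0 <= al" "al <= 2 * pi" "y - x = rotation al (s *R ?e)"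
   using s by (elim rotation_transitive) (auto simp: axis_eq_0_iff)
  then show "y : (%t. x + rotation t (s *R ?e)) ` {0..2 * pi}" by (intro image_eqI[of _ _ al]) (auto simp: algebra_simps)
 qed
 then have "hausdorff1_outer (sphere x s) <= hausdorff1_outer ((%t. x + rotation t (s *R ?e)) ` {0..2 * pi})" by (rule hausdorff1_outer_mono)
 also have "... <= ennreal (2 * s) * hausdorff1_outer {0..2 * pi}"
 proof (rule hausdorff1_outer_lipschitz_image, rule lipschitz_onI)
  fix a b :: real
  have half: "\<bar>sin ((a - b) / 2)\<bar> <= \<bar>a - b\<bar> / 2" "\<bar>sin ((b - a) / 2)\<bar> <= \<bar>a - b\<bar> / 2"
   using abs_sin_x_le_abs_x[of "(a - b) / 2"] abs_sin_x_le_abs_x[of "(b - a) / 2"] by auto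
  have ca: "\<bar>cos a - cos b\<bar> <= \<bar>a - b\<bar>"
  proof -
   have "\<bar>cos a - cos b\<bar> = 2 * (\<bar>sin ((a + b) / 2)\<bar> * \<bar>sin ((b - a) / 2)\<bar>)" unfolding cos_diff_cos by (simp add: abs_mult)
   also have "... <= 2 * (1 * (\<bar>a - b\<bar> / 2))" using half by (intro mult_left_mono mult_mono) auto
   finally show ?thesis by simp
  qed
  have sa: "\<bar>sin a - sin b\<bar> <= \<bar>a - b\<bar>"
  proof -
   have "\<bar>sin a - sin b\<bar> = 2 * (\<bar>sin ((a - b) / 2)\<bar> * \<bar>cos ((a + b) / 2)\<bar>)" unfolding sin_diff_sin by (simp add: abs_mult)
   also have "... <= 2 * ((\<bar>a - b\<bar> / 2) * 1)" using half by (intro mult_left_mono mult_mono) auto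
   finally show ?thesis by simp
  qed
  have "norm (rotation a (s *R ?e) - rotation b (s *R ?e)) <= \<bar>cos a - cos b\<bar> * s + \<bar>sin a - sin b\<bar> * s"
  proof -
   have q: "norm (quarter_turn (s *R ?e)) = s"
    using norm_rotation[of "pi / 2" "s *R ?e"] s by (simp add: rotation_def)
   have "rotation a (s *R ?e) - rotation b (s *R ?e) = (cos a - cos b) *R (s *R ?e) + (sin a - sin b) *R quarter_turn (s *R ?e)"
    by (simp only: rotation_def scaleR_diff_left add_diff_add)
   also have "norm ... <= norm ((cos a - cos b) *R (s *R ?e)) + norm ((sin a - sin b) *R quarter_turn (s *R ?e))" by (rule norm_triangle_ineq)
   also have "... = \<bar>cos a - cos b\<bar> * s + \<bar>sin a - sin b\<bar> * s" using s q by (simp add: abs_mult)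
   finally show ?thesis .
  qed
  also have "... <= \<bar>a - b\<bar> * s + \<bar>a - b\<bar> * s"
   by (rule add_mono[OF mult_right_mono[OF ca] mult_right_mono[OF sa]]) (use s in auto)
  finally have "norm (rotation a (s *R ?e) - rotation b (s *R ?e)) <= \<bar>a - b\<bar> * s + \<bar>a - b\<bar> * s" .
  then show "dist (x + rotation a (s *R ?e)) (x + rotation b (s *R ?e)) <= 2 * s * dist a b"
   by (simp add: dist_norm)
 qed (use s in simp)
 also have "hausdorff1_outer {0..2 * pi} = ennreal (2 * pi)" using hausdorff1_outer_Icc[of 0 "2 * pi"] by simp
 also have "ennreal (2 * s) * ennreal (2 * pi) = ennreal (2 * s * (2 * pi))" by (rule ennreal_mult[symmetric]) (use s in auto)
 also have "2 * s * (2 * pi) = 4 * pi * s" by simp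
 finally show "hausdorff1_outer (sphere x s) <= ennreal (4 * pi * s)" .
qed

lemma ennreal_mult_left_le_cancel: "0 < r ==> ennreal r * a <= ennreal r * b ==> a <= b"
 using ennreal_mult_le_mult_iff[of "ennreal r" a b] by simp

lemma ennreal_mult_right_le_cancel: "0 < r ==> a * ennreal r <= b * ennreal r ==> a <= b"
 using ennreal_mult_left_le_cancel[of r a b] by (simp only: mult.commute)

lemma nn_integral_periodic_shift:
 fixes F :: "real => ennreal"
 assumes F[measurable]: "F : borel_measurable borel" and per: "!!t. F (t + T) = F t" and al: "0 <= al" "al <= T"
 shows "(NN t. indicator {0<..T} t * F (t + al)) = (NN t. indicator {0<..T} t * F t)"
proof -
 have shift: "(NN t. k (t + c)) = (NN t. k t)" if [measurable]: "k : borel_measurable borel" for k :: "real => ennreal" and c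
 proof -
  have "(NN t. k t) = (\<integral>\<^sup>+t. k t \<partial>distr lborel borel ((+) c))" by (simp add: lborel_distr_plus)
  also have "... = (NN t. k (c + t))" by (rule nn_integral_distr) simp_all
  finally show ?thesis by (simp add: add.commute)
 qed
 have "(NN t. indicator {0<..T} t * F (t + al)) = (NN t. indicator {al<..T + al} (t + al) * F (t + al))"
  by (intro nn_integral_cong) (simp add: indicator_def)
 also have "... = (NN t. indicator {al<..T + al} t * F t)" by (rule shift) measurable
 also have "... = (NN t. indicator {al<..T} t * F t + indicator {T<..T + al} t * F t)"
  using al by (intro nn_integral_cong) (auto simp: indicator_def)
 also have "... = (NN t. indicator {al<..T} t * F t) + (NN t. indicator {T<..T + al} t * F t)"
  by (rule nn_integral_add) measurable
 also have "(NN t. indicator {T<..T + al} t * F t) = (NN t. indicator {T<..T + al} (t + T) * F (t + T))"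
  by (rule shift[symmetric]) measurable
 also have "... = (NN t. indicator {0<..al} t * F t)" unfolding per by (intro nn_integral_cong) (simp add: indicator_def add.commute)
 also have "(NN t. indicator {al<..T} t * F t) + (NN t. indicator {0<..al} t * F t)
  = (NN t. indicator {al<..T} t * F t + indicator {0<..al} t * F t)"
  by (rule nn_integral_add[symmetric]) measurable
 also have "... = (NN t. indicator {0<..T} t * F t)"
  using al by (intro nn_integral_cong) (auto simp: indicator_def)
 finally show ?thesis .
qed

text \<open>Polar coordinates are replaced by averaging over rotations about x. The average
  \<open>k\<close> is radial, and its integral is 2 pi times that of \<open>U\<close> on each circle
  as well as on the disc. On a circle \<open>k\<close> is constant, so the circular means determine
  its size to be of order |y - x|, which is then integrated over the disc.\<close>

lemma spherical_to_solid_mean: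
 fixes U :: "real^2 => ennreal"
 assumes U[measurable]: "U : borel_measurable borel" and c: "0 <= c" "0 <= C" and rh: "0 < rh"
  and b: "!!s. 0 < s ==> s < rh ==> ennreal (c * s^2) <= (\<integral>\<^sup>+y. U y \<partial>hm (sphere x s)) & (\<integral>\<^sup>+y. U y \<partial>hm (sphere x s)) <= ennreal (C * s^2)"
 shows "(NN y. ib x rh y * U y) <= ennreal (2 * C * rh ^ 3)"
  and "ennreal (c / 16 * rh ^ 3) <= (NN y. ib x rh y * U y)"
proof -
 let ?R = "%th y. x + rotation th (y - x)"
 have Rc: "continuous_on UNIV (%z. ?R (fst z) (snd z))"
  by (intro continuous_intros continuous_on_compose2[OF continuous_rotation, of _ "%z. (fst z, snd z - x)", simplified])
 have "(%z. ?R (fst z) (snd z)) : borel_measurable borel" by (rule cont_borel[OF Rc])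
 then have Rm[measurable]: "(%z. ?R (fst z) (snd z)) : borel_measurable (borel \<Otimes>\<^sub>M borel)" by (simp add: borel_prod)
 have Um: "(%z. U (?R (fst z) (snd z))) : borel_measurable (borel \<Otimes>\<^sub>M borel)" using measurable_compose[OF Rm U] .
 define k where "k y = (NN th. indicator {0<..2 * pi} th * U (?R th y))" for y
 have U1: "(%th. U (?R th y)) : borel_measurable borel" for y
  by (rule measurable_compose[OF cont_borel U])
   (intro continuous_intros continuous_on_compose2[OF continuous_rotation, of _ "%th. (th, y - x)", simplified])
 have R1[measurable]: "?R th : borel_measurable borel" for th
  by (rule cont_borel)
   (intro continuous_intros continuous_on_compose2[OF continuous_rotation, of _ "%y. (th, y - x)", simplified])
 have U2: "(%y. U (?R th y)) : borel_measurable borel" for th by (rule measurable_compose[OF R1 U])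
 have radial: "k y' = k y" if yy: "norm (y - x) = norm (y' - x)" "y ~= x" for y y'
 proof -
  have "y - x ~= 0" using yy(2) by simp
  then obtain al where al: "0 <= al" "al <= 2 * pi" "y' - x = rotation al (y - x)"
   using rotation_transitive[OF yy(1)] by blast
  have "k y' = (NN th. indicator {0<..2 * pi} th * U (?R (th + al) y))"
   unfolding k_def al(3) rotation_add ..
  also have "... = k y" unfolding k_def
   by (rule nn_integral_periodic_shift[OF U1 _ al(1,2)]) (simp add: rotation_def)
  finally show ?thesis .
 qed
 \<comment> \<open>Stated for any rotation-invariant measure since it is applied to length on a
   circle and to area.\<close>
 have avg: "(\<integral>\<^sup>+y. indicator S y * k y \<partial>N) = ennreal (2 * pi) * (\<integral>\<^sup>+y. indicator S y * U y \<partial>N)"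
  if N: "sigma_finite_measure N" "sets N = sets borel" and rot: "!!th. distr N borel (?R th) = N"
   and S: "S : sets borel" "!!th y. ?R th y : S \<longleftrightarrow> y : S" for N :: "(real^2) measure" and S
 proof -
  interpret N: sigma_finite_measure N by (rule N(1))
  interpret P: pair_sigma_finite N "lborel :: real measure" by unfold_locales
  have mb: "measurable (borel \<Otimes>\<^sub>M borel) M = measurable (lborel \<Otimes>\<^sub>M N) M" for M :: "ennreal measure"
   by (rule measurable_cong_sets) (simp_all add: N(2) cong: sets_pair_measure_cong)
  have mb2: "measurable (borel \<Otimes>\<^sub>M borel) M = measurable (N \<Otimes>\<^sub>M lborel) M" for M :: "ennreal measure"
   by (rule measurable_cong_sets) (simp_all add: N(2) cong: sets_pair_measure_cong)
  have mN: "measurable borel M = measurable N M" for M :: "ennreal measure"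
   by (rule measurable_cong_sets) (simp_all add: N(2))
  have m3: "(%z. indicator S (fst z) * (indicator {0<..2 * pi} (snd z) * U (?R (snd z) (fst z)))) : borel_measurable (N \<Otimes>\<^sub>M lborel)"
  proof -
   have 1: "(%z. U (?R (snd z) (fst z))) : borel_measurable (borel \<Otimes>\<^sub>M borel)"
    using measurable_compose[OF measurable_pair_swap' Um] by (simp add: case_prod_beta)
   have 2: "(%z. indicator S (fst z) * (indicator {0<..2 * pi} (snd z) * U (?R (snd z) (fst z)))) : borel_measurable (borel \<Otimes>\<^sub>M borel)"
    using 1 S(1) by measurable
   then show ?thesis by (simp only: mb2)
  qed
  have mk: "(%th. indicator {0<..2 * pi} th * U (?R th y)) : borel_measurable lborel" for y using U1 by measurable
  have "(\<integral>\<^sup>+y. indicator S y * k y \<partial>N) = (\<integral>\<^sup>+y. \<integral>\<^sup>+th. indicator S y * (indicator {0<..2 * pi} th * U (?R th y)) \<partial>lborel \<partial>N)"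
   unfolding k_def by (intro nn_integral_cong nn_integral_cmult[symmetric] mk)
  also have "... = (NN th. \<integral>\<^sup>+y. indicator S y * (indicator {0<..2 * pi} th * U (?R th y)) \<partial>N)"
   using P.Fubini[of "%z. indicator S (fst z) * (indicator {0<..2 * pi} (snd z) * U (?R (snd z) (fst z)))"] m3 by simp
  also have "... = (\<integral>\<^sup>+th. (\<integral>\<^sup>+y. indicator S y * U y \<partial>N) * indicator {0<..2 * pi} th \<partial>(lborel :: real measure))"
  proof (rule nn_integral_cong)
   fix th :: real
   have m: "(%y. indicator S y * U y) : borel_measurable borel" using S(1) by measurable
   have "(\<integral>\<^sup>+y. indicator S y * U (?R th y) \<partial>N) = (\<integral>\<^sup>+y. indicator S (?R th y) * U (?R th y) \<partial>N)"
    by (intro nn_integral_cong) (simp add: indicator_def S(2))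
   also have "... = (\<integral>\<^sup>+y. indicator S y * U y \<partial>distr N borel (?R th))"
    by (rule nn_integral_distr[symmetric, where f = "%y. indicator S y * U y"]) (use R1 m in \<open>simp_all cong: measurable_cong_sets add: N(2)\<close>)
   finally show "(\<integral>\<^sup>+y. indicator S y * (indicator {0<..2 * pi} th * U (?R th y)) \<partial>N) = (\<integral>\<^sup>+y. indicator S y * U y \<partial>N) * indicator {0<..2 * pi} th"
    by (cases "th : {0<..2 * pi}") (simp_all add: rot)
  qed
  also have "... = ennreal (2 * pi) * (\<integral>\<^sup>+y. indicator S y * U y \<partial>N)" by (subst nn_integral_cmult_indicator) (simp_all add: mult.commute)
  finally show ?thesis .
 qed
 have kb: "ennreal (c * norm (y - x) / 2) <= k y & k y <= ennreal (pi * C * norm (y - x))" if y: "0 < norm (y - x)" "norm (y - x) < rh" for y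
 proof -
  define s where "s = norm (y - x)"
  have s: "0 < s" "s < rh" using y by (auto simp: s_def)
  let ?S = "sphere x s"
  have Sb: "?S : sets borel" by (simp add: borel_closed)
  have h: "ennreal (2 * s) <= hausdorff1_outer ?S" "hausdorff1_outer ?S <= ennreal (4 * pi * s)"
   using hausdorff1_outer_circle[OF s(1)] by auto
  interpret F: finite_measure "hm ?S" by (rule finite_measure_hm[OF Sb]) (use h(2) in \<open>auto intro: le_less_trans\<close>)
  have "AE z in hm ?S. z : ?S"
  proof (rule AE_I[where N = "- ?S"])
   show "emeasure (hm ?S) (- ?S) = 0" using emeasure_hm[OF Sb, of "- ?S"] Sb by (simp add: hausdorff1_outer_empty)
  qed (use Sb in auto)
  then have "AE z in hm ?S. indicator UNIV z * k z = k y"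
  proof eventually_elim
   case (elim z)
   then show ?case using radial[of y z] s by (simp add: s_def dist_norm norm_minus_commute)
  qed
  then have "(\<integral>\<^sup>+z. indicator UNIV z * k z \<partial>hm ?S) = (\<integral>\<^sup>+z. k y \<partial>hm ?S)" by (rule nn_integral_cong_AE)
  also have "... = k y * hausdorff1_outer ?S" using emeasure_hm[OF Sb, of UNIV] by simp
  also have "(\<integral>\<^sup>+z. indicator UNIV z * k z \<partial>hm ?S) = ennreal (2 * pi) * (\<integral>\<^sup>+z. indicator UNIV z * U z \<partial>hm ?S)"
   by (rule avg) (use F.sigma_finite_measure_axioms hm_sphere_rotation in auto)
  finally have eq: "ennreal (2 * pi) * (\<integral>\<^sup>+z. U z \<partial>hm ?S) = k y * hausdorff1_outer ?S" by simp
  have "k y * ennreal (2 * s) <= k y * hausdorff1_outer ?S" using h by (intro mult_left_mono) auto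
  also have "... <= ennreal (2 * pi) * ennreal (C * s^2)" unfolding eq[symmetric] using b[OF s] by (intro mult_left_mono) auto
  also have "... = ennreal (pi * C * s) * ennreal (2 * s)" using s c by (simp add: ennreal_mult[symmetric] power2_eq_square mult_ac)
  finally have up: "k y <= ennreal (pi * C * s)"
   by (rule ennreal_mult_right_le_cancel[rotated]) (use s in simp)
  have "ennreal (c * s / 2) * ennreal (4 * pi * s) = ennreal (2 * pi) * ennreal (c * s^2)"
   using s c by (simp add: ennreal_mult[symmetric] power2_eq_square mult_ac)
  also have "... <= ennreal (2 * pi) * (\<integral>\<^sup>+z. U z \<partial>hm ?S)" using b[OF s] by (intro mult_left_mono) auto
  also have "... <= k y * ennreal (4 * pi * s)" unfolding eq using h by (intro mult_left_mono) auto
  finally have lo: "ennreal (c * s / 2) <= k y"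
   by (rule ennreal_mult_right_le_cancel[rotated]) (use s in simp)
  show ?thesis using up lo by (simp add: s_def)
 qed
 have rotl: "distr lborel borel (?R th) = lborel" for th
 proof -
  have 1: "(%y. y - x) : borel_measurable lborel" "rotation th : borel_measurable borel" "(%y. x + y) : borel_measurable borel"
   using cont_borel[OF linear_continuous_on[OF linear_conv_bounded_linear[THEN iffD1, OF linear_rotation]]] by auto
  have "distr lborel borel (?R th) = distr (distr (distr lborel borel (%y. y - x)) borel (rotation th)) borel (%y. x + y)"
   using 1 by (simp add: distr_distr comp_def)
  also have "(%y. y - x) = (+) (- x)" by auto
  also have "distr lborel borel ((+) (- x)) = (lborel :: (real^2) measure)" by (rule lborel_distr_plus)
  finally show ?thesis by (simp add: distr_lborel_rotation lborel_distr_plus)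
 qed
 have area: "(NN y. ib x rh y * k y) = ennreal (2 * pi) * (NN y. ib x rh y * U y)"
  by (rule avg) (auto simp: rotl lborel.sigma_finite_measure_axioms dist_norm norm_minus_commute[of x])
 have vol: "emeasure lborel (ball x t) = ennreal (pi * t^2)" if "0 <= t" for t
  using emeasure_bounded_finite[of "ball x t"] content_ball[OF that, of x] by (simp add: emeasure_eq_ennreal_measure unit_ball_vol_2)
 have bb: "ball x rh : sets lborel" "ball x (rh / 2) : sets lborel" by auto
 have "(NN y. ib x rh y * k y) <= (NN y. ennreal (pi * C * rh) * ib x rh y)"
 proof (rule nn_integral_mono_AE)
  have "AE y in lborel. y ~= x" by (rule AE_lborel_singleton)
  then show "AE y in lborel. ib x rh y * k y <= ennreal (pi * C * rh) * ib x rh y"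
  proof eventually_elim
   case (elim y)
   show ?case
   proof (cases "y : ball x rh")
    case True
    then have n: "0 < norm (y - x)" "norm (y - x) < rh" using elim by (auto simp: dist_norm norm_minus_commute)
    then have "k y <= ennreal (pi * C * norm (y - x))" using kb by blast
    also have "... <= ennreal (pi * C * rh)" using n c by (intro ennreal_leI mult_left_mono) auto
    finally show ?thesis using True by simp
   qed simp
  qed
 qed
 also have "... = ennreal (2 * pi) * ennreal (pi / 2 * C * rh ^ 3)"
  using bb(1) rh c by (subst nn_integral_cmult_indicator) (simp_all add: vol ennreal_mult[symmetric] power2_eq_square power3_eq_cube mult_ac)
 finally have "ennreal (2 * pi) * (NN y. ib x rh y * U y) <= ennreal (2 * pi) * ennreal (pi / 2 * C * rh ^ 3)"
  unfolding area .
 then have "(NN y. ib x rh y * U y) <= ennreal (pi / 2 * C * rh ^ 3)"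
  by (rule ennreal_mult_left_le_cancel[rotated]) simp
 also have "... <= ennreal (2 * C * rh ^ 3)" using pi_less_4 c rh by (intro ennreal_leI mult_right_mono) auto
 finally show "(NN y. ib x rh y * U y) <= ennreal (2 * C * rh ^ 3)" .
 \<comment> \<open>Only the annulus between rh / 2 and rh is used: there \<open>k\<close> is at
   least c rh / 4, and 3 c / 32 is more than c / 16.\<close>
 have "ennreal (2 * pi) * ennreal (c / 16 * rh ^ 3) <= ennreal (c * rh / 4) * emeasure lborel (ball x rh - ball x (rh / 2))"
 proof -
  have "emeasure lborel (ball x rh - ball x (rh / 2)) = ennreal (pi * rh^2) - ennreal (pi * (rh / 2)^2)"
   using rh bb by (subst emeasure_Diff) (auto simp: vol)
  also have "... = ennreal (pi * rh^2 * 3 / 4)" using rh by (simp add: ennreal_minus power_divide)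
  finally have "ennreal (c * rh / 4) * emeasure lborel (ball x rh - ball x (rh / 2)) = ennreal (c * rh / 4 * (pi * rh^2 * 3 / 4))"
   using c rh by (simp add: ennreal_mult[symmetric])
  moreover have "2 * pi * (c / 16 * rh ^ 3) <= c * rh / 4 * (pi * rh^2 * 3 / 4)"
  proof -
   have "0 <= pi * (c * rh ^ 3)" using c rh by simp
   then have le: "pi * (c * rh ^ 3) * (1 / 8) <= pi * (c * rh ^ 3) * (3 / 16)" by (rule mult_left_mono[rotated]) simp
   have e1: "2 * pi * (c / 16 * rh ^ 3) = pi * (c * rh ^ 3) * (1 / 8)" by simp
   have e2: "c * rh / 4 * (pi * rh^2 * 3 / 4) = pi * (c * rh ^ 3) * (3 / 16)"
    by (simp add: power2_eq_square power3_eq_cube)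
   show ?thesis unfolding e1 e2 by (rule le)
  qed
  ultimately show ?thesis using c rh by (simp add: ennreal_mult[symmetric] ennreal_leI)
 qed
 also have "... = (NN y. ennreal (c * rh / 4) * indicator (ball x rh - ball x (rh / 2)) y)"
  using bb by (subst nn_integral_cmult_indicator) auto
 also have "... <= (NN y. ib x rh y * k y)"
 proof (rule nn_integral_mono)
  fix y
  show "ennreal (c * rh / 4) * indicator (ball x rh - ball x (rh / 2)) y <= ib x rh y * k y"
  proof (cases "y : ball x rh - ball x (rh / 2)")
   case True
   then have n: "rh / 2 <= norm (y - x)" "norm (y - x) < rh" by (auto simp: dist_norm norm_minus_commute)
   have "ennreal (c * rh / 4) <= ennreal (c * norm (y - x) / 2)" using mult_left_mono[OF n(1) c(1)] by (intro ennreal_leI) (simp add: mult.commute)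
   also have "... <= k y"
   proof -
    have "0 < norm (y - x)" using n rh by linarith
    then show ?thesis using kb n(2) by blast
   qed
   finally show ?thesis using True by simp
  qed simp
 qed
 finally show "ennreal (c / 16 * rh ^ 3) <= (NN y. ib x rh y * U y)"
  unfolding area by (rule ennreal_mult_left_le_cancel[rotated]) simp
qed

section \<open>Finite length of the free boundary\<close>

text \<open>Choose disjoint balls centred on \<open>F\<close> whose five-fold enlargements cover
  \<open>F\<close>. Fields with disjoint supports add up to a field of norm at most 1, so the
  perimeter bound controls c times the sum of the radii. The enlarged balls have diameters 10 r,
  which gives length at most 10 c1 / c at every mesh.\<close>

lemma finite_length_of_fields:
 fixes A :: "(real^2) set"
 assumes per: "locally_finite_perimeter Om A" and A: "open A" and U: "open U" "compactly_contained U Om"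
  and F: "!!x. x : F ==> ball x ta <= U" and ta: "0 < ta" and c: "0 < c"
  and fields: "!!x rh. x : F ==> 0 < rh ==> rh < ta ==>
   EX X. C1_test_field (ball x rh) X & (ALL y. norm (X y) <= 1) & c * rh <= (LINT y:A|lebesgue. divergence X y)"
 shows "hausdorff1_outer F < top"
proof -
 obtain c1 where c1: "!!X. C1_test_field U X ==> (!!x. norm (X x) <= 1) ==> \<bar>LINT x:A|lebesgue. divergence X x\<bar> <= c1"
  using per U unfolding locally_finite_perimeter_def by meson
 have "hausdorff1_outer F <= ennreal (10 * c1 / c)"
 proof (rule hausdorff1_outer_leI)
  fix dl :: real assume dl: "0 < dl"
  define B where "B = min ta (dl / 10)"
  have B: "0 < B" "B <= ta" "10 * B <= dl" using ta dl by (auto simp: B_def)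
  have fine: "EX r. 0 < r & r < d & True" if "0 < d" for d :: real using dense[OF that] by auto
  obtain N :: "nat set" and a :: "nat => real^2" and r :: "nat => real"
   where N: "!!n. n : N ==> a n : F & 0 < r n & r n < B & True"
    and dis: "pairwise (%i j. disjnt (cball (a i) (r i)) (cball (a j) (r j))) N"
    and cov: "!!m. F <= (\<Union>n\<in>{n:N. n < m}. cball (a n) (r n)) Un (\<Union>n\<in>{n:N. m <= n}. cball (a n) (5 * r n))"
   using fine_cover_sequence[where F = F and P = "%_ _. True" and B = B, OF fine B(1)] by blast
  have "EX X. C1_test_field (ball (a n) (r n)) X & (ALL y. norm (X y) <= 1) & c * r n <= (LINT y:A|lebesgue. divergence X y)"
   if "n : N" for n
   using fields[of "a n" "r n"] N[OF that] B(2) by auto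
  then obtain X where X: "!!n. n : N ==> C1_test_field (ball (a n) (r n)) (X n)"
   "!!n y. n : N ==> norm (X n y) <= 1" "!!n. n : N ==> c * r n <= (LINT y:A|lebesgue. divergence (X n) y)"
   by metis
  have X0: "X n y = 0" if "n : N" "y ~: ball (a n) (r n)" for n y
   using X(1)[OF that(1)] that(2) closure_subset[of "{y. X n y ~= 0}"]
   by (auto simp: C1_test_field_def compactly_supported_in_def)
  have Xd: "(X n has_derivative frechet_derivative (X n) (at y)) (at y)" if "n : N" for n y
   using X(1)[OF that] by (simp add: C1_test_field_def frechet_derivative_works)
  have idiv: "integrable lebesgue (%y. indicator A y *R divergence (X n) y)" if n: "n : N" for n
  proof -
   have c: "continuous_on UNIV (divergence (X n))"
    unfolding divergence_def [abs_def]
    by (intro continuous_on_sum continuous_on_inner continuous_on_const) (use X(1)[OF n] in \<open>simp add: C1_test_field_def\<close>)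
   have "X n y = 0" if "norm (a n) + r n < norm y" for y
   proof (rule X0[OF n])
    show "y ~: ball (a n) (r n)" using that norm_triangle_ineq2[of y "a n"] by (auto simp: dist_norm norm_minus_commute)
   qed
   then have "divergence (X n) y = 0" if "norm (a n) + r n < norm y" for y
    unfolding divergence_def using frechet_derivative_eq_0_outside[of "norm (a n) + r n" "X n", OF _ that] by simp
   then have "integrable lebesgue (divergence (X n))"
    by (rule integrable_lebesgue_continuous_compact_support[OF c])
   then show ?thesis by (intro integrable_mult_indicator) (use A in \<open>auto intro: borel_open\<close>)
  qed
  have partial: "c * (\<Sum>n\<in>I. r n) <= c1" if I: "finite I" "I <= N" for I
  proof -
   let ?X = "%y. \<Sum>n\<in>I. X n y"
   have one: "norm (?X y) <= 1" for y
   proof (cases "EX n:I. y : ball (a n) (r n)")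
    case True
    then obtain n where n: "n : I" "y : ball (a n) (r n)" by blast
    have "X m y = 0" if m: "m : I - {n}" for m
    proof (rule X0)
     have "disjnt (cball (a m) (r m)) (cball (a n) (r n))" using dis m n I(2) unfolding pairwise_def by blast
     then show "y ~: ball (a m) (r m)" using n(2) unfolding disjnt_def by (meson ball_subset_cball disjoint_iff subset_iff)
    qed (use m I in auto)
    then have "?X y = X n y" using n(1) I(1) by (simp add: sum.remove[OF I(1) n(1)])
    then show ?thesis using X(2) n(1) I(2) by auto
   next
    case False
    then have "?X y = 0" using X0 I(2) by (intro sum.neutral) blast
    then show ?thesis by simp
   qed
   have "Ck 1 ?X" using X(1) I(2) by (intro Ck_sum) (auto simp: C1_test_field_def)
   moreover have "compactly_supported_in U ?X"
   proof -
    define T where "T = (\<Union>n\<in>I. closure {y. X n y ~= 0})"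
    have T: "compact T" unfolding T_def using X(1) I
     by (intro compact_UN) (auto simp: C1_test_field_def compactly_supported_in_def)
    have "{y. ?X y ~= 0} <= T"
    proof
     fix y assume y: "y : {y. ?X y ~= 0}"
     have "EX n:I. X n y ~= 0"
     proof (rule ccontr)
      assume "~ ?thesis"
      then have "?X y = 0" by (intro sum.neutral) blast
      then show False using y by simp
     qed
     then obtain n where "n : I" "X n y ~= 0" by blast
     then show "y : T" unfolding T_def using closure_subset[of "{y. X n y ~= 0}"] by blast
    qed
    then have cl: "closure {y. ?X y ~= 0} <= T" by (rule closure_minimal) (rule compact_imp_closed[OF T])
    moreover have "T <= U"
    proof -
     have "closure {y. X n y ~= 0} <= U" if "n : I" for n
     proof -
      have n: "n : N" using that I by auto
      have "closure {y. X n y ~= 0} <= ball (a n) (r n)" using X(1)[OF n] by (simp add: C1_test_field_def compactly_supported_in_def)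
      also have "... <= ball (a n) ta" using N[OF n] B by (intro subset_ball) auto
      also have "... <= U" using F N[OF n] by auto
      finally show ?thesis .
     qed
     then show ?thesis by (auto simp: T_def)
    qed
    moreover have "compact (closure {y. ?X y ~= 0})"
     using bounded_subset[OF compact_imp_bounded[OF T] cl] by (simp add: compact_eq_bounded_closed)
    ultimately show ?thesis unfolding compactly_supported_in_def by blast
   qed
   ultimately have "C1_test_field U ?X" by (simp add: C1_test_field_def)
   then have le: "(LINT y:A|lebesgue. divergence ?X y) <= c1" using c1[of ?X] one by fastforce
   have div: "divergence ?X y = (\<Sum>n\<in>I. divergence (X n) y)" for y
   proof -
    have "(?X has_derivative (%v. \<Sum>n\<in>I. frechet_derivative (X n) (at y) v)) (at y)"
     using Xd I(2) by (intro has_derivative_sum) auto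
    from frechet_derivative_at[OF this]
    have "frechet_derivative ?X (at y) = (%v. \<Sum>n\<in>I. frechet_derivative (X n) (at y) v)" by simp
    then show ?thesis unfolding divergence_def by (simp add: inner_sum_left) (rule sum.swap)
   qed
   have "c * (\<Sum>n\<in>I. r n) <= (\<Sum>n\<in>I. LINT y:A|lebesgue. divergence (X n) y)"
    unfolding sum_distrib_left using X(3) I(2) by (intro sum_mono) auto
   also have "... = (LINT y:A|lebesgue. divergence ?X y)"
    unfolding set_lebesgue_integral_def div scaleR_sum_right
    using idiv I(2) by (intro B_integral_sum[symmetric]) auto
   finally show ?thesis using le by simp
  qed
  define S where "S n = (if n : N then cball (a n) (5 * r n) else {})" for n
  have diam: "diameter (S n) <= (if n : N then 10 * r n else 0)" for n
   using N[of n] by (auto simp: S_def)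
  have "hausdorff1_delta dl F <= (\<Sum>n. ennreal (diameter (S n)))"
  proof (rule hausdorff1_delta_le)
   show "F <= (\<Union>n. S n)" using cov[of 0] by (auto simp: S_def)
   show "bounded (S n)" for n by (simp add: S_def)
   show "diameter (S n) <= dl" for n
    using diam[of n] N[of n] B(3) dl by (auto split: if_splits)
  qed
  also have "... <= ennreal (10 * c1 / c)"
  proof (rule suminf_le_const)
   fix m
   have "(\<Sum>n<m. ennreal (diameter (S n))) <= (\<Sum>n<m. ennreal (if n : N then 10 * r n else 0))"
    by (intro sum_mono ennreal_leI diam)
   also have "... = ennreal (\<Sum>n<m. if n : N then 10 * r n else 0)"
    using N by (intro sum_ennreal) (auto simp: less_imp_le)
   also have "(\<Sum>n<m. if n : N then 10 * r n else 0) = (\<Sum>n\<in>{..<m} Int N. 10 * r n)"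
    by (rule sum.inter_restrict[symmetric]) simp
   also have "... = 10 * (\<Sum>n\<in>{..<m} Int N. r n)" by (rule sum_distrib_left[symmetric])
   also have "... <= 10 * c1 / c" using partial[of "{..<m} Int N"] c by (simp add: field_simps)
   finally show "(\<Sum>n<m. ennreal (diameter (S n))) <= ennreal (10 * c1 / c)" by (simp add: ennreal_leI)
  qed simp
  finally show "hausdorff1_delta dl F <= ennreal (10 * c1 / c)" .
 qed
 then show ?thesis by (rule le_less_trans) simp
qed

text \<open>\<open>u\<close> is replaced by the nonnegative Borel function \<open>w\<close> that
  vanishes outside the ball of radius e, because nothing is known of \<open>u\<close> outside
  \<open>Om\<close>.\<close>

lemma solid_growth:
 fixes u :: "real^2 => real"
 assumes op: "open Om" and cu: "continuous_on Om u" and u0: "!!x. x : Om ==> 0 <= u x" and sub: "cball x e <= Om"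
  and c: "0 <= c" "0 <= C" and rh: "0 < rh" "rh <= e"
  and b: "!!s. 0 < s ==> s < e ==> c <= 1 / s^2 * (LINT y:sphere x s|hausdorff1. u y) & 1 / s^2 * (LINT y:sphere x s|hausdorff1. u y) <= C"
 shows "(LBINT y. ib x rh y * u y) <= 2 * C * rh ^ 3"
  and "c / 16 * rh ^ 3 <= (LBINT y. ib x rh y * u y)"
proof -
 define w where "w y = ib x e y * u y" for y
 have be: "ball x e <= Om" using sub ball_subset_cball by blast
 have wm: "w : borel_measurable borel" unfolding w_def by (rule borel_measurable_ball_continuous[OF cu be])
 have w0: "0 <= w y" for y using u0 be by (auto simp: w_def indicator_def)
 have "compact (u ` cball x e)" by (intro compact_continuous_image continuous_on_subset[OF cu sub] compact_cball)
 then have "bounded (u ` cball x e)" by (rule compact_imp_bounded)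
 then obtain B where "ALL y:cball x e. \<bar>u y\<bar> <= B" unfolding bounded_iff by auto
 then have B: "\<bar>u y\<bar> <= B" if "y : cball x e" for y using that by blast
 have wB: "norm (w y) <= max 0 B" for y
  using B[of y] by (cases "y : ball x e") (auto simp: w_def)
 have sph: "(\<integral>\<^sup>+y. ennreal (w y) \<partial>hm (sphere x s)) = ennreal (LINT y:sphere x s|hausdorff1. u y)" if s: "0 < s" "s < e" for s
 proof -
  have Sb: "sphere x s : sets borel" by (simp add: borel_closed)
  have fin: "hausdorff1_outer (sphere x s) < top" using hausdorff1_outer_circle(2)[OF s(1), of x] by (rule le_less_trans) simp
  interpret F: finite_measure "hm (sphere x s)" by (rule finite_measure_hm[OF Sb fin])
  have "integrable (hm (sphere x s)) w"
  proof (rule F.integrable_const_bound[where B = "max 0 B"])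
   show "w : borel_measurable (hm (sphere x s))" using wm by (simp cong: measurable_cong_sets)
  qed (use wB in simp)
  then have "(\<integral>\<^sup>+y. ennreal (w y) \<partial>hm (sphere x s)) = ennreal (\<integral>y. w y \<partial>hm (sphere x s))"
   by (rule nn_integral_eq_integral) (simp add: w0)
  also have "(\<integral>y. w y \<partial>hm (sphere x s)) = (LINT y:sphere x s|hausdorff1. w y)" by (rule integral_hm[OF Sb wm])
  also have "... = (LINT y:sphere x s|hausdorff1. u y)"
   unfolding set_lebesgue_integral_def using s by (intro B_integral_cong refl) (auto simp: w_def indicator_def)
  finally show ?thesis .
 qed
 have sb: "ennreal (c * s^2) <= (\<integral>\<^sup>+y. ennreal (w y) \<partial>hm (sphere x s)) & (\<integral>\<^sup>+y. ennreal (w y) \<partial>hm (sphere x s)) <= ennreal (C * s^2)"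
  if s: "0 < s" "s < rh" for s
 proof -
  have s': "0 < s" "s < e" using s rh by auto
  have "c * s^2 <= (LINT y:sphere x s|hausdorff1. u y)" "(LINT y:sphere x s|hausdorff1. u y) <= C * s^2"
   using b[OF s'] s(1) by (auto simp: pos_le_divide_eq pos_divide_le_eq)
  then show ?thesis unfolding sph[OF s'] by (simp add: ennreal_leI)
 qed
 have cr: "cball x rh <= Om" using rh sub subset_cball[of rh e x] by blast
 have int: "(NN y. ib x rh y * ennreal (w y)) = ennreal (LBINT y. ib x rh y * u y)"
 proof -
  have "(NN y. ib x rh y * ennreal (w y)) = (NN y. ennreal (ib x rh y * u y))"
   using rh by (intro nn_integral_cong) (auto simp: w_def indicator_def)
  also have "... = ennreal (LBINT y. ib x rh y * u y)"
   by (rule nn_integral_eq_integral[OF integrable_ball_continuous_on[OF cu cr]], rule AE_I2)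
    (use u0 cr in \<open>auto simp: indicator_def subset_iff\<close>)
  finally show ?thesis .
 qed
 have nn: "0 <= (LBINT y. ib x rh y * u y)"
  by (rule B_integral_nonneg) (use u0 cr in \<open>auto simp: indicator_def subset_iff\<close>)
 have em: "(%y. ennreal (w y)) : borel_measurable borel" using wm by simp
 have "ennreal (LBINT y. ib x rh y * u y) <= ennreal (2 * C * rh ^ 3)"
  using spherical_to_solid_mean(1)[OF em c rh(1) sb] unfolding int by blast
 then show "(LBINT y. ib x rh y * u y) <= 2 * C * rh ^ 3"
  using c rh by (subst (asm) ennreal_le_iff) auto
 have "ennreal (c / 16 * rh ^ 3) <= ennreal (LBINT y. ib x rh y * u y)"
  using spherical_to_solid_mean(2)[OF em c rh(1) sb] unfolding int by blast
 then show "c / 16 * rh ^ 3 <= (LBINT y. ib x rh y * u y)"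
  using nn by (subst (asm) ennreal_le_iff) auto
qed

lemma open_positivity_set:
 fixes u :: "'a::topological_space => real"
 assumes "open Om" "continuous_on Om u"
 shows "open (positivity_set Om u)"
proof -
 have "open (u -` {0<..} Int Om)" using assms continuous_on_open_vimage[OF assms(1), of u] by (simp add: open_greaterThan)
 moreover have "u -` {0<..} Int Om = positivity_set Om u" by (auto simp: positivity_set_def)
 ultimately show ?thesis by simp
qed

text \<open>All discs that are tested lie in one concentric disc \<open>D\<close>, so a single pair
  of growth constants serves the whole piece of the free boundary. Both phases then have positive
  density in every small disc, which provides the fields for the covering argument.\<close>

lemma finite_length_free_boundary:
 fixes u :: "real^2 => real"
 assumes p: "2 <= p" and sol: "weak_solution (ball 0 1) p l u" and theta: "0 < th"
  and dens: "!!x r. [|x : free_boundary (ball 0 1) u; 0 < r; ball x r <= ball 0 1|] ==>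
   measure lebesgue ({y : ball 0 1. u y = 0} Int ball x r) / measure lebesgue (ball x r) >= th"
  and sub: "cball x0 r0 <= ball 0 1"
 shows "hausdorff1_outer (free_boundary (ball 0 1) u Int cball x0 r0) < top"
proof (cases "cball x0 r0 = {}")
 case True then show ?thesis by (simp add: hausdorff1_outer_empty)
next
 case False
 let ?Om = "ball 0 1 :: (real^2) set"
 let ?A = "positivity_set ?Om u"
 let ?F = "free_boundary ?Om u Int cball x0 r0"
 have W: "sobolev_W1 ?Om p u" and cu: "continuous_on ?Om u" and u0: "!!x. x : ?Om ==> 0 <= u x"
  and harm: "weakly_p_harmonic_on_positivity_set ?Om p u" and lg: "linear_growth_nondegenerate ?Om p l u"
  and per: "locally_finite_perimeter ?Om ?A"
  using sol by (auto simp: weak_solution_def)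
 obtain x1 where x1: "x1 : cball x0 r0" "!!y. y : cball x0 r0 ==> norm y <= norm x1"
  using continuous_attains_sup[OF compact_cball False, of norm] continuous_on_norm_id by blast
 have n1: "norm x1 < 1" using x1(1) sub by auto
 \<comment> \<open>\<open>x1\<close> is a point of the closed disc farthest from 0; discs of radius
   e about any of its points lie in \<open>D\<close> since norm x1 + e = R.\<close>
 define R where "R = (1 + norm x1) / 2"
 define e where "e = (1 - norm x1) / 2"
 have R: "0 < R" "R < 1" and e: "0 < e" using n1 by (auto simp: R_def e_def add_pos_nonneg)
 define D where "D = (ball 0 R :: (real^2) set)"
 have cD: "closure D = cball 0 R" using R by (simp add: D_def)
 have D: "open D" "connected D" "D ~= {}" "bounded D" "compactly_contained D ?Om"
  using R cD by (auto simp: D_def compactly_contained_def)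
 have in1: "cball x e <= ?Om" and in2: "ball x e <= D" if "x : ?F" for x
 proof -
  have nx: "norm x <= norm x1" using that x1(2) by blast
  show "cball x e <= ?Om"
  proof
   fix y assume "y : cball x e"
   then have "norm y <= norm x + e" using norm_triangle_ineq2[of y x] by (simp add: dist_norm norm_minus_commute)
   then show "y : ?Om" using nx n1 by (simp add: e_def field_simps)
  qed
  show "ball x e <= D"
  proof
   fix y assume "y : ball x e"
   then have "norm y < norm x + e" using norm_triangle_ineq2[of y x] by (simp add: dist_norm norm_minus_commute)
   then show "y : D" using nx by (simp add: D_def e_def R_def field_simps)
  qed
 qed
 obtain c C where c: "0 < c" "c <= C"
  and g: "!!x r. x : free_boundary ?Om u ==> 0 < r ==> ball x r <= D ==>
   c <= 1 / r^2 * (LINT y:sphere x r|hausdorff1. u y) & 1 / r^2 * (LINT y:sphere x r|hausdorff1. u y) <= C"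
  using lg D unfolding linear_growth_nondegenerate_def Let_def by meson
 have C0: "0 <= C" using c by simp
 have growth: "(LBINT y. ib x rh y * u y) <= 2 * C * rh ^ 3"
  "c / 16 * rh ^ 3 <= (LBINT y. ib x rh y * u y)" if x: "x : ?F" and rh: "0 < rh" "rh <= e" for x rh
 proof -
  have b: "c <= 1 / s^2 * (LINT y:sphere x s|hausdorff1. u y) & 1 / s^2 * (LINT y:sphere x s|hausdorff1. u y) <= C"
   if "0 < s" "s < e" for s
  proof (rule g)
   show "ball x s <= D" using in2[OF x] that subset_ball[of s e x] by auto
  qed (use x that in auto)
  show "(LBINT y. ib x rh y * u y) <= 2 * C * rh ^ 3"
   by (rule solid_growth(1)[OF open_ball cu u0 in1[OF x] less_imp_le[OF c(1)] C0 rh b])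
  show "c / 16 * rh ^ 3 <= (LBINT y. ib x rh y * u y)"
   by (rule solid_growth(2)[OF open_ball cu u0 in1[OF x] less_imp_le[OF c(1)] C0 rh b])
 qed
 have C16: "0 <= 16 * C" using C0 by simp
 obtain K where K: "0 < K" "!!z r. 0 < r ==> cball z (3 * r) <= ?Om ==>
  (LBINT x. ib z (2 * r) x * u x) <= 16 * C * r ^ 3 ==>
  (NN x. ib z (r / 2) x * ennreal (u x powr p)) <= ennreal (K * r powr (p + 2))"
  using Lp_growth[OF harm p W cu u0 C16] by blast
 \<comment> \<open>The lower bound (c / 16) (r / 2)^3 on the half disc, written as c' r^3.\<close>
 define c' where "c' = c / 128"
 define a0 where "a0 = c' / (2 * (2 * K / c') powr (1 / (p - 1)))"
 have c': "0 < c'" using c by (simp add: c'_def)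
 have a0: "0 < a0" using c' K by (simp add: a0_def)
 have openA: "open ?A" by (rule open_positivity_set[OF open_ball cu])
 have fields: "EX X. C1_test_field (ball x rh) X & (ALL y. norm (X y) <= 1) & (a0 * th / 32) * rh <= (LINT y:?A|lebesgue. divergence X y)"
  if x: "x : ?F" and rh: "0 < rh" "rh < e / 2" for x rh
 proof -
  \<comment> \<open>The isoperimetric field for radius r / 2 is supported in the disc of radius 4 (r
    / 2) = rh.\<close>
  define r where "r = rh / 2"
  have r: "0 < r" "3 * r <= e" using rh by (auto simp: r_def)
  have s3: "cball x (3 * r) <= ?Om" and s2: "cball x (r / 2) <= ?Om"
   using in1[OF x] r subset_cball[of "3 * r" e x] subset_cball[of "r / 2" e x] by auto
  have "(LBINT y. ib x (2 * r) y * u y) <= 2 * C * (2 * r) ^ 3" by (rule growth(1)[OF x]) (use r in auto)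
  also have "... = 16 * C * r ^ 3" by (simp add: power_mult_distrib)
  finally have Lp: "(NN y. ib x (r / 2) y * ennreal (u y powr p)) <= ennreal (K * r powr (p + 2))"
   by (rule K(2)[OF r(1) s3])
  have "c' * r ^ 3 = c / 16 * (r / 2) ^ 3" by (simp add: c'_def power_divide)
  also have "... <= (LBINT y. ib x (r / 2) y * u y)" by (rule growth(2)[OF x]) (use r in auto)
  finally have lower: "c' * r ^ 3 <= (LBINT y. ib x (r / 2) y * u y)" .
  have al: "a0 * r^2 <= measure lborel (?A Int ball x (r / 2))"
   unfolding a0_def by (rule positivity_density[OF cu u0 s2 open_ball r(1) K(1) c' p Lp lower])
  have bs: "ball x (r / 2) <= ?Om" using s2 ball_subset_cball by blast
  have r2: "0 < r / 2" using r by simp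
  have mb: "measure lebesgue (ball x (r / 2)) = pi * (r / 2)^2" using measure_ball_plane[of "r / 2" x] r by simp
  have "th <= measure lebesgue ({y : ?Om. u y = 0} Int ball x (r / 2)) / measure lebesgue (ball x (r / 2))"
   by (rule dens[OF _ r2 bs]) (use x in auto)
  then have d1: "th * (pi * (r / 2)^2) <= measure lebesgue ({y : ?Om. u y = 0} Int ball x (r / 2))"
   unfolding mb using r by (simp add: pos_le_divide_eq)
  have eqb: "{y : ?Om. u y = 0} Int ball x (r / 2) = ball x (r / 2) - ?A"
   using bs u0 by (force simp: positivity_set_def)
  have Kc: "compact (cball x (r / 2) - ?A)" by (intro compact_diff compact_cball openA)
  have "measure lebesgue (ball x (r / 2) - ?A) <= measure lebesgue (cball x (r / 2) - ?A)"
  proof (rule measure_mono_fmeasurable)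
   show "ball x (r / 2) - ?A : sets lebesgue" using openA by (intro sets.Diff) (auto intro: borel_open)
   show "cball x (r / 2) - ?A : lmeasurable" by (rule lmeasurable_compact[OF Kc])
  qed auto
  also have "... = measure lborel (cball x (r / 2) - ?A)"
   using Kc by (intro measure_completion) (auto intro: borel_closed compact_imp_closed)
  finally have bet: "th * (pi * (r / 2)^2) <= measure lborel (cball x (r / 2) - ?A)" using d1 unfolding eqb by linarith
  have al0: "0 < a0 * r^2" and bet0: "0 < th * (pi * (r / 2)^2)" using a0 theta r by auto
  have V: "pi * r^2 = measure lborel (ball (0 :: real^2) (2 * (r / 2)))" using measure_ball_plane[of r 0] r by simp
  obtain X where X: "C1_test_field (ball x (4 * (r / 2))) X" "!!y. norm (X y) <= 1"
   "(a0 * r^2) * (th * (pi * (r / 2)^2)) / (8 * (pi * r^2) * (r / 2)) <= (LINT y:?A|lebesgue. divergence X y)"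
   using isoperimetric_field[OF openA r2 V al0 al bet0 bet] by blast
  have "(a0 * r^2) * (th * (pi * (r / 2)^2)) / (8 * (pi * r^2) * (r / 2)) = (a0 * th / 32) * rh"
   using r by (simp add: r_def power2_eq_square field_simps)
  then show ?thesis using X by (intro exI[of _ X]) (auto simp: r_def)
 qed
 show ?thesis
 proof (rule finite_length_of_fields[OF per openA D(1,5) _ _ _ fields])
  show "ball x (e / 2) <= D" if "x : ?F" for x using in2[OF that] e subset_ball[of "e / 2" e x] by auto
  show "0 < e / 2" "0 < a0 * th / 32" using e a0 theta by auto
 qed
qed

theorem theorem1p3:
  fixes p l \<theta> :: real and u :: "real^2 \<Rightarrow> real"
  assumes p: "2 \<le> p" and l: "0 < l"
    and sol: "weak_solution (ball 0 1) p l u"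
    and theta: "0 < \<theta>"
    and dens: "\<And>x r. \<lbrakk>x \<in> free_boundary (ball 0 1) u; 0 < r; ball x r \<subseteq> ball 0 1\<rbrakk> \<Longrightarrow>
      measure lebesgue ({y \<in> ball 0 1. u y = 0} \<inter> ball x r) / measure lebesgue (ball x r) \<ge> \<theta>"
    and curv: "locally_bounded_first_variation (ball 0 1) (free_boundary (ball 0 1) u)"
    and curv_nonneg: "\<And>A. 0 \<le> emeasure (curvature_measure (ball 0 1) (free_boundary (ball 0 1) u)) A"
    and index: "\<And>x0. x0 \<in> free_boundary (ball 0 1) u \<Longrightarrow> finite_Morse_index (ball 0 1) p u x0"
  shows "locally_finitely_connected (free_boundary (ball 0 1) u)"
proof (rule locally_finitely_connected_of_curvature[OF open_ball _ _ _ curv])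
  have cu: "continuous_on (ball 0 1) u" and u0: "\<And>x. x \<in> ball 0 1 \<Longrightarrow> 0 \<le> u x"
    using sol by (auto simp: weak_solution_def)
  show "closedin (top_of_set (ball 0 1)) (free_boundary (ball 0 1) u)"
    unfolding free_boundary_def by (rule closedin_closed_Int) (rule frontier_closed)
  show fin: "hausdorff1_outer (free_boundary (ball 0 1) u \<inter> cball x r) < top" if "cball x r \<subseteq> ball 0 1" for x r
    by (rule finite_length_free_boundary[OF p sol theta dens that])
  show "\<not> connected (ball x r - free_boundary (ball 0 1) u)"
    if "x \<in> free_boundary (ball 0 1) u" "0 < r" "ball x r \<subseteq> ball 0 1" for x r
    by (rule free_boundary_separates[OF open_ball cu u0 fin theta dens that])
qed

end
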